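(* Assume $d\ge 2$. Let $(\Gamma_n)_{n\ge1}$ be a sequence of symmetric non-negative definite real $(d,d)$-matrices which converges to a symmetric non-negative definite $(d,d)$-matrix $\Gamma\neq 0$. Assume that for any $\alpha>0$, $$\sum_{k=1}^\infty k^{-\delta}\Delta_k(\alpha)<\infty\quad\text{for all }\delta>0,$$ where $\Delta_k(\alpha)=\max_{n_k(\alpha)\le m\le n\le n_{k+1}(\alpha)}\|\Gamma_n^2-\Gamma_m^2\|$ and $n_k(\alpha)=[\exp(\alpha k/Lk)]$. Let $T_n=\sum_{j=1}^n Z_j$, $n\ge1$, where $(Z_n)_{n\ge1}$ is a sequence of independent $\mathcal N(0,I)$-distributed $d$-dimensional random vectors. Let $\lambda_{n,1}\ge\dots\ge\lambda_{n,d}$ be the eigenvalues of $\Gamma_n$ and let $d_1$ be the multiplicity of the largest eigenvalue of $\Gamma$. Then for any non-decreasing sequence $(\phi_n)_{n\ge1}$ of positive real numbers, $$\mathbb P\{|\Gamma_nT_n|\le\sqrt n\,\phi_n\text{ eventually}\}=1\ \text{ or }\ =0$$ according as $$\sum_{n=1}^\infty\frac{\phi_n}{n\lambda_{n,1}}\prod_{i=2}^{d_1}\left(\frac{\lambda_{n,1}}{(\lambda_{n,1}^2-\lambda_{n,i}^2)^{1/2}}\wedge\frac{\phi_n}{\lambda_{n,1}}\right)\exp\left(-\frac{\phi_n^2}{2\lambda_{n,1}^2}\right)<\infty\ \text{ or }\ =\infty.$$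
   Context: $|\cdot|$ is the Euclidean norm on $\mathbb R^d$ and $\|A\|=\sup_{|v|\le1}|Av|$. $Lt=\log_e(t\vee e)$ for $t\ge0$; $[x]$ is the integer part of $x$; $a\wedge b=\min(a,b)$, $a\vee b=\max(a,b)$. $\mathcal N(\mu,\Sigma)$ is the $d$-dimensional normal distribution with mean $\mu$ and covariance matrix $\Sigma$; $I$ is the identity matrix. Eigenvalues are listed with multiplicity. "Eventually" means for all sufficiently large $n$. Conventions: $a/0=\infty$ for $a>0$, and $\prod_{i=2}^1a_i=1$. Since $\lambda_{n,1}$ converges to the largest eigenvalue of $\Gamma$, which is positive, $\lambda_{n,1}=0$ for at most finitely many $n$; such $n$ are omitted from the series. *)

theory Defs
  imports
    "HOL-Probability.Probability"
    "HOL-Computational_Algebra.Polynomial"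
begin

definition sym_nonneg_definite :: "real ^ 'n ^ 'n \<Rightarrow> bool" where
  "sym_nonneg_definite A \<longleftrightarrow> transpose A = A \<and> (\<forall>v. 0 \<le> v \<bullet> (A *v v))"

definition mat_norm :: "real ^ 'n ^ 'n \<Rightarrow> real" where
  "mat_norm A = onorm (\<lambda>v. A *v v)"

definition mat_charpoly :: "real ^ 'n ^ 'n \<Rightarrow> real poly" where
  "mat_charpoly A = det (mat [:0, 1:] - (\<chi> i j. [:A $ i $ j:]))"

text \<open>The real eigenvalues in decreasing order, repeated according to their multiplicity as roots
  of the characteristic polynomial (a list of length \<open>CARD('n)\<close> if \<open>A\<close> is symmetric).\<close>

definition eigenvalue_list :: "real ^ 'n ^ 'n \<Rightarrow> real list" where
  "eigenvalue_list A = rev (sorted_list_of_multiset (proots (mat_charpoly A)))"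

text \<open>The index starts at 1, so \<open>eigenvalue A 1\<close> is the largest eigenvalue.\<close>

definition eigenvalue :: "real ^ 'n ^ 'n \<Rightarrow> nat \<Rightarrow> real" where
  "eigenvalue A i = eigenvalue_list A ! (i - 1)"

definition largest_eigenvalue_mult :: "real ^ 'n ^ 'n \<Rightarrow> nat" where
  "largest_eigenvalue_mult A = order (eigenvalue A 1) (mat_charpoly A)"

text \<open>Lebesgue density of the normal distribution with mean \<open>\<mu>\<close> and (positive definite)
  covariance matrix \<open>\<Sigma>\<close>.\<close>

definition multi_normal_density :: "real ^ 'n \<Rightarrow> real ^ 'n ^ 'n \<Rightarrow> real ^ 'n \<Rightarrow> real" where
  "multi_normal_density \<mu> \<Sigma> x =
     exp (- ((x - \<mu>) \<bullet> (matrix_inv \<Sigma> *v (x - \<mu>))) / 2) / sqrt ((2 * pi) ^ CARD('n) * det \<Sigma>)"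

definition L :: "real \<Rightarrow> real" where
  "L t = ln (max t (exp 1))"

definition block_index :: "real \<Rightarrow> nat \<Rightarrow> nat" where
  "block_index \<alpha> k = nat \<lfloor>exp (\<alpha> * real k / L (real k))\<rfloor>"

definition block_osc :: "(nat \<Rightarrow> real ^ 'n ^ 'n) \<Rightarrow> real \<Rightarrow> nat \<Rightarrow> real" where
  "block_osc \<Gamma> \<alpha> k =
     Max {mat_norm (\<Gamma> n ** \<Gamma> n - \<Gamma> m ** \<Gamma> m) | m n.
            block_index \<alpha> k \<le> m \<and> m \<le> n \<and> n \<le> block_index \<alpha> (k + 1)}"

text \<open>The terms of the series and its sum are taken in \<^typ>\<open>ennreal\<close>, where \<open>a / 0 = \<infinity>\<close> for
  \<open>a > 0\<close>.\<close>

definition test_term :: "(nat \<Rightarrow> real ^ 'n ^ 'n) \<Rightarrow> nat \<Rightarrow> (nat \<Rightarrow> real) \<Rightarrow> nat \<Rightarrow> ennreal" where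
  "test_term \<Gamma> d1 \<phi> n =
     (let l = eigenvalue (\<Gamma> n) in
        ennreal (\<phi> n / (real n * l 1))
        * (\<Prod>i = 2..d1. min (ennreal (l 1) / ennreal (sqrt ((l 1)\<^sup>2 - (l i)\<^sup>2)))
                             (ennreal (\<phi> n / l 1)))
        * ennreal (exp (- (\<phi> n)\<^sup>2 / (2 * (l 1)\<^sup>2))))"

definition test_series :: "(nat \<Rightarrow> real ^ 'n ^ 'n) \<Rightarrow> nat \<Rightarrow> (nat \<Rightarrow> real) \<Rightarrow> ennreal" where
  "test_series \<Gamma> d1 \<phi> = (\<Sum>\<^sub>\<infinity>n\<in>{n. 1 \<le> n \<and> eigenvalue (\<Gamma> n) 1 \<noteq> 0}. test_term \<Gamma> d1 \<phi> n)"

end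

theory Submission
  imports Defs "HOL-Real_Asymp.Real_Asymp"
begin

text \<open>
  Write \<open>Y\<close> for a standard Gaussian vector, so that \<open>\<Gamma>\<^sub>n T\<^sub>n / \<surd>n\<close> has the law of \<open>\<Gamma>\<^sub>n Y\<close>, and let \<open>G(A, t)\<close>
  be the probability of \<open>|A Y| > t\<close>. Three facts together give the integral test.

  The terms of the series are tail probabilities in disguise. In an eigenbasis \<open>|A Y|\<^sup>2\<close> is the sum of
  \<open>\<lambda>\<^sub>i\<^sup>2 Y\<^sub>i\<^sup>2\<close>. Conditioning on the coordinates other than the first and integrating the
  one-dimensional tail \<open>exp (- u\<^sup>2 / 2) / u\<close> tilts the other densities; the \<open>i\<close>-th of them then contributes
  \<open>\<lambda>\<^sub>1 / (\<lambda>\<^sub>1\<^sup>2 - \<lambda>\<^sub>i\<^sup>2)\<^sup>1\<^sup>/\<^sup>2 \<and> t / \<lambda>\<^sub>1\<close> up to constants. Thus \<open>G(A, t)\<close> is known up to a factor depending only on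
  the dimension (\<open>gtail_two_sided\<close>), the factors with \<open>i > d\<^sub>1\<close> stay bounded because these eigenvalues
  remain separated from the largest one, and the \<open>n\<close>-th term of the series is of the order of
  \<open>(\<phi>\<^sub>n\<^sup>2 / n) G(\<Gamma>\<^sub>n, \<phi>\<^sub>n)\<close> (\<open>term_at_vs_gtail\<close>).

  Only boundaries with \<open>\<phi>\<^sub>n\<^sup>2\<close> of the order of \<open>ln ln n\<close> matter. A nondecreasing boundary that is too small at
  late times makes the series diverge (\<open>term_at_not_summable\<close>), and a boundary above \<open>6 \<sigma> (ln ln n)\<^sup>1\<^sup>/\<^sup>2\<close>, with \<open>\<sigma>\<close> the
  largest eigenvalue of the limit, has convergent series (\<open>term_at_upper\<close>); hence a boundary may be
  truncated from both sides.

  For such boundaries the time axis is cut at the indices \<open>n\<^sub>k\<close> of \<open>block_index 1\<close>. Consecutive indices have ratio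
  \<open>1 - O(1 / ln k)\<close>, and a change of \<open>\<phi>\<^sup>2\<close> by \<open>O(1)\<close>, or of the quadratic form by \<open>O(|x|\<^sup>2 / \<phi>\<^sup>2)\<close>, changes \<open>G\<close> only by a
  bounded factor (\<open>gtail_stable\<close>). So a block behaves like a single time, as long as \<open>\<Gamma>\<^sub>n\<^sup>2\<close> oscillates
  by at most \<open>\<epsilon> / ln k\<close> on it. The hypothesis on the oscillation says that the blocks violating this form a set
  so thin that \<open>\<Sum> k\<^sup>-\<^sup>\<delta>\<close> converges over it for every \<open>\<delta> > 0\<close>. On the \<open>k\<close>-th block \<open>G(\<Gamma>\<^sub>n, \<phi>\<^sub>n)\<close> is at
  most a negative power of \<open>k\<close>, so such blocks contribute finite sums to either side.

  If the series converges, Levy's maximal inequality on each block and the Borel-Cantelli lemma show that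
  the boundary is eventually not exceeded (\<open>almost_surely_below\<close>). If it diverges, the exceedances at the
  times \<open>n\<^sub>k\<close> have divergent probability sum. For nearby blocks \<open>j < k\<close> the second exceedance costs an
  additional factor \<open>exp (- c (k - j))\<close> (\<open>gauss_near_pair\<close>), for distant blocks the two events are
  independent up to a constant factor (\<open>gauss_far_pair\<close>); the second moment method gives infinitely many
  exceedances with positive probability. Kolmogorov's law raises this probability to one: it applies to
  exceedance up to an additive constant, and this constant is absorbed by using the slightly larger boundary
  \<open>\<phi> + 1 / \<phi>\<close> (\<open>almost_surely_above\<close>).
\<close>

section \<open>Spectral theory of symmetric matrices\<close>

text \<open>The Rayleigh quotient is stationary at its maximizer \<open>v\<close>: moving \<open>v\<close> in the direction of the residual
  \<open>w = f v - m v\<close> would increase it to first order by \<open>2 |w|\<^sup>2\<close>, so the residual vanishes.\<close>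

lemma self_adjoint_maximizer_eigenvector:
  fixes f :: "'a::euclidean_space \<Rightarrow> 'a"
  assumes f: "linear f" "\<And>x y. f x \<bullet> y = x \<bullet> f y"
    and S: "subspace S" "f ` S \<subseteq> S"
    and v: "v \<in> S" "norm v = 1"
    and max: "\<And>w. w \<in> S \<Longrightarrow> norm w = 1 \<Longrightarrow> w \<bullet> f w \<le> v \<bullet> f v"
  shows "f v = (v \<bullet> f v) *\<^sub>R v"
proof -
  define m where "m = v \<bullet> f v"
  have quad: "x \<bullet> f x \<le> m * (x \<bullet> x)" if "x \<in> S" for x
  proof (cases "x = 0")
    case True
    then show ?thesis using linear_0[OF f(1)] by simp
  next
    case False
    have "(x /\<^sub>R norm x) \<bullet> f (x /\<^sub>R norm x) \<le> m"
      unfolding m_def using that False S(1) by (intro max) (auto simp: subspace_scale)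
    then have "(x \<bullet> f x) / (norm x)\<^sup>2 \<le> m"
      by (simp add: linear_scale[OF f(1)] power2_eq_square divide_inverse algebra_simps)
    then show ?thesis using False
      by (simp add: field_simps dot_square_norm)
  qed
  define w where "w = f v - m *\<^sub>R v"
  have wS: "w \<in> S" unfolding w_def using S v by (auto intro!: subspace_diff subspace_scale)
  have vv: "v \<bullet> v = 1" using v by (simp add: dot_square_norm)
  have wv: "w \<bullet> v = 0" unfolding w_def using f(2)[of v v]
    by (simp add: inner_diff_left m_def vv)
  define a where "a = w \<bullet> f v"
  define K where "K = m * (w \<bullet> w) - w \<bullet> f w"
  have key: "2 * t * a \<le> t\<^sup>2 * K" for t
  proof -
    have "v + t *\<^sub>R w \<in> S" using S v wS by (auto intro!: subspace_add subspace_scale)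
    from quad[OF this] have "m + 2 * t * a + t\<^sup>2 * (w \<bullet> f w) \<le> m * (1 + t\<^sup>2 * (w \<bullet> w))"
      using wv vv f(2)[of v w]
      by (simp add: linear_add[OF f(1)] linear_scale[OF f(1)] inner_add_left inner_add_right
          a_def m_def[symmetric] inner_commute power2_eq_square algebra_simps)
    then show ?thesis by (simp add: K_def algebra_simps)
  qed
  have "a = 0"
  proof (rule ccontr)
    assume "a \<noteq> 0"
    define t where "t = a / (\<bar>K\<bar> + 1)"
    have "a = t * (\<bar>K\<bar> + 1)" by (simp add: t_def)
    then have "2 * t * a = t\<^sup>2 * (2 * (\<bar>K\<bar> + 1))" by (simp add: power2_eq_square)
    with key[of t] have "t\<^sup>2 * (2 * (\<bar>K\<bar> + 1)) \<le> t\<^sup>2 * K" by simp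
    moreover have "t\<^sup>2 > 0" using \<open>a \<noteq> 0\<close> by (simp add: t_def)
    ultimately show False by (simp add: mult_le_cancel_left)
  qed
  then have "w \<bullet> w = 0" using wv by (simp add: w_def a_def inner_diff_left inner_diff_right inner_commute)
  then show ?thesis by (simp add: w_def m_def)
qed

text \<open>Induction on the dimension: the orthogonal complement of an eigenvector is invariant under a
  self-adjoint map.\<close>

lemma self_adjoint_orthonormal_eigenbasis:
  fixes f :: "'a::euclidean_space \<Rightarrow> 'a"
  assumes f: "linear f" "\<And>x y. f x \<bullet> y = x \<bullet> f y"
  shows "subspace S \<Longrightarrow> f ` S \<subseteq> S \<Longrightarrow>
    \<exists>B. finite B \<and> pairwise orthogonal B \<and> (\<forall>b\<in>B. norm b = 1 \<and> f b = (b \<bullet> f b) *\<^sub>R b) \<and> span B = S"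
proof (induction "dim S" arbitrary: S rule: less_induct)
  case less
  show ?case
  proof (cases "S = {0}")
    case True
    then show ?thesis by (intro exI[of _ "{}"]) auto
  next
    case False
    let ?C = "S \<inter> sphere 0 1"
    obtain x where x: "x \<in> S" "x \<noteq> 0" using False less.prems subspace_0 by blast
    have "x /\<^sub>R norm x \<in> ?C" using x less.prems(1) by (auto simp: subspace_scale)
    then have ne: "?C \<noteq> {}" by blast
    have cpt: "compact ?C" using closed_subspace[OF less.prems(1)] by (auto intro: closed_Int_compact)
    have "continuous_on ?C (\<lambda>v. v \<bullet> f v)"
      by (intro continuous_intros linear_continuous_on_compose[OF _ f(1)])
    then obtain v where v: "v \<in> ?C" "\<And>w. w \<in> ?C \<Longrightarrow> w \<bullet> f w \<le> v \<bullet> f v"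
      using continuous_attains_sup[OF cpt ne] by blast
    have ev: "f v = (v \<bullet> f v) *\<^sub>R v"
      by (rule self_adjoint_maximizer_eigenvector[OF f less.prems]) (use v in auto)
    have vS: "v \<in> S" "norm v = 1" "v \<bullet> v = 1" using v by (auto simp: dot_square_norm)
    let ?S = "S \<inter> {w. w \<bullet> v = 0}"
    have sub: "subspace ?S" using less.prems(1)
      by (auto simp: subspace_def inner_add_left)
    have inv: "f ` ?S \<subseteq> ?S"
    proof safe
      fix w assume w: "w \<in> S" "w \<bullet> v = 0"
      show "f w \<in> S" using w less.prems by auto
      show "f w \<bullet> v = 0" by (subst f(2), subst ev) (simp add: w)
    qed
    have "v \<notin> ?S" using vS by auto
    then have "?S \<subset> S" using vS by blast
    moreover have "span ?S = ?S" "span S = S" using sub less.prems(1) by (auto simp: span_eq_iff)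
    ultimately have "dim ?S < dim S" by (intro dim_psubset) metis
    from less.hyps[OF this sub inv] obtain B where B: "finite B" "pairwise orthogonal B"
      "\<forall>b\<in>B. norm b = 1 \<and> f b = (b \<bullet> f b) *\<^sub>R b" "span B = ?S" by blast
    have Bv: "b \<bullet> v = 0" if "b \<in> B" for b using that B(4) span_base[of b B] by auto
    have "span (insert v B) = S"
    proof
      show "span (insert v B) \<subseteq> S"
        using vS B(4) span_superset[of B] less.prems(1) by (intro span_minimal) auto
      show "S \<subseteq> span (insert v B)"
      proof
        fix x assume x: "x \<in> S"
        have "x - (x \<bullet> v) *\<^sub>R v \<in> span B"
          unfolding B(4) using x vS less.prems(1)
          by (auto simp: inner_diff_left intro!: subspace_diff subspace_scale)
        then show "x \<in> span (insert v B)" by (auto simp: span_insert)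
      qed
    qed
    then show ?thesis using B ev vS Bv
      by (intro exI[of _ "insert v B"])
        (auto simp: pairwise_insert orthogonal_def inner_commute)
  qed
qed

text \<open>With the eigenvectors as columns of \<open>P\<close>, the identity \<open>(X - A) P = P (X - D)\<close> holds over the polynomial
  ring, where \<open>det P\<close> is a unit; the determinant is multiplicative there.\<close>

lemma mat_charpoly_diagonalizable:
  fixes A :: "real^'n^'n" and g :: "'n \<Rightarrow> real^'n" and c :: "'n \<Rightarrow> real"
  assumes on: "\<And>i j. g i \<bullet> g j = (if i = j then 1 else 0)"
    and ev: "\<And>i. A *v g i = c i *\<^sub>R g i"
  shows "mat_charpoly A = (\<Prod>i\<in>UNIV. [:- c i, 1:])"
proof -
  let ?lift = "\<lambda>B::real^'n^'n. (\<chi> i j. [:B $ i $ j:]) :: real poly^'n^'n"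
  define P where "P = (\<chi> i j. g j $ i)"
  define D where "D = ((\<chi> i j. if i = j then [:- c i, 1:] else 0) :: real poly^'n^'n)"
  have const_sum: "(\<Sum>k\<in>X. [:h k:]) = [:\<Sum>k\<in>X. h k:]" for h :: "'n \<Rightarrow> real" and X
    by (induction X rule: infinite_finite_induct) auto
  have lift_mult: "?lift B ** ?lift C = ?lift (B ** C)" for B C
    by (simp add: matrix_matrix_mult_def vec_eq_iff const_sum mult.commute)
  have PP: "transpose P ** P = mat 1"
    using on by (simp add: P_def transpose_def matrix_matrix_mult_def mat_def vec_eq_iff inner_vec_def)
  have "det (?lift (transpose P)) * det (?lift P) = det (?lift (mat 1))"
    unfolding det_mul[symmetric] lift_mult PP ..
  also have "?lift (mat 1) = mat 1" by (simp add: mat_def vec_eq_iff one_pCons)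
  finally have nz: "det (?lift P) \<noteq> 0" by auto
  have AP: "(A ** P) $ i $ j = c j * P $ i $ j" for i j
    using ev[of j] by (simp add: P_def matrix_matrix_mult_def matrix_vector_mult_def vec_eq_iff)
  have diff: "(B - C) ** E = B ** E - C ** E" for B C E :: "real poly^'n^'n"
    by (simp add: matrix_matrix_mult_def vec_eq_iff sum_subtractf left_diff_distrib)
  have "((mat [:0, 1:] - ?lift A) ** ?lift P) $ i $ j = (?lift P ** D) $ i $ j" for i j
  proof -
    have "(mat [:0, 1:] ** ?lift P) $ i $ j
        = (\<Sum>k\<in>UNIV. (if i = k then [:0, 1:] else 0) * [:P $ k $ j:])"
      by (simp add: matrix_matrix_mult_def mat_def)
    also have "\<dots> = (\<Sum>k\<in>UNIV. if i = k then [:0, 1:] * [:P $ k $ j:] else 0)"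
      by (intro sum.cong) auto
    also have "\<dots> = [:0, 1:] * [:P $ i $ j:]" by (subst sum.delta') simp_all
    finally have "(mat [:0, 1:] ** ?lift P) $ i $ j = [:0, 1:] * [:P $ i $ j:]" .
    moreover have "(?lift P ** D) $ i $ j = [:P $ i $ j:] * [:- c j, 1:]"
      by (simp add: matrix_matrix_mult_def D_def if_distrib[of "\<lambda>x. _ * x"] sum.delta cong: if_cong)
    ultimately show ?thesis by (simp add: diff lift_mult AP)
  qed
  then have "(mat [:0, 1:] - ?lift A) ** ?lift P = ?lift P ** D" unfolding vec_eq_iff by blast
  from arg_cong[OF this, of det] have "det (mat [:0, 1:] - ?lift A) * det (?lift P) = det (?lift P) * det D"
    by (simp only: det_mul)
  then have "mat_charpoly A = det D" using nz by (simp add: mat_charpoly_def)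
  also have "det D = (\<Prod>i\<in>UNIV. D $ i $ i)" by (rule det_diagonal) (simp add: D_def)
  finally show ?thesis by (simp add: D_def)
qed

text \<open>The eigenvalues of \<open>eigenvalue_list\<close> are roots of the characteristic polynomial. Sorting an orthonormal
  eigenbasis by eigenvalue lets the basis vectors be numbered in the same order.\<close>

lemma sym_eigenbasis:
  fixes A :: "real^'n^'n"
  assumes sym: "transpose A = A"
  obtains e :: "nat \<Rightarrow> real^'n" where
    "\<And>i j. i < CARD('n) \<Longrightarrow> j < CARD('n) \<Longrightarrow> e i \<bullet> e j = (if i = j then 1 else 0)"
    "\<And>i. i < CARD('n) \<Longrightarrow> A *v e i = eigenvalue A (Suc i) *\<^sub>R e i"
    "length (eigenvalue_list A) = CARD('n)"
    "sorted_wrt (\<ge>) (eigenvalue_list A)"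
    "proots (mat_charpoly A) = mset (eigenvalue_list A)"
    "mat_charpoly A \<noteq> 0"
proof -
  let ?f = "\<lambda>v. A *v v"
  have sa: "?f x \<bullet> y = x \<bullet> ?f y" for x y
    using dot_lmul_matrix[of x A y] vector_transpose_matrix[of x A] sym by simp
  obtain B where B: "finite B" "pairwise orthogonal B"
    "\<And>b. b \<in> B \<Longrightarrow> norm b = 1" "\<And>b. b \<in> B \<Longrightarrow> ?f b = (b \<bullet> ?f b) *\<^sub>R b" "span B = UNIV"
    using self_adjoint_orthonormal_eigenbasis[of ?f UNIV] sa by auto
  have "0 \<notin> B" using B(3) by force
  then have "independent B" using B by (intro pairwise_orthogonal_independent) auto
  then have cB: "card B = CARD('n)" using B(5) indep_card_eq_dim_span[of B] by simp
  then obtain g :: "'n \<Rightarrow> real^'n" where g: "bij_betw g UNIV B"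
    using finite_same_card_bij[of "UNIV :: 'n set" B] B(1) by auto
  have on: "g i \<bullet> g j = (if i = j then 1 else 0)" for i j
  proof -
    have "g i \<in> B" "g j \<in> B" "g i = g j \<longleftrightarrow> i = j" using g by (auto simp: bij_betw_def inj_def)
    then show ?thesis using B(2,3) by (auto simp: pairwise_def orthogonal_def dot_square_norm)
  qed
  define c where "c i = g i \<bullet> ?f (g i)" for i
  have ev: "A *v g i = c i *\<^sub>R g i" for i
    unfolding c_def using g B(4)[of "g i"] by (auto simp: bij_betw_def)
  have cp: "mat_charpoly A = (\<Prod>i\<in>UNIV. [:- c i, 1:])"
    by (rule mat_charpoly_diagonalizable[OF on ev])
  obtain zs :: "'n list" where zs: "set zs = UNIV" "distinct zs"
    using finite_distinct_list[of "UNIV :: 'n set"] by auto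
  define xs where "xs = sort_key (\<lambda>i. - c i) zs"
  have xs: "set xs = UNIV" "distinct xs" using zs by (auto simp: xs_def)
  have len: "length xs = CARD('n)" using distinct_card[OF xs(2)] xs(1) by simp
  have "sorted (map (\<lambda>i. - c i) xs)" by (simp add: xs_def)
  then have srt: "sorted_wrt (\<ge>) (map c xs)" by (simp add: sorted_wrt_map)
  have "proots (mat_charpoly A) = (\<Sum>i\<in>UNIV. {#c i#})"
    unfolding cp by (subst proots_prod) auto
  also have "\<dots> = (\<Sum>i\<in>set xs. {#c i#})" using xs by simp
  also have "\<dots> = mset (map c xs)" using xs(2)
    by (simp add: sum.distinct_set_conv_list)
  finally have pr: "proots (mat_charpoly A) = mset (map c xs)" .
  have "sort (map c xs) = rev (map c xs)"
  proof -
    have "sorted (rev (map c xs))" using srt by (simp add: sorted_wrt_rev)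
    then have "sort (rev (map c xs)) = rev (map c xs)" by (rule sorted_sort_id)
    moreover have "sort (map c xs) = sort (rev (map c xs))"
      by (metis mset_rev sorted_list_of_multiset_mset)
    ultimately show ?thesis by simp
  qed
  then have el: "eigenvalue_list A = map c xs"
    unfolding eigenvalue_list_def pr sorted_list_of_multiset_mset by simp
  show ?thesis
  proof (rule that[of "\<lambda>i. g (xs ! i)"])
    show "g (xs ! i) \<bullet> g (xs ! j) = (if i = j then 1 else 0)"
      if "i < CARD('n)" "j < CARD('n)" for i j
      using that xs(2) len by (auto simp: on nth_eq_iff_index_eq)
    show "A *v g (xs ! i) = eigenvalue A (Suc i) *\<^sub>R g (xs ! i)" if "i < CARD('n)" for i
      using that len by (simp add: ev eigenvalue_def el)
    show "mat_charpoly A \<noteq> 0" by (simp add: cp)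
  qed (use len srt pr el in auto)
qed

lemma orthonormal_coordinates:
  fixes e :: "nat \<Rightarrow> real^'n"
  assumes on: "\<And>i j. i < CARD('n) \<Longrightarrow> j < CARD('n) \<Longrightarrow> e i \<bullet> e j = (if i = j then 1 else 0)"
  shows "v = (\<Sum>i<CARD('n). (e i \<bullet> v) *\<^sub>R e i)" and "(norm v)\<^sup>2 = (\<Sum>i<CARD('n). (e i \<bullet> v)\<^sup>2)"
proof -
  let ?B = "e ` {..<CARD('n)}"
  have inj: "inj_on e {..<CARD('n)}"
  proof (rule inj_onI)
    fix i j assume "i \<in> {..<CARD('n)}" "j \<in> {..<CARD('n)}" "e i = e j"
    then show "i = j" using on[of i j] on[of i i] by (auto split: if_splits)
  qed
  have orth: "pairwise orthogonal ?B" by (auto simp: pairwise_def orthogonal_def on)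
  moreover have "0 \<notin> ?B" using on by fastforce
  ultimately have "independent ?B" by (rule pairwise_orthogonal_independent)
  moreover have "card ?B = CARD('n)" using card_image[OF inj] by simp
  ultimately have "v \<in> span ?B"
    using card_ge_dim_independent[of ?B UNIV] by auto
  moreover have "\<And>b. b \<in> ?B \<Longrightarrow> norm b = 1" using on by (auto simp: norm_eq_sqrt_inner)
  moreover have "finite ?B" by simp
  ultimately have "(\<Sum>b\<in>?B. (v \<bullet> b) *\<^sub>R b) = v" using orth
    by (intro orthonormal_basis_expand) auto
  then show *: "v = (\<Sum>i<CARD('n). (e i \<bullet> v) *\<^sub>R e i)"
    by (simp add: sum.reindex[OF inj] inner_commute)
  have "v \<bullet> v = (\<Sum>i<CARD('n). (e i \<bullet> v)\<^sup>2)"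
    by (subst (2) *) (simp add: inner_sum_right power2_eq_square inner_commute)
  then show "(norm v)\<^sup>2 = (\<Sum>i<CARD('n). (e i \<bullet> v)\<^sup>2)" by (simp add: power2_norm_eq_inner)
qed

lemma sym_matrix_inner:
  fixes A :: "real^'n^'n"
  assumes "transpose A = A"
  shows "(A *v x) \<bullet> y = x \<bullet> (A *v y)"
  using dot_lmul_matrix[of x A y] vector_transpose_matrix[of x A] assms by simp

lemma sym_nonneg_eigenbasis:
  fixes A :: "real^'n^'n"
  assumes A: "sym_nonneg_definite A"
  obtains e :: "nat \<Rightarrow> real^'n" where
    "\<And>i j. i < CARD('n) \<Longrightarrow> j < CARD('n) \<Longrightarrow> e i \<bullet> e j = (if i = j then 1 else 0)"
    "\<And>i. i < CARD('n) \<Longrightarrow> A *v e i = eigenvalue A (Suc i) *\<^sub>R e i"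
    "\<And>v. (norm (A *v v))\<^sup>2 = (\<Sum>i<CARD('n). (eigenvalue A (Suc i))\<^sup>2 * (e i \<bullet> v)\<^sup>2)"
proof -
  have sym: "transpose A = A" and nn: "\<And>v. 0 \<le> v \<bullet> (A *v v)"
    using A by (auto simp: sym_nonneg_definite_def)
  obtain e where e: "\<And>i j. i < CARD('n) \<Longrightarrow> j < CARD('n) \<Longrightarrow> e i \<bullet> e j = (if i = j then 1 else 0)"
    "\<And>i. i < CARD('n) \<Longrightarrow> A *v e i = eigenvalue A (Suc i) *\<^sub>R e i"
    by (rule sym_eigenbasis[OF sym]) (rule that)
  have "(norm (A *v v))\<^sup>2 = (\<Sum>i<CARD('n). (eigenvalue A (Suc i))\<^sup>2 * (e i \<bullet> v)\<^sup>2)" for v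
  proof -
    have "(norm (A *v v))\<^sup>2 = (\<Sum>i<CARD('n). (e i \<bullet> (A *v v))\<^sup>2)"
      by (rule orthonormal_coordinates(2)) (rule e(1))
    also have "\<dots> = (\<Sum>i<CARD('n). (eigenvalue A (Suc i))\<^sup>2 * (e i \<bullet> v)\<^sup>2)"
      by (intro sum.cong refl)
        (simp add: sym_matrix_inner[OF sym, symmetric] e(2) power_mult_distrib)
    finally show ?thesis .
  qed
  with e show ?thesis by (rule that)
qed

lemma eigenvalue_decreasing:
  fixes A :: "real^'n^'n"
  assumes A: "transpose A = A" and "1 \<le> i" "i \<le> j" "j \<le> CARD('n)"
  shows "eigenvalue A j \<le> eigenvalue A i"
proof -
  have l: "length (eigenvalue_list A) = CARD('n)" "sorted_wrt (\<ge>) (eigenvalue_list A)"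
    by (rule sym_eigenbasis[OF A]; assumption)+
  show ?thesis
  proof (cases "i = j")
    case False
    then show ?thesis
      using assms sorted_wrt_nth_less[OF l(2), of "i - 1" "j - 1"] l(1) by (simp add: eigenvalue_def)
  qed simp
qed

lemma eigenvalue_nonneg:
  fixes A :: "real^'n^'n"
  assumes A: "sym_nonneg_definite A" and "1 \<le> i" "i \<le> CARD('n)"
  shows "0 \<le> eigenvalue A i"
proof -
  obtain e :: "nat \<Rightarrow> real^'n" where e: "\<And>i j. i < CARD('n) \<Longrightarrow> j < CARD('n) \<Longrightarrow> e i \<bullet> e j = (if i = j then 1 else 0)"
    "\<And>i. i < CARD('n) \<Longrightarrow> A *v e i = eigenvalue A (Suc i) *\<^sub>R e i"
    by (rule sym_nonneg_eigenbasis[OF A]) (rule that)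
  have "0 \<le> e (i - 1) \<bullet> (A *v e (i - 1))" using A by (simp add: sym_nonneg_definite_def)
  also have "\<dots> = eigenvalue A i" using assms e(2)[of "i - 1"] e(1)[of "i - 1" "i - 1"] by simp
  finally show ?thesis .
qed

lemma norm_matrix_le_top_eigenvalue:
  fixes A :: "real^'n^'n"
  assumes A: "sym_nonneg_definite A"
  shows "norm (A *v v) \<le> eigenvalue A 1 * norm v"
proof -
  have sym: "transpose A = A" using A by (simp add: sym_nonneg_definite_def)
  obtain e :: "nat \<Rightarrow> real^'n" where e: "\<And>i j. i < CARD('n) \<Longrightarrow> j < CARD('n) \<Longrightarrow> e i \<bullet> e j = (if i = j then 1 else 0)"
    "\<And>i. i < CARD('n) \<Longrightarrow> A *v e i = eigenvalue A (Suc i) *\<^sub>R e i"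
    "\<And>v. (norm (A *v v))\<^sup>2 = (\<Sum>i<CARD('n). (eigenvalue A (Suc i))\<^sup>2 * (e i \<bullet> v)\<^sup>2)"
    by (rule sym_nonneg_eigenbasis[OF A]) (rule that)
  have "(norm (A *v v))\<^sup>2 \<le> (\<Sum>i<CARD('n). (eigenvalue A 1)\<^sup>2 * (e i \<bullet> v)\<^sup>2)"
    unfolding e(3)
    by (intro sum_mono mult_right_mono power_mono eigenvalue_nonneg[OF A] eigenvalue_decreasing[OF sym]) auto
  also have "\<dots> = (eigenvalue A 1 * norm v)\<^sup>2"
    by (simp add: power_mult_distrib orthonormal_coordinates(2)[OF e(1), of v] sum_distrib_left)
  finally show ?thesis
    using eigenvalue_nonneg[OF A, of 1] by (auto intro: power2_le_imp_le mult_nonneg_nonneg)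
qed

text \<open>Weyl's inequality, by counting dimensions: the span of the first \<open>k + 1\<close> eigenvectors of \<open>A\<close> meets the
  orthogonal complement of the first \<open>k\<close> eigenvectors of \<open>B\<close>, and on a common vector \<open>A\<close> is large while \<open>B\<close> is small.\<close>

lemma eigenvalue_perturbation:
  fixes A B :: "real^'n^'n"
  assumes A: "sym_nonneg_definite A" and B: "sym_nonneg_definite B"
    and AB: "\<And>v. norm (A *v v - B *v v) \<le> \<delta> * norm v" and k: "k < CARD('n)"
  shows "eigenvalue A (Suc k) \<le> eigenvalue B (Suc k) + \<delta>"
proof -
  let ?d = "CARD('n)"
  have symA: "transpose A = A" and symB: "transpose B = B" using A B by (auto simp: sym_nonneg_definite_def)
  obtain e :: "nat \<Rightarrow> real^'n" where e: "\<And>i j. i < ?d \<Longrightarrow> j < ?d \<Longrightarrow> e i \<bullet> e j = (if i = j then 1 else 0)"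
    "\<And>i. i < ?d \<Longrightarrow> A *v e i = eigenvalue A (Suc i) *\<^sub>R e i"
    "\<And>v. (norm (A *v v))\<^sup>2 = (\<Sum>i<?d. (eigenvalue A (Suc i))\<^sup>2 * (e i \<bullet> v)\<^sup>2)"
    by (rule sym_nonneg_eigenbasis[OF A]) (rule that)
  obtain f :: "nat \<Rightarrow> real^'n" where f: "\<And>i j. i < ?d \<Longrightarrow> j < ?d \<Longrightarrow> f i \<bullet> f j = (if i = j then 1 else 0)"
    "\<And>i. i < ?d \<Longrightarrow> B *v f i = eigenvalue B (Suc i) *\<^sub>R f i"
    "\<And>v. (norm (B *v v))\<^sup>2 = (\<Sum>i<?d. (eigenvalue B (Suc i))\<^sup>2 * (f i \<bullet> v)\<^sup>2)"
    by (rule sym_nonneg_eigenbasis[OF B]) (rule that)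
  define F where "F = f ` {..<k}"
  have cF: "dim F \<le> k"
    unfolding F_def using dim_le_card'[of "f ` {..<k}"] card_image_le[of "{..<k}" f] by simp
  define E where "E = e ` {..k}"
  have injE: "inj_on e {..k}"
  proof (rule inj_onI)
    fix i j assume "i \<in> {..k}" "j \<in> {..k}" "e i = e j"
    then show "i = j" using e(1)[of i j] e(1)[of i i] k by (auto split: if_splits)
  qed
  have "pairwise orthogonal E" using k by (auto simp: pairwise_def orthogonal_def E_def e(1))
  moreover have "0 \<notin> E"
  proof
    assume "0 \<in> E"
    then obtain i where "i \<le> k" "e i = 0" by (auto simp: E_def)
    then show False using e(1)[of i i] k by simp
  qed
  ultimately have "independent E" by (rule pairwise_orthogonal_independent)
  then have dE: "dim E = Suc k" using card_image[OF injE] by (simp add: E_def dim_eq_card_independent)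
  have "dim {y \<in> UNIV. \<forall>x\<in>span F. orthogonal x y} + dim (span F) = ?d"
    using dim_subspace_orthogonal_to_vectors[of "span F" UNIV] by simp
  moreover define Fp where "Fp = {y. \<forall>x\<in>span F. orthogonal x y}"
  ultimately have dFp: "dim Fp \<ge> ?d - k" using cF by simp
  have sFp: "subspace Fp" unfolding Fp_def by (rule subspace_orthogonal_to_vectors)
  have "dim {x + y |x y. x \<in> span E \<and> y \<in> Fp} + dim (span E \<inter> Fp) = dim (span E) + dim Fp"
    using sFp by (intro dim_sums_Int) auto
  moreover have "dim {x + y |x y. x \<in> span E \<and> y \<in> Fp} \<le> ?d" by (rule dim_subset_UNIV_cart)
  ultimately have "dim (span E \<inter> Fp) > 0" using dE dFp k by simp
  then have "\<not> span E \<inter> Fp \<subseteq> {0}"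
  proof (rule contrapos_pp)
    assume "\<not> \<not> span E \<inter> Fp \<subseteq> {0}"
    then have "span E \<inter> Fp \<subseteq> {0}" by (rule notnotD)
    then have "dim (span E \<inter> Fp) = 0" by (rule dim_eq_0[THEN iffD2])
    then show "\<not> 0 < dim (span E \<inter> Fp)" by (rule ssubst) (rule less_irrefl)
  qed
  then obtain v where v: "v \<in> span E" "v \<in> Fp" "v \<noteq> 0" by blast
  have ev0: "e i \<bullet> v = 0" if "k < i" "i < ?d" for i
  proof -
    have "orthogonal (e i) v"
      by (rule orthogonal_to_span[OF v(1)]) (use that k e(1) in \<open>auto simp: E_def orthogonal_def\<close>)
    then show ?thesis by (simp add: orthogonal_def)
  qed
  have fv0: "f i \<bullet> v = 0" if "i < k" for i
    using v(2) span_base[of "f i" F] that by (auto simp: Fp_def F_def orthogonal_def)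
  have "(eigenvalue A (Suc k) * norm v)\<^sup>2 = (\<Sum>i<?d. (eigenvalue A (Suc k))\<^sup>2 * (e i \<bullet> v)\<^sup>2)"
    by (simp add: power_mult_distrib orthonormal_coordinates(2)[OF e(1), of v] sum_distrib_left)
  also have "\<dots> \<le> (\<Sum>i<?d. (eigenvalue A (Suc i))\<^sup>2 * (e i \<bullet> v)\<^sup>2)"
  proof (intro sum_mono)
    fix i assume i: "i \<in> {..<?d}"
    show "(eigenvalue A (Suc k))\<^sup>2 * (e i \<bullet> v)\<^sup>2 \<le> (eigenvalue A (Suc i))\<^sup>2 * (e i \<bullet> v)\<^sup>2"
    proof (cases "k < i")
      case False
      then show ?thesis using k
        by (intro mult_right_mono power_mono eigenvalue_nonneg[OF A] eigenvalue_decreasing[OF symA]) auto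
    qed (use ev0 i in auto)
  qed
  also have "\<dots> = (norm (A *v v))\<^sup>2" by (simp add: e(3))
  finally have lo: "eigenvalue A (Suc k) * norm v \<le> norm (A *v v)" by (rule power2_le_imp_le) simp
  have "(norm (B *v v))\<^sup>2 \<le> (\<Sum>i<?d. (eigenvalue B (Suc k))\<^sup>2 * (f i \<bullet> v)\<^sup>2)"
    unfolding f(3)
  proof (intro sum_mono)
    fix i assume i: "i \<in> {..<?d}"
    show "(eigenvalue B (Suc i))\<^sup>2 * (f i \<bullet> v)\<^sup>2 \<le> (eigenvalue B (Suc k))\<^sup>2 * (f i \<bullet> v)\<^sup>2"
    proof (cases "i < k")
      case False
      then show ?thesis using i
        by (intro mult_right_mono power_mono eigenvalue_nonneg[OF B] eigenvalue_decreasing[OF symB]) auto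
    qed (use fv0 i in auto)
  qed
  also have "\<dots> = (eigenvalue B (Suc k) * norm v)\<^sup>2"
    by (simp add: power_mult_distrib orthonormal_coordinates(2)[OF f(1), of v] sum_distrib_left)
  finally have up: "norm (B *v v) \<le> eigenvalue B (Suc k) * norm v"
    by (rule power2_le_imp_le) (use eigenvalue_nonneg[OF B] k in auto)
  have "norm (A *v v) \<le> norm (B *v v) + \<delta> * norm v"
    using AB[of v] norm_triangle_sub[of "A *v v" "B *v v"] by simp
  with lo up have "eigenvalue A (Suc k) * norm v \<le> (eigenvalue B (Suc k) + \<delta>) * norm v"
    by (simp add: algebra_simps)
  then show ?thesis using v(3) by simp
qed

text \<open>The multiplicity as a root is the number of occurrences in the sorted list of eigenvalues, where
  the largest one occupies an initial segment.\<close>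

lemma largest_eigenvalue_mult_props:
  fixes A :: "real^'n^'n"
  assumes A: "transpose A = A"
  shows "1 \<le> largest_eigenvalue_mult A" "largest_eigenvalue_mult A \<le> CARD('n)"
    and "\<And>i. largest_eigenvalue_mult A < i \<Longrightarrow> i \<le> CARD('n) \<Longrightarrow> eigenvalue A i < eigenvalue A 1"
proof -
  let ?l = "eigenvalue_list A" and ?m = "largest_eigenvalue_mult A"
  have l: "length ?l = CARD('n)" "sorted_wrt (\<ge>) ?l"
      "proots (mat_charpoly A) = mset ?l" "mat_charpoly A \<noteq> 0"
    by (rule sym_eigenbasis[OF A]; assumption)+
  have "?m = count (proots (mat_charpoly A)) (eigenvalue A 1)"
    using l(4) by (simp add: largest_eigenvalue_mult_def)
  also have "\<dots> = card {i. i < CARD('n) \<and> ?l ! i = eigenvalue A 1}"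
    unfolding l(3) by (simp add: count_mset count_list_eq_length_filter length_filter_conv_card l(1) eq_commute)
  finally have m: "?m = card {i. i < CARD('n) \<and> ?l ! i = eigenvalue A 1}" (is "_ = card ?I") .
  have "0 \<in> ?I" by (simp add: eigenvalue_def)
  then show "1 \<le> ?m" unfolding m using card_gt_0_iff[of ?I] by force
  have "card ?I \<le> card {..<CARD('n)}" by (intro card_mono) auto
  then show "?m \<le> CARD('n)" unfolding m by simp
  fix i assume i: "?m < i" "i \<le> CARD('n)"
  have le: "eigenvalue A i \<le> eigenvalue A 1" using i by (intro eigenvalue_decreasing[OF A]) auto
  show "eigenvalue A i < eigenvalue A 1"
  proof (rule ccontr)
    assume "\<not> ?thesis"
    with le have eq: "eigenvalue A i = eigenvalue A 1" by simp
    have "{..<i} \<subseteq> ?I"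
    proof
      fix j assume j: "j \<in> {..<i}"
      have "eigenvalue A i \<le> eigenvalue A (Suc j)" "eigenvalue A (Suc j) \<le> eigenvalue A 1"
        using i j by (auto intro!: eigenvalue_decreasing[OF A])
      with eq have "eigenvalue A (Suc j) = eigenvalue A 1" by simp
      then show "j \<in> ?I" using i j by (simp add: eigenvalue_def)
    qed
    then have "card {..<i} \<le> ?m" unfolding m by (intro card_mono) auto
    then show False using i by simp
  qed
qed

section \<open>Centred Gaussian vectors\<close>

lemma borel_measurable_component [measurable]:
  "(\<lambda>x::real^'n. x $ i) \<in> borel_measurable borel"
  by (intro borel_measurable_continuous_onI continuous_intros)

lemma borel_measurable_matrix_vector [measurable]:
  "(\<lambda>x::real^'n. A *v x) \<in> borel_measurable borel"
  by (intro borel_measurable_continuous_onI linear_continuous_on matrix_vector_mul_bounded_linear)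

lemma borel_measurable_vec_lambda_PiM [measurable]:
  "(\<lambda>f. \<chi> i. f i) \<in> PiM (UNIV::'n::finite set) (\<lambda>_. lborel :: real measure) \<rightarrow>\<^sub>M (borel :: (real^'n) measure)"
proof (rule borel_measurable_euclidean_space[THEN iffD2, rule_format])
  fix b :: "real^'n" assume "b \<in> Basis"
  then obtain i where b: "b = axis i 1" by (auto simp: Basis_vec_def)
  have "(\<lambda>f. (\<chi> i. f i) \<bullet> b) = (\<lambda>f. f i)" by (simp add: b inner_axis)
  also have "\<dots> \<in> borel_measurable (PiM (UNIV::'n set) (\<lambda>_. lborel))" by measurable
  finally show "(\<lambda>f. (\<chi> i. f i) \<bullet> b) \<in> borel_measurable (PiM (UNIV::'n set) (\<lambda>_. lborel))" .
qed

lemma prod_Basis_vec: "(\<Prod>b\<in>(Basis::(real^'n) set). h b) = (\<Prod>i\<in>UNIV. h (axis i 1))"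
proof -
  have "bij_betw (\<lambda>i. axis i 1 :: real^'n) UNIV Basis"
    by (auto simp: bij_betw_def Basis_vec_def inj_def axis_eq_axis)
  then show ?thesis by (rule prod.reindex_bij_betw[symmetric])
qed

interpretation lborel_product: product_sigma_finite "\<lambda>_. lborel :: real measure"
  by standard

text \<open>Fubini's theorem for single coordinates is available for product measures; it is carried over to
  vectors along this identity.\<close>

lemma lborel_vec_eq_PiM:
  "lborel = distr (PiM (UNIV::'n::finite set) (\<lambda>_. lborel :: real measure)) borel (\<lambda>f. (\<chi> i. f i) :: real^'n)"
proof (rule lborel_eqI)
  fix l u :: "real^'n" assume le: "\<And>b. b \<in> Basis \<Longrightarrow> l \<bullet> b \<le> u \<bullet> b"
  have le': "l $ i \<le> u $ i" for i using le[of "axis i 1"] by (simp add: inner_axis)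
  let ?P = "PiM (UNIV::'n set) (\<lambda>_. lborel :: real measure)"
  have "emeasure (distr ?P borel (\<lambda>f. \<chi> i. f i)) (box l u) = emeasure ?P ((\<lambda>f. \<chi> i. f i) -` box l u \<inter> space ?P)"
    by (rule emeasure_distr) auto
  also have "(\<lambda>f. (\<chi> i. f i) :: real^'n) -` box l u \<inter> space ?P = (\<Pi>\<^sub>E i\<in>UNIV. {l$i <..< u$i})"
    by (auto simp: space_PiM mem_box_cart PiE_iff)
  also have "emeasure ?P \<dots> = (\<Prod>i\<in>UNIV. emeasure lborel {l$i <..< u$i})"
    by (rule lborel_product.emeasure_PiM) auto
  also have "\<dots> = (\<Prod>i\<in>UNIV. ennreal (u$i - l$i))" using le' by simp
  also have "\<dots> = ennreal (\<Prod>b\<in>Basis. (u - l) \<bullet> b)"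
    using le' by (simp add: prod_Basis_vec inner_axis prod_ennreal)
  finally show "emeasure (distr ?P borel (\<lambda>f. \<chi> i. f i)) (box l u) = (\<Prod>b\<in>Basis. (u - l) \<bullet> b)" .
qed simp

lemma nn_integral_lborel_vec:
  fixes h :: "real^'n \<Rightarrow> ennreal"
  assumes [measurable]: "h \<in> borel_measurable borel"
  shows "(\<integral>\<^sup>+x. h x \<partial>lborel) = (\<integral>\<^sup>+f. h (\<chi> i. f i) \<partial>PiM (UNIV::'n set) (\<lambda>_. lborel))"
  by (subst lborel_vec_eq_PiM) (simp add: nn_integral_distr)

lemma nn_integral_lborel_vec_prod:
  assumes [measurable]: "\<And>i. f i \<in> borel_measurable borel"
  shows "(\<integral>\<^sup>+x. (\<Prod>i\<in>UNIV. f i (x $ i)) \<partial>(lborel :: (real^'n) measure)) = (\<Prod>i\<in>UNIV. \<integral>\<^sup>+y. f i y \<partial>lborel)"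
  by (subst nn_integral_lborel_vec) (simp_all add: lborel_product.product_nn_integral_prod)

text \<open>The centred normal distribution with covariance matrix \<open>v I\<close>.\<close>

definition gauss :: "real \<Rightarrow> (real^'n) measure" where
  "gauss v = density lborel (\<lambda>x. ennreal (\<Prod>i\<in>UNIV. normal_density 0 (sqrt v) (x $ i)))"

lemma space_gauss [simp]: "space (gauss v) = UNIV" and sets_gauss [simp, measurable_cong]: "sets (gauss v) = sets borel"
  by (simp_all add: gauss_def)

lemma gauss_density_norm:
  fixes x :: "real^'n"
  assumes "v > 0"
  shows "(\<Prod>i\<in>UNIV. normal_density 0 (sqrt v) (x $ i)) = (1 / sqrt (2 * pi * v)) ^ CARD('n) * exp (- (norm x)\<^sup>2 / (2 * v))"
proof -
  have "(norm x)\<^sup>2 = (\<Sum>i\<in>UNIV. (x $ i)\<^sup>2)"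
    unfolding power2_norm_eq_inner inner_vec_def by (simp add: power2_eq_square)
  then have "exp (- (norm x)\<^sup>2 / (2 * v)) = (\<Prod>i\<in>UNIV. exp (- (x $ i)\<^sup>2 / (2 * v)))"
    by (simp add: exp_sum[symmetric] sum_divide_distrib[symmetric] sum_negf)
  then show ?thesis using assms
    by (simp add: normal_density_def prod.distrib power_divide prod_dividef)
qed

lemma gauss_1_eq: "density lborel (\<lambda>x. ennreal (multi_normal_density 0 (mat 1) x)) = (gauss 1 :: (real^'n) measure)"
proof -
  have inv: "matrix_inv (mat 1 :: real^'n^'n) = mat 1"
    unfolding matrix_inv_def by (rule some_equality) auto
  have "multi_normal_density 0 (mat 1) x = (\<Prod>i\<in>UNIV. normal_density 0 (sqrt 1) (x $ i))" for x :: "real^'n"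
    unfolding gauss_density_norm[OF zero_less_one]
    unfolding multi_normal_density_def inv
    using real_sqrt_power[of "2 * pi" "CARD('n)"]
    by (simp add: dot_square_norm power_one_over del: power_mult_distrib real_sqrt_mult)
  then show ?thesis by (simp add: gauss_def)
qed

lemma prob_space_gauss:
  assumes "v > 0" shows "prob_space (gauss v :: (real^'n) measure)"
proof
  have "(\<integral>\<^sup>+y. ennreal (normal_density 0 (sqrt v) y) \<partial>lborel) = 1"
    using prob_space.emeasure_space_1[OF prob_space_normal_density[of "sqrt v" 0]] assms
    by (simp add: emeasure_density)
  then have "(\<Prod>i\<in>(UNIV::'n set). \<integral>\<^sup>+y. ennreal (normal_density 0 (sqrt v) y) \<partial>lborel) = 1" by simp
  then show "emeasure (gauss v :: (real^'n) measure) (space (gauss v)) = 1"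
    by (subst (asm) nn_integral_lborel_vec_prod[symmetric])
      (simp_all add: gauss_def emeasure_density prod_ennreal normal_density_nonneg)
qed

text \<open>Lebesgue measure is the only translation invariant measure that gives the unit ball its
  volume: integrate \<open>1\<^sub>A(f x) 1\<^sub>B(y - f x)\<close> over \<open>(x, y)\<close> in both orders.\<close>

lemma lborel_orthogonal_invariant:
  fixes f :: "'a::euclidean_space \<Rightarrow> 'a"
  assumes f: "orthogonal_transformation f"
  shows "distr lborel borel f = lborel"
proof (rule measure_eqI)
  have lin: "linear f" by (rule orthogonal_transformation_linear[OF f])
  have fm [measurable]: "f \<in> borel_measurable borel"
    by (intro borel_measurable_continuous_onI linear_continuous_on linear_conv_bounded_linear[THEN iffD1] lin)
  have nf: "norm (f x) = norm x" for x using f by (simp add: orthogonal_transformation)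
  let ?B = "ball 0 1 :: 'a set"
  have [measurable]: "?B \<in> sets borel" by simp
  fix A :: "'a set" assume "A \<in> sets (distr lborel borel f)"
  then have A [measurable]: "A \<in> sets borel" by simp
  have shift: "(\<integral>\<^sup>+y. h (y + c) \<partial>lborel) = (\<integral>\<^sup>+y. h y \<partial>lborel)"
    if [measurable]: "h \<in> borel_measurable borel" for h :: "'a \<Rightarrow> ennreal" and c
  proof -
    have "(\<integral>\<^sup>+y. h y \<partial>lborel) = (\<integral>\<^sup>+y. h y \<partial>distr lborel borel ((+) c))" by (simp add: lborel_distr_plus)
    also have "\<dots> = (\<integral>\<^sup>+y. h (c + y) \<partial>lborel)" by (rule nn_integral_distr) simp_all
    finally show ?thesis by (simp add: add.commute)
  qed
  have "emeasure lborel (f -` A) * emeasure lborel ?B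
      = (\<integral>\<^sup>+x. indicator A (f x) * (\<integral>\<^sup>+y. indicator ?B (y + (- f x)) \<partial>lborel) \<partial>lborel)"
  proof -
    have "(\<integral>\<^sup>+y. indicator ?B (y + (- f x)) \<partial>lborel) = emeasure lborel ?B" for x
    proof -
      have [measurable]: "(indicator ?B :: 'a \<Rightarrow> ennreal) \<in> borel_measurable borel" by simp
      show ?thesis by (subst shift) auto
    qed
    moreover have "(\<integral>\<^sup>+x. indicator A (f x) \<partial>lborel) = emeasure lborel (f -` A)"
    proof -
      have "f -` A \<in> sets borel" using measurable_sets[OF fm A] by simp
      then have "(\<integral>\<^sup>+x. indicator (f -` A) x \<partial>lborel) = emeasure lborel (f -` A)" by simp
      then show ?thesis by (simp add: indicator_def)
    qed
    ultimately show ?thesis by (simp add: nn_integral_multc)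
  qed
  also have "\<dots> = (\<integral>\<^sup>+x. \<integral>\<^sup>+y. indicator A (f x) * indicator ?B (y - f x) \<partial>lborel \<partial>lborel)"
  proof (rule nn_integral_cong)
    fix x
    have "(indicator ?B :: 'a \<Rightarrow> ennreal) \<in> borel_measurable borel" by simp
    from measurable_compose[OF _ this, of "\<lambda>y. y - f x"]
    have "(\<lambda>y. indicator ?B (y - f x) :: ennreal) \<in> borel_measurable lborel" by simp
    from nn_integral_cmult[OF this, of "indicator A (f x)"]
    show "indicator A (f x) * (\<integral>\<^sup>+y. indicator ?B (y + - f x) \<partial>lborel)
        = (\<integral>\<^sup>+y. indicator A (f x) * indicator ?B (y - f x) \<partial>lborel)" by simp
  qed
  also have "\<dots> = (\<integral>\<^sup>+y. \<integral>\<^sup>+x. indicator A (f x) * indicator ?B (y - f x) \<partial>lborel \<partial>lborel)"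
    by (rule lborel_pair.Fubini') measurable
  also have "\<dots> = (\<integral>\<^sup>+y. \<integral>\<^sup>+x. indicator A (y + f x) * indicator ?B (f x) \<partial>lborel \<partial>lborel)"
  proof (rule nn_integral_cong)
    fix y
    obtain z where z: "f z = y" using orthogonal_transformation_surj[OF f] by (metis surjD)
    have "(\<integral>\<^sup>+x. indicator A (f x) * indicator ?B (y - f x) \<partial>lborel)
        = (\<integral>\<^sup>+x. indicator A (f (x + z)) * indicator ?B (y - f (x + z)) \<partial>lborel)"
      by (rule shift[symmetric]) measurable
    also have "\<dots> = (\<integral>\<^sup>+x. indicator A (y + f x) * indicator ?B (f x) \<partial>lborel)"
      by (simp add: linear_add[OF lin] z add.commute indicator_def)
    finally show "(\<integral>\<^sup>+x. indicator A (f x) * indicator ?B (y - f x) \<partial>lborel)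
        = (\<integral>\<^sup>+x. indicator A (y + f x) * indicator ?B (f x) \<partial>lborel)" .
  qed
  also have "\<dots> = (\<integral>\<^sup>+x. \<integral>\<^sup>+y. indicator A (y + f x) * indicator ?B (f x) \<partial>lborel \<partial>lborel)"
    by (rule lborel_pair.Fubini') measurable
  also have "\<dots> = (\<integral>\<^sup>+x. (\<integral>\<^sup>+y. indicator A (y + f x) \<partial>lborel) * indicator ?B (f x) \<partial>lborel)"
    by (simp add: nn_integral_multc)
  also have "\<dots> = (\<integral>\<^sup>+x. emeasure lborel A * indicator ?B x \<partial>lborel)"
    by (subst shift) (auto simp: indicator_def nf intro!: nn_integral_cong)
  also have "\<dots> = emeasure lborel A * emeasure lborel ?B" by (simp add: nn_integral_cmult)
  finally have "emeasure lborel (f -` A) * emeasure lborel ?B = emeasure lborel A * emeasure lborel ?B" .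
  moreover have "emeasure lborel ?B \<noteq> \<infinity>" using emeasure_bounded_finite[of ?B] by simp
  moreover have "emeasure lborel ?B \<noteq> 0"
    using content_ball_pos[of 1 "0::'a"] by (auto simp: measure_def)
  ultimately have "emeasure lborel (f -` A) = emeasure lborel A"
    by (metis ennreal_mult_cancel_left infinity_ennreal_def mult.commute)
  then show "emeasure (distr lborel borel f) A = emeasure lborel A" by (simp add: emeasure_distr)
qed simp

lemma gauss_orthogonal_invariant:
  fixes f :: "real^'n \<Rightarrow> real^'n"
  assumes v: "v > 0" and f: "orthogonal_transformation f"
  shows "distr (gauss v) borel f = gauss v"
proof -
  have lin: "linear f" by (rule orthogonal_transformation_linear[OF f])
  have [measurable]: "f \<in> borel_measurable borel"
    by (intro borel_measurable_continuous_onI linear_continuous_on linear_conv_bounded_linear[THEN iffD1] lin)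
  have nf: "norm (f x) = norm x" for x using f by (simp add: orthogonal_transformation)
  let ?h = "\<lambda>x::real^'n. ennreal ((1 / sqrt (2 * pi * v)) ^ CARD('n) * exp (- (norm x)\<^sup>2 / (2 * v)))"
  have "distr (density lborel ?h) borel f = distr (density lborel (\<lambda>x. ?h (f x))) borel f" by (simp add: nf)
  also have "\<dots> = density (distr lborel borel f) ?h" by (rule density_distr[symmetric]) auto
  also have "\<dots> = density lborel ?h" by (simp add: lborel_orthogonal_invariant[OF f])
  finally show ?thesis unfolding gauss_def gauss_density_norm[OF v] .
qed

lemma gauss_symmetric:
  assumes "v > 0" shows "distr (gauss v) borel uminus = (gauss v :: (real^'n) measure)"
  by (rule gauss_orthogonal_invariant[OF assms]) (simp add: orthogonal_transformation linear_uminus)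

lemma gauss_scale:
  assumes v: "v > 0"
  shows "distr (gauss 1) borel (\<lambda>x. sqrt v *\<^sub>R x) = (gauss v :: (real^'n) measure)"
proof -
  let ?c = "sqrt v"
  let ?h = "\<lambda>v x::real^'n. ennreal ((1 / sqrt (2 * pi * v)) ^ CARD('n) * exp (- (norm x)\<^sup>2 / (2 * v)))"
  have eq: "ennreal (?c ^ CARD('n)) * ?h v (?c *\<^sub>R x) = ?h 1 x" for x
    using v by (simp add: ennreal_mult'[symmetric] power_mult_distrib real_sqrt_mult power_divide field_simps)
  have "gauss v = density lborel (?h v)" unfolding gauss_def gauss_density_norm[OF v] ..
  also have "\<dots> = density (density (distr lborel borel (\<lambda>x. 0 + ?c *\<^sub>R x)) (\<lambda>_. ennreal (\<bar>?c\<bar> ^ DIM(real^'n)))) (?h v)"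
    using lborel_affine[of ?c "0::real^'n"] v by simp
  also have "\<dots> = density (distr lborel borel (\<lambda>x. ?c *\<^sub>R x)) (\<lambda>x. ennreal (?c ^ CARD('n)) * ?h v x)"
    using v by (subst density_density_eq) simp_all
  also have "\<dots> = distr (density lborel (\<lambda>x. ennreal (?c ^ CARD('n)) * ?h v (?c *\<^sub>R x))) borel (\<lambda>x. ?c *\<^sub>R x)"
    by (rule density_distr) auto
  also have "\<dots> = distr (density lborel (?h 1)) borel (\<lambda>x. ?c *\<^sub>R x)" unfolding eq ..
  also have "density lborel (?h 1) = gauss 1" unfolding gauss_def gauss_density_norm[OF zero_less_one] ..
  finally show ?thesis by simp
qed

text \<open>The convolution integral factorizes over the coordinates.\<close>

lemma gauss_add:
  assumes a: "a > 0" and b: "b > 0"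
  shows "distr (gauss a \<Otimes>\<^sub>M gauss b) borel (\<lambda>(x, y). x + y) = (gauss (a + b) :: (real^'n) measure)"
proof (rule measure_eqI)
  let ?d = "\<lambda>v x::real^'n. \<Prod>i\<in>UNIV. normal_density 0 (sqrt v) (x $ i)"
  interpret A: prob_space "gauss a :: (real^'n) measure" by (rule prob_space_gauss[OF a])
  interpret B: prob_space "gauss b :: (real^'n) measure" by (rule prob_space_gauss[OF b])
  fix S :: "(real^'n) set" assume "S \<in> sets (distr (gauss a \<Otimes>\<^sub>M gauss b) borel (\<lambda>(x, y). x + y))"
  then have [measurable]: "S \<in> sets borel" by simp
  have [measurable]: "(\<lambda>p::(real^'n)\<times>(real^'n). fst p + snd p) \<in> gauss a \<Otimes>\<^sub>M gauss b \<rightarrow>\<^sub>M borel" by measurable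
  have pos: "0 \<le> ?d v x" for v x by (intro prod_nonneg) (simp add: normal_density_nonneg)
  have conv: "(\<integral>\<^sup>+x. ennreal (?d a x) * ennreal (?d b (z - x)) \<partial>lborel) = ennreal (?d (a + b) z)" for z
  proof -
    have "(\<integral>\<^sup>+x. ennreal (?d a x) * ennreal (?d b (z - x)) \<partial>lborel)
       = (\<integral>\<^sup>+x. (\<Prod>i\<in>UNIV. ennreal (normal_density 0 (sqrt b) (z $ i - x $ i) * normal_density 0 (sqrt a) (x $ i))) \<partial>lborel)"
      by (intro nn_integral_cong)
        (simp add: prod_ennreal normal_density_nonneg ennreal_mult'[symmetric] pos prod.distrib mult.commute)
    also have "\<dots> = (\<Prod>i\<in>UNIV. \<integral>\<^sup>+y. ennreal (normal_density 0 (sqrt b) (z $ i - y) * normal_density 0 (sqrt a) y) \<partial>lborel)"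
      by (rule nn_integral_lborel_vec_prod) measurable
    also have "\<dots> = (\<Prod>i\<in>UNIV. ennreal (normal_density 0 (sqrt (b + a)) (z $ i)))"
      using fun_cong[OF conv_normal_density_zero_mean[of "sqrt b" "sqrt a"]] a b by simp
    finally show ?thesis by (simp add: prod_ennreal normal_density_nonneg add.commute)
  qed
  have "emeasure (distr (gauss a \<Otimes>\<^sub>M gauss b) borel (\<lambda>(x, y). x + y)) S
      = (\<integral>\<^sup>+p. indicator S (fst p + snd p) \<partial>(gauss a \<Otimes>\<^sub>M gauss b))"
    by (simp add: nn_integral_indicator[symmetric] nn_integral_distr split_beta' del: nn_integral_indicator)
  also have "\<dots> = (\<integral>\<^sup>+x. \<integral>\<^sup>+y. indicator S (x + y) \<partial>gauss b \<partial>gauss a)"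
    by (subst B.nn_integral_fst[symmetric]) simp_all
  also have "\<dots> = (\<integral>\<^sup>+x. ennreal (?d a x) * (\<integral>\<^sup>+y. ennreal (?d b y) * indicator S (x + y) \<partial>lborel) \<partial>lborel)"
    unfolding gauss_def by (simp add: nn_integral_density)
  also have "\<dots> = (\<integral>\<^sup>+x. ennreal (?d a x) * (\<integral>\<^sup>+z. ennreal (?d b (z - x)) * indicator S z \<partial>lborel) \<partial>lborel)"
  proof -
    have "(\<integral>\<^sup>+z. ennreal (?d b (z - x)) * indicator S z \<partial>lborel)
        = (\<integral>\<^sup>+y. ennreal (?d b y) * indicator S (x + y) \<partial>lborel)" for x
    proof -
      have "(\<integral>\<^sup>+z. ennreal (?d b (z - x)) * indicator S z \<partial>lborel)
          = (\<integral>\<^sup>+z. ennreal (?d b (z - x)) * indicator S z \<partial>distr lborel borel ((+) x))"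
        by (simp add: lborel_distr_plus)
      also have "\<dots> = (\<integral>\<^sup>+y. ennreal (?d b y) * indicator S (x + y) \<partial>lborel)"
        by (subst nn_integral_distr) simp_all
      finally show ?thesis .
    qed
    then show ?thesis by simp
  qed
  also have "\<dots> = (\<integral>\<^sup>+x. \<integral>\<^sup>+z. ennreal (?d a x) * (ennreal (?d b (z - x)) * indicator S z) \<partial>lborel \<partial>lborel)"
    by (intro nn_integral_cong nn_integral_cmult[symmetric]) measurable
  also have "\<dots> = (\<integral>\<^sup>+z. \<integral>\<^sup>+x. ennreal (?d a x) * (ennreal (?d b (z - x)) * indicator S z) \<partial>lborel \<partial>lborel)"
    by (rule lborel_pair.Fubini') measurable
  also have "\<dots> = (\<integral>\<^sup>+z. (\<integral>\<^sup>+x. ennreal (?d a x) * ennreal (?d b (z - x)) \<partial>lborel) * indicator S z \<partial>lborel)"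
    by (simp add: mult.assoc[symmetric] nn_integral_multc)
  also have "\<dots> = emeasure (gauss (a + b)) S"
    unfolding conv gauss_def by (simp add: emeasure_density)
  finally show "emeasure (distr (gauss a \<Otimes>\<^sub>M gauss b) borel (\<lambda>(x, y). x + y)) S = emeasure (gauss (a + b)) S" .
qed simp

section \<open>Tails of Gaussian quadratic forms\<close>

text \<open>On \<open>|y| \<ge> u\<close> the density is at most \<open>|y| / u\<close> times itself, and \<open>y exp (- y\<^sup>2 / 2)\<close> has an elementary
  antiderivative.\<close>

lemma std_normal_upper_tail:
  assumes u: "u > 0"
  shows "(\<integral>\<^sup>+y. ennreal (std_normal_density y) * indicator {y. u \<le> \<bar>y\<bar>} y \<partial>lborel) \<le> ennreal (exp (- u\<^sup>2 / 2) / u)"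
proof -
  let ?g = "\<lambda>y. y / u * std_normal_density y"
  have half: "(\<integral>\<^sup>+y. ennreal (?g y) * indicator {u..} y \<partial>lborel) = ennreal (std_normal_density u / u)"
  proof -
    have "(\<integral>\<^sup>+y. ennreal (?g y) * indicator {u..} y \<partial>lborel) = ennreal (0 - (- std_normal_density u / u))"
    proof (rule nn_integral_FTC_atLeast[where F = "\<lambda>y. - std_normal_density y / u" and T = 0])
      show "?g \<in> borel_measurable borel" by measurable
      show "((\<lambda>y. - std_normal_density y / u) has_real_derivative ?g y) (at y)" for y
        unfolding std_normal_density_def using u by (auto intro!: derivative_eq_intros simp: field_simps)
      show "0 \<le> ?g y" if "u \<le> y" for y using that u by (simp add: normal_density_nonneg)
      have "((\<lambda>y. - (1 / sqrt (2 * pi) * exp (- y\<^sup>2 / 2)) / u) \<longlongrightarrow> 0) at_top"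
        using u by real_asymp
      then show "((\<lambda>y. - std_normal_density y / u) \<longlongrightarrow> 0) at_top" by (simp only: std_normal_density_def)
    qed
    then show ?thesis by simp
  qed
  have "(\<integral>\<^sup>+y. ennreal (std_normal_density y) * indicator {y. u \<le> \<bar>y\<bar>} y \<partial>lborel)
     \<le> (\<integral>\<^sup>+y. ennreal (?g y) * indicator {u..} y + ennreal (?g (- y)) * indicator {u..} (- y) \<partial>lborel)"
  proof (intro nn_integral_mono)
    fix y :: real
    have "std_normal_density y \<le> \<bar>y\<bar> / u * std_normal_density y" if "u \<le> \<bar>y\<bar>"
      using that u mult_right_mono[of 1 "\<bar>y\<bar> / u" "std_normal_density y"] by (simp add: normal_density_nonneg)
    then show "ennreal (std_normal_density y) * indicator {y. u \<le> \<bar>y\<bar>} y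
       \<le> ennreal (?g y) * indicator {u..} y + ennreal (?g (- y)) * indicator {u..} (- y)"
      using u by (auto simp: indicator_def abs_if std_normal_density_def split: if_splits intro!: ennreal_leI)
  qed
  also have "\<dots> = (\<integral>\<^sup>+y. ennreal (?g y) * indicator {u..} y \<partial>lborel)
      + (\<integral>\<^sup>+y. ennreal (?g (- y)) * indicator {u..} (- y) \<partial>lborel)"
    by (rule nn_integral_add) measurable
  also have "(\<integral>\<^sup>+y. ennreal (?g (- y)) * indicator {u..} (- y) \<partial>lborel) = (\<integral>\<^sup>+y. ennreal (?g y) * indicator {u..} y \<partial>lborel)"
    using nn_integral_real_affine[of "\<lambda>y. ennreal (?g y) * indicator {u..} y" "-1" 0] by simp
  also have "(\<integral>\<^sup>+y. ennreal (?g y) * indicator {u..} y \<partial>lborel) + (\<integral>\<^sup>+y. ennreal (?g y) * indicator {u..} y \<partial>lborel)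
      = ennreal (2 / sqrt (2 * pi) * (exp (- u\<^sup>2 / 2) / u))"
    unfolding half using u by (simp add: ennreal_plus[symmetric] std_normal_density_def del: ennreal_plus)
  also have "\<dots> \<le> ennreal (1 * (exp (- u\<^sup>2 / 2) / u))"
  proof (intro ennreal_leI mult_right_mono)
    have "2 \<le> sqrt (2 * pi)" using pi_gt3 by (intro real_le_rsqrt) simp
    then show "2 / sqrt (2 * pi) \<le> 1" by simp
  qed (use u in simp)
  finally show ?thesis by simp
qed

lemma nn_integral_ge_on_interval:
  fixes g :: "real \<Rightarrow> real"
  assumes "a \<le> b" "c \<ge> 0" "\<And>y. a < y \<Longrightarrow> y < b \<Longrightarrow> ennreal c \<le> h y"
  shows "ennreal (c * (b - a)) \<le> (\<integral>\<^sup>+y. h y \<partial>lborel)"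
proof -
  have "ennreal (c * (b - a)) = (\<integral>\<^sup>+y. ennreal c * indicator {a<..<b} y \<partial>lborel)"
    using assms(1,2) by (simp add: nn_integral_cmult ennreal_mult)
  also have "\<dots> \<le> (\<integral>\<^sup>+y. h y \<partial>lborel)"
    by (intro nn_integral_mono) (use assms(3) in \<open>auto simp: indicator_def\<close>)
  finally show ?thesis .
qed

text \<open>Between \<open>u\<close> and \<open>u + 1 / u\<close> the exponent \<open>y\<^sup>2 / 2\<close> grows by a bounded amount only.\<close>

lemma std_normal_lower_tail:
  assumes u: "u \<ge> 1/2"
  shows "ennreal (exp (-3) / sqrt (2 * pi) * (exp (- u\<^sup>2 / 2) / u))
    \<le> (\<integral>\<^sup>+y. ennreal (std_normal_density y) * indicator {y. u < \<bar>y\<bar>} y \<partial>lborel)"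
proof -
  define c where "c = exp (-3) / sqrt (2 * pi) * exp (- u\<^sup>2 / 2)"
  have "ennreal (c * ((u + 1/u) - u)) \<le> (\<integral>\<^sup>+y. ennreal (std_normal_density y) * indicator {y. u < \<bar>y\<bar>} y \<partial>lborel)"
  proof (rule nn_integral_ge_on_interval)
    fix y assume y: "u < y" "y < u + 1/u"
    have "1 / u \<le> 2" using u by (simp add: field_simps)
    then have "(1 / u)\<^sup>2 \<le> 2\<^sup>2" using u by (intro power_mono) auto
    moreover have "(u + 1/u)\<^sup>2 = u\<^sup>2 + 2 + (1/u)\<^sup>2" using u by (simp add: power2_eq_square field_simps)
    moreover have "y\<^sup>2 \<le> (u + 1/u)\<^sup>2" using y u by (intro power_mono) auto
    ultimately have "y\<^sup>2 \<le> u\<^sup>2 + 6" by simp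
    then have "exp (-3 + - u\<^sup>2 / 2) \<le> exp (- y\<^sup>2 / 2)" by simp
    then have "exp (-3) * exp (- u\<^sup>2 / 2) \<le> exp (- y\<^sup>2 / 2)" by (simp only: exp_add)
    then have "c \<le> std_normal_density y" unfolding c_def std_normal_density_def
      by (simp add: divide_right_mono)
    then show "ennreal c \<le> ennreal (std_normal_density y) * indicator {y. u < \<bar>y\<bar>} y"
      using y u by (simp add: indicator_def ennreal_leI)
  qed (use u in \<open>auto simp: c_def\<close>)
  then show ?thesis by (simp add: c_def)
qed

text \<open>Tilting by \<open>exp ((1 - b\<^sup>2) y\<^sup>2 / 2)\<close> turns the standard normal density into a Gaussian profile of width \<open>1 / b\<close>.
  Restricted to \<open>|y| = O(x)\<close> its mass is of the order of the smaller one of \<open>1 / b\<close> and \<open>x\<close>; these masses become the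
  factors of the product in the tail of a quadratic form.\<close>

lemma std_normal_tilt:
  "std_normal_density y * exp ((1 - b\<^sup>2) * y\<^sup>2 / 2) = 1 / sqrt (2 * pi) * exp (- (b * y)\<^sup>2 / 2)"
  by (simp add: std_normal_density_def exp_add[symmetric] power_mult_distrib algebra_simps diff_divide_distrib)

lemma tilted_normal_mass_upper:
  assumes b: "0 \<le> b" "b \<le> 1" and x: "x \<ge> 1"
  shows "(\<integral>\<^sup>+y. ennreal (std_normal_density y * exp ((1 - b\<^sup>2) * y\<^sup>2 / 2)) * indicator {y. \<bar>y\<bar> \<le> 2 * x} y \<partial>lborel)
     \<le> ennreal (4 / max b (1 / x))"
proof -
  have s1: "1 / sqrt (2 * pi) \<le> 1" using pi_gt3 by simp
  show ?thesis
  proof (cases "b \<le> 1 / x")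
    case True
    have "(\<integral>\<^sup>+y. ennreal (std_normal_density y * exp ((1 - b\<^sup>2) * y\<^sup>2 / 2)) * indicator {y. \<bar>y\<bar> \<le> 2 * x} y \<partial>lborel)
       \<le> (\<integral>\<^sup>+y. ennreal 1 * indicator {-2*x..2*x} y \<partial>lborel)"
      unfolding std_normal_tilt using s1
    proof (intro nn_integral_mono)
      fix y
      have "1 / sqrt (2 * pi) * exp (- (b * y)\<^sup>2 / 2) \<le> 1 * 1" using s1 by (intro mult_mono) auto
      then show "ennreal (1 / sqrt (2 * pi) * exp (- (b * y)\<^sup>2 / 2)) * indicator {y. \<bar>y\<bar> \<le> 2 * x} y
          \<le> ennreal 1 * indicator {-2*x..2*x} y"
        by (auto simp: indicator_def abs_le_iff simp del: ennreal_1 intro!: ennreal_leI)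
    qed
    also have "\<dots> = ennreal (4 * x)" using x by simp
    finally show ?thesis using True x by (simp add: max_absorb2)
  next
    case False
    then have bp: "b > 0" using x by (smt (verit) divide_nonneg_nonneg)
    have "1 / sqrt (2 * pi) * exp (- (b * y)\<^sup>2 / 2) = (1 / b) * normal_density 0 (1 / b) y" for y
      using bp by (simp add: normal_density_def real_sqrt_divide real_sqrt_mult power_mult_distrib power_divide field_simps)
    then have "(\<integral>\<^sup>+y. ennreal (std_normal_density y * exp ((1 - b\<^sup>2) * y\<^sup>2 / 2)) * indicator {y. \<bar>y\<bar> \<le> 2 * x} y \<partial>lborel)
       \<le> (\<integral>\<^sup>+y. ennreal (1 / b) * ennreal (normal_density 0 (1 / b) y) \<partial>lborel)"
      unfolding std_normal_tilt using bp
      by (intro nn_integral_mono) (auto simp: indicator_def ennreal_mult'[symmetric] normal_density_nonneg)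
    also have "\<dots> = ennreal (1 / b) * (\<integral>\<^sup>+y. ennreal (normal_density 0 (1 / b) y) \<partial>lborel)"
      by (rule nn_integral_cmult) measurable
    also have "(\<integral>\<^sup>+y. ennreal (normal_density 0 (1 / b) y) \<partial>lborel) = 1"
      using prob_space.emeasure_space_1[OF prob_space_normal_density[of "1 / b" 0]] bp
      by (simp add: emeasure_density)
    also have "ennreal (1 / b) * 1 \<le> ennreal (4 / max b (1 / x))"
      using False bp by (auto simp: max_absorb1 divide_right_mono intro!: ennreal_leI)
    finally show ?thesis .
  qed
qed

lemma tilted_normal_mass_lower:
  assumes b: "0 \<le> b" "b \<le> 1" and x: "x \<ge> 1" and k: "0 < \<kappa>" "\<kappa> \<le> 1"
  shows "ennreal (\<kappa> * exp (-1/2) / sqrt (2 * pi) / max b (1 / x)) \<le>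
     (\<integral>\<^sup>+y. ennreal (std_normal_density y * exp ((1 - b\<^sup>2) * y\<^sup>2 / 2)) * indicator {y. \<bar>y\<bar> \<le> \<kappa> * x} y \<partial>lborel)"
proof -
  define m where "m = 1 / max b (1 / x)"
  have m0: "max b (1 / x) > 0" using x by (simp add: less_max_iff_disj)
  have m: "0 < m" "m \<le> x" "b * m \<le> 1"
    using m0 b x by (auto simp: m_def field_simps max_def)
  define c where "c = exp (-1/2) / sqrt (2 * pi)"
  have "ennreal (c * (\<kappa> * m - 0)) \<le> (\<integral>\<^sup>+y. ennreal (std_normal_density y * exp ((1 - b\<^sup>2) * y\<^sup>2 / 2)) * indicator {y. \<bar>y\<bar> \<le> \<kappa> * x} y \<partial>lborel)"
  proof (rule nn_integral_ge_on_interval)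
    fix y assume y: "0 < y" "y < \<kappa> * m"
    have "\<kappa> * m \<le> m" using m k by (simp add: mult_left_le_one_le)
    then have "b * y \<le> b * m" using y b by (intro mult_left_mono) auto
    then have "b * y \<le> 1" using m by simp
    then have "(b * y)\<^sup>2 \<le> 1" using y b by (intro power_le_one) auto
    then have "c \<le> 1 / sqrt (2 * pi) * exp (- (b * y)\<^sup>2 / 2)"
      unfolding c_def by (simp add: divide_right_mono)
    moreover have "\<bar>y\<bar> \<le> \<kappa> * x" using y m k mult_left_mono[of m x \<kappa>] by linarith
    ultimately show "ennreal c \<le> ennreal (std_normal_density y * exp ((1 - b\<^sup>2) * y\<^sup>2 / 2)) * indicator {y. \<bar>y\<bar> \<le> \<kappa> * x} y"
      unfolding std_normal_tilt by (simp add: indicator_def ennreal_leI)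
  qed (use m k in \<open>auto simp: c_def\<close>)
  then show ?thesis by (simp add: c_def m_def mult.commute)
qed

lemma emeasure_gauss_slice:
  fixes S :: "(real^'n) set"
  assumes [measurable]: "S \<in> sets borel"
  shows "emeasure (gauss 1) S = (\<integral>\<^sup>+f. (\<Prod>j\<in>UNIV-{i0}. ennreal (std_normal_density (f j))) *
      (\<integral>\<^sup>+y. ennreal (std_normal_density y) * indicator S (\<chi> i. (f(i0 := y)) i) \<partial>lborel)
    \<partial>PiM (UNIV-{i0}) (\<lambda>_. lborel))"
proof -
  let ?h = "\<lambda>x::real^'n. (\<Prod>i\<in>UNIV. ennreal (std_normal_density (x $ i))) * indicator S x"
  let ?P = "PiM (UNIV-{i0}) (\<lambda>_. lborel :: real measure)"
  have ins: "insert i0 (UNIV-{i0}) = UNIV" by auto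
  have "emeasure (gauss 1) S = (\<integral>\<^sup>+x. ?h x \<partial>lborel)"
    unfolding gauss_def by (simp add: emeasure_density prod_ennreal normal_density_nonneg)
  also have "\<dots> = (\<integral>\<^sup>+f. ?h (\<chi> i. f i) \<partial>PiM (insert i0 (UNIV-{i0})) (\<lambda>_. lborel))"
    unfolding ins by (rule nn_integral_lborel_vec) measurable
  also have "\<dots> = (\<integral>\<^sup>+f. \<integral>\<^sup>+y. ?h (\<chi> i. (f(i0 := y)) i) \<partial>lborel \<partial>?P)"
  proof (rule lborel_product.product_nn_integral_insert)
    have "?h \<in> borel_measurable borel" by measurable
    from measurable_compose[OF borel_measurable_vec_lambda_PiM this]
    show "(\<lambda>f. ?h (\<chi> i. f i)) \<in> borel_measurable (PiM (insert i0 (UNIV-{i0})) (\<lambda>_. lborel))"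
      unfolding ins .
  qed auto
  also have "\<dots> = (\<integral>\<^sup>+f. (\<Prod>j\<in>UNIV-{i0}. ennreal (std_normal_density (f j))) *
      (\<integral>\<^sup>+y. ennreal (std_normal_density y) * indicator S (\<chi> i. (f(i0 := y)) i) \<partial>lborel) \<partial>?P)"
  proof (rule nn_integral_cong)
    fix f assume f: "f \<in> space ?P"
    have "(\<lambda>y. f(i0 := y)) \<in> lborel \<rightarrow>\<^sub>M PiM (insert i0 (UNIV-{i0})) (\<lambda>_. lborel)"
      using f by (intro measurable_component_update) auto
    then have "(\<lambda>y. f(i0 := y)) \<in> lborel \<rightarrow>\<^sub>M PiM UNIV (\<lambda>_. lborel)" unfolding ins .
    from measurable_compose[OF this borel_measurable_vec_lambda_PiM]
    have [measurable]: "(\<lambda>y. \<chi> i. (f(i0 := y)) i) \<in> lborel \<rightarrow>\<^sub>M borel" by simp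
    have "?h (\<chi> i. (f(i0 := y)) i) = (\<Prod>j\<in>UNIV-{i0}. ennreal (std_normal_density (f j))) *
        (ennreal (std_normal_density y) * indicator S (\<chi> i. (f(i0 := y)) i))" for y
    proof -
      have "(\<Prod>i\<in>UNIV. ennreal (std_normal_density ((f(i0 := y)) i)))
          = ennreal (std_normal_density y) * (\<Prod>j\<in>UNIV-{i0}. ennreal (std_normal_density (f j)))"
        by (subst prod.remove[of UNIV i0]) (auto intro!: arg_cong2[where f="(*)"] prod.cong)
      then show ?thesis by (simp add: ac_simps)
    qed
    then have "(\<integral>\<^sup>+y. ?h (\<chi> i. (f(i0 := y)) i) \<partial>lborel) = (\<integral>\<^sup>+y. (\<Prod>j\<in>UNIV-{i0}. ennreal (std_normal_density (f j))) *
        (ennreal (std_normal_density y) * indicator S (\<chi> i. (f(i0 := y)) i)) \<partial>lborel)"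
      by (simp only:)
    also have "\<dots> = (\<Prod>j\<in>UNIV-{i0}. ennreal (std_normal_density (f j))) *
      (\<integral>\<^sup>+y. ennreal (std_normal_density y) * indicator S (\<chi> i. (f(i0 := y)) i) \<partial>lborel)"
      by (rule nn_integral_cmult) measurable
    finally show "(\<integral>\<^sup>+y. ?h (\<chi> i. (f(i0 := y)) i) \<partial>lborel) = (\<Prod>j\<in>UNIV-{i0}. ennreal (std_normal_density (f j))) *
      (\<integral>\<^sup>+y. ennreal (std_normal_density y) * indicator S (\<chi> i. (f(i0 := y)) i) \<partial>lborel)" .
  qed
  finally show ?thesis .
qed

lemma ennreal_prod_mono:
  fixes f g :: "'i \<Rightarrow> ennreal"
  assumes "\<And>i. i \<in> A \<Longrightarrow> f i \<le> g i"
  shows "prod f A \<le> prod g A"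
  using assms by (induction A rule: infinite_finite_induct) (auto intro: mult_mono)

text \<open>Given the other coordinates, with \<open>w = \<Sum> (1 - b\<^sub>j\<^sup>2) y\<^sub>j\<^sup>2\<close>, the coordinate \<open>i0\<close> has to exceed \<open>u = (x\<^sup>2 - w)\<^sup>1\<^sup>/\<^sup>2\<close>. Its
  tail \<open>exp (- u\<^sup>2 / 2) / u\<close> contains the factor \<open>exp (w / 2)\<close>, which tilts the densities of the other coordinates. The
  assumption that \<open>i0\<close> is the largest coordinate keeps \<open>u\<close> of the order of \<open>x\<close>.\<close>

lemma gauss_max_coordinate_tail_upper:
  fixes b :: "'n::finite \<Rightarrow> real"
  assumes b: "\<And>i. 0 \<le> b i" "\<And>i. b i \<le> 1" "b i0 = 0" and x: "x \<ge> 1"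
  shows "emeasure (gauss 1) {y::real^'n. x\<^sup>2 < (\<Sum>i\<in>UNIV. (1 - (b i)\<^sup>2) * (y$i)\<^sup>2) \<and> (\<forall>j. \<bar>y$j\<bar> \<le> \<bar>y$i0\<bar>) \<and> \<bar>y$i0\<bar> \<le> 2 * x}
    \<le> ennreal (sqrt CARD('n) * 4 ^ CARD('n) * (exp (- x\<^sup>2 / 2) / x * (\<Prod>j\<in>UNIV-{i0}. 1 / max (b j) (1 / x))))"
    (is "emeasure _ ?S \<le> _")
proof -
  let ?P = "PiM (UNIV-{i0}) (\<lambda>_. lborel :: real measure)"
  let ?J = "UNIV - {i0}"
  define S where "S = ?S"
  have S [measurable]: "S \<in> sets borel" unfolding S_def by measurable
  have bb: "(b i)\<^sup>2 \<le> 1" for i using b by (simp add: power_le_one)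
  define K where "K = sqrt CARD('n) / x * exp (- x\<^sup>2 / 2)"
  have K0: "K \<ge> 0" using x by (simp add: K_def)
  have d1: "real CARD('n) \<ge> 1" by (simp add: Suc_leI)
  let ?g = "\<lambda>j y. ennreal (std_normal_density y * exp ((1 - (b j)\<^sup>2) * y\<^sup>2 / 2)) * indicator {y. \<bar>y\<bar> \<le> 2 * x} y"
  have "emeasure (gauss 1) S = (\<integral>\<^sup>+f. (\<Prod>j\<in>?J. ennreal (std_normal_density (f j))) *
      (\<integral>\<^sup>+y. ennreal (std_normal_density y) * indicator S (\<chi> i. (f(i0 := y)) i) \<partial>lborel) \<partial>?P)"
    by (rule emeasure_gauss_slice[OF S])
  also have "\<dots> \<le> (\<integral>\<^sup>+f. ennreal K * (\<Prod>j\<in>?J. ?g j (f j)) \<partial>?P)"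
  proof (intro nn_integral_mono)
    fix f :: "'n \<Rightarrow> real"
    define w where "w = (\<Sum>j\<in>?J. (1 - (b j)\<^sup>2) * (f j)\<^sup>2)"
    \<comment> \<open>the second lower bound for the square of coordinate \<open>i0\<close> holds because it is the largest coordinate\<close>
    define u where "u = sqrt (max (x\<^sup>2 - w) (x\<^sup>2 / CARD('n)))"
    have u2: "u\<^sup>2 = max (x\<^sup>2 - w) (x\<^sup>2 / CARD('n))" unfolding u_def
      by (rule real_sqrt_pow2) (simp add: le_max_iff_disj)
    have "x / sqrt CARD('n) = sqrt (x\<^sup>2 / CARD('n))" using x by (simp add: real_sqrt_divide)
    also have "\<dots> \<le> u" unfolding u_def by simp
    finally have ulow: "x / sqrt CARD('n) \<le> u" .
    moreover have "x / sqrt CARD('n) > 0" using x by simp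
    ultimately have u0: "u > 0" by linarith
    have "1 / u \<le> 1 / (x / sqrt CARD('n))" using ulow x u0 by (intro divide_left_mono mult_pos_pos) auto
    then have uinv: "1 / u \<le> sqrt CARD('n) / x" by simp
    have inS: "u \<le> \<bar>y\<bar> \<and> (\<forall>j\<in>?J. \<bar>f j\<bar> \<le> 2 * x)" if "(\<chi> i. (f(i0 := y)) i) \<in> S" for y
    proof -
      from that have s: "x\<^sup>2 < (\<Sum>i\<in>UNIV. (1 - (b i)\<^sup>2) * ((f(i0 := y)) i)\<^sup>2)" and
        m: "\<And>j. \<bar>(f(i0 := y)) j\<bar> \<le> \<bar>y\<bar>" and yx: "\<bar>y\<bar> \<le> 2 * x" unfolding S_def by auto
      have "(\<Sum>i\<in>UNIV. (1 - (b i)\<^sup>2) * ((f(i0 := y)) i)\<^sup>2) = y\<^sup>2 + w"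
        unfolding w_def by (subst sum.remove[of UNIV i0]) (auto simp: b(3) intro!: sum.cong)
      with s have 1: "x\<^sup>2 - w \<le> y\<^sup>2" by simp
      have "(\<Sum>i\<in>UNIV. (1 - (b i)\<^sup>2) * ((f(i0 := y)) i)\<^sup>2) \<le> (\<Sum>i\<in>(UNIV::'n set). 1 * y\<^sup>2)"
        using m bb by (intro sum_mono mult_mono) (auto simp: abs_le_square_iff[symmetric])
      with s have "x\<^sup>2 / CARD('n) \<le> y\<^sup>2" using d1 by (simp add: field_simps)
      with 1 have "u\<^sup>2 \<le> \<bar>y\<bar>\<^sup>2" unfolding u2 by simp
      then have "u \<le> \<bar>y\<bar>" by (rule power2_le_imp_le) simp
      moreover have "\<bar>f j\<bar> \<le> 2 * x" if "j \<in> ?J" for j using m[of j] yx that by simp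
      ultimately show ?thesis by blast
    qed
    show "(\<Prod>j\<in>?J. ennreal (std_normal_density (f j))) *
      (\<integral>\<^sup>+y. ennreal (std_normal_density y) * indicator S (\<chi> i. (f(i0 := y)) i) \<partial>lborel)
      \<le> ennreal K * (\<Prod>j\<in>?J. ?g j (f j))"
    proof (cases "\<forall>j\<in>?J. \<bar>f j\<bar> \<le> 2 * x")
      case False
      then have "(\<chi> i. (f(i0 := y)) i) \<notin> S" for y using inS[of y] by blast
      then show ?thesis by (simp del: fun_upd_apply)
    next
      case True
      have "(\<integral>\<^sup>+y. ennreal (std_normal_density y) * indicator S (\<chi> i. (f(i0 := y)) i) \<partial>lborel)
          \<le> (\<integral>\<^sup>+y. ennreal (std_normal_density y) * indicator {y. u \<le> \<bar>y\<bar>} y \<partial>lborel)"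
        by (intro nn_integral_mono mult_left_mono) (auto simp: indicator_def simp del: fun_upd_apply dest: inS)
      also have "\<dots> \<le> ennreal (exp (- u\<^sup>2 / 2) / u)" by (rule std_normal_upper_tail[OF u0])
      also have "\<dots> \<le> ennreal (exp (- (x\<^sup>2 - w) / 2) * (sqrt CARD('n) / x))"
      proof (rule ennreal_leI)
        have "exp (- u\<^sup>2 / 2) * (1 / u) \<le> exp (- (x\<^sup>2 - w) / 2) * (sqrt CARD('n) / x)"
          using u2 uinv u0 by (intro mult_mono) auto
        then show "exp (- u\<^sup>2 / 2) / u \<le> exp (- (x\<^sup>2 - w) / 2) * (sqrt CARD('n) / x)" by simp
      qed
      also have "exp (- (x\<^sup>2 - w) / 2) * (sqrt CARD('n) / x) = K * exp (w / 2)"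
        by (simp add: K_def exp_add[symmetric] diff_divide_distrib)
      also have "exp (w / 2) = (\<Prod>j\<in>?J. exp ((1 - (b j)\<^sup>2) * (f j)\<^sup>2 / 2))"
        by (simp add: w_def exp_sum[symmetric] sum_divide_distrib[symmetric])
      finally have "(\<Prod>j\<in>?J. ennreal (std_normal_density (f j))) *
        (\<integral>\<^sup>+y. ennreal (std_normal_density y) * indicator S (\<chi> i. (f(i0 := y)) i) \<partial>lborel)
        \<le> (\<Prod>j\<in>?J. ennreal (std_normal_density (f j))) * ennreal (K * (\<Prod>j\<in>?J. exp ((1 - (b j)\<^sup>2) * (f j)\<^sup>2 / 2)))"
        by (intro mult_left_mono) auto
      also have "\<dots> = ennreal K * (\<Prod>j\<in>?J. ennreal (std_normal_density (f j) * exp ((1 - (b j)\<^sup>2) * (f j)\<^sup>2 / 2)))"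
        using K0 by (simp add: prod_ennreal normal_density_nonneg ennreal_mult'[symmetric] prod.distrib prod_nonneg ac_simps)
      also have "(\<Prod>j\<in>?J. ennreal (std_normal_density (f j) * exp ((1 - (b j)\<^sup>2) * (f j)\<^sup>2 / 2))) = (\<Prod>j\<in>?J. ?g j (f j))"
        using True by (intro prod.cong) (auto simp: indicator_def)
      finally show ?thesis .
    qed
  qed
  also have "\<dots> = ennreal K * (\<integral>\<^sup>+f. (\<Prod>j\<in>?J. ?g j (f j)) \<partial>?P)"
    by (rule nn_integral_cmult) measurable
  also have "(\<integral>\<^sup>+f. (\<Prod>j\<in>?J. ?g j (f j)) \<partial>?P) = (\<Prod>j\<in>?J. \<integral>\<^sup>+y. ?g j y \<partial>lborel)"
    by (rule lborel_product.product_nn_integral_prod) (simp, measurable)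
  also have "(\<Prod>j\<in>?J. \<integral>\<^sup>+y. ?g j y \<partial>lborel) \<le> (\<Prod>j\<in>?J. ennreal (4 / max (b j) (1 / x)))"
    by (intro ennreal_prod_mono tilted_normal_mass_upper b x)
  also have "\<dots> = ennreal (4 ^ card ?J * (\<Prod>j\<in>?J. 1 / max (b j) (1 / x)))"
    using x by (simp add: prod_ennreal le_max_iff_disj prod_dividef)
  also have "ennreal K * \<dots> = ennreal (K * (4 ^ card ?J * (\<Prod>j\<in>?J. 1 / max (b j) (1 / x))))"
    using K0 by (simp add: ennreal_mult')
  also have "\<dots> \<le> ennreal (K * (4 ^ CARD('n) * (\<Prod>j\<in>?J. 1 / max (b j) (1 / x))))"
    using K0 x
    by (intro ennreal_leI mult_left_mono mult_right_mono power_increasing card_mono prod_nonneg)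
      (auto simp: le_max_iff_disj)
  also have "K * (4 ^ CARD('n) * (\<Prod>j\<in>?J. 1 / max (b j) (1 / x)))
      = sqrt CARD('n) * 4 ^ CARD('n) * (exp (- x\<^sup>2 / 2) / x * (\<Prod>j\<in>?J. 1 / max (b j) (1 / x)))"
    by (simp add: K_def)
  finally show ?thesis by (simp add: mult_left_mono S_def)
qed

lemma prod_inverse_max_ge_1:
  fixes b :: "'i \<Rightarrow> real"
  assumes "\<And>i. i \<in> J \<Longrightarrow> 0 \<le> b i" "\<And>i. i \<in> J \<Longrightarrow> b i \<le> 1" "x \<ge> 1"
  shows "1 \<le> (\<Prod>j\<in>J. 1 / max (b j) (1 / x))"
  using assms by (intro prod_ge_1) (auto simp: le_max_iff_disj less_max_iff_disj le_divide_eq)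

lemma gauss_coordinate_tail:
  assumes u: "u > 0"
  shows "emeasure (gauss 1) {y::real^'n. u \<le> \<bar>y$i\<bar>} \<le> ennreal (exp (- u\<^sup>2 / 2) / u)"
proof -
  let ?g = "\<lambda>j y. ennreal (std_normal_density y) * (if j = i then indicator {y. u \<le> \<bar>y\<bar>} y else 1)"
  have 1: "(\<integral>\<^sup>+y. ennreal (std_normal_density y) \<partial>lborel) = 1"
    using prob_space.emeasure_space_1[OF prob_space_normal_density[of 1 0]]
    by (simp add: emeasure_density)
  have "emeasure (gauss 1) {y::real^'n. u \<le> \<bar>y$i\<bar>} = (\<integral>\<^sup>+x. (\<Prod>j\<in>UNIV. ?g j (x $ j)) \<partial>lborel)"
    unfolding gauss_def
    by (subst emeasure_density)
      (auto simp: prod.distrib prod_ennreal normal_density_nonneg indicator_def intro!: nn_integral_cong)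
  also have "\<dots> = (\<Prod>j\<in>UNIV. \<integral>\<^sup>+y. ?g j y \<partial>lborel)"
    by (rule nn_integral_lborel_vec_prod) measurable
  also have "\<dots> = (\<integral>\<^sup>+y. ?g i y \<partial>lborel) * (\<Prod>j\<in>UNIV-{i}. \<integral>\<^sup>+y. ?g j y \<partial>lborel)"
    by (subst prod.remove[of UNIV i]) auto
  also have "(\<Prod>j\<in>UNIV-{i}. \<integral>\<^sup>+y. ?g j y \<partial>lborel) = 1" using 1 by (intro prod.neutral) auto
  finally show ?thesis using std_normal_upper_tail[OF u] by simp
qed

lemma swap_coordinates_orthogonal:
  "orthogonal_transformation (\<lambda>y::real^'n. \<chi> j. y $ (Transposition.transpose i k j))"
proof -
  have "(\<Sum>j\<in>UNIV. v $ (Transposition.transpose i k j) * w $ (Transposition.transpose i k j)) = (\<Sum>j\<in>UNIV. v $ j * w $ j)"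
    for v w :: "real^'n"
    by (rule sum.reindex_bij_betw[of "Transposition.transpose i k" UNIV UNIV "\<lambda>j. v $ j * w $ j"]) simp
  then show ?thesis
    unfolding orthogonal_transformation_def
    by (auto simp: inner_vec_def intro!: linearI simp: vec_eq_iff)
qed

lemma emeasure_gauss_orthogonal:
  fixes f :: "real^'n \<Rightarrow> real^'n"
  assumes v: "v > 0" and f: "orthogonal_transformation f" and [measurable]: "S \<in> sets borel"
  shows "emeasure (gauss v) (f -` S) = emeasure (gauss v) S"
proof -
  have "linear f" by (rule orthogonal_transformation_linear[OF f])
  then have [measurable]: "f \<in> borel_measurable borel"
    by (intro borel_measurable_continuous_onI linear_continuous_on linear_conv_bounded_linear[THEN iffD1])
  have "emeasure (gauss v) S = emeasure (distr (gauss v) borel f) S" by (simp add: gauss_orthogonal_invariant[OF v f])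
  also have "\<dots> = emeasure (gauss v) (f -` S)" by (subst emeasure_distr) simp_all
  finally show ?thesis ..
qed

text \<open>Split according to the largest coordinate. If it is not \<open>i0\<close>, exchanging it with \<open>i0\<close> preserves the Gaussian
  measure and can only increase the form, because \<open>i0\<close> carries the largest coefficient.\<close>

lemma gauss_quadratic_tail_upper:
  fixes b :: "'n::finite \<Rightarrow> real"
  assumes b: "\<And>i. 0 \<le> b i" "\<And>i. b i \<le> 1" "b i0 = 0" and x: "x \<ge> 1"
  shows "measure (gauss 1) {y::real^'n. x\<^sup>2 < (\<Sum>i\<in>UNIV. (1 - (b i)\<^sup>2) * (y$i)\<^sup>2)}
    \<le> CARD('n) * (sqrt CARD('n) * 4 ^ CARD('n) + 1) * (exp (- x\<^sup>2 / 2) / x * (\<Prod>j\<in>UNIV-{i0}. 1 / max (b j) (1 / x)))"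
proof -
  interpret prob_space "gauss 1 :: (real^'n) measure" by (rule prob_space_gauss) simp
  define q where "q y = (\<Sum>i\<in>UNIV. (1 - (b i)\<^sup>2) * (y$i)\<^sup>2)" for y :: "real^'n"
  have [measurable]: "q \<in> borel_measurable borel" unfolding q_def by measurable
  define H where "H = exp (- x\<^sup>2 / 2) / x * (\<Prod>j\<in>UNIV-{i0}. 1 / max (b j) (1 / x))"
  have P1: "1 \<le> (\<Prod>j\<in>UNIV-{i0}. 1 / max (b j) (1 / x))" using b x by (intro prod_inverse_max_ge_1) auto
  have H0: "exp (- x\<^sup>2 / 2) / x \<le> H" unfolding H_def using P1 x mult_left_mono[OF P1, of "exp (- x\<^sup>2 / 2) / x"] by simp
  have Hn: "0 \<le> H" using H0 x by (meson divide_nonneg_nonneg exp_ge_zero order_trans zero_le_one)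
  let ?S = "\<lambda>i. {y::real^'n. x\<^sup>2 < q y \<and> (\<forall>j. \<bar>y$j\<bar> \<le> \<bar>y$i\<bar>)}"
  have Sm [measurable]: "?S i \<in> sets borel" for i by measurable
  have S0: "emeasure (gauss 1) (?S i0) \<le> ennreal ((sqrt CARD('n) * 4 ^ CARD('n) + 1) * H)"
  proof -
    have "emeasure (gauss 1) (?S i0) \<le> emeasure (gauss 1) ({y::real^'n. x\<^sup>2 < q y \<and> (\<forall>j. \<bar>y$j\<bar> \<le> \<bar>y$i0\<bar>) \<and> \<bar>y$i0\<bar> \<le> 2 * x}
        \<union> {y. 2 * x \<le> \<bar>y$i0\<bar>})"
      by (intro emeasure_mono) auto
    also have "\<dots> \<le> emeasure (gauss 1) {y::real^'n. x\<^sup>2 < q y \<and> (\<forall>j. \<bar>y$j\<bar> \<le> \<bar>y$i0\<bar>) \<and> \<bar>y$i0\<bar> \<le> 2 * x}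
        + emeasure (gauss 1) {y::real^'n. 2 * x \<le> \<bar>y$i0\<bar>}"
      by (intro emeasure_subadditive) measurable
    also have "\<dots> \<le> ennreal (sqrt CARD('n) * 4 ^ CARD('n) * H) + ennreal H"
    proof (rule add_mono)
      show "emeasure (gauss 1) {y::real^'n. x\<^sup>2 < q y \<and> (\<forall>j. \<bar>y$j\<bar> \<le> \<bar>y$i0\<bar>) \<and> \<bar>y$i0\<bar> \<le> 2 * x}
          \<le> ennreal (sqrt CARD('n) * 4 ^ CARD('n) * H)"
        unfolding q_def H_def by (rule gauss_max_coordinate_tail_upper[of b i0 x, OF b x])
      have "emeasure (gauss 1) {y::real^'n. 2 * x \<le> \<bar>y$i0\<bar>} \<le> ennreal (exp (- (2 * x)\<^sup>2 / 2) / (2 * x))"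
        using x by (intro gauss_coordinate_tail) simp
      also have "\<dots> \<le> ennreal (exp (- x\<^sup>2 / 2) / x)"
        using x by (intro ennreal_leI frac_le) (auto simp: power2_eq_square)
      also have "\<dots> \<le> ennreal H" by (rule ennreal_leI[OF H0])
      finally show "emeasure (gauss 1) {y::real^'n. 2 * x \<le> \<bar>y$i0\<bar>} \<le> ennreal H" .
    qed
    also have "\<dots> = ennreal ((sqrt CARD('n) * 4 ^ CARD('n) + 1) * H)"
      using Hn by (subst ennreal_plus[symmetric]) (auto simp: distrib_right)
    finally show ?thesis .
  qed
  have Si: "emeasure (gauss 1) (?S i) \<le> emeasure (gauss 1) (?S i0)" for i
  proof -
    let ?p = "Transposition.transpose i0 i"
    let ?f = "\<lambda>y::real^'n. \<chi> j. y $ (?p j)"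
    have "?S i \<subseteq> ?f -` ?S i0"
    proof
      fix y :: "real^'n" assume "y \<in> ?S i"
      then have y: "x\<^sup>2 < q y" "\<forall>j. \<bar>y$j\<bar> \<le> \<bar>y$i\<bar>" by auto
      have A: "\<bar>?f y $ j\<bar> \<le> \<bar>?f y $ i0\<bar>" for j using y by simp
      have "q y \<le> q (?f y)"
      proof (cases "i = i0")
        case False
        have split: "q z = (1 - (b i0)\<^sup>2) * (z$i0)\<^sup>2 + ((1 - (b i)\<^sup>2) * (z$i)\<^sup>2
            + (\<Sum>k\<in>UNIV-{i0}-{i}. (1 - (b k)\<^sup>2) * (z$k)\<^sup>2))" for z
          unfolding q_def using False by (subst sum.remove[of UNIV i0]; simp; subst sum.remove[of "UNIV-{i0}" i]; simp)
        have "(\<Sum>k\<in>UNIV-{i0}-{i}. (1 - (b k)\<^sup>2) * ((?f y)$k)\<^sup>2) = (\<Sum>k\<in>UNIV-{i0}-{i}. (1 - (b k)\<^sup>2) * (y$k)\<^sup>2)"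
          by (intro sum.cong) auto
        moreover have "(b i)\<^sup>2 * (y$i0)\<^sup>2 \<le> (b i)\<^sup>2 * (y$i)\<^sup>2"
          using y(2) by (intro mult_left_mono) (auto simp: abs_le_square_iff[symmetric])
        ultimately show ?thesis unfolding split using b(3) by (simp add: algebra_simps)
      qed simp
      then have "x\<^sup>2 < q (?f y)" using y by simp
      with A show "y \<in> ?f -` ?S i0" by blast
    qed
    moreover have "?f -` ?S i0 \<in> sets borel"
    proof -
      have "linear ?f" using orthogonal_transformation_linear[OF swap_coordinates_orthogonal] .
      then have "?f \<in> borel_measurable borel"
        by (intro borel_measurable_continuous_onI linear_continuous_on linear_conv_bounded_linear[THEN iffD1])
      from measurable_sets[OF this Sm[of i0]] show ?thesis by (simp only: space_borel Int_UNIV_right)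
    qed
    ultimately have "emeasure (gauss 1) (?S i) \<le> emeasure (gauss 1) (?f -` ?S i0)"
      by (intro emeasure_mono) auto
    also have "\<dots> = emeasure (gauss 1) (?S i0)"
      by (rule emeasure_gauss_orthogonal[OF zero_less_one swap_coordinates_orthogonal Sm])
    finally show ?thesis .
  qed
  have "{y. x\<^sup>2 < q y} \<subseteq> (\<Union>i\<in>UNIV. ?S i)"
  proof
    fix y :: "real^'n" assume y: "y \<in> {y. x\<^sup>2 < q y}"
    obtain i where i: "\<forall>j. \<bar>y$j\<bar> \<le> \<bar>y$i\<bar>"
    proof -
      have "finite (range (\<lambda>j. \<bar>y$j\<bar>))" "range (\<lambda>j. \<bar>y$j\<bar>) \<noteq> {}" by auto
      from Max_in[OF this] obtain i where "\<bar>y$i\<bar> = Max (range (\<lambda>j. \<bar>y$j\<bar>))" by (metis imageE)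
      then have "\<forall>j. \<bar>y$j\<bar> \<le> \<bar>y$i\<bar>" by simp
      then show ?thesis by (rule that)
    qed
    with y show "y \<in> (\<Union>i\<in>UNIV. ?S i)" by auto
  qed
  then have "emeasure (gauss 1) {y. x\<^sup>2 < q y} \<le> emeasure (gauss 1) (\<Union>i\<in>UNIV. ?S i)"
    by (intro emeasure_mono) (auto intro!: sets.finite_UN)
  also have "\<dots> \<le> (\<Sum>i\<in>UNIV. emeasure (gauss 1) (?S i))"
    by (rule emeasure_subadditive_finite) (use Sm in auto)
  also have "\<dots> \<le> (\<Sum>i\<in>(UNIV::'n set). ennreal ((sqrt CARD('n) * 4 ^ CARD('n) + 1) * H))"
    by (intro sum_mono order_trans[OF Si S0])
  also have "\<dots> = ennreal (CARD('n) * ((sqrt CARD('n) * 4 ^ CARD('n) + 1) * H))"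
    by (simp add: ennreal_mult' ennreal_of_nat_eq_real_of_nat)
  finally have "measure (gauss 1) {y. x\<^sup>2 < q y} \<le> CARD('n) * ((sqrt CARD('n) * 4 ^ CARD('n) + 1) * H)"
    using Hn by (simp add: emeasure_eq_measure)
  then show ?thesis by (simp add: q_def H_def mult.assoc)
qed

text \<open>Only the event that all other coordinates are at most \<open>\<kappa> x\<close> is used. The choice \<open>\<kappa>\<^sup>2 = 1 / (2 d)\<close> leaves at
  least half of \<open>x\<^sup>2\<close> for the coordinate \<open>i0\<close>, to which the lower bound for the one-dimensional tail applies.\<close>

lemma gauss_quadratic_tail_lower:
  fixes b :: "'n::finite \<Rightarrow> real"
  assumes b: "\<And>i. 0 \<le> b i" "\<And>i. b i \<le> 1" "b i0 = 0" and x: "x \<ge> 1"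
  shows "exp (-3) / sqrt (2 * pi) * (exp (-1/2) / sqrt (2 * pi) / sqrt (2 * CARD('n))) ^ CARD('n)
      * (exp (- x\<^sup>2 / 2) / x * (\<Prod>j\<in>UNIV-{i0}. 1 / max (b j) (1 / x)))
    \<le> measure (gauss 1) {y::real^'n. x\<^sup>2 < (\<Sum>i\<in>UNIV. (1 - (b i)\<^sup>2) * (y$i)\<^sup>2)}"
    (is "_ \<le> measure _ ?S")
proof -
  interpret prob_space "gauss 1 :: (real^'n) measure" by (rule prob_space_gauss) simp
  let ?P = "PiM (UNIV-{i0}) (\<lambda>_. lborel :: real measure)"
  let ?J = "UNIV - {i0}"
  define S where "S = ?S"
  have S [measurable]: "S \<in> sets borel" unfolding S_def by measurable
  have bb: "(b i)\<^sup>2 \<le> 1" for i using b by (simp add: power_le_one)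
  define \<kappa> where "\<kappa> = 1 / sqrt (2 * CARD('n))"
  have d1: "real CARD('n) \<ge> 1" by (simp add: Suc_leI)
  have "1 \<le> 2 * real CARD('n)" using d1 by linarith
  then have "1 \<le> sqrt (2 * real CARD('n))" by (rule real_sqrt_ge_one)
  then have k: "0 < \<kappa>" "\<kappa> \<le> 1" by (simp_all add: \<kappa>_def divide_le_eq_1)
  have k2: "\<kappa>\<^sup>2 = 1 / (2 * CARD('n))" by (simp add: \<kappa>_def power_divide)
  define c where "c = exp (-3) / sqrt (2 * pi)"
  define K where "K = c / x * exp (- x\<^sup>2 / 2)"
  have K0: "K \<ge> 0" using x by (simp add: K_def c_def)
  define c1 where "c1 = \<kappa> * exp (-1/2) / sqrt (2 * pi)"
  have c1: "0 \<le> c1" "c1 \<le> 1"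
  proof -
    have "\<kappa> * exp (-1/2) \<le> 1 * 1" using k by (intro mult_mono) auto
    moreover have s: "1 \<le> sqrt (2 * pi)" using pi_gt3 by simp
    ultimately have "\<kappa> * exp (-1/2) \<le> sqrt (2 * pi)" by linarith
    then show "c1 \<le> 1" unfolding c1_def using s by (subst divide_le_eq_1_pos) linarith+
  qed (use k in \<open>simp add: c1_def\<close>)
  let ?g = "\<lambda>j y. ennreal (std_normal_density y * exp ((1 - (b j)\<^sup>2) * y\<^sup>2 / 2)) * indicator {y. \<bar>y\<bar> \<le> \<kappa> * x} y"
  have Pp: "0 \<le> (\<Prod>j\<in>?J. 1 / max (b j) (1 / x))" using x by (intro prod_nonneg) (auto simp: le_max_iff_disj)
  have "K * (c1 ^ CARD('n) * (\<Prod>j\<in>?J. 1 / max (b j) (1 / x))) \<le> K * (c1 ^ card ?J * (\<Prod>j\<in>?J. 1 / max (b j) (1 / x)))"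
    using K0 Pp c1 by (intro mult_left_mono mult_right_mono power_decreasing card_mono) auto
  then have "ennreal (K * (c1 ^ CARD('n) * (\<Prod>j\<in>?J. 1 / max (b j) (1 / x)))) \<le> ennreal (K * (c1 ^ card ?J * (\<Prod>j\<in>?J. 1 / max (b j) (1 / x))))"
    by (rule ennreal_leI)
  also have "\<dots> = ennreal K * (\<Prod>j\<in>?J. ennreal (c1 / max (b j) (1 / x)))"
  proof -
    have "(\<Prod>j\<in>?J. c1 / max (b j) (1 / x)) = c1 ^ card ?J * (\<Prod>j\<in>?J. 1 / max (b j) (1 / x))"
      by (simp only: prod_constant[symmetric] prod.distrib[symmetric]) (simp add: divide_inverse)
    moreover have "(\<Prod>j\<in>?J. ennreal (c1 / max (b j) (1 / x))) = ennreal (\<Prod>j\<in>?J. c1 / max (b j) (1 / x))"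
      using x c1 by (intro prod_ennreal) (simp add: le_max_iff_disj)
    ultimately show ?thesis using K0 by (simp only: ennreal_mult')
  qed
  also have "\<dots> \<le> ennreal K * (\<Prod>j\<in>?J. \<integral>\<^sup>+y. ?g j y \<partial>lborel)"
    unfolding c1_def by (intro mult_left_mono ennreal_prod_mono tilted_normal_mass_lower b x k) simp
  also have "(\<Prod>j\<in>?J. \<integral>\<^sup>+y. ?g j y \<partial>lborel) = (\<integral>\<^sup>+f. (\<Prod>j\<in>?J. ?g j (f j)) \<partial>?P)"
    by (rule lborel_product.product_nn_integral_prod[symmetric]) (simp, measurable)
  also have "ennreal K * (\<integral>\<^sup>+f. (\<Prod>j\<in>?J. ?g j (f j)) \<partial>?P) = (\<integral>\<^sup>+f. ennreal K * (\<Prod>j\<in>?J. ?g j (f j)) \<partial>?P)"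
    by (rule nn_integral_cmult[symmetric]) measurable
  also have "\<dots> \<le> (\<integral>\<^sup>+f. (\<Prod>j\<in>?J. ennreal (std_normal_density (f j))) *
      (\<integral>\<^sup>+y. ennreal (std_normal_density y) * indicator S (\<chi> i. (f(i0 := y)) i) \<partial>lborel) \<partial>?P)"
  proof (intro nn_integral_mono)
    fix f :: "'n \<Rightarrow> real"
    define w where "w = (\<Sum>j\<in>?J. (1 - (b j)\<^sup>2) * (f j)\<^sup>2)"
    show "ennreal K * (\<Prod>j\<in>?J. ?g j (f j)) \<le> (\<Prod>j\<in>?J. ennreal (std_normal_density (f j))) *
      (\<integral>\<^sup>+y. ennreal (std_normal_density y) * indicator S (\<chi> i. (f(i0 := y)) i) \<partial>lborel)"
    proof (cases "\<forall>j\<in>?J. \<bar>f j\<bar> \<le> \<kappa> * x")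
      case False
      then obtain j where "j \<in> ?J" "\<not> \<bar>f j\<bar> \<le> \<kappa> * x" by blast
      then have "(\<Prod>j\<in>?J. ?g j (f j)) = 0" by (intro prod_zero) (auto simp: indicator_def)
      then show ?thesis by (simp only: mult_zero_right zero_le)
    next
      case True
      have w0: "0 \<le> w" unfolding w_def using bb by (intro sum_nonneg) simp
      have "w \<le> (\<Sum>j\<in>?J. 1 * (\<kappa> * x)\<^sup>2)"
        unfolding w_def using True bb k x
        by (intro sum_mono mult_mono) (auto simp: abs_le_square_iff[symmetric])
      also have "\<dots> \<le> CARD('n) * (\<kappa> * x)\<^sup>2"
        by (simp add: mult_right_mono card_mono del: card_Diff_insert)
      also have "\<dots> = x\<^sup>2 / 2" by (simp add: power_mult_distrib k2)
      finally have w1: "w \<le> x\<^sup>2 / 2" .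
      define u where "u = sqrt (x\<^sup>2 - w)"
      have u2: "u\<^sup>2 = x\<^sup>2 - w" unfolding u_def
        by (rule real_sqrt_pow2) (use w1 zero_le_power2[of x] in linarith)
      have ux: "u \<le> x" unfolding u_def using w0 x by (intro real_le_lsqrt) auto
      have "1/2 \<le> x\<^sup>2 - w" using w1 x one_le_power[of x 2] by linarith
      then have u0: "1/2 \<le> u" unfolding u_def by (intro real_le_rsqrt) (simp add: power2_eq_square)
      have "K * exp (w / 2) = c * (exp (- u\<^sup>2 / 2) / x)"
        by (simp add: K_def u2 exp_add[symmetric] diff_divide_distrib)
      also have "\<dots> \<le> c * (exp (- u\<^sup>2 / 2) / u)"
        using ux u0 by (intro mult_left_mono divide_left_mono mult_pos_pos) (auto simp: c_def)
      finally have "ennreal (K * exp (w / 2)) \<le> ennreal (c * (exp (- u\<^sup>2 / 2) / u))" by (rule ennreal_leI)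
      also have "\<dots> \<le> (\<integral>\<^sup>+y. ennreal (std_normal_density y) * indicator {y. u < \<bar>y\<bar>} y \<partial>lborel)"
        unfolding c_def by (rule std_normal_lower_tail[OF u0])
      also have "\<dots> \<le> (\<integral>\<^sup>+y. ennreal (std_normal_density y) * indicator S (\<chi> i. (f(i0 := y)) i) \<partial>lborel)"
      proof (intro nn_integral_mono mult_left_mono)
        fix y
        have "(\<Sum>i\<in>UNIV. (1 - (b i)\<^sup>2) * ((f(i0 := y)) i)\<^sup>2) = y\<^sup>2 + w"
          unfolding w_def by (subst sum.remove[of UNIV i0]) (auto simp: b(3) intro!: sum.cong)
        moreover have "x\<^sup>2 < y\<^sup>2 + w" if "u < \<bar>y\<bar>"
          using power_strict_mono[OF that, of 2] u0 u2 by simp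
        ultimately show "indicator {y. u < \<bar>y\<bar>} y \<le> (indicator S (\<chi> i. (f(i0 := y)) i) :: ennreal)"
          by (auto simp: indicator_def S_def)
      qed simp
      finally have A: "ennreal (K * exp (w / 2)) \<le> (\<integral>\<^sup>+y. ennreal (std_normal_density y) * indicator S (\<chi> i. (f(i0 := y)) i) \<partial>lborel)" .
      have E: "exp (w / 2) = (\<Prod>j\<in>?J. exp ((1 - (b j)\<^sup>2) * (f j)\<^sup>2 / 2))"
        by (simp add: w_def exp_sum[symmetric] sum_divide_distrib[symmetric])
      have "ennreal K * (\<Prod>j\<in>?J. ?g j (f j)) = ennreal K * (\<Prod>j\<in>?J. ennreal (std_normal_density (f j) * exp ((1 - (b j)\<^sup>2) * (f j)\<^sup>2 / 2)))"
        using True by (intro arg_cong2[where f="(*)"] refl prod.cong) (auto simp: indicator_def)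
      also have "\<dots> = (\<Prod>j\<in>?J. ennreal (std_normal_density (f j))) * ennreal (K * exp (w / 2))"
        unfolding E using K0
        by (simp add: prod_ennreal normal_density_nonneg ennreal_mult'[symmetric] prod.distrib prod_nonneg ac_simps)
      also have "\<dots> \<le> (\<Prod>j\<in>?J. ennreal (std_normal_density (f j))) *
          (\<integral>\<^sup>+y. ennreal (std_normal_density y) * indicator S (\<chi> i. (f(i0 := y)) i) \<partial>lborel)"
        by (rule mult_left_mono[OF A]) simp
      finally show ?thesis .
    qed
  qed
  also have "\<dots> = emeasure (gauss 1) S" by (rule emeasure_gauss_slice[OF S, symmetric])
  also have "\<dots> = ennreal (measure (gauss 1) S)" by (rule emeasure_eq_measure)
  finally have "K * (c1 ^ CARD('n) * (\<Prod>j\<in>?J. 1 / max (b j) (1 / x))) \<le> measure (gauss 1) S"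
    by (simp add: ennreal_le_iff)
  moreover have "c1 = exp (-1/2) / sqrt (2 * pi) / sqrt (2 * CARD('n))" by (simp add: c1_def \<kappa>_def)
  ultimately show ?thesis by (simp add: K_def c_def S_def mult_ac)
qed

section \<open>The tail of \<open>|A Y|\<close> for a symmetric matrix\<close>

definition eigen_gap :: "real^'n^'n \<Rightarrow> nat \<Rightarrow> real" where
  "eigen_gap A i = sqrt (1 - (eigenvalue A i / eigenvalue A 1)\<^sup>2)"

text \<open>This is the order of magnitude of the tail at \<open>x\<close> times the largest eigenvalue; the factors are
  \<open>\<lambda>\<^sub>1 / (\<lambda>\<^sub>1\<^sup>2 - \<lambda>\<^sub>i\<^sup>2)\<^sup>1\<^sup>/\<^sup>2 \<and> x\<close>, written without a division by zero.\<close>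

definition tail_size :: "real^'n^'n \<Rightarrow> real \<Rightarrow> real" where
  "tail_size A x = exp (- x\<^sup>2 / 2) / x * (\<Prod>i=2..CARD('n). 1 / max (eigen_gap A i) (1 / x))"

definition gtail :: "real^'n^'n \<Rightarrow> real \<Rightarrow> real" where
  "gtail A t = measure (gauss 1) {v. t < norm (A *v v)}"

lemma eigen_gap_bounds:
  fixes A :: "real^'n^'n"
  assumes A: "sym_nonneg_definite A" and "eigenvalue A 1 > 0" "1 \<le> i" "i \<le> CARD('n)"
  shows "0 \<le> eigen_gap A i" "eigen_gap A i \<le> 1"
    "(eigen_gap A i)\<^sup>2 = 1 - (eigenvalue A i / eigenvalue A 1)\<^sup>2"
proof -
  have sym: "transpose A = A" using A by (simp add: sym_nonneg_definite_def)
  have "0 \<le> eigenvalue A i / eigenvalue A 1" using assms eigenvalue_nonneg[OF A, of i] by simp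
  moreover have "eigenvalue A i / eigenvalue A 1 \<le> 1"
    using assms eigenvalue_decreasing[OF sym, of 1 i] by simp
  ultimately have "(eigenvalue A i / eigenvalue A 1)\<^sup>2 \<le> 1" by (rule power_le_one)
  then show "0 \<le> eigen_gap A i" "eigen_gap A i \<le> 1"
    "(eigen_gap A i)\<^sup>2 = 1 - (eigenvalue A i / eigenvalue A 1)\<^sup>2"
    by (auto simp: eigen_gap_def)
qed

lemma norm_vec_power2: "(norm (z::real^'n))\<^sup>2 = (\<Sum>i\<in>UNIV. (z $ i)\<^sup>2)"
  unfolding power2_norm_eq_inner inner_vec_def by (simp add: power2_eq_square)

text \<open>The coordinates in an eigenbasis of \<open>A\<close> are again standard Gaussian, by rotation invariance.\<close>

lemma gtail_as_quadratic_tail: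
  fixes A :: "real^'n^'n"
  assumes A: "sym_nonneg_definite A" and pos: "eigenvalue A 1 > 0" and x: "x \<ge> 0"
  obtains b :: "'n \<Rightarrow> real" and i0 where "\<And>i. 0 \<le> b i" "\<And>i. b i \<le> 1" "b i0 = 0"
    "\<And>x. (\<Prod>j\<in>UNIV-{i0}. 1 / max (b j) (1 / x)) = (\<Prod>i=2..CARD('n). 1 / max (eigen_gap A i) (1 / x))"
    "gtail A (x * eigenvalue A 1) = measure (gauss 1) {y::real^'n. x\<^sup>2 < (\<Sum>i\<in>UNIV. (1 - (b i)\<^sup>2) * (y$i)\<^sup>2)}"
proof -
  let ?d = "CARD('n)"
  let ?s = "eigenvalue A 1"
  obtain e :: "nat \<Rightarrow> real^'n" where e: "\<And>i j. i < ?d \<Longrightarrow> j < ?d \<Longrightarrow> e i \<bullet> e j = (if i = j then 1 else 0)"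
    "\<And>i. i < ?d \<Longrightarrow> A *v e i = eigenvalue A (Suc i) *\<^sub>R e i"
    "\<And>v. (norm (A *v v))\<^sup>2 = (\<Sum>i<?d. (eigenvalue A (Suc i))\<^sup>2 * (e i \<bullet> v)\<^sup>2)"
    by (rule sym_nonneg_eigenbasis[OF A]) (rule that)
  obtain h :: "'n \<Rightarrow> nat" where h: "bij_betw h UNIV {..<?d}"
    using finite_same_card_bij[of "UNIV :: 'n set" "{..<?d}"] by auto
  have hd: "h i < ?d" for i using h by (auto simp: bij_betw_def)
  obtain i0 where i0: "h i0 = 0" using h by (metis bij_betw_iff_bijections lessThan_iff zero_less_card_finite)
  define b where "b i = eigen_gap A (Suc (h i))" for i
  define f where "f v = (\<chi> i. e (h i) \<bullet> v)" for v
  have b: "0 \<le> b i" "b i \<le> 1" "(b i)\<^sup>2 = 1 - (eigenvalue A (Suc (h i)) / ?s)\<^sup>2" for i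
    using eigen_gap_bounds[OF A pos, of "Suc (h i)"] hd[of i] by (auto simp: b_def)
  have b0: "b i0 = 0" using pos by (simp add: b_def i0 eigen_gap_def)
  have nf: "norm (f v) = norm v" for v
  proof -
    have "(norm (f v))\<^sup>2 = (\<Sum>i\<in>UNIV. (e (h i) \<bullet> v)\<^sup>2)"
      unfolding norm_vec_power2 by (simp add: f_def)
    also have "\<dots> = (\<Sum>k<?d. (e k \<bullet> v)\<^sup>2)" by (rule sum.reindex_bij_betw[OF h])
    also have "\<dots> = (norm v)\<^sup>2" by (rule orthonormal_coordinates(2)[symmetric]) (rule e(1))
    finally show ?thesis by (simp add: power2_eq_iff_nonneg)
  qed
  have orth: "orthogonal_transformation f"
    unfolding orthogonal_transformation
  proof
    show "linear f" by (rule linearI) (auto simp: f_def vec_eq_iff inner_add_right)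
  qed (use nf in blast)
  define S where "S = {y::real^'n. x\<^sup>2 < (\<Sum>i\<in>UNIV. (1 - (b i)\<^sup>2) * (y$i)\<^sup>2)}"
  have S: "S \<in> sets borel" unfolding S_def by measurable
  have "{v. x * ?s < norm (A *v v)} = f -` S"
  proof -
    have "x * ?s < norm (A *v v) \<longleftrightarrow> f v \<in> S" for v
    proof -
      have "(norm (A *v v))\<^sup>2 = (\<Sum>i\<in>UNIV. (eigenvalue A (Suc (h i)))\<^sup>2 * (e (h i) \<bullet> v)\<^sup>2)"
        unfolding e(3) by (rule sum.reindex_bij_betw[OF h, symmetric])
      also have "\<dots> = ?s\<^sup>2 * (\<Sum>i\<in>UNIV. (1 - (b i)\<^sup>2) * (f v $ i)\<^sup>2)"
        using pos by (simp add: b(3) f_def sum_distrib_left power_divide)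
      finally have n: "(norm (A *v v))\<^sup>2 = ?s\<^sup>2 * (\<Sum>i\<in>UNIV. (1 - (b i)\<^sup>2) * (f v $ i)\<^sup>2)" .
      have "x * ?s < norm (A *v v) \<longleftrightarrow> (x * ?s)\<^sup>2 < (norm (A *v v))\<^sup>2"
      proof -
        have "0 \<le> x * ?s" using x pos by simp
        then show ?thesis by (auto intro: power_strict_mono power2_less_imp_less)
      qed
      also have "\<dots> \<longleftrightarrow> f v \<in> S" unfolding n S_def using pos by (simp add: power_mult_distrib mult.commute[of "x\<^sup>2"])
      finally show ?thesis .
    qed
    then show ?thesis by auto
  qed
  then have g: "gtail A (x * ?s) = measure (gauss 1) S"
    unfolding gtail_def measure_def by (simp add: emeasure_gauss_orthogonal[OF zero_less_one orth S])
  have pr: "(\<Prod>j\<in>UNIV-{i0}. 1 / max (b j) (1 / x)) = (\<Prod>i=2..?d. 1 / max (eigen_gap A i) (1 / x))" for x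
  proof -
    have inj: "inj h" using h by (simp add: bij_betw_def)
    have "bij_betw (\<lambda>i. Suc (h i)) (UNIV - {i0}) {2..?d}"
    proof (rule bij_betw_imageI)
      show "inj_on (\<lambda>i. Suc (h i)) (UNIV - {i0})" using inj by (auto simp: inj_on_def)
      have "h ` (UNIV - {i0}) = {..<?d} - {0}"
        using h inj i0 by (simp add: image_set_diff bij_betw_def)
      then have "Suc ` h ` (UNIV - {i0}) = Suc ` ({..<?d} - {0})" by simp
      also have "\<dots> = {2..?d}"
      proof (intro equalityI subsetI)
        fix k assume "k \<in> {2..?d}"
        then show "k \<in> Suc ` ({..<?d} - {0})" by (intro image_eqI[of _ _ "k - 1"]) auto
      qed auto
      finally show "(\<lambda>i. Suc (h i)) ` (UNIV - {i0}) = {2..?d}" by (simp add: image_image)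
    qed
    from prod.reindex_bij_betw[OF this, of "\<lambda>i. 1 / max (eigen_gap A i) (1 / x)"]
    show ?thesis by (simp add: b_def)
  qed
  show ?thesis by (rule that[OF b(1,2) b0 pr g[unfolded S_def]])
qed

lemma gtail_two_sided:
  "\<exists>c C. 0 < c \<and> 0 < C \<and> (\<forall>(A::real^'n^'n) x. sym_nonneg_definite A \<longrightarrow> eigenvalue A 1 > 0 \<longrightarrow> 1 \<le> x \<longrightarrow>
     c * tail_size A x \<le> gtail A (x * eigenvalue A 1) \<and> gtail A (x * eigenvalue A 1) \<le> C * tail_size A x)"
proof -
  define c where "c = exp (-3) / sqrt (2 * pi) * (exp (-1/2) / sqrt (2 * pi) / sqrt (2 * CARD('n))) ^ CARD('n)"
  define C where "C = CARD('n) * (sqrt CARD('n) * 4 ^ CARD('n) + 1)"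
  have "c > 0" by (simp add: c_def)
  moreover have "C > 0" by (simp add: C_def add_nonneg_pos)
  moreover have "c * tail_size A x \<le> gtail A (x * eigenvalue A 1) \<and> gtail A (x * eigenvalue A 1) \<le> C * tail_size A x"
    if A: "sym_nonneg_definite A" "eigenvalue A 1 > 0" "1 \<le> x" for A :: "real^'n^'n" and x
  proof -
    have "0 \<le> x" using that by simp
    obtain b :: "'n \<Rightarrow> real" and i0 where b: "\<And>i. 0 \<le> b i" "\<And>i. b i \<le> 1" "b i0 = 0"
      and pr: "\<And>x. (\<Prod>j\<in>UNIV-{i0}. 1 / max (b j) (1 / x)) = (\<Prod>i=2..CARD('n). 1 / max (eigen_gap A i) (1 / x))"
      and g: "gtail A (x * eigenvalue A 1) = measure (gauss 1) {y::real^'n. x\<^sup>2 < (\<Sum>i\<in>UNIV. (1 - (b i)\<^sup>2) * (y$i)\<^sup>2)}"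
      by (rule gtail_as_quadratic_tail[OF A(1,2) \<open>0 \<le> x\<close>]) (rule that)
    show ?thesis
      using gauss_quadratic_tail_lower[of b i0 x, OF b A(3)]
        gauss_quadratic_tail_upper[of b i0 x, OF b A(3)]
      unfolding tail_size_def pr g c_def C_def by auto
  qed
  ultimately show ?thesis by blast
qed

section \<open>Regularity of the tail\<close>

lemma inverse_max_mono:
  fixes b x y :: real
  assumes "0 \<le> b" "0 < x" "x \<le> y"
  shows "1 / max b (1 / x) \<le> 1 / max b (1 / y)" "1 / max b (1 / y) \<le> (y / x) * (1 / max b (1 / x))"
proof -
  have p: "max b (1 / x) > 0" "max b (1 / y) > 0" using assms by (auto simp: less_max_iff_disj)
  have "max b (1 / y) \<le> max b (1 / x)" using assms by (intro max.mono frac_le) auto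
  then show "1 / max b (1 / x) \<le> 1 / max b (1 / y)" using p by (intro divide_left_mono mult_pos_pos) auto
  have "(x / y) * max b (1 / x) \<le> max b (1 / y)"
  proof -
    have "(x / y) * b \<le> 1 * b" using assms by (intro mult_right_mono) auto
    then show ?thesis using assms by (auto simp: max_def)
  qed
  then have "1 / max b (1 / y) \<le> 1 / ((x / y) * max b (1 / x))"
    using p assms by (intro divide_left_mono mult_pos_pos) auto
  then show "1 / max b (1 / y) \<le> (y / x) * (1 / max b (1 / x))" by simp
qed

text \<open>The product in \<open>tail_size\<close> grows at most polynomially, so a change of level is governed by the
  exponential factor.\<close>

lemma tail_size_ratio:
  fixes A :: "real^'n^'n"
  assumes A: "sym_nonneg_definite A" "eigenvalue A 1 > 0" and xy: "1 \<le> x" "x \<le> y"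
  shows "tail_size A y \<le> (y / x) ^ CARD('n) * exp (- (y\<^sup>2 - x\<^sup>2) / 2) * tail_size A x"
    "tail_size A x \<le> (y / x) * exp ((y\<^sup>2 - x\<^sup>2) / 2) * tail_size A y"
    "exp (- x\<^sup>2 / 2) / x \<le> tail_size A x"
    "tail_size A x \<le> x ^ CARD('n) * exp (- x\<^sup>2 / 2)"
proof -
  let ?I = "{2..CARD('n)}"
  let ?P = "\<lambda>x. \<Prod>i\<in>?I. 1 / max (eigen_gap A i) (1 / x)"
  have g: "0 \<le> eigen_gap A i" "eigen_gap A i \<le> 1" if "i \<in> ?I" for i using eigen_gap_bounds[OF A, of i] that by auto
  have p0: "0 \<le> 1 / max (eigen_gap A i) (1 / z)" if "z \<ge> 1" for z i using that by (simp add: le_max_iff_disj)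
  have Pn: "0 \<le> ?P z" if "z \<ge> 1" for z using p0[OF that] by (intro prod_nonneg) auto
  have P1: "1 \<le> ?P z" if "z \<ge> 1" for z using g that by (intro prod_inverse_max_ge_1) auto
  have Pmono: "?P x \<le> ?P y" using xy g p0 by (intro prod_mono conjI inverse_max_mono(1)) auto
  have cd: "card ?I \<le> CARD('n)" by simp
  have "?P y \<le> (\<Prod>i\<in>?I. (y / x) * (1 / max (eigen_gap A i) (1 / x)))"
    using xy g p0 by (intro prod_mono conjI inverse_max_mono(2)) auto
  also have "\<dots> = (y / x) ^ card ?I * ?P x" by (simp only: prod.distrib prod_constant)
  also have "\<dots> \<le> (y / x) ^ CARD('n) * ?P x"
    using xy Pn[OF xy(1)] by (intro mult_right_mono power_increasing) auto
  finally have Pup: "?P y \<le> (y / x) ^ CARD('n) * ?P x" .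
  have e: "exp (- y\<^sup>2 / 2) = exp (- (y\<^sup>2 - x\<^sup>2) / 2) * exp (- x\<^sup>2 / 2)" by (simp add: exp_add[symmetric] diff_divide_distrib)
  have "exp (- y\<^sup>2 / 2) / y * ?P y \<le> exp (- y\<^sup>2 / 2) / x * ((y / x) ^ CARD('n) * ?P x)"
    using xy Pup Pn by (intro mult_mono divide_left_mono) auto
  then show "tail_size A y \<le> (y / x) ^ CARD('n) * exp (- (y\<^sup>2 - x\<^sup>2) / 2) * tail_size A x"
    unfolding tail_size_def e by (simp add: mult_ac)
  have e2: "exp (- x\<^sup>2 / 2) = exp ((y\<^sup>2 - x\<^sup>2) / 2) * exp (- y\<^sup>2 / 2)" by (simp add: exp_add[symmetric] diff_divide_distrib)
  have "exp (- x\<^sup>2 / 2) / x * ?P x \<le> exp (- x\<^sup>2 / 2) / x * ?P y"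
    using xy Pmono by (intro mult_left_mono) auto
  also have "\<dots> = (y / x) * exp ((y\<^sup>2 - x\<^sup>2) / 2) * (exp (- y\<^sup>2 / 2) / y * ?P y)"
    unfolding e2 using xy by simp
  finally show "tail_size A x \<le> (y / x) * exp ((y\<^sup>2 - x\<^sup>2) / 2) * tail_size A y"
    unfolding tail_size_def .
  show "exp (- x\<^sup>2 / 2) / x \<le> tail_size A x"
    unfolding tail_size_def using mult_left_mono[OF P1[OF xy(1)], of "exp (- x\<^sup>2 / 2) / x"] xy by simp
  have "?P x \<le> (\<Prod>i\<in>?I. x)"
  proof (intro prod_mono conjI)
    fix i assume "i \<in> ?I"
    have "1 / x \<le> max (eigen_gap A i) (1 / x)" by simp
    then have "1 / max (eigen_gap A i) (1 / x) \<le> 1 / (1 / x)" using xy by (intro divide_left_mono mult_pos_pos) (auto simp: less_max_iff_disj)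
    then show "1 / max (eigen_gap A i) (1 / x) \<le> x" by simp
  qed (use p0 xy in auto)
  also have "\<dots> \<le> x ^ CARD('n)" using xy cd by (simp only: prod_constant) (intro power_increasing, auto)
  finally have "exp (- x\<^sup>2 / 2) / x * ?P x \<le> exp (- x\<^sup>2 / 2) / 1 * x ^ CARD('n)"
    using xy Pn by (intro mult_mono divide_left_mono) auto
  then show "tail_size A x \<le> x ^ CARD('n) * exp (- x\<^sup>2 / 2)" unfolding tail_size_def by (simp add: mult.commute)
qed

lemma gtail_nonneg: "0 \<le> gtail A t" and gtail_le_1: "gtail (A::real^'n^'n) t \<le> 1"
proof -
  interpret prob_space "gauss 1 :: (real^'n) measure" by (rule prob_space_gauss) simp
  show "0 \<le> gtail A t" "gtail A t \<le> 1" by (simp_all add: gtail_def)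
qed

lemma gtail_antimono: "s \<le> t \<Longrightarrow> gtail (A::real^'n^'n) t \<le> gtail A s"
proof -
  interpret prob_space "gauss 1 :: (real^'n) measure" by (rule prob_space_gauss) simp
  show "s \<le> t \<Longrightarrow> gtail A t \<le> gtail A s"
    unfolding gtail_def by (intro finite_measure_mono) auto
qed

lemma gtail_ratio:
  "\<exists>C\<ge>1. \<forall>(A::real^'n^'n) t r. sym_nonneg_definite A \<longrightarrow> 0 < eigenvalue A 1 \<longrightarrow> eigenvalue A 1 \<le> t \<longrightarrow> t \<le> r \<longrightarrow>
     gtail A r \<le> C * (r / t) ^ CARD('n) * exp (- (r\<^sup>2 - t\<^sup>2) / (2 * (eigenvalue A 1)\<^sup>2)) * gtail A t \<and>
     gtail A t \<le> C * (r / t) * exp ((r\<^sup>2 - t\<^sup>2) / (2 * (eigenvalue A 1)\<^sup>2)) * gtail A r"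
proof -
  obtain c C where cC: "0 < c" "0 < C" and *: "\<And>A::real^'n^'n. \<And>x. sym_nonneg_definite A \<Longrightarrow> eigenvalue A 1 > 0 \<Longrightarrow> 1 \<le> x \<Longrightarrow>
     c * tail_size A x \<le> gtail A (x * eigenvalue A 1) \<and> gtail A (x * eigenvalue A 1) \<le> C * tail_size A x"
    using gtail_two_sided[where 'n='n] by blast
  define K where "K = max 1 (C / c)"
  have "gtail A r \<le> K * (r / t) ^ CARD('n) * exp (- (r\<^sup>2 - t\<^sup>2) / (2 * (eigenvalue A 1)\<^sup>2)) * gtail A t \<and>
     gtail A t \<le> K * (r / t) * exp ((r\<^sup>2 - t\<^sup>2) / (2 * (eigenvalue A 1)\<^sup>2)) * gtail A r"
    if A: "sym_nonneg_definite A" "0 < eigenvalue A 1" and t: "eigenvalue A 1 \<le> t" "t \<le> r" for A :: "real^'n^'n" and t r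
  proof -
    let ?s = "eigenvalue A 1"
    define x y where "x = t / ?s" and "y = r / ?s"
    have xy: "1 \<le> x" "x \<le> y" "1 \<le> y" using A t by (auto simp: x_def y_def divide_right_mono)
    have tr: "t = x * ?s" "r = y * ?s" using A by (auto simp: x_def y_def)
    have q: "(r\<^sup>2 - t\<^sup>2) / (2 * ?s\<^sup>2) = (y\<^sup>2 - x\<^sup>2) / 2" "r / t = y / x"
      using A unfolding tr by (auto simp: power_mult_distrib field_simps)
    have q': "- (r\<^sup>2 - t\<^sup>2) / (2 * ?s\<^sup>2) = - (y\<^sup>2 - x\<^sup>2) / 2" using q(1) by (simp only: minus_divide_left[symmetric])
    note b = *[OF A xy(1)] *[OF A xy(3)]
    note R = tail_size_ratio[OF A xy(1,2)]
    have tx: "tail_size A x \<le> gtail A t / c" "tail_size A y \<le> gtail A r / c"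
      using b cC unfolding tr by (auto simp: field_simps)
    have gen: "C * (Q * (g / c)) \<le> K * Q * g" if "Q \<ge> 0" "g \<ge> 0" for Q g
    proof -
      have "(C / c) * (Q * g) \<le> K * (Q * g)" using that by (intro mult_right_mono) (auto simp: K_def)
      then show ?thesis by (simp add: mult_ac)
    qed
    let ?Q = "(y / x) ^ CARD('n) * exp (- (y\<^sup>2 - x\<^sup>2) / 2)"
    have Q: "?Q \<ge> 0" using xy by simp
    have "gtail A r \<le> C * tail_size A y" using b tr by simp
    also have "\<dots> \<le> C * (?Q * tail_size A x)" using R(1) cC by (intro mult_left_mono) auto
    also have "\<dots> \<le> C * (?Q * (gtail A t / c))" using Q tx cC by (intro mult_left_mono) auto
    also have "\<dots> \<le> K * ?Q * gtail A t" by (rule gen[OF Q gtail_nonneg])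
    finally have 1: "gtail A r \<le> K * ?Q * gtail A t" .
    let ?Q = "(y / x) * exp ((y\<^sup>2 - x\<^sup>2) / 2)"
    have Q: "?Q \<ge> 0" using xy by simp
    have "gtail A t \<le> C * tail_size A x" using b tr by simp
    also have "\<dots> \<le> C * (?Q * tail_size A y)" using R(2) cC by (intro mult_left_mono) auto
    also have "\<dots> \<le> C * (?Q * (gtail A r / c))" using Q tx cC by (intro mult_left_mono) auto
    also have "\<dots> \<le> K * ?Q * gtail A r" by (rule gen[OF Q gtail_nonneg])
    finally show ?thesis using 1 unfolding q q' by (simp add: mult.assoc)
  qed
  moreover have "K \<ge> 1" by (simp add: K_def)
  ultimately show ?thesis by blast
qed

lemma gtail_lower_bound:
  "\<exists>c>0. \<forall>(A::real^'n^'n) t. sym_nonneg_definite A \<longrightarrow> 0 < eigenvalue A 1 \<longrightarrow> eigenvalue A 1 \<le> t \<longrightarrow>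
     c * (eigenvalue A 1 / t) * exp (- t\<^sup>2 / (2 * (eigenvalue A 1)\<^sup>2)) \<le> gtail A t"
proof -
  obtain c C where cC: "0 < c" "0 < C" and *: "\<And>A::real^'n^'n. \<And>x. sym_nonneg_definite A \<Longrightarrow> eigenvalue A 1 > 0 \<Longrightarrow> 1 \<le> x \<Longrightarrow>
     c * tail_size A x \<le> gtail A (x * eigenvalue A 1) \<and> gtail A (x * eigenvalue A 1) \<le> C * tail_size A x"
    using gtail_two_sided[where 'n='n] by blast
  have "c * (eigenvalue A 1 / t) * exp (- t\<^sup>2 / (2 * (eigenvalue A 1)\<^sup>2)) \<le> gtail A t"
    if A: "sym_nonneg_definite A" "0 < eigenvalue A 1" and t: "eigenvalue A 1 \<le> t" for A :: "real^'n^'n" and t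
  proof -
    let ?x = "t / eigenvalue A 1"
    have x: "1 \<le> ?x" using A t by simp
    have "c * (exp (- ?x\<^sup>2 / 2) / ?x) \<le> c * tail_size A ?x"
      using tail_size_ratio(3)[OF A x order_refl] cC by (intro mult_left_mono) auto
    also have "\<dots> \<le> gtail A t" using *[OF A x] A by simp
    finally show ?thesis by (simp add: power_divide mult_ac)
  qed
  then show ?thesis using cC by blast
qed

lemma top_eigenvalue_id: "eigenvalue (mat 1 :: real^'n^'n) 1 = 1" and sym_nonneg_definite_id: "sym_nonneg_definite (mat 1 :: real^'n^'n)"
proof -
  show s: "sym_nonneg_definite (mat 1 :: real^'n^'n)" by (simp add: sym_nonneg_definite_def transpose_mat)
  obtain e :: "nat \<Rightarrow> real^'n" where e: "\<And>i j. i < CARD('n) \<Longrightarrow> j < CARD('n) \<Longrightarrow> e i \<bullet> e j = (if i = j then 1 else 0)"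
    "\<And>i. i < CARD('n) \<Longrightarrow> (mat 1 :: real^'n^'n) *v e i = eigenvalue (mat 1 :: real^'n^'n) (Suc i) *\<^sub>R e i"
    "\<And>v. (norm ((mat 1 :: real^'n^'n) *v v))\<^sup>2 = (\<Sum>i<CARD('n). (eigenvalue (mat 1 :: real^'n^'n) (Suc i))\<^sup>2 * (e i \<bullet> v)\<^sup>2)"
    by (rule sym_nonneg_eigenbasis[OF s]) (rule that)
  have "e 0 = eigenvalue (mat 1 :: real^'n^'n) 1 *\<^sub>R e 0" using e(2)[of 0] by simp
  then have "e 0 \<bullet> e 0 = eigenvalue (mat 1 :: real^'n^'n) 1 * (e 0 \<bullet> e 0)" by (metis inner_scaleR_left)
  then show "eigenvalue (mat 1 :: real^'n^'n) 1 = 1" using e(1)[of 0 0] by simp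
qed

lemma power_exp_bound:
  fixes r :: real
  assumes "r \<ge> 0" shows "r ^ d * exp (- r\<^sup>2 / 4) \<le> exp ((real d)\<^sup>2)"
proof -
  have "r \<le> exp r" using exp_ge_add_one_self[of r] by linarith
  then have "r ^ d \<le> exp r ^ d" using assms by (intro power_mono) auto
  also have "\<dots> = exp (d * r)" by (simp add: exp_of_nat_mult)
  finally have "r ^ d * exp (- r\<^sup>2 / 4) \<le> exp (d * r) * exp (- r\<^sup>2 / 4)" by (intro mult_right_mono) auto
  also have "\<dots> = exp (d * r - r\<^sup>2 / 4)" by (simp add: exp_add[symmetric])
  also have "\<dots> \<le> exp ((real d)\<^sup>2)"
  proof -
    have "0 \<le> (r / 2 - d)\<^sup>2" by simp
    then have "d * r - r\<^sup>2 / 4 \<le> (real d)\<^sup>2" by (simp add: power2_eq_square algebra_simps)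
    then show ?thesis by simp
  qed
  finally show ?thesis .
qed

lemma gauss_norm_tail:
  "\<exists>C\<ge>1. \<forall>r\<ge>0. measure (gauss 1 :: (real^'n) measure) {v. r < norm v} \<le> C * exp (- r\<^sup>2 / 4)"
proof -
  obtain c C where cC: "0 < c" "0 < C" and *: "\<And>A::real^'n^'n. \<And>x. sym_nonneg_definite A \<Longrightarrow> eigenvalue A 1 > 0 \<Longrightarrow> 1 \<le> x \<Longrightarrow>
     c * tail_size A x \<le> gtail A (x * eigenvalue A 1) \<and> gtail A (x * eigenvalue A 1) \<le> C * tail_size A x"
    using gtail_two_sided[where 'n='n] by blast
  define I where "I = (mat 1 :: real^'n^'n)"
  have I: "sym_nonneg_definite I" "eigenvalue I 1 = 1" by (simp_all only: I_def top_eigenvalue_id sym_nonneg_definite_id)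
  have g: "gtail I r = measure (gauss 1 :: (real^'n) measure) {v. r < norm v}" for r by (simp add: gtail_def I_def)
  define K where "K = max (exp 1) (C * exp ((real CARD('n))\<^sup>2))"
  have "gtail I r \<le> K * exp (- r\<^sup>2 / 4)" if r: "r \<ge> 0" for r
  proof (cases "r \<ge> 1")
    case True
    have "gtail I r \<le> C * tail_size I r" using *[of I r] I True by simp
    also have "\<dots> \<le> C * (r ^ CARD('n) * exp (- r\<^sup>2 / 2))"
      using tail_size_ratio(4)[of I r r] I True cC by (intro mult_left_mono) auto
    also have "\<dots> = C * ((r ^ CARD('n) * exp (- r\<^sup>2 / 4)) * exp (- r\<^sup>2 / 4))"
      by (simp add: exp_add[symmetric])
    also have "\<dots> \<le> C * (exp ((real CARD('n))\<^sup>2) * exp (- r\<^sup>2 / 4))"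
      using power_exp_bound[OF r, of "CARD('n)"] cC by (intro mult_left_mono mult_right_mono) auto
    also have "\<dots> = (C * exp ((real CARD('n))\<^sup>2)) * exp (- r\<^sup>2 / 4)" by simp
    also have "\<dots> \<le> K * exp (- r\<^sup>2 / 4)" by (intro mult_right_mono) (auto simp: K_def)
    finally show ?thesis .
  next
    case False
    then have "r\<^sup>2 \<le> 1" using r by (intro power_le_one) auto
    then have "1 \<le> exp (1 + - r\<^sup>2 / 4)" by simp
    also have "\<dots> = exp 1 * exp (- r\<^sup>2 / 4)" by (rule exp_add)
    also have "\<dots> \<le> K * exp (- r\<^sup>2 / 4)" by (intro mult_right_mono) (auto simp: K_def)
    finally show ?thesis using gtail_le_1[of I r] by linarith
  qed
  moreover have "K \<ge> 1" using exp_ge_add_one_self[of "1::real"] by (simp add: K_def le_max_iff_disj)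
  ultimately show ?thesis unfolding g by blast
qed

lemma gtail_gaussian_bound:
  assumes s1: "s1 > 0"
  shows "\<exists>C\<ge>1. \<forall>(A::real^'n^'n) t. sym_nonneg_definite A \<longrightarrow> eigenvalue A 1 \<le> s1 \<longrightarrow> 0 \<le> t \<longrightarrow>
     gtail A t \<le> C * exp (- t\<^sup>2 / (4 * s1\<^sup>2))"
proof -
  interpret prob_space "gauss 1 :: (real^'n) measure" by (rule prob_space_gauss) simp
  obtain C where C: "C \<ge> 1" "\<And>r. r \<ge> 0 \<Longrightarrow> prob {v. r < norm v} \<le> C * exp (- r\<^sup>2 / 4)"
    using gauss_norm_tail[where 'n='n] by blast
  have "gtail A t \<le> C * exp (- t\<^sup>2 / (4 * s1\<^sup>2))"
    if A: "sym_nonneg_definite A" "eigenvalue A 1 \<le> s1" "0 \<le> t" for A :: "real^'n^'n" and t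
  proof -
    have "gtail A t \<le> prob {v. t / s1 < norm v}"
      unfolding gtail_def
    proof (intro finite_measure_mono subsetI CollectI)
      fix v :: "real^'n" assume "v \<in> {v. t < norm (A *v v)}"
      then have "t < eigenvalue A 1 * norm v" using norm_matrix_le_top_eigenvalue[OF A(1), of v] by simp
      also have "\<dots> \<le> s1 * norm v" using A by (intro mult_right_mono) auto
      finally show "t / s1 < norm v" using s1 by (simp add: field_simps)
    qed auto
    also have "\<dots> \<le> C * exp (- ((t / s1)\<^sup>2 / 4))" using C(2)[of "t / s1"] s1 that by simp
    also have "(t / s1)\<^sup>2 / 4 = t\<^sup>2 / (4 * s1\<^sup>2)" by (simp add: power_divide)
    finally show ?thesis by simp
  qed
  then show ?thesis using C by blast
qed

text \<open>Matrices whose top eigenvalue lies in a fixed compact interval of positive numbers; all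
  constants below are uniform over this class.\<close>

definition spectral_class :: "real \<Rightarrow> real \<Rightarrow> (real^'n^'n) set" where
  "spectral_class s0 s1 = {A. sym_nonneg_definite A \<and> s0 \<le> eigenvalue A 1 \<and> eigenvalue A 1 \<le> s1}"

lemma real_mult_exp_neg_square_le_1: "t * exp (- t\<^sup>2) \<le> (1::real)"
proof -
  have "t \<le> 1 + t\<^sup>2" using zero_le_power2[of "t - 1/2"] by (simp add: power2_eq_square algebra_simps)
  also have "\<dots> \<le> exp (t\<^sup>2)" by (rule exp_ge_add_one_self)
  finally show ?thesis by (simp add: exp_minus field_simps)
qed

lemma gtail_lower_bound_class:
  assumes s: "0 < s0" "s0 \<le> s1"
  shows "\<exists>c>0. \<forall>A\<in>(spectral_class s0 s1 :: (real^'n^'n) set). \<forall>t\<ge>s1. c * exp (- (1 / (2 * s0\<^sup>2) + 1) * t\<^sup>2) \<le> gtail A t"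
proof -
  obtain c where c: "c > 0" "\<And>A::real^'n^'n. \<And>t. sym_nonneg_definite A \<Longrightarrow> 0 < eigenvalue A 1 \<Longrightarrow> eigenvalue A 1 \<le> t \<Longrightarrow>
     c * (eigenvalue A 1 / t) * exp (- t\<^sup>2 / (2 * (eigenvalue A 1)\<^sup>2)) \<le> gtail A t"
    using gtail_lower_bound[where 'n='n] by blast
  have "c * s0 * exp (- (1 / (2 * s0\<^sup>2) + 1) * t\<^sup>2) \<le> gtail A t"
    if A: "A \<in> spectral_class s0 s1" and t: "t \<ge> s1" for A :: "real^'n^'n" and t
  proof -
    let ?s = "eigenvalue A 1"
    have A': "sym_nonneg_definite A" "s0 \<le> ?s" "?s \<le> s1" using A by (auto simp: spectral_class_def)
    have t0: "t > 0" using s t by linarith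
    have "s0 * exp (- t\<^sup>2) \<le> s0 / t" using real_mult_exp_neg_square_le_1[of t] s t0 by (simp add: field_simps)
    also have "\<dots> \<le> ?s / t" using A' t0 by (intro divide_right_mono) auto
    finally have 1: "s0 * exp (- t\<^sup>2) \<le> ?s / t" .
    have "t\<^sup>2 / (2 * ?s\<^sup>2) \<le> t\<^sup>2 / (2 * s0\<^sup>2)" using A' s by (intro divide_left_mono mult_left_mono power_mono mult_pos_pos) auto
    then have 2: "exp (- t\<^sup>2 / (2 * s0\<^sup>2)) \<le> exp (- t\<^sup>2 / (2 * ?s\<^sup>2))" by simp
    have "c * s0 * exp (- (1 / (2 * s0\<^sup>2) + 1) * t\<^sup>2) = c * ((s0 * exp (- t\<^sup>2)) * exp (- t\<^sup>2 / (2 * s0\<^sup>2)))"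
      by (simp add: exp_add[symmetric] algebra_simps)
    also have "\<dots> \<le> c * ((?s / t) * exp (- t\<^sup>2 / (2 * ?s\<^sup>2)))"
      using 1 2 c s A' t0 by (intro mult_left_mono mult_mono) auto
    also have "\<dots> \<le> gtail A t" using c(2)[of A t] A' s t by (simp add: mult_ac)
    finally show ?thesis .
  qed
  then show ?thesis using c s by (intro exI[of _ "c * s0"]) auto
qed

text \<open>The tail \<open>gtail A t\<close> is at least \<open>exp (- k t\<^sup>2)\<close> up to a constant, uniformly over the class; a large multiple
  \<open>R\<close> makes the tail of the norm smaller than any prescribed power of this.\<close>

lemma gauss_norm_tail_negligible:
  assumes s: "0 < s0" "s0 \<le> s1" and K: "0 \<le> K"
  shows "\<exists>R\<ge>1. \<exists>C\<ge>1. \<forall>A\<in>(spectral_class s0 s1 :: (real^'n^'n) set). \<forall>t\<ge>s1.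
     measure (gauss 1 :: (real^'n) measure) {v. R * t < norm v} \<le> C * exp (- K * t\<^sup>2) * gtail A t"
proof -
  obtain c where c: "c > 0" "\<And>A::real^'n^'n. \<And>t. A \<in> spectral_class s0 s1 \<Longrightarrow> t \<ge> s1 \<Longrightarrow>
      c * exp (- (1 / (2 * s0\<^sup>2) + 1) * t\<^sup>2) \<le> gtail A t"
    using gtail_lower_bound_class[OF s, where 'n='n] by blast
  obtain C where C: "C \<ge> 1" "\<And>r. r \<ge> 0 \<Longrightarrow> measure (gauss 1 :: (real^'n) measure) {v. r < norm v} \<le> C * exp (- r\<^sup>2 / 4)"
    using gauss_norm_tail[where 'n='n] by blast
  define k where "k = 1 / (2 * s0\<^sup>2) + 1"
  define R where "R = sqrt (4 * (K + k))"
  have k1: "k \<ge> 1" using s by (simp add: k_def)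
  have R2: "R\<^sup>2 = 4 * (K + k)" unfolding R_def by (rule real_sqrt_pow2) (use K k1 in simp)
  have "1 \<le> K + k" using K k1 by (rule add_increasing)
  then have "1 \<le> 4 * (K + k)" by simp
  then have R1: "R \<ge> 1" unfolding R_def by (rule real_sqrt_ge_one)
  define C' where "C' = max 1 (C / c)"
  have "measure (gauss 1 :: (real^'n) measure) {v. R * t < norm v} \<le> C' * exp (- K * t\<^sup>2) * gtail A t"
    if A: "A \<in> spectral_class s0 s1" and t: "t \<ge> s1" for A :: "real^'n^'n" and t
  proof -
    have "measure (gauss 1 :: (real^'n) measure) {v. R * t < norm v} \<le> C * exp (- (R * t)\<^sup>2 / 4)"
      using R1 s t by (intro C(2)) auto
    also have "- (R * t)\<^sup>2 / 4 = - K * t\<^sup>2 + - k * t\<^sup>2"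
    proof -
      have "(R * t)\<^sup>2 = 4 * (K * t\<^sup>2 + k * t\<^sup>2)" by (simp add: power_mult_distrib R2 distrib_right)
      then show ?thesis by simp
    qed
    also have "C * exp (- K * t\<^sup>2 + - k * t\<^sup>2) = C / c * exp (- K * t\<^sup>2) * (c * exp (- k * t\<^sup>2))"
      unfolding exp_add using c(1) by simp
    also have "\<dots> \<le> C' * exp (- K * t\<^sup>2) * gtail A t"
      using c(2)[OF A t] c(1) C(1) unfolding k_def[symmetric] by (intro mult_mono) (auto simp: C'_def)
    finally show ?thesis .
  qed
  moreover have "C' \<ge> 1" by (simp add: C'_def)
  ultimately show ?thesis using R1 by blast
qed

text \<open>Outside the negligible event \<open>|v| > R t\<close> the added form \<open>(K / t\<^sup>2) |v|\<^sup>2\<close> is bounded, so all perturbations together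
  lower \<open>t\<^sup>2\<close> by a bounded amount \<open>L\<close>, which costs the bounded factor \<open>exp (L / (2 s0\<^sup>2))\<close> up to constants. This is what
  allows a whole block of times to be treated as a single time.\<close>

lemma gtail_stable:
  assumes s: "0 < s0" "s0 \<le> s1" and K: "0 \<le> K"
  shows "\<exists>C\<ge>1. \<exists>t0\<ge>s1. \<forall>A\<in>(spectral_class s0 s1 :: (real^'n^'n) set). \<forall>t\<ge>t0.
     measure (gauss 1 :: (real^'n) measure) {v. t\<^sup>2 - K < (norm (A *v v))\<^sup>2 + (K / t\<^sup>2) * (norm v)\<^sup>2} \<le> C * gtail A t"
proof -
  interpret prob_space "gauss 1 :: (real^'n) measure" by (rule prob_space_gauss) simp
  obtain R C1 where R: "R \<ge> 1" "C1 \<ge> 1" "\<And>A::real^'n^'n. \<And>t. A \<in> spectral_class s0 s1 \<Longrightarrow> t \<ge> s1 \<Longrightarrow>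
      prob {v. R * t < norm v} \<le> C1 * exp (- 0 * t\<^sup>2) * gtail A t"
    using gauss_norm_tail_negligible[OF s order_refl, where 'n='n] by blast
  obtain C2 where C2: "C2 \<ge> 1" "\<And>A::real^'n^'n. \<And>t r. sym_nonneg_definite A \<Longrightarrow> 0 < eigenvalue A 1 \<Longrightarrow> eigenvalue A 1 \<le> t \<Longrightarrow> t \<le> r \<Longrightarrow>
     gtail A t \<le> C2 * (r / t) * exp ((r\<^sup>2 - t\<^sup>2) / (2 * (eigenvalue A 1)\<^sup>2)) * gtail A r"
    using gtail_ratio[where 'n='n] by blast
  define L where "L = K * (1 + R\<^sup>2)"
  have L0: "L \<ge> 0" using K by (simp add: L_def)
  define t0 where "t0 = max (2 * s1) (2 * sqrt L)"
  define C where "C = C1 + C2 * 2 * exp (L / (2 * s0\<^sup>2))"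
  have "prob {v. t\<^sup>2 - K < (norm (A *v v))\<^sup>2 + (K / t\<^sup>2) * (norm v)\<^sup>2} \<le> C * gtail A t"
    if A: "A \<in> spectral_class s0 s1" and t: "t \<ge> t0" for A :: "real^'n^'n" and t
  proof -
    let ?s = "eigenvalue A 1"
    have A': "sym_nonneg_definite A" "s0 \<le> ?s" "?s \<le> s1" using A by (auto simp: spectral_class_def)
    have t1: "t \<ge> 2 * s1" "t \<ge> 2 * sqrt L" using t by (auto simp: t0_def)
    have tp: "t > 0" using t1 s by linarith
    have "(2 * sqrt L)\<^sup>2 \<le> t\<^sup>2" using t1 L0 by (intro power_mono) auto
    then have tL: "4 * L \<le> t\<^sup>2" using L0 by (simp add: power_mult_distrib)
    define t' where "t' = sqrt (t\<^sup>2 - L)"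
    have t'2: "t'\<^sup>2 = t\<^sup>2 - L" unfolding t'_def by (rule real_sqrt_pow2) (use tL L0 in linarith)
    have "(t / 2)\<^sup>2 = t\<^sup>2 / 4" by (simp add: power_divide)
    then have "(t / 2)\<^sup>2 \<le> t'\<^sup>2" unfolding t'2 using tL zero_le_power2[of t] by linarith
    then have t'h: "t / 2 \<le> t'" by (rule power2_le_imp_le) (use tL L0 in \<open>simp add: t'_def\<close>)
    have t's: "?s \<le> t'" using t'h t1 A' by linarith
    have t't: "t' \<le> t"
    proof (rule power2_le_imp_le)
      show "t'\<^sup>2 \<le> t\<^sup>2" unfolding t'2 using L0 by simp
    qed (use tp in simp)
    have "{v. t\<^sup>2 - K < (norm (A *v v))\<^sup>2 + (K / t\<^sup>2) * (norm v)\<^sup>2} \<subseteq> {v. R * t < norm v} \<union> {v. t' < norm (A *v v)}"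
    proof
      fix v assume v: "v \<in> {v. t\<^sup>2 - K < (norm (A *v v))\<^sup>2 + (K / t\<^sup>2) * (norm v)\<^sup>2}"
      show "v \<in> {v. R * t < norm v} \<union> {v. t' < norm (A *v v)}"
      proof (cases "R * t < norm v")
        case False
        then have "(norm v)\<^sup>2 \<le> (R * t)\<^sup>2" by (intro power_mono) auto
        then have "(K / t\<^sup>2) * (norm v)\<^sup>2 \<le> (K / t\<^sup>2) * (R * t)\<^sup>2" using K by (intro mult_left_mono) auto
        also have "\<dots> = K * R\<^sup>2" using tp by (simp add: power_mult_distrib)
        finally have "t'\<^sup>2 < (norm (A *v v))\<^sup>2" using v unfolding t'2 L_def by (simp add: algebra_simps)
        then show ?thesis by (auto intro: power2_less_imp_less)
      qed simp
    qed
    then have "prob {v. t\<^sup>2 - K < (norm (A *v v))\<^sup>2 + (K / t\<^sup>2) * (norm v)\<^sup>2} \<le> prob ({v. R * t < norm v} \<union> {v. t' < norm (A *v v)})"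
      by (intro finite_measure_mono) auto
    also have "\<dots> \<le> prob {v. R * t < norm v} + prob {v. t' < norm (A *v v)}"
      by (intro measure_Un_le) auto
    also have "\<dots> \<le> C1 * gtail A t + gtail A t'"
      using R(3)[OF A, of t] t1 s by (simp add: gtail_def)
    also have "gtail A t' \<le> C2 * (t / t') * exp ((t\<^sup>2 - t'\<^sup>2) / (2 * ?s\<^sup>2)) * gtail A t"
      using C2(2)[of A t' t] A' s t's t't by simp
    also have "\<dots> \<le> C2 * 2 * exp (L / (2 * s0\<^sup>2)) * gtail A t"
    proof -
      have "t / t' \<le> 2" using t'h tp by (simp add: field_simps)
      moreover have "L / (2 * ?s\<^sup>2) \<le> L / (2 * s0\<^sup>2)"
        using A' s L0 by (intro divide_left_mono mult_left_mono power_mono mult_pos_pos) auto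
      ultimately show ?thesis
        using C2(1) t'h tp unfolding t'2
        by (intro mult_right_mono mult_mono mult_left_mono) (auto simp: gtail_nonneg)
    qed
    finally show ?thesis by (simp add: C_def algebra_simps)
  qed
  moreover have "C \<ge> 1" using R(2) C2(1) by (simp add: C_def add_increasing2)
  moreover have "t0 \<ge> s1" using s by (simp add: t0_def le_max_iff_disj)
  ultimately show ?thesis by blast
qed

section \<open>Joint exceedances of two correlated Gaussian vectors\<close>

text \<open>Two nearby times. If \<open>A X\<close> is large then with overwhelming probability it barely exceeds
  the threshold \<open>f\<close>; to exceed it again after shrinking by \<open>\<rho> = 1 - \<theta>\<close>, the independent part must make
  up for a loss of order \<open>\<theta> f\<close> with standard deviation of order \<open>sqrt \<theta>\<close>.\<close>

lemma (in prob_space) gauss_near_pair: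
  assumes s: "0 < s0" "s0 \<le> s1"
  shows "\<exists>C\<ge>1. \<exists>c>0. \<exists>\<epsilon>>0. \<forall>A\<in>(spectral_class s0 s1 :: (real^'n^'n) set). \<forall>B\<in>spectral_class s0 s1. \<forall>f\<ge>s1. \<forall>g\<ge>f. \<forall>\<rho> \<Delta> X W.
     0 \<le> \<rho> \<longrightarrow> \<rho> < 1 \<longrightarrow> 0 \<le> \<Delta> \<longrightarrow> \<Delta> \<le> \<epsilon> * (1 - \<rho>) \<longrightarrow> (\<forall>x. (norm (B *v x))\<^sup>2 \<le> (norm (A *v x))\<^sup>2 + \<Delta> * (norm x)\<^sup>2) \<longrightarrow>
     indep_var borel X borel W \<longrightarrow> distr M borel X = gauss 1 \<longrightarrow> distr M borel W = gauss 1 \<longrightarrow>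
     prob {\<omega>\<in>space M. f < norm (A *v X \<omega>) \<and> g < norm (B *v (\<rho> *\<^sub>R X \<omega> + sqrt (1 - \<rho>\<^sup>2) *\<^sub>R W \<omega>))}
       \<le> C * gtail A f * exp (- c * (1 - \<rho>) * f\<^sup>2)"
proof -
  obtain R C1 where R: "R \<ge> 1" "C1 \<ge> 1" "\<And>A::real^'n^'n. \<And>t. A \<in> spectral_class s0 s1 \<Longrightarrow> t \<ge> s1 \<Longrightarrow>
      measure (gauss 1 :: (real^'n) measure) {v. R * t < norm v} \<le> C1 * exp (- 1 * t\<^sup>2) * gtail A t"
    using gauss_norm_tail_negligible[OF s zero_le_one, where 'n='n] by blast
  obtain C2 where C2: "C2 \<ge> 1" "\<And>A::real^'n^'n. \<And>t r. sym_nonneg_definite A \<Longrightarrow> 0 < eigenvalue A 1 \<Longrightarrow> eigenvalue A 1 \<le> t \<Longrightarrow> t \<le> r \<Longrightarrow>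
     gtail A r \<le> C2 * (r / t) ^ CARD('n) * exp (- (r\<^sup>2 - t\<^sup>2) / (2 * (eigenvalue A 1)\<^sup>2)) * gtail A t"
    using gtail_ratio[where 'n='n] by blast
  have s1: "s1 > 0" using s by linarith
  obtain C3 where C3: "C3 \<ge> 1" "\<And>A::real^'n^'n. \<And>t. sym_nonneg_definite A \<Longrightarrow> eigenvalue A 1 \<le> s1 \<Longrightarrow> 0 \<le> t \<Longrightarrow>
     gtail A t \<le> C3 * exp (- t\<^sup>2 / (4 * s1\<^sup>2))"
    using gtail_gaussian_bound[OF s1, where 'n='n] by blast
  define c where "c = min 1 (1 / (25 * s1\<^sup>2))"
  define \<epsilon> where "\<epsilon> = 1 / (8 * R\<^sup>2)"
  define C where "C = C1 + C2 * 2 ^ CARD('n) + C3"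
  have c0: "c > 0" "\<epsilon> > 0" using s1 R by (auto simp: c_def \<epsilon>_def)
  have "prob {\<omega>\<in>space M. f < norm (A *v X \<omega>) \<and> g < norm (B *v (\<rho> *\<^sub>R X \<omega> + sqrt (1 - \<rho>\<^sup>2) *\<^sub>R W \<omega>))}
       \<le> C * gtail A f * exp (- c * (1 - \<rho>) * f\<^sup>2)"
    if A: "A \<in> spectral_class s0 s1" and B: "B \<in> spectral_class s0 s1" and f: "f \<ge> s1" "g \<ge> f"
      and \<rho>: "0 \<le> \<rho>" "\<rho> < 1" and \<Delta>: "0 \<le> \<Delta>" "\<Delta> \<le> \<epsilon> * (1 - \<rho>)"
      and AB: "\<forall>x. (norm (B *v x))\<^sup>2 \<le> (norm (A *v x))\<^sup>2 + \<Delta> * (norm x)\<^sup>2"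
      and ind: "indep_var borel X borel W" and dX: "distr M borel X = gauss 1" and dW: "distr M borel W = gauss 1"
    for A B :: "real^'n^'n" and f g \<rho> \<Delta> X W
  proof -
    let ?s = "eigenvalue A 1"
    have A': "sym_nonneg_definite A" "s0 \<le> ?s" "?s \<le> s1" using A by (auto simp: spectral_class_def)
    have B': "sym_nonneg_definite B" "eigenvalue B 1 \<le> s1" using B by (auto simp: spectral_class_def)
    have rv [measurable]: "X \<in> borel_measurable M" "W \<in> borel_measurable M"
      using indep_var_rv1[OF ind] indep_var_rv2[OF ind] by auto
    define \<theta> where "\<theta> = 1 - \<rho>"
    have \<theta>: "0 < \<theta>" "\<theta> \<le> 1" using \<rho> by (auto simp: \<theta>_def)
    have f0: "f > 0" using f s1 by linarith
    \<comment> \<open>\<open>h\<close> is the largest overshoot of the first exceedance that leaves a loss of order \<open>\<theta> f\<close>; the factor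
        \<open>2 / 5\<close> in \<open>r\<close> is the remaining loss \<open>5 / 8\<close> divided by \<open>25 / 16 \<ge> sqrt 2\<close>\<close>
    define h where "h = f * (1 + \<theta> / 4)"
    define r where "r = 2 / 5 * sqrt \<theta> * f"
    have r0: "r \<ge> 0" using \<theta> f0 by (simp add: r_def)
    have PX: "prob {\<omega>\<in>space M. X \<omega> \<in> S} = measure (gauss 1) S" if "S \<in> sets borel" for S
      using measure_distr[of X M borel S] that unfolding dX by (simp add: vimage_def Int_def conj_commute)
    have PW: "prob {\<omega>\<in>space M. W \<omega> \<in> S} = measure (gauss 1) S" if "S \<in> sets borel" for S
      using measure_distr[of W M borel S] that unfolding dW by (simp add: vimage_def Int_def conj_commute)
    have Xm: "{\<omega>\<in>space M. X \<omega> \<in> S} \<in> events" if "S \<in> sets borel" for S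
    proof -
      have "{\<omega>\<in>space M. X \<omega> \<in> S} = X -` S \<inter> space M" by auto
      then show ?thesis using measurable_sets[OF rv(1) that] by simp
    qed
    have XWm: "{\<omega>\<in>space M. X \<omega> \<in> S \<and> W \<omega> \<in> S'} \<in> events" if "S \<in> sets borel" "S' \<in> sets borel" for S S'
    proof -
      have "{\<omega>\<in>space M. X \<omega> \<in> S \<and> W \<omega> \<in> S'} = (X -` S \<inter> space M) \<inter> (W -` S' \<inter> space M)" by auto
      then show ?thesis using measurable_sets[OF rv(1) that(1)] measurable_sets[OF rv(2) that(2)] by simp
    qed
    \<comment> \<open>too large an overshoot, too long a vector \<open>X\<close>, or a large independent part\<close>
    let ?E1 = "{\<omega>\<in>space M. X \<omega> \<in> {v. h < norm (A *v v)}}"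
    let ?E2 = "{\<omega>\<in>space M. X \<omega> \<in> {v. R * f < norm v}}"
    let ?E3 = "{\<omega>\<in>space M. X \<omega> \<in> {v. f < norm (A *v v)} \<and> W \<omega> \<in> {v. r < norm (B *v v)}}"
    let ?E = "{\<omega>\<in>space M. f < norm (A *v X \<omega>) \<and> g < norm (B *v (\<rho> *\<^sub>R X \<omega> + sqrt (1 - \<rho>\<^sup>2) *\<^sub>R W \<omega>))}"
    have "?E \<subseteq> ?E1 \<union> ?E2 \<union> ?E3"
    proof
      fix \<omega> assume w: "\<omega> \<in> ?E"
      show "\<omega> \<in> ?E1 \<union> ?E2 \<union> ?E3"
      proof (cases "h < norm (A *v X \<omega>) \<or> R * f < norm (X \<omega>)")
        case False
        have Ah: "norm (A *v X \<omega>) \<le> h" and Xr: "norm (X \<omega>) \<le> R * f" using False by auto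
        have "\<Delta> * (norm (X \<omega>))\<^sup>2 \<le> (\<epsilon> * \<theta>) * (R * f)\<^sup>2"
          using \<Delta> Xr c0 \<theta> unfolding \<theta>_def[symmetric] by (intro mult_mono power_mono) auto
        also have "\<dots> = \<theta> * f\<^sup>2 / 8" using R by (simp add: \<epsilon>_def power_mult_distrib)
        finally have 1: "\<Delta> * (norm (X \<omega>))\<^sup>2 \<le> \<theta> * f\<^sup>2 / 8" .
        have "(norm (A *v X \<omega>))\<^sup>2 \<le> h\<^sup>2" using Ah by (intro power_mono) auto
        with 1 AB have "(norm (B *v X \<omega>))\<^sup>2 \<le> h\<^sup>2 + \<theta> * f\<^sup>2 / 8" by (meson add_mono order_trans)
        also have "\<dots> \<le> (f * (1 + 3 * \<theta> / 8))\<^sup>2"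
        proof -
          have "(f * (1 + 3 * \<theta> / 8))\<^sup>2 - (h\<^sup>2 + \<theta> * f\<^sup>2 / 8) = f\<^sup>2 * (\<theta> / 8 + 5 * \<theta>\<^sup>2 / 64)"
            by (simp add: h_def power2_eq_square field_simps)
          moreover have "\<dots> \<ge> 0" using \<theta> by simp
          ultimately show ?thesis by linarith
        qed
        finally have "norm (B *v X \<omega>) \<le> f * (1 + 3 * \<theta> / 8)"
          by (rule power2_le_imp_le) (use f0 \<theta> in simp)
        then have 2: "\<rho> * norm (B *v X \<omega>) \<le> \<rho> * (f * (1 + 3 * \<theta> / 8))" using \<rho> by (intro mult_left_mono) auto
        have "\<rho> * (f * (3 * \<theta> / 8)) \<le> 1 * (f * (3 * \<theta> / 8))" using \<rho> f0 \<theta> by (intro mult_right_mono) auto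
        moreover have "\<rho> * (f * (1 + 3 * \<theta> / 8)) = \<rho> * f + \<rho> * (f * (3 * \<theta> / 8))" by (simp add: algebra_simps)
        moreover have "\<rho> * f = f - \<theta> * f" by (simp add: \<theta>_def algebra_simps)
        moreover have "1 * (f * (3 * \<theta> / 8)) = 3 / 8 * (\<theta> * f)" "5 / 8 * \<theta> * f = 5 / 8 * (\<theta> * f)" by simp_all
        ultimately have 3: "\<rho> * norm (B *v X \<omega>) \<le> f - 5 / 8 * \<theta> * f" using 2 by linarith
        let ?c = "sqrt (1 - \<rho>\<^sup>2)"
        have c2: "1 - \<rho>\<^sup>2 = \<theta> * (1 + \<rho>)" by (simp add: \<theta>_def power2_eq_square algebra_simps)
        have cn: "0 \<le> 1 - \<rho>\<^sup>2" unfolding c2 using \<theta> \<rho> by simp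
        have "norm (B *v (\<rho> *\<^sub>R X \<omega> + ?c *\<^sub>R W \<omega>)) \<le> norm (\<rho> *\<^sub>R (B *v X \<omega>)) + norm (?c *\<^sub>R (B *v W \<omega>))"
          unfolding matrix_vector_right_distrib matrix_vector_mult_scaleR by (rule norm_triangle_ineq)
        also have "\<dots> = \<rho> * norm (B *v X \<omega>) + ?c * norm (B *v W \<omega>)" using \<rho> cn by simp
        finally have n: "norm (B *v (\<rho> *\<^sub>R X \<omega> + ?c *\<^sub>R W \<omega>)) \<le> \<rho> * norm (B *v X \<omega>) + ?c * norm (B *v W \<omega>)" .
        have "g < norm (B *v (\<rho> *\<^sub>R X \<omega> + ?c *\<^sub>R W \<omega>))" using w by simp
        with n 3 f(2) have "5 / 8 * \<theta> * f < ?c * norm (B *v W \<omega>)" by linarith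
        also have "\<dots> \<le> sqrt (2 * \<theta>) * norm (B *v W \<omega>)"
          unfolding c2 using \<theta> \<rho> by (intro mult_right_mono real_sqrt_le_mono) auto
        finally have 4: "5 / 8 * \<theta> * f < sqrt 2 * sqrt \<theta> * norm (B *v W \<omega>)"
          by (simp only: real_sqrt_mult)
        have "sqrt 2 \<le> 25 / 16" by (intro real_le_lsqrt) (auto simp: power2_eq_square)
        then have "sqrt 2 * sqrt \<theta> * norm (B *v W \<omega>) \<le> 25 / 16 * sqrt \<theta> * norm (B *v W \<omega>)"
          using \<theta> by (intro mult_right_mono) auto
        with 4 have 5: "5 / 8 * \<theta> * f < 25 / 16 * sqrt \<theta> * norm (B *v W \<omega>)" by (rule less_le_trans)
        have "sqrt \<theta> * (5 / 8 * sqrt \<theta> * f) = 5 / 8 * (sqrt \<theta> * sqrt \<theta>) * f" by simp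
        also have "\<dots> = 5 / 8 * \<theta> * f" using \<theta> by simp
        also note 5
        also have "25 / 16 * sqrt \<theta> * norm (B *v W \<omega>) = sqrt \<theta> * (25 / 16 * norm (B *v W \<omega>))" by simp
        finally have "5 / 8 * sqrt \<theta> * f < 25 / 16 * norm (B *v W \<omega>)"
          by (rule mult_left_less_imp_less) (use \<theta> in simp)
        then have "r < norm (B *v W \<omega>)" unfolding r_def by linarith
        then show ?thesis using w by simp
      qed (use w in auto)
    qed
    moreover have Em: "?E1 \<in> events" "?E2 \<in> events" by (intro Xm; measurable)+
    moreover have Em3: "?E3 \<in> events" by (intro XWm; measurable)
    ultimately have "prob ?E \<le> prob (?E1 \<union> ?E2 \<union> ?E3)" by (intro finite_measure_mono sets.Un)
    also have "\<dots> \<le> prob (?E1 \<union> ?E2) + prob ?E3" using Em Em3 by (intro measure_Un_le sets.Un)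
    also have "\<dots> \<le> prob ?E1 + prob ?E2 + prob ?E3"
      using Em by (intro add_right_mono measure_Un_le)
    also have "prob ?E1 = gtail A h" unfolding gtail_def by (rule PX) measurable
    also have "prob ?E2 = measure (gauss 1) {v::real^'n. R * f < norm v}" by (rule PX) measurable
    also have "prob ?E3 = gtail A f * gtail B r"
    proof -
      have Sm: "{v. f < norm (A *v v)} \<in> sets borel" "{v. r < norm (B *v v)} \<in> sets borel" by measurable
      have "prob ?E3 = prob ((\<lambda>\<omega>. (X \<omega>, W \<omega>)) -` ({v. f < norm (A *v v)} \<times> {v. r < norm (B *v v)}) \<inter> space M)"
        by (intro arg_cong[where f=prob]) auto
      also have "\<dots> = prob (X -` {v. f < norm (A *v v)} \<inter> space M) * prob (W -` {v. r < norm (B *v v)} \<inter> space M)"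
        by (rule indep_varD[OF ind Sm])
      also have "X -` {v. f < norm (A *v v)} \<inter> space M = {\<omega>\<in>space M. X \<omega> \<in> {v. f < norm (A *v v)}}" by auto
      also have "W -` {v. r < norm (B *v v)} \<inter> space M = {\<omega>\<in>space M. W \<omega> \<in> {v. r < norm (B *v v)}}" by auto
      finally show ?thesis unfolding PX[OF Sm(1)] PW[OF Sm(2)] gtail_def .
    qed
    finally have bound: "prob ?E \<le> gtail A h + measure (gauss 1) {v::real^'n. R * f < norm v} + gtail A f * gtail B r" .
    let ?e = "exp (- c * \<theta> * f\<^sup>2)"
    have b1: "gtail A h \<le> C2 * 2 ^ CARD('n) * ?e * gtail A f"
    proof -
      have "gtail A h \<le> C2 * (h / f) ^ CARD('n) * exp (- (h\<^sup>2 - f\<^sup>2) / (2 * ?s\<^sup>2)) * gtail A f"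
        using A' s f f0 \<theta> by (intro C2(2)) (auto simp: h_def)
      also have "\<dots> \<le> C2 * 2 ^ CARD('n) * ?e * gtail A f"
      proof (intro mult_right_mono mult_mono power_mono)
        show "h / f \<le> 2" using f0 \<theta> by (simp add: h_def)
        have "c * \<theta> * f\<^sup>2 \<le> (1 / (25 * s1\<^sup>2)) * \<theta> * f\<^sup>2" using \<theta> by (intro mult_right_mono) (auto simp: c_def)
        also have "\<dots> \<le> (\<theta> * f\<^sup>2 / 2) / (2 * s1\<^sup>2)" using \<theta> s1 by (simp add: field_simps)
        also have "\<dots> \<le> (\<theta> * f\<^sup>2 / 2) / (2 * ?s\<^sup>2)" using \<theta> A' s by (intro divide_left_mono mult_left_mono power_mono mult_pos_pos) auto
        also have "\<dots> \<le> (h\<^sup>2 - f\<^sup>2) / (2 * ?s\<^sup>2)"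
        proof (intro divide_right_mono)
          have "h\<^sup>2 - f\<^sup>2 = \<theta> * f\<^sup>2 / 2 + f\<^sup>2 * \<theta>\<^sup>2 / 16" by (simp add: h_def power2_eq_square field_simps)
          then show "\<theta> * f\<^sup>2 / 2 \<le> h\<^sup>2 - f\<^sup>2" by simp
        qed simp
        finally show "exp (- (h\<^sup>2 - f\<^sup>2) / (2 * ?s\<^sup>2)) \<le> ?e"
          unfolding exp_le_cancel_iff minus_divide_left[symmetric] mult_minus_left by linarith
      qed (use C2(1) f0 \<theta> gtail_nonneg in \<open>auto simp: h_def\<close>)
      finally show ?thesis .
    qed
    have b2: "measure (gauss 1) {v::real^'n. R * f < norm v} \<le> C1 * ?e * gtail A f"
    proof -
      have "c * \<theta> \<le> 1 * 1" using \<theta> c0 by (intro mult_mono) (auto simp: c_def)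
      then have "c * \<theta> * f\<^sup>2 \<le> 1 * f\<^sup>2" by (intro mult_right_mono) auto
      then have "C1 * exp (- 1 * f\<^sup>2) * gtail A f \<le> C1 * ?e * gtail A f"
        using R gtail_nonneg by (intro mult_right_mono mult_left_mono) auto
      then show ?thesis using R(3)[OF A f(1)] by linarith
    qed
    have b3: "gtail A f * gtail B r \<le> gtail A f * (C3 * ?e)"
    proof (intro mult_left_mono gtail_nonneg)
      have "gtail B r \<le> C3 * exp (- r\<^sup>2 / (4 * s1\<^sup>2))" by (rule C3(2)[OF B' r0])
      also have "\<dots> \<le> C3 * ?e"
      proof -
        have "r\<^sup>2 / (4 * s1\<^sup>2) = (1 / (25 * s1\<^sup>2)) * \<theta> * f\<^sup>2" using \<theta> by (simp add: r_def power_mult_distrib power2_eq_square)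
        moreover have "c * \<theta> * f\<^sup>2 \<le> (1 / (25 * s1\<^sup>2)) * \<theta> * f\<^sup>2" using \<theta> by (intro mult_right_mono) (auto simp: c_def)
        ultimately have "exp (- (r\<^sup>2 / (4 * s1\<^sup>2))) \<le> ?e" by simp
        then show ?thesis using C3(1) by simp
      qed
      finally show "gtail B r \<le> C3 * ?e" .
    qed
    from bound b1 b2 b3 have "prob ?E \<le> C * gtail A f * ?e" by (simp add: C_def algebra_simps)
    then show ?thesis by (simp add: \<theta>_def)
  qed
  moreover have "1 \<le> C" using R(2) C2(1) C3(1) by (simp add: C_def add_increasing2)
  ultimately show ?thesis using c0 by blast
qed

text \<open>The common part \<open>\<rho> B X\<close> has norm at most \<open>K / g\<close>, up to a negligible event. Dropping it lowers \<open>g\<^sup>2\<close> by a bounded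
  amount, and the remaining events are independent.\<close>

lemma (in prob_space) gauss_far_pair:
  assumes s: "0 < s0" "s0 \<le> s1"
  shows "\<exists>C\<ge>1. \<exists>t0\<ge>s1. \<forall>A\<in>(spectral_class s0 s1 :: (real^'n^'n) set). \<forall>B\<in>spectral_class s0 s1. \<forall>f\<ge>t0. \<forall>g\<ge>f. \<forall>\<rho> X W.
     0 \<le> \<rho> \<longrightarrow> \<rho> < 1 \<longrightarrow> \<rho> * g\<^sup>2 \<le> 1 \<longrightarrow>
     indep_var borel X borel W \<longrightarrow> distr M borel X = gauss 1 \<longrightarrow> distr M borel W = gauss 1 \<longrightarrow>
     prob {\<omega>\<in>space M. f < norm (A *v X \<omega>) \<and> g < norm (B *v (\<rho> *\<^sub>R X \<omega> + sqrt (1 - \<rho>\<^sup>2) *\<^sub>R W \<omega>))}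
       \<le> C * gtail A f * gtail B g"
proof -
  define k where "k = 1 / (2 * s0\<^sup>2) + 1"
  have k0: "0 \<le> k" by (simp add: k_def)
  obtain c where c: "c > 0" "\<And>A::real^'n^'n. \<And>t. A \<in> spectral_class s0 s1 \<Longrightarrow> t \<ge> s1 \<Longrightarrow> c * exp (- k * t\<^sup>2) \<le> gtail A t"
    using gtail_lower_bound_class[OF s, where 'n='n] unfolding k_def by blast
  obtain R C1 where R: "R \<ge> 1" "C1 \<ge> 1" "\<And>A::real^'n^'n. \<And>t. A \<in> spectral_class s0 s1 \<Longrightarrow> t \<ge> s1 \<Longrightarrow>
      measure (gauss 1 :: (real^'n) measure) {v. R * t < norm v} \<le> C1 * exp (- k * t\<^sup>2) * gtail A t"
    using gauss_norm_tail_negligible[OF s k0, where 'n='n] by blast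
  have s1: "s1 > 0" using s by linarith
  define K where "K = s1 * R"
  have K0: "0 \<le> K" "0 \<le> 2 * K" using s1 R by (auto simp: K_def)
  obtain C2 t1 where C2: "C2 \<ge> 1" "t1 \<ge> s1" "\<And>A::real^'n^'n. \<And>t. A \<in> spectral_class s0 s1 \<Longrightarrow> t \<ge> t1 \<Longrightarrow>
     measure (gauss 1 :: (real^'n) measure) {v. t\<^sup>2 - 2 * K < (norm (A *v v))\<^sup>2 + (2 * K / t\<^sup>2) * (norm v)\<^sup>2} \<le> C2 * gtail A t"
    using gtail_stable[OF s K0(2), where 'n='n] by blast
  define t0 where "t0 = max t1 (sqrt K)"
  define C where "C = C1 / c + C2"
  have "prob {\<omega>\<in>space M. f < norm (A *v X \<omega>) \<and> g < norm (B *v (\<rho> *\<^sub>R X \<omega> + sqrt (1 - \<rho>\<^sup>2) *\<^sub>R W \<omega>))}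
       \<le> C * gtail A f * gtail B g"
    if A: "A \<in> spectral_class s0 s1" and B: "B \<in> spectral_class s0 s1" and f: "f \<ge> t0" "g \<ge> f"
      and \<rho>: "0 \<le> \<rho>" "\<rho> < 1" "\<rho> * g\<^sup>2 \<le> 1"
      and ind: "indep_var borel X borel W" and dX: "distr M borel X = gauss 1" and dW: "distr M borel W = gauss 1"
    for A B :: "real^'n^'n" and f g \<rho> X W
  proof -
    have B': "sym_nonneg_definite B" "eigenvalue B 1 \<le> s1" using B by (auto simp: spectral_class_def)
    have rv [measurable]: "X \<in> borel_measurable M" "W \<in> borel_measurable M"
      using indep_var_rv1[OF ind] indep_var_rv2[OF ind] by auto
    have g: "g \<ge> t1" "g \<ge> sqrt K" "g \<ge> s1" "g > 0" "f \<ge> s1" using f C2(2) s1 by (auto simp: t0_def)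
    have "(sqrt K)\<^sup>2 \<le> g\<^sup>2" using g K0 by (intro power_mono) auto
    then have gK: "K \<le> g\<^sup>2" using K0 by simp
    have PX: "prob {\<omega>\<in>space M. X \<omega> \<in> S} = measure (gauss 1) S" if "S \<in> sets borel" for S
      using measure_distr[of X M borel S] that unfolding dX by (simp add: vimage_def Int_def conj_commute)
    have PW: "prob {\<omega>\<in>space M. W \<omega> \<in> S} = measure (gauss 1) S" if "S \<in> sets borel" for S
      using measure_distr[of W M borel S] that unfolding dW by (simp add: vimage_def Int_def conj_commute)
    have Xm: "{\<omega>\<in>space M. X \<omega> \<in> S} \<in> events" if "S \<in> sets borel" for S
    proof -
      have "{\<omega>\<in>space M. X \<omega> \<in> S} = X -` S \<inter> space M" by auto
      then show ?thesis using measurable_sets[OF rv(1) that] by simp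
    qed
    have XWm: "{\<omega>\<in>space M. X \<omega> \<in> S \<and> W \<omega> \<in> S'} \<in> events" if "S \<in> sets borel" "S' \<in> sets borel" for S S'
    proof -
      have "{\<omega>\<in>space M. X \<omega> \<in> S \<and> W \<omega> \<in> S'} = (X -` S \<inter> space M) \<inter> (W -` S' \<inter> space M)" by auto
      then show ?thesis using measurable_sets[OF rv(1) that(1)] measurable_sets[OF rv(2) that(2)] by simp
    qed
    let ?Q = "{v. g\<^sup>2 - 2 * K < (norm (B *v v))\<^sup>2 + (2 * K / g\<^sup>2) * (norm v)\<^sup>2}"
    let ?E2 = "{\<omega>\<in>space M. X \<omega> \<in> {v. R * g < norm v}}"
    let ?E3 = "{\<omega>\<in>space M. X \<omega> \<in> {v. f < norm (A *v v)} \<and> W \<omega> \<in> ?Q}"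
    let ?E = "{\<omega>\<in>space M. f < norm (A *v X \<omega>) \<and> g < norm (B *v (\<rho> *\<^sub>R X \<omega> + sqrt (1 - \<rho>\<^sup>2) *\<^sub>R W \<omega>))}"
    have "?E \<subseteq> ?E2 \<union> ?E3"
    proof
      fix \<omega> assume w: "\<omega> \<in> ?E"
      show "\<omega> \<in> ?E2 \<union> ?E3"
      proof (cases "R * g < norm (X \<omega>)")
        case False
        let ?c = "sqrt (1 - \<rho>\<^sup>2)"
        have cn: "0 \<le> 1 - \<rho>\<^sup>2" using \<rho> by (simp add: power_le_one)
        have "norm (B *v X \<omega>) \<le> eigenvalue B 1 * norm (X \<omega>)" by (rule norm_matrix_le_top_eigenvalue[OF B'(1)])
        also have "\<dots> \<le> s1 * (R * g)" using False B' s1 by (intro mult_mono) auto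
        finally have "\<rho> * norm (B *v X \<omega>) \<le> \<rho> * (K * g)" using \<rho> by (intro mult_left_mono) (auto simp: K_def)
        also have "\<dots> = (K / g) * (\<rho> * g\<^sup>2)" using g by (simp add: power2_eq_square)
        also have "\<dots> \<le> (K / g) * 1" using \<rho> K0 g by (intro mult_left_mono) auto
        finally have 1: "\<rho> * norm (B *v X \<omega>) \<le> K / g" by simp
        have "norm (B *v (\<rho> *\<^sub>R X \<omega> + ?c *\<^sub>R W \<omega>)) \<le> norm (\<rho> *\<^sub>R (B *v X \<omega>)) + norm (?c *\<^sub>R (B *v W \<omega>))"
          unfolding matrix_vector_right_distrib matrix_vector_mult_scaleR by (rule norm_triangle_ineq)
        also have "\<dots> = \<rho> * norm (B *v X \<omega>) + ?c * norm (B *v W \<omega>)" using \<rho> cn by simp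
        also have "\<dots> \<le> K / g + 1 * norm (B *v W \<omega>)" using 1 by (intro add_mono mult_right_mono) auto
        finally have n: "norm (B *v (\<rho> *\<^sub>R X \<omega> + ?c *\<^sub>R W \<omega>)) \<le> K / g + 1 * norm (B *v W \<omega>)" .
        have "g < norm (B *v (\<rho> *\<^sub>R X \<omega> + ?c *\<^sub>R W \<omega>))" using w by simp
        with n have 2: "g - K / g < norm (B *v W \<omega>)" by linarith
        have "0 \<le> g - K / g" using gK g by (simp add: field_simps power2_eq_square)
        with 2 have "(g - K / g)\<^sup>2 < (norm (B *v W \<omega>))\<^sup>2" by (intro power_strict_mono) auto
        moreover have "(g - K / g)\<^sup>2 = g\<^sup>2 - 2 * K + (K / g)\<^sup>2" using g by (simp add: power2_eq_square field_simps)
        ultimately have "g\<^sup>2 - 2 * K < (norm (B *v W \<omega>))\<^sup>2" using zero_le_power2[of "K / g"] by linarith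
        moreover have "0 \<le> (2 * K / g\<^sup>2) * (norm (W \<omega>))\<^sup>2" using K0 by simp
        ultimately have "W \<omega> \<in> ?Q" unfolding mem_Collect_eq by linarith
        then show ?thesis using w by simp
      qed (use w in auto)
    qed
    moreover have Em: "?E2 \<in> events" by (intro Xm; measurable)
    moreover have Em3: "?E3 \<in> events" by (intro XWm; measurable)
    ultimately have "prob ?E \<le> prob (?E2 \<union> ?E3)" by (intro finite_measure_mono sets.Un)
    also have "\<dots> \<le> prob ?E2 + prob ?E3" using Em Em3 by (intro measure_Un_le)
    also have "prob ?E2 = measure (gauss 1) {v::real^'n. R * g < norm v}" by (rule PX) measurable
    also have "prob ?E3 = gtail A f * measure (gauss 1) ?Q"
    proof -
      have Qm: "?Q \<in> sets borel" by measurable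
      have "prob ?E3 = prob ((\<lambda>\<omega>. (X \<omega>, W \<omega>)) -` ({v. f < norm (A *v v)} \<times> ?Q) \<inter> space M)"
        by (intro arg_cong[where f=prob]) auto
      also have "\<dots> = prob (X -` {v. f < norm (A *v v)} \<inter> space M) * prob (W -` ?Q \<inter> space M)"
        by (rule indep_varD[OF ind _ Qm]) measurable
      also have "X -` {v. f < norm (A *v v)} \<inter> space M = {\<omega>\<in>space M. X \<omega> \<in> {v. f < norm (A *v v)}}" by auto
      also have "W -` ?Q \<inter> space M = {\<omega>\<in>space M. W \<omega> \<in> ?Q}" by auto
      also have "prob \<dots> = measure (gauss 1) ?Q" by (rule PW[OF Qm])
      also have "prob {\<omega>\<in>space M. X \<omega> \<in> {v. f < norm (A *v v)}} = gtail A f" unfolding gtail_def by (rule PX) measurable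
      finally show ?thesis .
    qed
    also have "gtail A f * measure (gauss 1) ?Q \<le> gtail A f * (C2 * gtail B g)"
      using C2(3)[OF B g(1)] by (intro mult_left_mono gtail_nonneg)
    \<comment> \<open>\<open>R\<close> was chosen so large that this term still contains the factor \<open>gtail A f\<close>\<close>
    also have "measure (gauss 1) {v::real^'n. R * g < norm v} \<le> C1 * exp (- k * g\<^sup>2) * gtail B g" by (rule R(3)[OF B g(3)])
    also have "\<dots> \<le> C1 * (gtail A f / c) * gtail B g"
    proof (intro mult_right_mono mult_left_mono gtail_nonneg)
      have "c * exp (- k * g\<^sup>2) \<le> gtail A g" by (rule c(2)[OF A g(3)])
      also have "\<dots> \<le> gtail A f" by (rule gtail_antimono[OF f(2)])
      finally show "exp (- k * g\<^sup>2) \<le> gtail A f / c" using c(1) by (simp add: field_simps)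
    qed (use R in simp)
    finally show ?thesis by (simp add: C_def algebra_simps)
  qed
  moreover have "C \<ge> 1" using R(2) C2(1) c(1) by (simp add: C_def add_increasing)
  moreover have "t0 \<ge> s1" using C2(2) by (simp add: t0_def)
  ultimately show ?thesis by blast
qed

section \<open>Block indices\<close>

text \<open>The indices \<open>n\<^sub>k\<close> for \<open>\<alpha> = 1\<close>. The ratio \<open>n\<^sub>k / n\<^sub>k\<^sub>+\<^sub>1\<close> differs from 1 by the order of \<open>1 / ln k\<close>, the reciprocal of the order of
  \<open>\<phi>\<^sup>2\<close>: blocks are short enough not to change the tail, and long enough to give neighbouring exceedances
  some independence.\<close>

abbreviation bi :: "nat \<Rightarrow> nat" where "bi \<equiv> block_index 1"

lemma L_eq_ln: "exp 1 \<le> t \<Longrightarrow> L t = ln t" by (simp add: L_def max_def)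

lemma L_nat: "3 \<le> k \<Longrightarrow> L (real k) = ln (real k)"
proof (rule L_eq_ln)
  assume "3 \<le> k"
  have "exp 1 \<le> (3::real)" by (rule exp_le)
  also have "\<dots> \<le> real k" using \<open>3 \<le> k\<close> by simp
  finally show "exp 1 \<le> real k" .
qed

lemma L_ge_1: "1 \<le> L t"
proof -
  have "ln (exp 1) \<le> ln (max t (exp 1))" by (subst ln_le_cancel_iff) (auto simp: less_max_iff_disj)
  then show ?thesis by (simp add: L_def)
qed

lemma L_mono: "s \<le> t \<Longrightarrow> L s \<le> L t"
  unfolding L_def by (subst ln_le_cancel_iff) (auto simp: less_max_iff_disj)

text \<open>The increments of \<open>k / ln k\<close> lie between \<open>1 / (2 ln k)\<close> and \<open>1 / ln k\<close>, by \<open>ln (k / j) \<le> k / j - 1\<close> and \<open>ln j \<ge> 2\<close>.\<close>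

lemma div_ln_diff_bounds:
  assumes "8 \<le> j" "j \<le> k"
  shows "(real k - real j) / (2 * ln k) \<le> k / ln k - j / ln j"
    and "k / ln k - j / ln j \<le> (real k - real j) / ln k"
proof -
  have j: "real j > 0" "real k > 0" using assms by auto
  have "exp 2 \<le> (8::real)"
  proof -
    have "exp (2::real) = exp 1 * exp 1" by (simp add: exp_add[symmetric])
    also have "\<dots> \<le> (2.75::real) * 2.75"
      using e_less_272 by (intro mult_mono) auto
    finally show ?thesis by simp
  qed
  also have "\<dots> \<le> j" using assms by simp
  finally have lj: "2 \<le> ln j" using j by (simp add: ln_ge_iff)
  have lk: "ln j \<le> ln k" using assms j by simp
  have id: "k / ln k - j / ln j = (real k - real j) / ln k - j * (ln k - ln j) / (ln j * ln k)"
    using lj lk by (simp add: field_simps)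
  have "ln k - ln j = ln (k / j)" using j by (simp add: ln_div)
  also have "\<dots> \<le> k / j - 1" using j by (intro ln_le_minus_one) simp
  finally have "j * (ln k - ln j) \<le> j * (k / j - 1)" using j by (intro mult_left_mono) auto
  also have "\<dots> = real k - real j" using j by (simp add: algebra_simps)
  finally have "j * (ln k - ln j) / (ln j * ln k) \<le> (real k - real j) / (2 * ln k)"
    using lj lk assms by (intro frac_le mult_right_mono) auto
  moreover have "(real k - real j) / ln k - (real k - real j) / (2 * ln k) = (real k - real j) / (2 * ln k)"
    using lj lk by (simp add: field_simps)
  ultimately show "(real k - real j) / (2 * ln k) \<le> k / ln k - j / ln j" unfolding id by linarith
  have "0 \<le> j * (ln k - ln j) / (ln j * ln k)" using lj lk by (intro divide_nonneg_nonneg mult_nonneg_nonneg) auto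
  then show "k / ln k - j / ln j \<le> (real k - real j) / ln k" unfolding id by linarith
qed

lemma bi_bounds:
  assumes "3 \<le> k"
  shows "real (bi k) \<le> exp (k / ln k)" "exp (k / ln k) < real (bi k) + 1" "1 \<le> bi k"
proof -
  have b: "bi k = nat \<lfloor>exp (k / ln k)\<rfloor>" using assms by (simp add: block_index_def L_nat)
  have "0 \<le> k / ln k" using assms by simp
  then have e1: "1 \<le> exp (k / ln k)" by simp
  then have f: "1 \<le> \<lfloor>exp (k / ln k)\<rfloor>" by (simp add: le_floor_iff)
  have r: "real (bi k) = of_int \<lfloor>exp (k / ln k)\<rfloor>" unfolding b using f by simp
  show "real (bi k) \<le> exp (k / ln k)" unfolding r by (rule of_int_floor_le)
  show "exp (k / ln k) < real (bi k) + 1" unfolding r by (rule floor_correct[THEN conjunct2, unfolded of_int_add of_int_1])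
  show "1 \<le> bi k" unfolding b using f by (simp add: nat_le_iff le_nat_iff)
qed

lemma bi_mono:
  assumes "8 \<le> j" "j \<le> k" shows "bi j \<le> bi k"
proof -
  have "0 \<le> (real k - real j) / (2 * ln k)" using assms by simp
  then have "j / ln j \<le> k / ln k" using div_ln_diff_bounds(1)[OF assms] by linarith
  then show ?thesis unfolding block_index_def using assms by (intro nat_mono floor_mono) (simp add: L_nat)
qed

lemma ratio_minus_one_le_exp: "1 < e \<Longrightarrow> e / (e - 1) \<le> exp (1 / (e - 1))" for e :: real
proof -
  assume "1 < e"
  then have "e / (e - 1) = 1 + 1 / (e - 1)" by (simp add: field_simps)
  then show ?thesis by (metis exp_ge_add_one_self)
qed

lemma bi_ratio_upper:
  "\<forall>\<^sub>F k in sequentially. \<forall>j. 8 \<le> j \<longrightarrow> j < k \<longrightarrow> real (bi j) / real (bi k) \<le> exp (- (real k - real j) / (4 * ln k))"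
proof -
  have "\<forall>\<^sub>F k in sequentially. 4 * ln (real k) + 1 \<le> exp (real k / ln (real k))" by real_asymp
  with eventually_ge_at_top[of 9] show ?thesis
  proof eventually_elim
    case (elim k)
    show ?case
    proof (intro allI impI)
      fix j assume j: "8 \<le> j" "j < k"
      have lk: "ln k > 0" using elim by simp
      let ?E = "\<lambda>k::nat. exp (real k / ln (real k))"
      have bk: "?E k - 1 < real (bi k)" "0 < real (bi k)" using bi_bounds[of k] elim by auto
      have E1: "0 < ?E k - 1" "4 * ln k \<le> ?E k - 1" using elim lk by linarith+
      have "?E k / (?E k - 1) \<le> exp (1 / (?E k - 1))" using E1 by (intro ratio_minus_one_le_exp) linarith
      also have "\<dots> \<le> exp (1 / (4 * ln k))" using E1 lk by (simp add: frac_le)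
      finally have A: "?E k / (?E k - 1) \<le> exp (1 / (4 * ln k))" .
      have "real (bi j) / real (bi k) \<le> ?E j / (?E k - 1)"
        using bi_bounds[of j] j bk E1 by (intro frac_le) auto
      also have "\<dots> = exp (- (k / ln k - j / ln j)) * (?E k / (?E k - 1))"
        by (simp add: exp_diff exp_minus field_simps)
      also have "\<dots> \<le> exp (- ((real k - real j) / (2 * ln k))) * exp (1 / (4 * ln k))"
        using A div_ln_diff_bounds(1)[of j k] j E1 by (intro mult_mono) auto
      also have "\<dots> = exp (1 / (4 * ln k) - (real k - real j) / (2 * ln k))" by (simp add: exp_diff exp_minus field_simps)
      also have "\<dots> \<le> exp (- (real k - real j) / (4 * ln k))"
      proof -
        have "1 / (4 * ln k) \<le> (real k - real j) / (4 * ln k)" using j lk by (intro divide_right_mono) auto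
        moreover have "(real k - real j) / (2 * ln k) = 2 * ((real k - real j) / (4 * ln k))" using lk by (simp add: field_simps)
        ultimately have "1 / (4 * ln k) - (real k - real j) / (2 * ln k) \<le> - (real k - real j) / (4 * ln k)"
          unfolding minus_divide_left[symmetric] by linarith
        then show ?thesis by (simp only: exp_le_cancel_iff)
      qed
      finally show "real (bi j) / real (bi k) \<le> exp (- (real k - real j) / (4 * ln k))" .
    qed
  qed
qed

lemma bi_ratio_lower:
  "\<forall>\<^sub>F k in sequentially. 1 - 2 / ln (real k) \<le> real (bi k) / real (bi (Suc k))"
proof -
  have "\<forall>\<^sub>F k in sequentially. 4 * ln (real k) + 1 \<le> exp (real k / ln (real k))" by real_asymp
  with eventually_ge_at_top[of 9] show ?thesis
  proof eventually_elim
    case (elim k)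
    have lk: "ln k > 0" "ln k \<le> ln (Suc k)" using elim by auto
    let ?E = "\<lambda>k::nat. exp (real k / ln (real k))"
    have E1: "0 < ?E k - 1" "4 * ln k \<le> ?E k - 1" using elim lk by linarith+
    have "?E k / (?E k - 1) \<le> exp (1 / (?E k - 1))" using E1 by (intro ratio_minus_one_le_exp) linarith
    also have "\<dots> \<le> exp (1 / (4 * ln k))" using E1 lk by (simp add: frac_le)
    finally have A: "?E k / (?E k - 1) \<le> exp (1 / (4 * ln k))" .
    then have B: "exp (- (1 / (4 * ln k))) \<le> (?E k - 1) / ?E k" using E1 by (simp add: exp_minus field_simps)
    have "Suc k / ln (Suc k) - k / ln k \<le> (real (Suc k) - real k) / ln (Suc k)"
      using elim by (intro div_ln_diff_bounds) auto
    also have "\<dots> \<le> 1 / ln k" using lk by (simp add: frac_le)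
    finally have C: "- (1 / ln k) \<le> k / ln k - Suc k / ln (Suc k)" by linarith
    have "1 - 2 / ln k \<le> 1 + (- (1 / ln k) + - (1 / (4 * ln k)))" using lk by (simp add: field_simps)
    also have "\<dots> \<le> exp (- (1 / ln k) + - (1 / (4 * ln k)))" by (rule exp_ge_add_one_self)
    also have "\<dots> \<le> exp (k / ln k - Suc k / ln (Suc k)) * ((?E k - 1) / ?E k)"
      unfolding exp_add using B C by (intro mult_mono) auto
    also have "\<dots> = (?E k - 1) / ?E (Suc k)" using E1 by (simp add: exp_diff field_simps)
    also have "\<dots> \<le> real (bi k) / real (bi (Suc k))"
      using bi_bounds[of k] bi_bounds[of "Suc k"] elim by (intro frac_le) auto
    finally show ?case .
  qed
qed

lemma one_minus_exp_neg: "0 \<le> z \<Longrightarrow> min 1 z / 2 \<le> 1 - exp (- z)" for z :: real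
proof -
  assume z: "0 \<le> z"
  define m where "m = min 1 z"
  have m: "0 \<le> m" "m \<le> 1" "m \<le> z" using z by (auto simp: m_def)
  have "exp (- z) \<le> exp (- m)" using m by simp
  also have "\<dots> = 1 / exp m" by (simp add: exp_minus field_simps)
  also have "\<dots> \<le> 1 / (1 + m)" using m by (intro divide_left_mono mult_pos_pos exp_ge_add_one_self) auto
  also have "\<dots> \<le> 1 - m / 2"
  proof -
    have "m * m \<le> 1 * m" using m by (intro mult_right_mono) auto
    then have "1 \<le> (1 - m / 2) * (1 + m)" by (simp add: algebra_simps)
    then show ?thesis using m by (simp add: divide_le_eq)
  qed
  finally show ?thesis unfolding m_def by linarith
qed

lemma bi_gap:
  "\<forall>\<^sub>F k in sequentially. real (bi (Suc k)) / (32 * ln k) \<le> real (bi (Suc k)) - real (bi k)"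
proof -
  have "\<forall>\<^sub>F k in sequentially. \<forall>j. 8 \<le> j \<longrightarrow> j < Suc k \<longrightarrow> real (bi j) / real (bi (Suc k)) \<le> exp (- (real (Suc k) - real j) / (4 * ln (Suc k)))"
    by (rule eventually_sequentially_Suc[THEN iffD2, OF bi_ratio_upper])
  moreover have "\<forall>\<^sub>F k in sequentially. ln (real (Suc k)) \<le> 2 * ln (real k)" by real_asymp
  ultimately show ?thesis using eventually_ge_at_top[of 9]
  proof eventually_elim
    case (elim k)
    have b: "0 < real (bi (Suc k))" using bi_bounds[of "Suc k"] elim by simp
    have l: "1 \<le> ln (Suc k)" "1 \<le> ln k" using L_ge_1[of "real (Suc k)"] L_ge_1[of "real k"] L_nat[of k] L_nat[of "Suc k"] elim by auto
    let ?z = "1 / (4 * ln (Suc k))"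
    have z: "0 \<le> ?z" using l by simp
    have z1: "?z \<le> 1" using l by (subst divide_le_eq_1_pos) linarith+
    have "1 / (32 * ln k) \<le> ?z / 2"
    proof -
      have "1 / (32 * ln k) \<le> 1 / (8 * ln (Suc k))" using elim l by (intro divide_left_mono mult_pos_pos) auto
      then show ?thesis by simp
    qed
    also have "\<dots> = min 1 ?z / 2" using z1 by simp
    also have "\<dots> \<le> 1 - exp (- ?z)" by (rule one_minus_exp_neg[OF z])
    finally have "1 / (32 * ln k) \<le> 1 - real (bi k) / real (bi (Suc k))" using elim(1)[rule_format, of k] elim(3) by simp
    then have "1 / (32 * ln k) * real (bi (Suc k)) \<le> (1 - real (bi k) / real (bi (Suc k))) * real (bi (Suc k))"
      using b by (intro mult_right_mono) auto
    then show ?case using b by (simp add: left_diff_distrib)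
  qed
qed

definition iter_log :: "nat \<Rightarrow> real" where "iter_log n = L (L (real n))"

lemma iter_log_ge_1: "1 \<le> iter_log n" and iter_log_mono: "m \<le> n \<Longrightarrow> iter_log m \<le> iter_log n"
  by (auto simp: iter_log_def L_ge_1 intro!: L_mono)

lemma iter_log_eq: "\<forall>\<^sub>F n in sequentially. iter_log n = ln (ln (real n))"
proof -
  have "\<forall>\<^sub>F n in sequentially. exp 1 \<le> ln (real n)" "\<forall>\<^sub>F n in sequentially. exp 1 \<le> real n" by real_asymp+
  then show ?thesis by eventually_elim (simp add: iter_log_def L_eq_ln)
qed

lemma bi_at_top: "filterlim bi at_top sequentially"
proof -
  have "filterlim (\<lambda>k. exp (real k / ln (real k)) - 1) at_top sequentially" by real_asymp
  moreover have "\<forall>\<^sub>F k in sequentially. exp (real k / ln (real k)) - 1 \<le> real (bi k)"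
    using eventually_ge_at_top[of 3] by eventually_elim (use bi_bounds in \<open>simp add: less_imp_le algebra_simps\<close>)
  ultimately have "filterlim (\<lambda>k. real (bi k)) at_top sequentially" by (rule filterlim_at_top_mono)
  then show ?thesis by (simp add: filterlim_sequentially_iff_filterlim_real)
qed

lemma iter_log_block:
  "\<forall>\<^sub>F k in sequentially. \<forall>n. bi k \<le> n \<longrightarrow> n \<le> bi (Suc k) \<longrightarrow> ln (real k) / 2 \<le> iter_log n \<and> iter_log n \<le> ln (real k)"
proof -
  have "\<forall>\<^sub>F k in sequentially. \<forall>n\<ge>k. iter_log n = ln (ln (real n))"
    using iter_log_eq by (rule eventually_all_ge_at_top)
  moreover have "\<forall>\<^sub>F n in sequentially. \<forall>m\<ge>n. exp 1 \<le> ln (real m)"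
    by (rule eventually_all_ge_at_top) real_asymp
  ultimately have "\<forall>\<^sub>F k in sequentially. \<forall>n\<ge>k. iter_log n = ln (ln (real n)) \<and> exp 1 \<le> ln (real n)"
    by eventually_elim auto
  then have 1: "\<forall>\<^sub>F k in sequentially. \<forall>n\<ge>bi k. iter_log n = ln (ln (real n)) \<and> exp 1 \<le> ln (real n)"
    using bi_at_top by (rule eventually_compose_filterlim)
  have 2: "\<forall>\<^sub>F k in sequentially. exp (sqrt (real k)) \<le> exp (real k / ln (real k)) - 1" by real_asymp
  have 3: "\<forall>\<^sub>F k in sequentially. real (Suc k) / ln (real (Suc k)) \<le> real k" by real_asymp
  show ?thesis using 1 2 3 eventually_ge_at_top[of 3]
  proof eventually_elim
    case (elim k)
    show ?case
    proof (intro allI impI)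
      fix n assume n: "bi k \<le> n" "n \<le> bi (Suc k)"
      have il: "iter_log n = ln (ln (real n))" "exp 1 \<le> ln (real n)" using elim n by auto
      have k0: "real k > 0" using elim by simp
      have l0: "0 < ln (real n)" using il(2) exp_gt_zero[of "1::real"] by linarith
      have n0: "0 < real n" using bi_bounds[of k] elim n by simp
      have "exp (sqrt (real k)) \<le> real n" using elim bi_bounds(2)[of k] n by linarith
      then have "sqrt (real k) \<le> ln (real n)" using n0 by (simp add: ln_ge_iff)
      then have "ln (sqrt (real k)) \<le> ln (ln (real n))" using k0 l0 by (subst ln_le_cancel_iff) auto
      then have lo: "ln (real k) / 2 \<le> iter_log n" using k0 il by (simp add: ln_sqrt)
      have "real n \<le> exp (Suc k / ln (Suc k))" using bi_bounds(1)[of "Suc k"] n elim(4) by linarith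
      then have "ln (real n) \<le> Suc k / ln (Suc k)" using n0 by (metis ln_exp ln_le_cancel_iff exp_gt_zero)
      then have "ln (real n) \<le> real k" using elim by linarith
      then have "ln (ln (real n)) \<le> ln (real k)" using l0 k0 by simp
      then show "ln (real k) / 2 \<le> iter_log n \<and> iter_log n \<le> ln (real k)" using lo il by simp
    qed
  qed
qed

section \<open>Thin sets of blocks\<close>

text \<open>Whatever happens on a thin set of blocks is irrelevant, because the probabilities involved are at
  most a negative power of \<open>k\<close>.\<close>

definition thin :: "nat set \<Rightarrow> bool" where
  "thin B \<longleftrightarrow> (\<forall>\<delta>>0. summable (\<lambda>k. if k \<in> B then real k powr (- \<delta>) else 0))"

text \<open>Half of the exponent pays for the factor \<open>ln k\<close> from Markov's inequality.\<close>

lemma thin_large_values: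
  assumes s: "\<And>\<delta>. \<delta> > 0 \<Longrightarrow> (\<lambda>k. real k powr (- \<delta>) * f k) summable_on {1..}" and f: "\<And>k. 8 \<le> k \<Longrightarrow> f k \<ge> 0" and \<epsilon>: "\<epsilon> > 0"
  shows "thin {k. \<epsilon> / ln (real k) < f k}"
  unfolding thin_def
proof (intro allI impI)
  fix \<delta> :: real assume \<delta>: "\<delta> > 0"
  have "(\<lambda>k. real k powr (- (\<delta> / 2)) * f k) summable_on {1..}" using \<delta> by (intro s) simp
  then have "(\<lambda>k. real k powr (- (\<delta> / 2)) * f k) summable_on UNIV"
    by (rule summable_on_cong_neutral[THEN iffD1, rotated -1]) (auto simp: not_le)
  then have sm: "summable (\<lambda>k. real k powr (- (\<delta> / 2)) * f k)" by (rule summable_on_imp_summable)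
  have sm': "summable (\<lambda>k. (real k powr (- (\<delta> / 2)) * f k) / \<epsilon>)" by (rule summable_divide[OF sm])
  have "\<forall>\<^sub>F k in sequentially. real k powr (- \<delta>) * ln (real k) \<le> real k powr (- (\<delta> / 2))" using \<delta> by real_asymp
  then have "\<forall>\<^sub>F k in sequentially. norm (if k \<in> {k. \<epsilon> / ln (real k) < f k} then real k powr (- \<delta>) else 0)
      \<le> (real k powr (- (\<delta> / 2)) * f k) / \<epsilon>"
    using eventually_ge_at_top[of 8]
  proof eventually_elim
    case (elim k)
    show ?case
    proof (cases "\<epsilon> / ln (real k) < f k")
      case True
      have l: "0 < ln (real k)" using elim by simp
      then have "1 \<le> ln (real k) * f k / \<epsilon>" using True \<epsilon> by (simp add: field_simps)
      then have "real k powr (- \<delta>) * 1 \<le> real k powr (- \<delta>) * (ln (real k) * f k / \<epsilon>)" by (intro mult_left_mono) auto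
      also have "\<dots> = (real k powr (- \<delta>) * ln (real k)) * (f k / \<epsilon>)" by simp
      also have "\<dots> \<le> real k powr (- (\<delta> / 2)) * (f k / \<epsilon>)" using elim(1) f[OF elim(2)] \<epsilon> by (intro mult_right_mono) auto
      finally show ?thesis using True by simp
    next
      case False
      then show ?thesis using f[OF elim(2)] \<epsilon> by simp
    qed
  qed
  then show "summable (\<lambda>k. if k \<in> {k. \<epsilon> / ln (real k) < f k} then real k powr (- \<delta>) else 0)"
    by (rule summable_comparison_test_ev[OF _ sm'])
qed

text \<open>Pairs of nearby times are estimated by passing from one block to the next, which requires all blocks
  in between to have small oscillation; this excludes the starting blocks \<open>j\<close> collected here.\<close>

definition before :: "nat set \<Rightarrow> nat set" where
  "before B = {j. \<exists>i\<ge>j. i \<in> B \<and> real i \<le> real j + 4 * (ln (real j))\<^sup>2}"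

text \<open>Each \<open>j\<close> is charged to a member \<open>i = j + s\<close> of \<open>B\<close> with weight \<open>1 / (1 + s)\<^sup>2\<close>. The weights are summable over \<open>s\<close>, and
  the loss of a power of \<open>ln j\<close> is absorbed by half of the exponent.\<close>

lemma thin_before:
  assumes B: "thin B" shows "thin (before B)"
  unfolding thin_def
proof (intro allI impI)
  fix \<delta> :: real assume \<delta>: "\<delta> > 0"
  define w where "w k = (if k \<in> B then real k powr (- (\<delta> / 2)) else 0)" for k
  have wn: "0 \<le> w k" for k by (simp add: w_def)
  have sw: "summable w" unfolding w_def using B \<delta> by (auto simp: thin_def)
  let ?a = "\<lambda>j. if j \<in> before B then real j powr (- \<delta>) else 0"
  have "\<forall>\<^sub>F j in sequentially. real j powr (- \<delta>) * (1 + 4 * (ln (real j))\<^sup>2)\<^sup>2 \<le> (real j + 4 * (ln (real j))\<^sup>2) powr (- (\<delta> / 2))"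
    using \<delta> by real_asymp
  then obtain j0 where j0: "j0 \<ge> 1" "\<And>j. j \<ge> j0 \<Longrightarrow> real j powr (- \<delta>) * (1 + 4 * (ln (real j))\<^sup>2)\<^sup>2 \<le> (real j + 4 * (ln (real j))\<^sup>2) powr (- (\<delta> / 2))"
    unfolding eventually_sequentially by (metis le_trans nat_le_linear)
  have sq: "summable (\<lambda>s. 1 / (1 + real s)\<^sup>2)"
  proof -
    have "summable (\<lambda>s. 1 / real s ^ 2)" using inverse_power_summable[of 2, where 'a=real] by (simp add: field_simps)
    then have "summable (\<lambda>s. 1 / real (Suc s) ^ 2)" by (subst summable_Suc_iff)
    then show ?thesis by (simp add: add.commute)
  qed
  define Q where "Q = (\<Sum>s. 1 / (1 + real s)\<^sup>2)"
  define W where "W = (\<Sum>k. w k)"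
  have key: "?a j \<le> (\<Sum>s\<le>S. w (j + s) * (1 / (1 + real s)\<^sup>2))" if j: "j \<ge> j0" and S: "real S \<ge> 4 * (ln (real j))\<^sup>2" for j S
  proof (cases "j \<in> before B")
    case True
    then obtain i where i: "i \<ge> j" "i \<in> B" "real i \<le> real j + 4 * (ln (real j))\<^sup>2" by (auto simp: before_def)
    define s where "s = i - j"
    have s: "i = j + s" "real s \<le> 4 * (ln (real j))\<^sup>2" using i by (auto simp: s_def)
    have "s \<le> S" using s(2) S by linarith
    have "real j powr (- \<delta>) * (1 + real s)\<^sup>2 \<le> real j powr (- \<delta>) * (1 + 4 * (ln (real j))\<^sup>2)\<^sup>2"
      using s by (intro mult_left_mono power_mono) auto
    also have "\<dots> \<le> (real j + 4 * (ln (real j))\<^sup>2) powr (- (\<delta> / 2))" by (rule j0(2)[OF j])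
    also have "\<dots> \<le> real i powr (- (\<delta> / 2))" using i \<delta> j j0 by (intro powr_mono2') auto
    finally have "real j powr (- \<delta>) \<le> w (j + s) * (1 / (1 + real s)\<^sup>2)"
      using i(2) s(1) by (simp add: w_def field_simps)
    also have "\<dots> \<le> (\<Sum>s\<le>S. w (j + s) * (1 / (1 + real s)\<^sup>2))"
      using \<open>s \<le> S\<close> wn by (intro member_le_sum) auto
    finally show ?thesis using True by simp
  next
    case False
    then show ?thesis using wn by (auto intro!: sum_nonneg)
  qed
  have bound: "(\<Sum>j<N. ?a (j + j0)) \<le> Q * W" for N
  proof -
    obtain S :: nat where S: "real S \<ge> 4 * (ln (real (N + j0)))\<^sup>2" using real_arch_simple by blast
    have "(\<Sum>j<N. ?a (j + j0)) \<le> (\<Sum>j<N. \<Sum>s\<le>S. w (j + j0 + s) * (1 / (1 + real s)\<^sup>2))"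
    proof (intro sum_mono key)
      fix j assume "j \<in> {..<N}"
      then have "ln (real (j + j0)) \<le> ln (real (N + j0))" "0 \<le> ln (real (j + j0))" using j0 by auto
      then have "(ln (real (j + j0)))\<^sup>2 \<le> (ln (real (N + j0)))\<^sup>2" by (intro power_mono) auto
      then show "4 * (ln (real (j + j0)))\<^sup>2 \<le> real S" using S by linarith
    qed simp
    also have "\<dots> = (\<Sum>s\<le>S. (1 / (1 + real s)\<^sup>2) * (\<Sum>j<N. w (j + j0 + s)))"
      by (subst sum.swap) (simp add: sum_divide_distrib)
    also have "\<dots> \<le> (\<Sum>s\<le>S. (1 / (1 + real s)\<^sup>2) * W)"
    proof (intro sum_mono mult_left_mono)
      fix s
      have "(\<Sum>j<N. w (j + j0 + s)) = (\<Sum>k\<in>(\<lambda>j. j + j0 + s) ` {..<N}. w k)" by (subst sum.reindex) (auto simp: inj_on_def)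
      also have "\<dots> \<le> W" unfolding W_def using sw wn by (intro sum_le_suminf) auto
      finally show "(\<Sum>j<N. w (j + j0 + s)) \<le> W" .
    qed auto
    also have "\<dots> = (\<Sum>s\<le>S. 1 / (1 + real s)\<^sup>2) * W" by (simp only: sum_distrib_right)
    also have "\<dots> \<le> Q * W" unfolding Q_def
      using sq by (intro mult_right_mono sum_le_suminf) (auto simp: W_def intro!: suminf_nonneg sw wn)
    finally show ?thesis .
  qed
  have "summable (\<lambda>j. ?a (j + j0))"
    by (rule summableI_nonneg_bounded[OF _ bound]) auto
  then show "summable ?a" by (rule summable_iff_shift[THEN iffD1])
qed

lemma thin_Un: "thin A \<Longrightarrow> thin B \<Longrightarrow> thin (A \<union> B)"
  unfolding thin_def
proof (intro allI impI)
  fix \<delta> :: real assume *: "\<forall>\<delta>>0. summable (\<lambda>k. if k \<in> A then real k powr - \<delta> else 0)"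
    "\<forall>\<delta>>0. summable (\<lambda>k. if k \<in> B then real k powr - \<delta> else 0)" "\<delta> > 0"
  then have "summable (\<lambda>k. (if k \<in> A then real k powr - \<delta> else 0) + (if k \<in> B then real k powr - \<delta> else 0))"
    by (intro summable_add) auto
  then show "summable (\<lambda>k. if k \<in> A \<union> B then real k powr - \<delta> else 0)"
    by (rule summable_comparison_test') (auto split: if_splits)
qed

lemma thin_Suc: "thin B \<Longrightarrow> thin {k. k \<ge> 1 \<and> k - 1 \<in> B}"
  unfolding thin_def
proof (intro allI impI)
  fix \<delta> :: real assume *: "\<forall>\<delta>>0. summable (\<lambda>k. if k \<in> B then real k powr - \<delta> else 0)" "\<delta> > 0"
  then have "summable (\<lambda>k. if k \<in> B then real k powr - \<delta> else 0)" by blast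
  then have "summable (\<lambda>k. if Suc k \<in> {k. k \<ge> 1 \<and> k - 1 \<in> B} then real (Suc k) powr - \<delta> else 0)"
  proof (rule summable_comparison_test_ev[rotated])
    show "\<forall>\<^sub>F k in sequentially. norm (if Suc k \<in> {k. k \<ge> 1 \<and> k - 1 \<in> B} then real (Suc k) powr - \<delta> else 0) \<le> (if k \<in> B then real k powr - \<delta> else 0)"
      using eventually_ge_at_top[of 1] by eventually_elim (use *(2) in \<open>auto intro!: powr_mono2'\<close>)
  qed
  then show "summable (\<lambda>k. if k \<in> {k. k \<ge> 1 \<and> k - 1 \<in> B} then real k powr - \<delta> else 0)"
    by (subst (asm) summable_Suc_iff)
qed

section \<open>The second moment method\<close>

text \<open>With \<open>N\<close> the number of events that occur, \<open>2 l N - l\<^sup>2 N\<^sup>2\<close> is at most the indicator of \<open>N > 0\<close>. Taking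
  expectations and the optimal \<open>l = 1 / (C S)\<close> bounds the probability of the union from below.\<close>

lemma (in prob_space) second_moment_union:
  assumes F: "finite F" and E: "\<And>k. k \<in> F \<Longrightarrow> E k \<in> events"
    and C: "0 \<le> C"
    and pair: "(\<Sum>j\<in>F. \<Sum>k\<in>F. prob (E j \<inter> E k)) \<le> C * (\<Sum>k\<in>F. prob (E k))\<^sup>2"
    and pos: "0 < (\<Sum>k\<in>F. prob (E k))"
  shows "1 \<le> C * prob (\<Union>k\<in>F. E k)"
proof -
  define S where "S = (\<Sum>k\<in>F. prob (E k))"
  define U where "U = (\<Union>k\<in>F. E k)"
  have U: "U \<in> events" unfolding U_def using F E by auto
  have Cp: "0 < C"
  proof (rule ccontr)
    assume "\<not> 0 < C"
    then have "(\<Sum>j\<in>F. \<Sum>k\<in>F. prob (E j \<inter> E k)) \<le> 0" using C pair by simp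
    moreover have "S \<le> (\<Sum>j\<in>F. \<Sum>k\<in>F. prob (E j \<inter> E k))"
      unfolding S_def
    proof (intro sum_mono)
      fix j assume "j \<in> F"
      then have "prob (E j \<inter> E j) \<le> (\<Sum>k\<in>F. prob (E j \<inter> E k))" using F by (intro member_le_sum) auto
      then show "prob (E j) \<le> (\<Sum>k\<in>F. prob (E j \<inter> E k))" by simp
    qed
    ultimately show False using pos by (simp add: S_def)
  qed
  define l where "l = 1 / (C * S)"
  let ?N = "\<lambda>\<omega>. \<Sum>k\<in>F. indicator (E k) \<omega> :: real"
  have N2: "(?N \<omega>)\<^sup>2 = (\<Sum>j\<in>F. \<Sum>k\<in>F. indicator (E j \<inter> E k) \<omega>)" for \<omega>
    by (simp add: power2_eq_square sum_product indicator_inter_arith)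
  have int: "integrable M (\<lambda>\<omega>. indicator A \<omega> :: real)" if "A \<in> events" for A
    using that by (intro integrable_real_indicator) (auto simp: emeasure_eq_measure)
  have pw: "2 * l * ?N \<omega> - l\<^sup>2 * (?N \<omega>)\<^sup>2 \<le> indicator U \<omega>" for \<omega>
  proof (cases "\<omega> \<in> U")
    case True
    have "0 \<le> (1 - l * ?N \<omega>)\<^sup>2" by simp
    then show ?thesis using True by (simp add: power2_eq_square algebra_simps)
  next
    case False
    then have "?N \<omega> = 0" by (auto simp: U_def)
    then show ?thesis by simp
  qed
  have i1: "integrable M ?N" using E by (intro Bochner_Integration.integrable_sum int) auto
  have i2: "integrable M (\<lambda>\<omega>. (?N \<omega>)\<^sup>2)" unfolding N2 using E by (intro Bochner_Integration.integrable_sum int) auto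
  have e1: "expectation ?N = S" unfolding S_def using E int by (subst Bochner_Integration.integral_sum) auto
  have e2: "expectation (\<lambda>\<omega>. (?N \<omega>)\<^sup>2) = (\<Sum>j\<in>F. \<Sum>k\<in>F. prob (E j \<inter> E k))"
  proof -
    have "expectation (\<lambda>\<omega>. (?N \<omega>)\<^sup>2) = (\<Sum>j\<in>F. expectation (\<lambda>\<omega>. \<Sum>k\<in>F. indicator (E j \<inter> E k) \<omega>))"
      unfolding N2 using E by (intro Bochner_Integration.integral_sum Bochner_Integration.integrable_sum int) auto
    also have "\<dots> = (\<Sum>j\<in>F. \<Sum>k\<in>F. expectation (indicator (E j \<inter> E k)))"
      using E by (intro sum.cong refl Bochner_Integration.integral_sum int) auto
    also have "\<dots> = (\<Sum>j\<in>F. \<Sum>k\<in>F. prob (E j \<inter> E k))"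
      using E by (intro sum.cong refl) auto
    finally show ?thesis .
  qed
  have "expectation (\<lambda>\<omega>. 2 * l * ?N \<omega> - l\<^sup>2 * (?N \<omega>)\<^sup>2) \<le> expectation (indicator U)"
    using i1 i2 int[OF U] pw by (intro integral_mono) auto
  also have "expectation (\<lambda>\<omega>. 2 * l * ?N \<omega> - l\<^sup>2 * (?N \<omega>)\<^sup>2) = 2 * l * S - l\<^sup>2 * (\<Sum>j\<in>F. \<Sum>k\<in>F. prob (E j \<inter> E k))"
    using i1 i2 e1 e2 by simp
  also have "expectation (indicator U) = prob U" using U by simp
  finally have "2 * l * S - l\<^sup>2 * (\<Sum>j\<in>F. \<Sum>k\<in>F. prob (E j \<inter> E k)) \<le> prob U" .
  moreover have "l\<^sup>2 * (\<Sum>j\<in>F. \<Sum>k\<in>F. prob (E j \<inter> E k)) \<le> l\<^sup>2 * (C * S\<^sup>2)"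
    using pair unfolding S_def by (intro mult_left_mono) auto
  moreover have "l\<^sup>2 * (C * S\<^sup>2) = 1 / C" "2 * l * S = 2 / C"
    using Cp pos by (auto simp: l_def S_def[symmetric] power2_eq_square field_simps)
  ultimately have "1 / C \<le> prob U" by simp
  then show ?thesis using Cp by (simp add: U_def field_simps)
qed

text \<open>The Kochen-Stone form of the second Borel-Cantelli lemma: the second moment bound is applied to late
  windows \<open>F\<close> whose total mass exceeds 1 plus the mass of everything before.\<close>

lemma (in prob_space) infinitely_often_of_pairwise_bound:
  fixes E :: "nat \<Rightarrow> 'a set"
  assumes E: "\<And>k. E k \<in> events" and C: "0 \<le> C"
    and pair: "\<And>j N. k0 \<le> j \<Longrightarrow> (\<Sum>k\<in>{j<..N}. prob (E j \<inter> E k)) \<le> C * prob (E j) * (1 + (\<Sum>k\<in>{k0..N}. prob (E k)))"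
    and div: "\<not> summable (\<lambda>k. prob (E k))"
  shows "0 < prob (\<Inter>m. \<Union>k\<in>{m..}. E k)"
proof -
  define D where "D = 1 + 6 * C"
  have D: "D \<ge> 1" using C by (simp add: D_def)
  have main: "1 / D \<le> prob (\<Union>k\<in>{m..}. E k)" for m
  proof -
    define m' where "m' = max m k0"
    have "\<not> summable (\<lambda>k. prob (E (k + m')))" using div by (simp add: summable_iff_shift[of "\<lambda>k. prob (E k)"])
    then have "\<not> (\<forall>n. (\<Sum>k<n. prob (E (k + m'))) \<le> 1 + (\<Sum>k\<in>{k0..<m'}. prob (E k)))"
      by (meson summableI_nonneg_bounded measure_nonneg)
    then obtain n where n: "1 + (\<Sum>k\<in>{k0..<m'}. prob (E k)) < (\<Sum>k<n. prob (E (k + m')))" by (auto simp: not_le)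
    define F where "F = {m'..<m' + n}"
    define S where "S = (\<Sum>k\<in>F. prob (E k))"
    have "(\<Sum>k<n. prob (E (k + m'))) = S"
      unfolding S_def F_def by (rule sum.reindex_bij_witness[of _ "\<lambda>k. k - m'" "\<lambda>k. k + m'"]) auto
    then have S: "1 + (\<Sum>k\<in>{k0..<m'}. prob (E k)) < S" using n by simp
    have S1: "1 \<le> S" using S sum_nonneg[of "{k0..<m'}" "\<lambda>k. prob (E k)"] by simp
    have tri: "(\<Sum>j\<in>F. \<Sum>k\<in>F. prob (E j \<inter> E k)) \<le> (\<Sum>j\<in>F. prob (E j) + 2 * (\<Sum>k\<in>{j<..<m' + n}. prob (E j \<inter> E k)))"
    proof -
      let ?p = "\<lambda>j k. prob (E j \<inter> E k)"
      have "(\<Sum>k\<in>F. ?p j k) = (\<Sum>k\<in>{m'..<j}. ?p j k) + (prob (E j) + (\<Sum>k\<in>{j<..<m' + n}. ?p j k))" if j: "j \<in> F" for j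
      proof -
        have "F = {m'..<j} \<union> insert j {j<..<m' + n}" using j by (auto simp: F_def)
        then have "(\<Sum>k\<in>F. ?p j k) = (\<Sum>k\<in>{m'..<j}. ?p j k) + (\<Sum>k\<in>insert j {j<..<m' + n}. ?p j k)"
          by (simp only:) (rule sum.union_disjoint, auto)
        then show ?thesis by simp
      qed
      then have "(\<Sum>j\<in>F. \<Sum>k\<in>F. ?p j k) = (\<Sum>j\<in>F. \<Sum>k\<in>{m'..<j}. ?p j k) + (\<Sum>j\<in>F. prob (E j) + (\<Sum>k\<in>{j<..<m' + n}. ?p j k))"
        by (simp add: sum.distrib)
      also have "(\<Sum>j\<in>F. \<Sum>k\<in>{m'..<j}. ?p j k) = (\<Sum>k\<in>F. \<Sum>j\<in>{k<..<m' + n}. ?p j k)"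
      proof -
        have "(\<Sum>j\<in>F. \<Sum>k\<in>{m'..<j}. ?p j k) = (\<Sum>(j, k)\<in>Sigma F (\<lambda>j. {m'..<j}). ?p j k)"
          by (rule sum.Sigma) (auto simp: F_def)
        also have "\<dots> = (\<Sum>(k, j)\<in>Sigma F (\<lambda>k. {k<..<m' + n}). ?p j k)"
          by (rule sum.reindex_bij_witness[of _ "\<lambda>(a, b). (b, a)" "\<lambda>(a, b). (b, a)"]) (auto simp: F_def)
        also have "\<dots> = (\<Sum>k\<in>F. \<Sum>j\<in>{k<..<m' + n}. ?p j k)"
          by (rule sum.Sigma[symmetric]) (auto simp: F_def)
        finally show ?thesis .
      qed
      also have "\<dots> = (\<Sum>j\<in>F. \<Sum>k\<in>{j<..<m' + n}. ?p j k)" by (intro sum.cong refl) (simp add: Int_commute)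
      finally show ?thesis by (simp add: sum.distrib sum_distrib_left)
    qed
    also have "\<dots> \<le> (\<Sum>j\<in>F. prob (E j) + 2 * (C * prob (E j) * (1 + 2 * S)))"
    proof (intro sum_mono add_mono mult_left_mono order_refl)
      fix j assume j: "j \<in> F"
      have "{j<..<m' + n} \<subseteq> {j<..m' + n - 1}" by auto
      then have "(\<Sum>k\<in>{j<..<m' + n}. prob (E j \<inter> E k)) \<le> (\<Sum>k\<in>{j<..m' + n - 1}. prob (E j \<inter> E k))"
        by (intro sum_mono2) auto
      also have "\<dots> \<le> C * prob (E j) * (1 + (\<Sum>k\<in>{k0..m' + n - 1}. prob (E k)))"
        using j by (intro pair) (auto simp: F_def m'_def)
      also have "\<dots> \<le> C * prob (E j) * (1 + 2 * S)"
      proof (intro mult_left_mono add_left_mono)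
        have "{k0..m' + n - 1} = {k0..<m'} \<union> F" using j by (auto simp: F_def m'_def)
        then have "(\<Sum>k\<in>{k0..m' + n - 1}. prob (E k)) = (\<Sum>k\<in>{k0..<m'}. prob (E k)) + S"
          unfolding S_def by (simp only:) (rule sum.union_disjoint, auto simp: F_def)
        then show "(\<Sum>k\<in>{k0..m' + n - 1}. prob (E k)) \<le> 2 * S" using S by simp
      qed (use C in auto)
      finally show "(\<Sum>k\<in>{j<..<m' + n}. prob (E j \<inter> E k)) \<le> C * prob (E j) * (1 + 2 * S)" .
    qed auto
    also have "\<dots> = S + 2 * (C * S * (1 + 2 * S))"
      by (simp add: sum.distrib S_def sum_distrib_left[symmetric] sum_distrib_right[symmetric])
    also have "\<dots> \<le> S * S + 2 * (C * S * (S + 2 * S))"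
      using S1 C by (intro add_mono mult_left_mono) auto
    also have "\<dots> = (1 + 6 * C) * S\<^sup>2" by (simp add: power2_eq_square algebra_simps)
    finally have "1 \<le> (1 + 6 * C) * prob (\<Union>k\<in>F. E k)"
      using S1 C E unfolding S_def by (intro second_moment_union) (auto simp: F_def)
    moreover have "prob (\<Union>k\<in>F. E k) \<le> prob (\<Union>k\<in>{m..}. E k)"
      using E by (intro finite_measure_mono) (auto simp: F_def m'_def)
    then have "D * prob (\<Union>k\<in>F. E k) \<le> D * prob (\<Union>k\<in>{m..}. E k)" using D by (intro mult_left_mono) auto
    ultimately have "1 \<le> D * prob (\<Union>k\<in>{m..}. E k)" unfolding D_def by linarith
    then show ?thesis using D by (simp add: field_simps)
  qed
  have "(\<lambda>m. prob (\<Union>k\<in>{m..}. E k)) \<longlonglongrightarrow> prob (\<Inter>m. \<Union>k\<in>{m..}. E k)"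
    using E by (intro finite_Lim_measure_decseq) (auto simp: decseq_def, meson atLeast_iff order_trans)
  then have "1 / D \<le> prob (\<Inter>m. \<Union>k\<in>{m..}. E k)" using main by (intro LIMSEQ_le_const) auto
  moreover have "0 < 1 / D" using D by simp
  ultimately show ?thesis by linarith
qed

section \<open>Gaussian random walks\<close>

locale gaussian_walk = prob_space M for M :: "'a measure" +
  fixes Z :: "nat \<Rightarrow> 'a \<Rightarrow> real^'n"
  assumes Z_indep: "indep_vars (\<lambda>_. borel) Z {1..}"
    and Z_distr: "\<And>n. n \<ge> 1 \<Longrightarrow> distr M borel (Z n) = gauss 1"
begin

lemma Z_measurable [measurable]: "n \<ge> 1 \<Longrightarrow> Z n \<in> borel_measurable M"
  using Z_indep by (auto simp: indep_vars_def)

definition T :: "nat \<Rightarrow> 'a \<Rightarrow> real^'n" where "T n \<omega> = (\<Sum>j = 1..n. Z j \<omega>)"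

lemma T_measurable [measurable]: "T n \<in> borel_measurable M"
  unfolding T_def by (intro borel_measurable_sum) auto

lemma indep_block_sums:
  assumes "I \<subseteq> {1..}" "J \<subseteq> {1..}" "I \<inter> J = {}"
  shows "indep_var borel (\<lambda>\<omega>. \<Sum>i\<in>I. Z i \<omega>) borel (\<lambda>\<omega>. \<Sum>i\<in>J. Z i \<omega>)"
proof -
  have m: "(\<lambda>f. \<Sum>i\<in>K. f i) \<in> borel_measurable (PiM K (\<lambda>_. borel :: (real^'n) measure))" for K :: "nat set" by measurable
  have "indep_var borel ((\<lambda>f. \<Sum>i\<in>I. f i) \<circ> (\<lambda>\<omega>. restrict (\<lambda>i. Z i \<omega>) I)) borel ((\<lambda>f. \<Sum>i\<in>J. f i) \<circ> (\<lambda>\<omega>. restrict (\<lambda>i. Z i \<omega>) J))"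
    using assms by (intro indep_var_compose[OF indep_var_restrict[OF Z_indep]] m) auto
  then show ?thesis by (simp add: comp_def)
qed

lemma distr_sum_indep_gauss:
  assumes ind: "indep_var borel X borel Y" and X: "distr M borel X = gauss a" and Y: "distr M borel Y = gauss b"
    and ab: "a > 0" "b > 0"
  shows "distr M borel (\<lambda>\<omega>. X \<omega> + Y \<omega> :: real^'n) = gauss (a + b)"
proof -
  have [measurable]: "X \<in> borel_measurable M" "Y \<in> borel_measurable M"
    using indep_var_rv1[OF ind] indep_var_rv2[OF ind] by auto
  have "distr M borel (\<lambda>\<omega>. X \<omega> + Y \<omega>) = distr (distr M (borel \<Otimes>\<^sub>M borel) (\<lambda>\<omega>. (X \<omega>, Y \<omega>))) borel (\<lambda>(x, y). x + y)"
    by (subst distr_distr) (auto simp: comp_def)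
  also have "distr M (borel \<Otimes>\<^sub>M borel) (\<lambda>\<omega>. (X \<omega>, Y \<omega>)) = gauss a \<Otimes>\<^sub>M gauss b"
    using ind unfolding indep_var_distribution_eq X Y by simp
  finally show ?thesis using gauss_add[OF ab] by simp
qed

lemma distr_block_sum:
  assumes "finite I" "I \<noteq> {}" "I \<subseteq> {1..}"
  shows "distr M borel (\<lambda>\<omega>. \<Sum>i\<in>I. Z i \<omega>) = gauss (real (card I))"
  using assms
proof (induction rule: finite_ne_induct)
  case (singleton i)
  then show ?case using Z_distr[of i] by simp
next
  case (insert i I)
  have "distr M borel (\<lambda>\<omega>. Z i \<omega> + (\<Sum>i\<in>I. Z i \<omega>)) = gauss (1 + real (card I))"
  proof (rule distr_sum_indep_gauss)
    show "indep_var borel (Z i) borel (\<lambda>\<omega>. \<Sum>i\<in>I. Z i \<omega>)"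
      using indep_block_sums[of "{i}" I] insert by auto
  qed (use insert Z_distr[of i] in \<open>auto simp: card_gt_0_iff\<close>)
  then show ?case using insert by (simp add: add.commute)
qed

lemma T_diff: "m \<le> n \<Longrightarrow> T n \<omega> - T m \<omega> = (\<Sum>i\<in>{m<..n}. Z i \<omega>)"
proof -
  assume "m \<le> n"
  then have "{1..n} = {1..m} \<union> {m<..n}" by auto
  then have "T n \<omega> = T m \<omega> + (\<Sum>i\<in>{m<..n}. Z i \<omega>)"
    unfolding T_def by (simp only:) (rule sum.union_disjoint, auto)
  then show ?thesis by simp
qed

lemma distr_scaled:
  assumes X: "distr M borel X = gauss v" and [measurable]: "X \<in> borel_measurable M" and v: "v > 0"
  shows "distr M borel (\<lambda>\<omega>. X \<omega> /\<^sub>R sqrt v) = (gauss 1 :: (real^'n) measure)"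
proof -
  have "distr M borel (\<lambda>\<omega>. X \<omega> /\<^sub>R sqrt v) = distr (distr M borel X) borel (\<lambda>x. x /\<^sub>R sqrt v)"
    by (subst distr_distr) (auto simp: comp_def)
  also have "\<dots> = distr (distr (gauss 1) borel (\<lambda>x. sqrt v *\<^sub>R x)) borel (\<lambda>x. x /\<^sub>R sqrt v)"
    unfolding X gauss_scale[OF v] ..
  also have "\<dots> = distr (gauss 1) borel (\<lambda>x. x)"
    using v by (subst distr_distr) (auto simp: comp_def)
  also have "\<dots> = gauss 1" by (rule distr_id2) simp
  finally show ?thesis .
qed

lemma prob_T:
  assumes "n \<ge> 1" and [measurable]: "S \<in> sets borel"
  shows "prob {\<omega>\<in>space M. T n \<omega> /\<^sub>R sqrt n \<in> S} = measure (gauss 1) S"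
proof -
  have "distr M borel (T n) = gauss n"
    using distr_block_sum[of "{1..n}"] assms by (simp add: T_def[abs_def])
  from distr_scaled[OF this] have d: "distr M borel (\<lambda>\<omega>. T n \<omega> /\<^sub>R sqrt n) = gauss 1" using assms by simp
  have "measure (gauss 1) S = prob ((\<lambda>\<omega>. T n \<omega> /\<^sub>R sqrt n) -` S \<inter> space M)"
    unfolding d[symmetric] by (rule measure_distr) auto
  also have "(\<lambda>\<omega>. T n \<omega> /\<^sub>R sqrt n) -` S \<inter> space M = {\<omega>\<in>space M. T n \<omega> /\<^sub>R sqrt n \<in> S}" by auto
  finally show ?thesis ..
qed

lemma prob_T_tail:
  assumes n: "n \<ge> 1"
  shows "prob {\<omega>\<in>space M. sqrt n * t < norm (A *v T n \<omega>)} = gtail A t"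
proof -
  have "{v. t < norm (A *v v)} \<in> sets borel" by measurable
  from prob_T[OF n this] have "prob {\<omega>\<in>space M. t < norm (A *v (T n \<omega> /\<^sub>R sqrt n))} = gtail A t"
    by (simp add: gtail_def)
  moreover have "t < norm (A *v (v /\<^sub>R sqrt n)) \<longleftrightarrow> sqrt n * t < norm (A *v v)" for v
    using n by (simp add: matrix_vector_mult_scaleR field_simps)
  ultimately show ?thesis by simp
qed

text \<open>Two times of the walk, rescaled, form a pair of standard Gaussian vectors with correlation \<open>(j / k)\<^sup>1\<^sup>/\<^sup>2\<close>,
  in the form required by the estimates for pairs.\<close>

lemma walk_pair:
  assumes jk: "1 \<le> j" "j < k"
  defines "X \<equiv> \<lambda>\<omega>. T j \<omega> /\<^sub>R sqrt j" and "W \<equiv> \<lambda>\<omega>. (T k \<omega> - T j \<omega>) /\<^sub>R sqrt (real k - real j)"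
  shows "indep_var borel X borel W" "distr M borel X = gauss 1" "distr M borel W = gauss 1"
    "T k \<omega> /\<^sub>R sqrt k = sqrt (j / k) *\<^sub>R X \<omega> + sqrt (1 - (sqrt (j / k))\<^sup>2) *\<^sub>R W \<omega>"
proof -
  have W: "W = (\<lambda>\<omega>. (\<Sum>i\<in>{j<..k}. Z i \<omega>) /\<^sub>R sqrt (real k - real j))"
    using jk by (simp add: W_def T_diff)
  have "indep_var borel (T j) borel (\<lambda>\<omega>. \<Sum>i\<in>{j<..k}. Z i \<omega>)"
    unfolding T_def[abs_def] using jk by (intro indep_block_sums) auto
  from indep_var_compose[OF this, of "\<lambda>x. x /\<^sub>R sqrt j" borel "\<lambda>x. x /\<^sub>R sqrt (real k - real j)" borel]
  show "indep_var borel X borel W" by (simp add: X_def W comp_def)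
  have "distr M borel (T j) = gauss j" using distr_block_sum[of "{1..j}"] jk by (simp add: T_def[abs_def])
  from distr_scaled[OF this] show "distr M borel X = gauss 1" using jk by (simp add: X_def)
  have "distr M borel (\<lambda>\<omega>. \<Sum>i\<in>{j<..k}. Z i \<omega>) = gauss (real k - real j)"
  proof -
    have "{j<..k} \<subseteq> {1..}" by auto
    then show ?thesis using distr_block_sum[of "{j<..k}"] jk by (simp add: of_nat_diff)
  qed
  from distr_scaled[OF this] show "distr M borel W = gauss 1" using jk by (simp add: W)
  have k: "real k > 0" "real j > 0" "real k - real j > 0" using jk by auto
  have "1 - (sqrt (j / k))\<^sup>2 = (real k - real j) / k" using k by (simp add: field_simps)
  then have "sqrt (1 - (sqrt (j / k))\<^sup>2) *\<^sub>R W \<omega> = (T k \<omega> - T j \<omega>) /\<^sub>R sqrt k"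
  proof -
    have "sqrt ((real k - real j) / k) * inverse (sqrt (real k - real j)) = inverse (sqrt k)"
      using k by (simp add: real_sqrt_divide field_simps)
    then show ?thesis unfolding \<open>1 - (sqrt (j / k))\<^sup>2 = (real k - real j) / k\<close> W_def scaleR_scaleR by simp
  qed
  moreover have "sqrt (j / k) *\<^sub>R X \<omega> = T j \<omega> /\<^sub>R sqrt k"
  proof -
    have "sqrt (real j / k) * inverse (sqrt j) = inverse (sqrt k)" using k by (simp add: real_sqrt_divide inverse_eq_divide)
    then show ?thesis unfolding X_def scaleR_scaleR by simp
  qed
  ultimately show "T k \<omega> /\<^sub>R sqrt k = sqrt (j / k) *\<^sub>R X \<omega> + sqrt (1 - (sqrt (j / k))\<^sup>2) *\<^sub>R W \<omega>"
    by (simp add: scaleR_diff_right)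
qed

text \<open>Reflect the walk after its first passage over \<open>r\<close>: of the walk and its reflection, at least one ends above \<open>r\<close>,
  and both have the same law.\<close>

lemma levy_maximal:
  fixes q :: "real^'n \<Rightarrow> real"
  assumes [measurable]: "q \<in> borel_measurable borel" and q: "\<And>x s. q x \<le> max (q (x + s)) (q (x - s))" and N: "1 \<le> N"
  shows "prob {\<omega>\<in>space M. \<exists>n\<in>{1..N}. r < q (T n \<omega>)} \<le> 2 * prob {\<omega>\<in>space M. r < q (T N \<omega>)}"
proof -
  define F where "F m = {\<omega>\<in>space M. r < q (T m \<omega>) \<and> (\<forall>i\<in>{1..<m}. q (T i \<omega>) \<le> r)}" for m
  let ?G = "{\<omega>\<in>space M. r < q (T N \<omega>)}"
  have F [measurable]: "F m \<in> events" for m unfolding F_def by measurable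
  have G [measurable]: "?G \<in> events" by measurable
  have dis: "disjoint_family_on F {1..N}"
    by (auto simp: disjoint_family_on_def F_def) (metis atLeastLessThan_iff linorder_neqE_nat not_less)
  have un: "{\<omega>\<in>space M. \<exists>n\<in>{1..N}. r < q (T n \<omega>)} \<subseteq> (\<Union>m\<in>{1..N}. F m)"
  proof
    fix \<omega> assume w: "\<omega> \<in> {\<omega>\<in>space M. \<exists>n\<in>{1..N}. r < q (T n \<omega>)}"
    then have ex: "\<exists>n. n \<in> {1..N} \<and> r < q (T n \<omega>)" by auto
    define m where "m = (LEAST n. n \<in> {1..N} \<and> r < q (T n \<omega>))"
    have m: "m \<in> {1..N}" "r < q (T m \<omega>)" using LeastI_ex[OF ex] by (auto simp: m_def)
    have "q (T i \<omega>) \<le> r" if "i \<in> {1..<m}" for i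
      using not_less_Least[of i "\<lambda>n. n \<in> {1..N} \<and> r < q (T n \<omega>)"] that m(1) unfolding m_def[symmetric] by auto
    then show "\<omega> \<in> (\<Union>m\<in>{1..N}. F m)" using m w by (auto simp: F_def)
  qed
  have step: "prob (F m) \<le> 2 * prob (F m \<inter> ?G)" if m: "m \<in> {1..N}" for m
  proof (cases "m = N")
    case True
    then have "F m \<inter> ?G = F m" by (auto simp: F_def)
    then show ?thesis by simp
  next
    case False
    then have mN: "1 \<le> m" "m < N" using m by auto
    define S where "S \<omega> = (\<Sum>i\<in>{m<..N}. Z i \<omega>)" for \<omega>
    define P where "P = PiM {1..m} (\<lambda>_. borel :: (real^'n) measure)"
    define V where "V \<omega> = restrict (\<lambda>i. Z i \<omega>) {1..m}" for \<omega>
    define t where "t i f = (\<Sum>j = 1..i. f j :: real^'n)" for i :: nat and f :: "nat \<Rightarrow> real^'n"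
    have tT: "t i (V \<omega>) = T i \<omega>" if "i \<le> m" for i \<omega>
      unfolding t_def V_def T_def using that by (intro sum.cong) auto
    have tm [measurable]: "t i \<in> borel_measurable P" if "i \<le> m" for i
      unfolding t_def P_def using that by (intro borel_measurable_sum measurable_component_singleton) auto
    define Q where "Q = {p \<in> space (P \<Otimes>\<^sub>M borel). r < q (t m (fst p)) \<and> (\<forall>i\<in>{1..<m}. q (t i (fst p)) \<le> r) \<and> r < q (t m (fst p) + snd p)}"
    have Qm: "Q \<in> sets (P \<Otimes>\<^sub>M borel)"
    proof -
      have [measurable]: "t m \<in> borel_measurable P" by (rule tm) simp
      have a: "{p \<in> space (P \<Otimes>\<^sub>M borel). q (t i (fst p)) \<le> r} \<in> sets (P \<Otimes>\<^sub>M (borel :: (real^'n) measure))" if "i \<in> {1..<m}" for i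
      proof -
        have [measurable]: "t i \<in> borel_measurable P" using that by (intro tm) simp
        show ?thesis by measurable
      qed
      have "{p \<in> space (P \<Otimes>\<^sub>M (borel :: (real^'n) measure)). \<forall>i\<in>{1..<m}. q (t i (fst p)) \<le> r} \<in> sets (P \<Otimes>\<^sub>M borel)"
        by (rule sets.sets_Collect_finite_All[OF a]) auto
      moreover have "{p \<in> space (P \<Otimes>\<^sub>M borel). r < q (t m (fst p)) \<and> r < q (t m (fst p) + snd p)} \<in> sets (P \<Otimes>\<^sub>M borel)" by measurable
      ultimately have "{p \<in> space (P \<Otimes>\<^sub>M (borel :: (real^'n) measure)). \<forall>i\<in>{1..<m}. q (t i (fst p)) \<le> r} \<inter>
         {p \<in> space (P \<Otimes>\<^sub>M borel). r < q (t m (fst p)) \<and> r < q (t m (fst p) + snd p)} \<in> sets (P \<Otimes>\<^sub>M borel)" by (rule sets.Int)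
      also have "{p \<in> space (P \<Otimes>\<^sub>M (borel :: (real^'n) measure)). \<forall>i\<in>{1..<m}. q (t i (fst p)) \<le> r} \<inter>
         {p \<in> space (P \<Otimes>\<^sub>M borel). r < q (t m (fst p)) \<and> r < q (t m (fst p) + snd p)} = Q"
        unfolding Q_def by blast
      finally show ?thesis .
    qed
    have Sm [measurable]: "S \<in> borel_measurable M" unfolding S_def by (intro borel_measurable_sum) auto
    have Vm [measurable]: "V \<in> M \<rightarrow>\<^sub>M P" unfolding V_def P_def by (intro measurable_restrict) auto
    define R where "R = PiM {m<..N} (\<lambda>_. borel :: (real^'n) measure)"
    define U where "U \<omega> = restrict (\<lambda>i. Z i \<omega>) {m<..N}" for \<omega>
    have Um [measurable]: "U \<in> M \<rightarrow>\<^sub>M R" unfolding U_def R_def by (intro measurable_restrict) auto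
    have ind: "indep_var P V R U"
      unfolding P_def R_def V_def[abs_def] U_def[abs_def] by (rule indep_var_restrict[OF Z_indep]) auto
    have pair: "distr M (P \<Otimes>\<^sub>M borel) (\<lambda>\<omega>. (V \<omega>, g (U \<omega>))) = distr M P V \<Otimes>\<^sub>M distr M borel (\<lambda>\<omega>. g (U \<omega>))"
      if [measurable]: "g \<in> R \<rightarrow>\<^sub>M (borel :: (real^'n) measure)" for g
    proof -
      interpret G: prob_space "distr M borel (\<lambda>\<omega>. g (U \<omega>))" by (rule prob_space_distr) measurable
      have dg: "distr (distr M R U) borel g = distr M borel (\<lambda>\<omega>. g (U \<omega>))"
        by (subst distr_distr) (auto simp: comp_def)
      have "distr M (P \<Otimes>\<^sub>M borel) (\<lambda>\<omega>. (V \<omega>, g (U \<omega>)))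
          = distr (distr M (P \<Otimes>\<^sub>M R) (\<lambda>\<omega>. (V \<omega>, U \<omega>))) (P \<Otimes>\<^sub>M borel) (\<lambda>(v, u). (v, g u))"
        by (subst distr_distr) (auto simp: comp_def)
      also have "distr M (P \<Otimes>\<^sub>M R) (\<lambda>\<omega>. (V \<omega>, U \<omega>)) = distr M P V \<Otimes>\<^sub>M distr M R U"
        using ind unfolding indep_var_distribution_eq by simp
      also have "distr (distr M P V \<Otimes>\<^sub>M distr M R U) (P \<Otimes>\<^sub>M borel) (\<lambda>(v, u). (v, g u))
          = distr (distr M P V) P (\<lambda>v. v) \<Otimes>\<^sub>M distr (distr M R U) borel g"
        by (rule pair_measure_distr[symmetric]) (auto simp: dg G.sigma_finite_measure)
      also have "distr (distr M P V) P (\<lambda>v. v) = distr M P V" by (rule distr_id2) simp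
      finally show ?thesis unfolding dg .
    qed
    have SU: "(\<Sum>i\<in>{m<..N}. U \<omega> i) = S \<omega>" for \<omega> by (simp add: U_def S_def)
    have gm: "(\<lambda>f. \<Sum>i\<in>{m<..N}. f i) \<in> R \<rightarrow>\<^sub>M (borel :: (real^'n) measure)"
      unfolding R_def by (intro borel_measurable_sum measurable_component_singleton) auto
    have dS: "distr M borel S = gauss (real (card {m<..N}))"
      unfolding S_def[abs_def] using mN by (intro distr_block_sum) auto
    have "distr M borel (\<lambda>\<omega>. - S \<omega>) = distr (distr M borel S) borel uminus"
      by (subst distr_distr) (auto simp: comp_def)
    also have "\<dots> = distr M borel S" unfolding dS using mN by (intro gauss_symmetric) auto
    finally have dS': "distr M borel (\<lambda>\<omega>. - S \<omega>) = distr M borel S" .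
    \<comment> \<open>the increment \<open>S\<close> after time \<open>m\<close> is symmetric and independent of the past \<open>V\<close>\<close>
    have "distr M (P \<Otimes>\<^sub>M borel) (\<lambda>\<omega>. (V \<omega>, - S \<omega>)) = distr M (P \<Otimes>\<^sub>M borel) (\<lambda>\<omega>. (V \<omega>, S \<omega>))"
      using pair[OF gm] pair[OF borel_measurable_uminus[OF gm]] unfolding SU dS' by simp
    then have "measure (distr M (P \<Otimes>\<^sub>M borel) (\<lambda>\<omega>. (V \<omega>, - S \<omega>))) Q = measure (distr M (P \<Otimes>\<^sub>M borel) (\<lambda>\<omega>. (V \<omega>, S \<omega>))) Q" by simp
    moreover have "(\<lambda>\<omega>. (V \<omega>, - S \<omega>)) \<in> M \<rightarrow>\<^sub>M P \<Otimes>\<^sub>M borel" "(\<lambda>\<omega>. (V \<omega>, S \<omega>)) \<in> M \<rightarrow>\<^sub>M P \<Otimes>\<^sub>M borel"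
      by measurable
    ultimately have Qeq: "prob ((\<lambda>\<omega>. (V \<omega>, - S \<omega>)) -` Q \<inter> space M) = prob ((\<lambda>\<omega>. (V \<omega>, S \<omega>)) -` Q \<inter> space M)"
      by (simp add: measure_distr Qm)
    have inQ: "(V \<omega>, s) \<in> Q \<longleftrightarrow> \<omega> \<in> F m \<and> r < q (T m \<omega> + s)" if "\<omega> \<in> space M" for \<omega> s
      using that measurable_space[OF Vm that] by (auto simp: Q_def F_def tT space_pair_measure)
    have TN: "T N \<omega> = T m \<omega> + S \<omega>" for \<omega> using T_diff[of m N \<omega>] mN by (simp add: S_def algebra_simps)
    have eq: "prob {\<omega>\<in>space M. \<omega> \<in> F m \<and> r < q (T m \<omega> - S \<omega>)} = prob (F m \<inter> ?G)"
    proof -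
      have "(\<lambda>\<omega>. (V \<omega>, - S \<omega>)) -` Q \<inter> space M = {\<omega>\<in>space M. \<omega> \<in> F m \<and> r < q (T m \<omega> - S \<omega>)}" using inQ by auto
      moreover have "(\<lambda>\<omega>. (V \<omega>, S \<omega>)) -` Q \<inter> space M = F m \<inter> ?G" using inQ by (auto simp: TN)
      ultimately show ?thesis using Qeq by simp
    qed
    have em: "{\<omega>\<in>space M. \<omega> \<in> F m \<and> r < q (T m \<omega> - S \<omega>)} \<in> events" by measurable
    have "F m \<subseteq> {\<omega>\<in>space M. \<omega> \<in> F m \<and> r < q (T m \<omega> - S \<omega>)} \<union> (F m \<inter> ?G)"
    proof
      fix \<omega> assume w: "\<omega> \<in> F m"
      then have "r < q (T m \<omega>)" "\<omega> \<in> space M" by (auto simp: F_def)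
      then have "r < max (q (T m \<omega> + S \<omega>)) (q (T m \<omega> - S \<omega>))" using q[of "T m \<omega>" "S \<omega>"] by linarith
      then show "\<omega> \<in> {\<omega>\<in>space M. \<omega> \<in> F m \<and> r < q (T m \<omega> - S \<omega>)} \<union> (F m \<inter> ?G)"
        using w \<open>\<omega> \<in> space M\<close> by (auto simp: TN less_max_iff_disj)
    qed
    then have "prob (F m) \<le> prob ({\<omega>\<in>space M. \<omega> \<in> F m \<and> r < q (T m \<omega> - S \<omega>)} \<union> (F m \<inter> ?G))"
      using em by (intro finite_measure_mono) auto
    also have "\<dots> \<le> prob {\<omega>\<in>space M. \<omega> \<in> F m \<and> r < q (T m \<omega> - S \<omega>)} + prob (F m \<inter> ?G)"
      using em by (intro measure_Un_le) auto
    finally show ?thesis unfolding eq by simp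
  qed
  have "prob {\<omega>\<in>space M. \<exists>n\<in>{1..N}. r < q (T n \<omega>)} \<le> prob (\<Union>m\<in>{1..N}. F m)"
    using un by (intro finite_measure_mono) auto
  also have "\<dots> \<le> (\<Sum>m\<in>{1..N}. prob (F m))" by (intro measure_UNION_le) auto
  also have "\<dots> \<le> (\<Sum>m\<in>{1..N}. 2 * prob (F m \<inter> ?G))" by (intro sum_mono step)
  also have "\<dots> = 2 * (\<Sum>m\<in>{1..N}. prob (F m \<inter> ?G))" by (simp only: sum_distrib_left)
  also have "(\<Sum>m\<in>{1..N}. prob (F m \<inter> ?G)) = prob (\<Union>m\<in>{1..N}. F m \<inter> ?G)"
    using dis by (intro finite_measure_finite_Union[symmetric]) (auto simp: disjoint_family_on_def)
  also have "\<dots> \<le> prob ?G" by (intro finite_measure_mono) auto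
  finally show ?thesis by simp
qed

end

section \<open>Convergent matrices with small block oscillation\<close>

lemma norm_matrix_vector_le:
  fixes A :: "real^'n^'m"
  shows "norm (A *v x) \<le> (\<Sum>i\<in>UNIV. norm (A $ i)) * norm x"
proof -
  have "norm (A *v x) \<le> (\<Sum>i\<in>UNIV. \<bar>(A *v x) $ i\<bar>)" by (rule norm_le_l1_cart)
  also have "\<dots> \<le> (\<Sum>i\<in>UNIV. norm (A $ i) * norm x)"
    by (intro sum_mono) (simp add: matrix_vector_mul_component Cauchy_Schwarz_ineq2)
  finally show ?thesis by (simp add: sum_distrib_right)
qed

lemma block_cover:
  assumes "bi k1 \<le> n"
  obtains k where "k1 \<le> k" "bi k \<le> n" "n \<le> bi (Suc k)"
proof -
  have "\<exists>k. k1 \<le> k \<and> n < bi k"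
    using bi_at_top[unfolded filterlim_at_top, rule_format, of "Suc n"] unfolding eventually_sequentially
    by (metis Suc_le_lessD max.cobounded1 max.cobounded2)
  then have ex: "\<exists>k. k1 \<le> k \<and> n < bi k" .
  define k' where "k' = (LEAST k. k1 \<le> k \<and> n < bi k)"
  have k': "k1 \<le> k'" "n < bi k'" using LeastI_ex[OF ex] by (auto simp: k'_def)
  then have "k' \<noteq> k1" using assms by auto
  then obtain k where k: "k' = Suc k" "k1 \<le> k" using k'(1) by (cases k') auto
  have "\<not> (k1 \<le> k \<and> n < bi k)" using not_less_Least[of k "\<lambda>k. k1 \<le> k \<and> n < bi k"] k by (simp add: k'_def[symmetric])
  then show ?thesis using k k' by (intro that[of k]) auto
qed

locale matrix_walk = gaussian_walk M Z for M :: "'a measure" and Z :: "nat \<Rightarrow> 'a \<Rightarrow> real^'n" +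
  fixes \<Gamma> :: "nat \<Rightarrow> real^'n^'n" and \<Gamma>lim :: "real^'n^'n"
  assumes psd: "\<And>n. n \<ge> 1 \<Longrightarrow> sym_nonneg_definite (\<Gamma> n)"
    and psd_lim: "sym_nonneg_definite \<Gamma>lim" and lim_nz: "\<Gamma>lim \<noteq> 0"
    and conv: "\<Gamma> \<longlonglongrightarrow> \<Gamma>lim"
    and osc: "\<And>\<delta>. \<delta> > 0 \<Longrightarrow> (\<lambda>k. real k powr (- \<delta>) * block_osc \<Gamma> 1 k) summable_on {1..}"
begin

definition \<sigma> :: real where "\<sigma> = eigenvalue \<Gamma>lim 1"

lemma \<sigma>_pos: "\<sigma> > 0"
proof (rule ccontr)
  assume "\<not> \<sigma> > 0"
  then have "\<sigma> = 0" using eigenvalue_nonneg[OF psd_lim, of 1] by (simp add: \<sigma>_def Suc_leI)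
  then have "norm (\<Gamma>lim *v v) \<le> 0" for v using norm_matrix_le_top_eigenvalue[OF psd_lim, of v] by (simp add: \<sigma>_def)
  then have "\<Gamma>lim *v v = 0 *v v" for v by simp
  then have "\<Gamma>lim = 0" by (subst matrix_eq) auto
  then show False using lim_nz by simp
qed

lemma matrices_close:
  assumes "\<epsilon> > 0"
  shows "\<forall>\<^sub>F n in sequentially. \<forall>v. norm (\<Gamma> n *v v - \<Gamma>lim *v v) \<le> \<epsilon> * norm v"
proof -
  have "(\<lambda>n. \<Sum>i\<in>UNIV. norm ((\<Gamma> n - \<Gamma>lim) $ i)) \<longlonglongrightarrow> (\<Sum>i\<in>(UNIV::'n set). norm ((\<Gamma>lim - \<Gamma>lim) $ i))"
    by (intro tendsto_intros conv)
  then have "\<forall>\<^sub>F n in sequentially. (\<Sum>i\<in>UNIV. norm ((\<Gamma> n - \<Gamma>lim) $ i)) < \<epsilon>"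
    using assms by (intro order_tendstoD(2)[where a = \<epsilon>]) auto
  then show ?thesis
  proof eventually_elim
    case (elim n)
    show ?case
    proof
      fix v
      have "norm (\<Gamma> n *v v - \<Gamma>lim *v v) = norm ((\<Gamma> n - \<Gamma>lim) *v v)" by (simp add: matrix_vector_mult_diff_rdistrib)
      also have "\<dots> \<le> (\<Sum>i\<in>UNIV. norm ((\<Gamma> n - \<Gamma>lim) $ i)) * norm v" by (rule norm_matrix_vector_le)
      also have "\<dots> \<le> \<epsilon> * norm v" using elim by (intro mult_right_mono) auto
      finally show "norm (\<Gamma> n *v v - \<Gamma>lim *v v) \<le> \<epsilon> * norm v" .
    qed
  qed
qed

lemma eventually_class: "\<forall>\<^sub>F n in sequentially. \<Gamma> n \<in> spectral_class (\<sigma> / 2) (2 * \<sigma>)"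
proof -
  have h: "\<sigma> / 2 > 0" using \<sigma>_pos by simp
  show ?thesis using matrices_close[OF h] eventually_ge_at_top[of 1]
  proof eventually_elim
    case (elim n)
    have d0: "0 < CARD('n)" by simp
    have c: "norm (\<Gamma>lim *v v - \<Gamma> n *v v) \<le> \<sigma> / 2 * norm v" for v using elim(1) by (subst norm_minus_commute) simp
    have "eigenvalue (\<Gamma> n) (Suc 0) \<le> eigenvalue \<Gamma>lim (Suc 0) + \<sigma> / 2"
      using elim by (intro eigenvalue_perturbation psd psd_lim) auto
    moreover have "eigenvalue \<Gamma>lim (Suc 0) \<le> eigenvalue (\<Gamma> n) (Suc 0) + \<sigma> / 2"
      by (rule eigenvalue_perturbation[OF psd_lim psd[OF elim(2)] c d0])
    ultimately show ?case using psd[OF elim(2)] \<sigma>_pos by (simp add: spectral_class_def \<sigma>_def)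
  qed
qed

lemma form_close:
  assumes \<epsilon>: "\<epsilon> > 0"
  shows "\<forall>\<^sub>F N in sequentially. \<forall>m\<ge>N. \<forall>n\<ge>N. \<forall>x. (norm (\<Gamma> n *v x))\<^sup>2 \<le> (norm (\<Gamma> m *v x))\<^sup>2 + \<epsilon> * (norm x)\<^sup>2"
proof -
  define e where "e = \<epsilon> / (8 * \<sigma>)"
  have e: "e > 0" using \<epsilon> \<sigma>_pos by (simp add: e_def)
  have "\<forall>\<^sub>F N in sequentially. \<forall>n\<ge>N. \<Gamma> n \<in> spectral_class (\<sigma> / 2) (2 * \<sigma>)"
    by (rule eventually_all_ge_at_top[OF eventually_class])
  moreover have "\<forall>\<^sub>F N in sequentially. \<forall>n\<ge>N. \<forall>v. norm (\<Gamma> n *v v - \<Gamma>lim *v v) \<le> e * norm v"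
    by (rule eventually_all_ge_at_top[OF matrices_close[OF e]])
  ultimately show ?thesis
  proof eventually_elim
    case (elim N)
    show ?case
    proof (intro allI impI)
      fix m n x assume mn: "m \<ge> N" "n \<ge> N"
      let ?a = "norm (\<Gamma> n *v x)" and ?b = "norm (\<Gamma> m *v x)"
      have bd: "norm (\<Gamma> k *v x) \<le> 2 * \<sigma> * norm x" if "k \<ge> N" for k
      proof -
        have "\<Gamma> k \<in> spectral_class (\<sigma> / 2) (2 * \<sigma>)" using elim(1) that by simp
        then have k: "sym_nonneg_definite (\<Gamma> k)" "eigenvalue (\<Gamma> k) 1 \<le> 2 * \<sigma>" by (auto simp: spectral_class_def)
        have "norm (\<Gamma> k *v x) \<le> eigenvalue (\<Gamma> k) 1 * norm x" by (rule norm_matrix_le_top_eigenvalue[OF k(1)])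
        also have "\<dots> \<le> 2 * \<sigma> * norm x" using k by (intro mult_right_mono) auto
        finally show ?thesis .
      qed
      have "?a - ?b \<le> norm (\<Gamma> n *v x - \<Gamma> m *v x)" by (rule norm_triangle_ineq2)
      also have "\<dots> \<le> norm (\<Gamma> n *v x - \<Gamma>lim *v x) + norm (\<Gamma> m *v x - \<Gamma>lim *v x)"
        using norm_triangle_ineq4[of "\<Gamma> n *v x - \<Gamma>lim *v x" "\<Gamma> m *v x - \<Gamma>lim *v x"] by simp
      also have "\<dots> \<le> e * norm x + e * norm x" using elim(2) mn by (intro add_mono) auto
      finally have d: "?a - ?b \<le> 2 * e * norm x" by simp
      have "?a\<^sup>2 - ?b\<^sup>2 = (?a - ?b) * (?a + ?b)" by (simp add: power2_eq_square algebra_simps)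
      also have "\<dots> \<le> (2 * e * norm x) * (2 * \<sigma> * norm x + 2 * \<sigma> * norm x)"
        using d bd[OF mn(2)] bd[OF mn(1)] e by (intro mult_mono add_mono) auto
      also have "\<dots> = \<epsilon> * (norm x)\<^sup>2" using \<sigma>_pos by (simp add: e_def power2_eq_square)
      finally show "?a\<^sup>2 \<le> ?b\<^sup>2 + \<epsilon> * (norm x)\<^sup>2" by linarith
    qed
  qed
qed

lemma form_block:
  assumes k: "3 \<le> k" and mn: "bi k \<le> m" "m \<le> bi (Suc k)" "bi k \<le> n" "n \<le> bi (Suc k)"
  shows "(norm (\<Gamma> n *v x))\<^sup>2 \<le> (norm (\<Gamma> m *v x))\<^sup>2 + block_osc \<Gamma> 1 k * (norm x)\<^sup>2"
proof -
  let ?S = "{mat_norm (\<Gamma> n ** \<Gamma> n - \<Gamma> m ** \<Gamma> m) | m n. bi k \<le> m \<and> m \<le> n \<and> n \<le> bi (k + 1)}"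
  have "?S \<subseteq> (\<lambda>(m, n). mat_norm (\<Gamma> n ** \<Gamma> n - \<Gamma> m ** \<Gamma> m)) ` ({..bi (k+1)} \<times> {..bi (k+1)})" by auto
  then have fin: "finite ?S" by (rule finite_subset) auto
  have b1: "1 \<le> bi k" using bi_bounds[OF k] by simp
  have form: "(norm (\<Gamma> i *v x))\<^sup>2 = x \<bullet> ((\<Gamma> i ** \<Gamma> i) *v x)" if "1 \<le> i" for i
  proof -
    have "transpose (\<Gamma> i) = \<Gamma> i" using psd[OF that] by (simp add: sym_nonneg_definite_def)
    then show ?thesis
      by (simp add: power2_norm_eq_inner sym_matrix_inner matrix_vector_mul_assoc[symmetric])
  qed
  have main: "\<bar>(norm (\<Gamma> j *v x))\<^sup>2 - (norm (\<Gamma> i *v x))\<^sup>2\<bar> \<le> block_osc \<Gamma> 1 k * (norm x)\<^sup>2"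
    if ij: "bi k \<le> i" "i \<le> j" "j \<le> bi (Suc k)" for i j
  proof -
    let ?D = "\<Gamma> j ** \<Gamma> j - \<Gamma> i ** \<Gamma> i"
    have "mat_norm ?D \<in> ?S" using ij by auto
    then have o: "mat_norm ?D \<le> block_osc \<Gamma> 1 k" unfolding block_osc_def by (rule Max_ge[OF fin])
    have "(norm (\<Gamma> j *v x))\<^sup>2 - (norm (\<Gamma> i *v x))\<^sup>2 = x \<bullet> (?D *v x)"
      using form[of i] form[of j] ij b1 by (simp add: matrix_vector_mult_diff_rdistrib inner_diff_right)
    then have "\<bar>(norm (\<Gamma> j *v x))\<^sup>2 - (norm (\<Gamma> i *v x))\<^sup>2\<bar> \<le> norm x * norm (?D *v x)"
      by (simp add: Cauchy_Schwarz_ineq2)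
    also have "\<dots> \<le> norm x * (mat_norm ?D * norm x)"
      unfolding mat_norm_def by (intro mult_left_mono onorm matrix_vector_mul_bounded_linear) auto
    also have "\<dots> \<le> norm x * (block_osc \<Gamma> 1 k * norm x)" using o by (intro mult_left_mono mult_right_mono) auto
    finally show ?thesis by (simp add: power2_eq_square mult_ac)
  qed
  show ?thesis
    using main[of m n] main[of n m] mn by (cases "m \<le> n") (auto simp: abs_le_iff)
qed

lemma block_osc_nonneg:
  assumes k: "8 \<le> k" shows "0 \<le> block_osc \<Gamma> 1 k"
proof -
  have "(norm (\<Gamma> (bi k) *v x))\<^sup>2 \<le> (norm (\<Gamma> (bi k) *v x))\<^sup>2 + block_osc \<Gamma> 1 k * (norm x)\<^sup>2" for x
    using k bi_mono[of k "Suc k"] by (intro form_block) auto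
  from this[of "axis undefined 1"] show ?thesis by simp
qed

definition bad :: "real \<Rightarrow> nat set" where "bad \<epsilon> = {k. \<epsilon> / ln (real k) < block_osc \<Gamma> 1 k}"

lemma thin_bad: "\<epsilon> > 0 \<Longrightarrow> thin (bad \<epsilon>)"
  unfolding bad_def by (rule thin_large_values[OF osc block_osc_nonneg])

end

section \<open>Boundaries of iterated logarithm size\<close>

definition block_sum :: "(nat \<Rightarrow> real) \<Rightarrow> nat \<Rightarrow> real" where
  "block_sum f k = (\<Sum>m\<in>{bi k..<bi (Suc k)}. f m)"

lemma block_sum_telescope:
  "(\<Sum>k<K. block_sum f (k + 8)) = (\<Sum>m\<in>{bi 8..<bi (K + 8)}. f m)"
proof (induction K)
  case (Suc K)
  have "bi 8 \<le> bi (K + 8)" "bi (K + 8) \<le> bi (Suc K + 8)" by (auto intro!: bi_mono)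
  then have "{bi 8..<bi (Suc K + 8)} = {bi 8..<bi (K + 8)} \<union> {bi (K + 8)..<bi (Suc K + 8)}" by auto
  then have "(\<Sum>m\<in>{bi 8..<bi (Suc K + 8)}. f m) = (\<Sum>m\<in>{bi 8..<bi (K + 8)}. f m) + (\<Sum>m\<in>{bi (K + 8)..<bi (Suc K + 8)}. f m)"
    by (simp only:) (rule sum.union_disjoint, auto)
  then show ?case using Suc by (simp add: block_sum_def)
qed simp

lemma summable_block_sum_iff:
  assumes f: "\<And>n. 0 \<le> f n"
  shows "summable (block_sum f) \<longleftrightarrow> summable f"
proof
  assume s: "summable f"
  have "(\<Sum>k<K. block_sum f (k + 8)) \<le> suminf f" for K
    unfolding block_sum_telescope using s f by (intro sum_le_suminf) auto
  then have "summable (\<lambda>k. block_sum f (k + 8))"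
    by (intro summableI_nonneg_bounded) (auto simp: block_sum_def intro!: sum_nonneg f)
  then show "summable (block_sum f)" by (rule summable_iff_shift[THEN iffD1])
next
  assume "summable (block_sum f)"
  then have s: "summable (\<lambda>k. block_sum f (k + 8))" by (rule summable_iff_shift[THEN iffD2])
  have "(\<Sum>n<N. f n) \<le> (\<Sum>m<bi 8. f m) + (\<Sum>k. block_sum f (k + 8))" for N
  proof -
    have "\<forall>\<^sub>F k in sequentially. N \<le> bi k" using bi_at_top unfolding filterlim_at_top by blast
    then have "\<forall>\<^sub>F K in sequentially. N \<le> bi (K + 8)" by (rule eventually_sequentially_seg[THEN iffD2])
    then obtain K where K: "N \<le> bi (K + 8)" by (auto simp: eventually_sequentially)
    have "(\<Sum>n<N. f n) \<le> (\<Sum>n\<in>{..<bi 8} \<union> {bi 8..<bi (K + 8)}. f n)"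
      using K f by (intro sum_mono2) auto
    also have "\<dots> = (\<Sum>m<bi 8. f m) + (\<Sum>k<K. block_sum f (k + 8))"
      unfolding block_sum_telescope by (rule sum.union_disjoint) auto
    also have "(\<Sum>k<K. block_sum f (k + 8)) \<le> (\<Sum>k. block_sum f (k + 8))"
      using s f by (intro sum_le_suminf) (auto simp: block_sum_def intro!: sum_nonneg)
    finally show ?thesis by simp
  qed
  then show "summable f" using f by (intro summableI_nonneg_bounded) auto
qed

text \<open>Size and monotonicity are required only from \<open>N0\<close> on: a boundary truncated from above by a multiple of the
  square root of the iterated logarithm lies above another such multiple only eventually.\<close>

locale threshold_walk = matrix_walk M Z \<Gamma> \<Gamma>lim for M :: "'a measure" and Z :: "nat \<Rightarrow> 'a \<Rightarrow> real^'n" and \<Gamma> \<Gamma>lim +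
  fixes \<phi> :: "nat \<Rightarrow> real" and c0 C0 :: real and N0 :: nat
  assumes c0: "0 < c0" and mono: "\<And>m n. N0 \<le> m \<Longrightarrow> m \<le> n \<Longrightarrow> \<phi> m \<le> \<phi> n"
    and bounds: "\<And>n. N0 \<le> n \<Longrightarrow> c0 * sqrt (iter_log n) \<le> \<phi> n" "\<And>n. N0 \<le> n \<Longrightarrow> \<phi> n \<le> C0 * sqrt (iter_log n)"
begin

definition regular :: "nat \<Rightarrow> bool" where
  "regular k \<longleftrightarrow> 8 \<le> k \<and> N0 \<le> bi k \<and> 4 \<le> ln (real k) \<and> (\<forall>n\<ge>bi k. \<Gamma> n \<in> spectral_class (\<sigma> / 2) (2 * \<sigma>)) \<and>
     (\<forall>n. bi k \<le> n \<longrightarrow> n \<le> bi (Suc k) \<longrightarrow> ln (real k) / 2 \<le> iter_log n \<and> iter_log n \<le> ln (real k)) \<and>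
     1 - 2 / ln (real k) \<le> real (bi k) / real (bi (Suc k)) \<and>
     real (bi (Suc k)) / (32 * ln k) \<le> real (bi (Suc k)) - real (bi k)"

lemma eventually_regular: "\<forall>\<^sub>F k in sequentially. regular k"
proof -
  have "\<forall>\<^sub>F k in sequentially. N0 \<le> bi k" using bi_at_top unfolding filterlim_at_top by blast
  moreover have "\<forall>\<^sub>F k in sequentially. 4 \<le> ln (real k)" by real_asymp
  moreover have "\<forall>\<^sub>F k in sequentially. \<forall>n\<ge>bi k. \<Gamma> n \<in> spectral_class (\<sigma> / 2) (2 * \<sigma>)"
    by (rule eventually_compose_filterlim[OF eventually_all_ge_at_top[OF eventually_class] bi_at_top])
  ultimately show ?thesis
    using iter_log_block bi_ratio_lower bi_gap eventually_ge_at_top[of 8]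
    unfolding regular_def by eventually_elim blast
qed

context
  fixes k assumes reg: "regular k"
begin

lemma reg: "8 \<le> k" "N0 \<le> bi k" "4 \<le> ln (real k)" "1 - 2 / ln (real k) \<le> real (bi k) / real (bi (Suc k))"
  "real (bi (Suc k)) / (32 * ln k) \<le> real (bi (Suc k)) - real (bi k)"
  and reg_class: "\<And>n. bi k \<le> n \<Longrightarrow> \<Gamma> n \<in> spectral_class (\<sigma> / 2) (2 * \<sigma>)"
  and reg_log: "\<And>n. bi k \<le> n \<Longrightarrow> n \<le> bi (Suc k) \<Longrightarrow> ln (real k) / 2 \<le> iter_log n" "\<And>n. bi k \<le> n \<Longrightarrow> n \<le> bi (Suc k) \<Longrightarrow> iter_log n \<le> ln (real k)"
  using reg unfolding regular_def by blast+

lemma reg_bi: "1 \<le> bi k" "bi k \<le> bi (Suc k)" "1 \<le> bi (Suc k)" "1 / 2 \<le> real (bi k) / real (bi (Suc k))"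
proof -
  show "1 \<le> bi k" "bi k \<le> bi (Suc k)" "1 \<le> bi (Suc k)" using reg(1) bi_bounds[of k] bi_bounds[of "Suc k"] bi_mono[of k "Suc k"] by auto
  have "2 / ln (real k) \<le> 2 / 4" using reg(3) by (intro divide_left_mono) auto
  then show "1 / 2 \<le> real (bi k) / real (bi (Suc k))" using reg(4) by linarith
qed

lemma reg_phi:
  assumes n: "bi k \<le> n" "n \<le> bi (Suc k)"
  shows "0 < \<phi> n" "c0\<^sup>2 * ln (real k) / 2 \<le> (\<phi> n)\<^sup>2" "(\<phi> n)\<^sup>2 \<le> C0\<^sup>2 * ln (real k)" "c0 * sqrt (ln (real k) / 2) \<le> \<phi> n"
proof -
  have N: "N0 \<le> n" using reg(2) n by linarith
  have i: "1 \<le> iter_log n" by (rule iter_log_ge_1)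
  have lo: "c0 * sqrt (iter_log n) \<le> \<phi> n" and hi: "\<phi> n \<le> C0 * sqrt (iter_log n)" using bounds N by auto
  have "0 < c0 * sqrt (iter_log n)" using c0 i by (intro mult_pos_pos) auto
  then show p: "0 < \<phi> n" using lo by linarith
  have "c0 * sqrt (ln (real k) / 2) \<le> c0 * sqrt (iter_log n)" using reg_log(1)[OF n] c0 by (intro mult_left_mono real_sqrt_le_mono) auto
  then show a: "c0 * sqrt (ln (real k) / 2) \<le> \<phi> n" using lo by linarith
  have "(c0 * sqrt (ln (real k) / 2))\<^sup>2 \<le> (\<phi> n)\<^sup>2" using a c0 reg(3) by (intro power_mono) auto
  then show "c0\<^sup>2 * ln (real k) / 2 \<le> (\<phi> n)\<^sup>2" using reg(3) by (simp add: power_mult_distrib)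
  have "(\<phi> n)\<^sup>2 \<le> (C0 * sqrt (iter_log n))\<^sup>2" using hi p by (intro power_mono) auto
  also have "\<dots> = C0\<^sup>2 * iter_log n" using i by (simp add: power_mult_distrib)
  also have "\<dots> \<le> C0\<^sup>2 * ln (real k)" using reg_log(2)[OF n] by (intro mult_left_mono) auto
  finally show "(\<phi> n)\<^sup>2 \<le> C0\<^sup>2 * ln (real k)" .
qed

lemma reg_good_form:
  assumes good: "k \<notin> bad \<epsilon>" and m: "bi k \<le> m" "m \<le> bi (Suc k)" and n: "bi k \<le> n" "n \<le> bi (Suc k)"
  shows "(norm (\<Gamma> m *v x))\<^sup>2 \<le> (norm (\<Gamma> n *v x))\<^sup>2 + \<epsilon> / ln (real k) * (norm x)\<^sup>2"
proof -
  have "(norm (\<Gamma> m *v x))\<^sup>2 \<le> (norm (\<Gamma> n *v x))\<^sup>2 + block_osc \<Gamma> 1 k * (norm x)\<^sup>2"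
    using reg(1) by (intro form_block n m) auto
  also have "\<dots> \<le> (norm (\<Gamma> n *v x))\<^sup>2 + \<epsilon> / ln (real k) * (norm x)\<^sup>2"
    using good by (intro add_left_mono mult_right_mono) (auto simp: bad_def)
  finally show ?thesis .
qed

lemma reg_inv_log:
  assumes n: "bi k \<le> n" "n \<le> bi (Suc k)"
  shows "1 / ln (real k) \<le> C0\<^sup>2 / (\<phi> n)\<^sup>2"
  using reg_phi[OF n] reg(3) by (simp add: field_simps)

text \<open>A block has length of order \<open>1 / ln k\<close> on the logarithmic scale, and the iterated logarithm is of order
  \<open>ln k\<close> there; hence a sum of \<open>weighted_tail\<close> over a block is comparable to a single tail probability.\<close>

lemma reg_weights:
  "1 / 64 \<le> (\<Sum>m\<in>{bi k..<bi (Suc k)}. iter_log m / m)" "(\<Sum>m\<in>{bi k..<bi (Suc k)}. iter_log m / m) \<le> 4"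
proof -
  let ?d = "real (bi (Suc k)) - real (bi k)"
  have l: "0 < ln (real k)" using reg(3) by linarith
  have b: "0 < real (bi k)" "0 < real (bi (Suc k))" using reg_bi by auto
  have card: "real (card {bi k..<bi (Suc k)}) = ?d" using reg_bi by (simp add: of_nat_diff)
  have "1 / 64 = (real (bi (Suc k)) / (32 * ln k)) * (ln (real k) / 2 / bi (Suc k))" using b l by simp
  also have "\<dots> \<le> ?d * (ln (real k) / 2 / bi (Suc k))" using reg(5) l b by (intro mult_right_mono) auto
  also have "\<dots> = (\<Sum>m\<in>{bi k..<bi (Suc k)}. ln (real k) / 2 / bi (Suc k))" by (simp only: sum_constant card)
  also have "\<dots> \<le> (\<Sum>m\<in>{bi k..<bi (Suc k)}. iter_log m / m)"
  proof (intro sum_mono frac_le)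
    fix m assume "m \<in> {bi k..<bi (Suc k)}"
    then show "ln (real k) / 2 \<le> iter_log m" "0 < real m" "real m \<le> real (bi (Suc k))" "0 \<le> iter_log m"
      using reg_log(1)[of m] reg_bi(1) iter_log_ge_1[of m] by auto
  qed
  finally show "1 / 64 \<le> (\<Sum>m\<in>{bi k..<bi (Suc k)}. iter_log m / m)" .
  have "(\<Sum>m\<in>{bi k..<bi (Suc k)}. iter_log m / m) \<le> (\<Sum>m\<in>{bi k..<bi (Suc k)}. ln (real k) / bi k)"
  proof (intro sum_mono frac_le)
    fix m assume "m \<in> {bi k..<bi (Suc k)}"
    then show "iter_log m \<le> ln (real k)" "0 < real (bi k)" "real (bi k) \<le> real m" "0 \<le> ln (real k)"
      using reg_log(2)[of m] b l by auto
  qed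
  also have "\<dots> = ?d * (ln (real k) / bi k)" by (simp only: sum_constant card)
  also have "\<dots> \<le> (2 / ln (real k) * bi (Suc k)) * (ln (real k) / bi k)"
  proof (intro mult_right_mono)
    have "(1 - 2 / ln (real k)) * bi (Suc k) \<le> bi k" using reg(4) b by (simp add: field_simps)
    then show "?d \<le> 2 / ln (real k) * bi (Suc k)" by (simp add: left_diff_distrib)
  qed (use l b in auto)
  also have "\<dots> = 2 * (bi (Suc k) / bi k)" using l b by simp
  also have "\<dots> \<le> 2 * 2" using reg_bi(4) b by (intro mult_left_mono) (auto simp: field_simps)
  finally show "(\<Sum>m\<in>{bi k..<bi (Suc k)}. iter_log m / m) \<le> 4" by simp
qed

end

lemma s_class: "0 < \<sigma> / 2" "\<sigma> / 2 \<le> 2 * \<sigma>" "0 < 2 * \<sigma>" using \<sigma>_pos by auto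

lemma eventually_phi_large:
  "\<forall>\<^sub>F k in sequentially. \<forall>n. bi k \<le> n \<longrightarrow> n \<le> bi (Suc k) \<longrightarrow> t \<le> \<phi> n"
proof -
  have "\<forall>\<^sub>F k in sequentially. t \<le> c0 * sqrt (ln (real k) / 2)" using c0 by real_asymp
  with eventually_regular show ?thesis
  proof eventually_elim
    case (elim k)
    then show ?case using reg_phi(4)[OF elim(1)] by (meson order_trans)
  qed
qed

lemma block_compare:
  "\<exists>C\<ge>1. \<forall>\<^sub>F k in sequentially. k \<notin> bad 1 \<longrightarrow> (\<forall>m n. bi k \<le> m \<longrightarrow> m \<le> bi (Suc k) \<longrightarrow> bi k \<le> n \<longrightarrow> n \<le> bi (Suc k) \<longrightarrow>
     gtail (\<Gamma> m) (\<phi> n) \<le> C * gtail (\<Gamma> n) (\<phi> n))"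
proof -
  interpret G: prob_space "gauss 1 :: (real^'n) measure" by (rule prob_space_gauss) simp
  have K: "0 \<le> C0\<^sup>2" by simp
  obtain C t0 where C: "C \<ge> 1" "\<And>A::real^'n^'n. \<And>t. A \<in> spectral_class (\<sigma> / 2) (2 * \<sigma>) \<Longrightarrow> t \<ge> t0 \<Longrightarrow>
     measure (gauss 1 :: (real^'n) measure) {v. t\<^sup>2 - C0\<^sup>2 < (norm (A *v v))\<^sup>2 + (C0\<^sup>2 / t\<^sup>2) * (norm v)\<^sup>2} \<le> C * gtail A t"
    using gtail_stable[OF s_class(1,2) K, where 'n='n] by blast
  have "\<forall>\<^sub>F k in sequentially. k \<notin> bad 1 \<longrightarrow> (\<forall>m n. bi k \<le> m \<longrightarrow> m \<le> bi (Suc k) \<longrightarrow> bi k \<le> n \<longrightarrow> n \<le> bi (Suc k) \<longrightarrow>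
     gtail (\<Gamma> m) (\<phi> n) \<le> C * gtail (\<Gamma> n) (\<phi> n))"
    using eventually_regular eventually_phi_large[of t0]
  proof eventually_elim
    case (elim k)
    show ?case
    proof (intro impI allI)
      fix m n assume good: "k \<notin> bad 1" and mn: "bi k \<le> m" "m \<le> bi (Suc k)" "bi k \<le> n" "n \<le> bi (Suc k)"
      have p: "0 < \<phi> n" by (rule reg_phi(1)[OF elim(1) mn(3,4)])
      have "gtail (\<Gamma> m) (\<phi> n) \<le> G.prob {v. (\<phi> n)\<^sup>2 - C0\<^sup>2 < (norm (\<Gamma> n *v v))\<^sup>2 + (C0\<^sup>2 / (\<phi> n)\<^sup>2) * (norm v)\<^sup>2}"
        unfolding gtail_def
      proof (intro G.finite_measure_mono subsetI CollectI)
        fix v assume "v \<in> {v. \<phi> n < norm (\<Gamma> m *v v)}"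
        then have "(\<phi> n)\<^sup>2 < (norm (\<Gamma> m *v v))\<^sup>2" using p by (intro power_strict_mono) auto
        also have "\<dots> \<le> (norm (\<Gamma> n *v v))\<^sup>2 + 1 / ln (real k) * (norm v)\<^sup>2" by (rule reg_good_form[OF elim(1) good mn])
        also have "\<dots> \<le> (norm (\<Gamma> n *v v))\<^sup>2 + (C0\<^sup>2 / (\<phi> n)\<^sup>2) * (norm v)\<^sup>2"
          using reg_inv_log[OF elim(1) mn(3,4)] by (intro add_left_mono mult_right_mono) auto
        finally show "(\<phi> n)\<^sup>2 - C0\<^sup>2 < (norm (\<Gamma> n *v v))\<^sup>2 + (C0\<^sup>2 / (\<phi> n)\<^sup>2) * (norm v)\<^sup>2"
          using zero_le_power2[of C0] by linarith
      qed measurable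
      also have "\<dots> \<le> C * gtail (\<Gamma> n) (\<phi> n)"
        using elim(2) mn by (intro C(2) reg_class[OF elim(1)]) auto
      finally show "gtail (\<Gamma> m) (\<phi> n) \<le> C * gtail (\<Gamma> n) (\<phi> n)" .
    qed
  qed
  then show ?thesis using C(1) by blast
qed

lemma exp_ln_powr: "0 < k \<Longrightarrow> exp (- (c * ln (real k))) = real k powr (- c)"
  by (simp add: powr_def)

text \<open>A lower bound of the boundary by a multiple of \<open>(ln k)\<^sup>1\<^sup>/\<^sup>2\<close> turns the Gaussian tail into a negative power of
  \<open>k\<close>; this suffices on thin sets of blocks.\<close>

lemma gtail_crude:
  "\<exists>C\<ge>1. \<exists>\<delta>>0. \<forall>\<^sub>F k in sequentially. \<forall>m n. bi k \<le> m \<longrightarrow> bi k \<le> n \<longrightarrow> n \<le> bi (Suc k) \<longrightarrow> gtail (\<Gamma> m) (\<phi> n) \<le> C * real k powr (- \<delta>)"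
proof -
  obtain C where C: "C \<ge> 1" "\<And>A::real^'n^'n. \<And>t. sym_nonneg_definite A \<Longrightarrow> eigenvalue A 1 \<le> 2 * \<sigma> \<Longrightarrow> 0 \<le> t \<Longrightarrow>
     gtail A t \<le> C * exp (- t\<^sup>2 / (4 * (2 * \<sigma>)\<^sup>2))"
    using gtail_gaussian_bound[OF s_class(3), where 'n='n] by blast
  define \<delta> where "\<delta> = c0\<^sup>2 / 2 / (4 * (2 * \<sigma>)\<^sup>2)"
  have d: "\<delta> > 0" using c0 \<sigma>_pos by (simp add: \<delta>_def)
  have "\<forall>\<^sub>F k in sequentially. \<forall>m n. bi k \<le> m \<longrightarrow> bi k \<le> n \<longrightarrow> n \<le> bi (Suc k) \<longrightarrow> gtail (\<Gamma> m) (\<phi> n) \<le> C * real k powr (- \<delta>)"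
    using eventually_regular
  proof eventually_elim
    case (elim k)
    show ?case
    proof (intro allI impI)
      fix m n assume mn: "bi k \<le> m" "bi k \<le> n" "n \<le> bi (Suc k)"
      have cl: "sym_nonneg_definite (\<Gamma> m)" "eigenvalue (\<Gamma> m) 1 \<le> 2 * \<sigma>" using reg_class[OF elim mn(1)] by (auto simp: spectral_class_def)
      have "gtail (\<Gamma> m) (\<phi> n) \<le> C * exp (- (\<phi> n)\<^sup>2 / (4 * (2 * \<sigma>)\<^sup>2))"
        using reg_phi(1)[OF elim mn(2,3)] by (intro C(2) cl) auto
      also have "\<dots> \<le> C * exp (- (\<delta> * ln (real k)))"
      proof -
        have "\<delta> * ln (real k) = (c0\<^sup>2 * ln (real k) / 2) / (4 * (2 * \<sigma>)\<^sup>2)" by (simp add: \<delta>_def)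
        also have "\<dots> \<le> (\<phi> n)\<^sup>2 / (4 * (2 * \<sigma>)\<^sup>2)" by (rule divide_right_mono[OF reg_phi(2)[OF elim mn(2,3)]]) simp
        finally show ?thesis using C(1) by simp
      qed
      also have "exp (- (\<delta> * ln (real k))) = real k powr (- \<delta>)" using reg(1)[OF elim] by (intro exp_ln_powr) auto
      finally show "gtail (\<Gamma> m) (\<phi> n) \<le> C * real k powr (- \<delta>)" .
    qed
  qed
  then show ?thesis using C(1) d by blast
qed

section \<open>Almost sure boundedness\<close>

definition exceed :: "nat \<Rightarrow> 'a set" where
  "exceed k = {\<omega>\<in>space M. \<exists>n\<in>{bi k..bi (Suc k)}. sqrt n * \<phi> n < norm (\<Gamma> n *v T n \<omega>)}"

lemma exceed_measurable [measurable]: "exceed k \<in> events"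
  unfolding exceed_def by measurable

text \<open>On a good block \<open>|\<Gamma>\<^sub>n x|\<^sup>2\<close> is at most \<open>q x = |A x|\<^sup>2 + |x|\<^sup>2 / ln k\<close> for all \<open>n\<close> at once. The parallelogram law gives \<open>q\<close> the
  property required in Levy's inequality, so that only the end of the block counts. There \<open>gtail_stable\<close> absorbs
  the term \<open>|x|\<^sup>2 / ln k\<close> and the ratio of the two ends of the block.\<close>

lemma exceed_good:
  "\<exists>C\<ge>1. \<forall>\<^sub>F k in sequentially. k \<notin> bad 1 \<longrightarrow> prob (exceed k) \<le> C * gtail (\<Gamma> (bi k)) (\<phi> (bi k))"
proof -
  interpret G: prob_space "gauss 1 :: (real^'n) measure" by (rule prob_space_gauss) simp
  define K where "K = 2 * C0\<^sup>2"
  have K: "0 \<le> K" by (simp add: K_def)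
  obtain C t0 where C: "C \<ge> 1" "\<And>A::real^'n^'n. \<And>t. A \<in> spectral_class (\<sigma> / 2) (2 * \<sigma>) \<Longrightarrow> t \<ge> t0 \<Longrightarrow>
     measure (gauss 1 :: (real^'n) measure) {v. t\<^sup>2 - K < (norm (A *v v))\<^sup>2 + (K / t\<^sup>2) * (norm v)\<^sup>2} \<le> C * gtail A t"
    using gtail_stable[OF s_class(1,2) K, where 'n='n] by blast
  have "\<forall>\<^sub>F k in sequentially. k \<notin> bad 1 \<longrightarrow> prob (exceed k) \<le> (2 * C) * gtail (\<Gamma> (bi k)) (\<phi> (bi k))"
    using eventually_regular eventually_phi_large[of t0]
  proof eventually_elim
    case (elim k)
    note r = elim(1)
    show ?case
    proof
      assume good: "k \<notin> bad 1"
      define N t \<delta> where "N = bi (Suc k)" and "t = \<phi> (bi k)" and "\<delta> = 1 / ln (real k)"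
      define A where "A = \<Gamma> (bi k)"
      define q where "q x = (norm (A *v x))\<^sup>2 + \<delta> * (norm x)\<^sup>2" for x
      have l: "0 < ln (real k)" using reg(3)[OF r] by linarith
      have d: "0 \<le> \<delta>" using l by (simp add: \<delta>_def)
      have b: "0 < real (bi k)" "0 < real N" "1 \<le> N" "bi k \<le> N" using reg_bi[OF r] by (auto simp: N_def)
      have t: "0 < t" "t\<^sup>2 \<le> C0\<^sup>2 * ln (real k)" "t0 \<le> t"
        using reg_phi[OF r order_refl reg_bi(2)[OF r]] elim(2) reg_bi(2)[OF r] by (auto simp: t_def)
      have qm [measurable]: "q \<in> borel_measurable borel" unfolding q_def by measurable
      have qmax: "q x \<le> max (q (x + s)) (q (x - s))" for x s
      proof -
        have par: "(norm (u + w))\<^sup>2 + (norm (u - w))\<^sup>2 = 2 * (norm u)\<^sup>2 + 2 * (norm w)\<^sup>2" for u w :: "real^'n"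
          by (simp add: power2_norm_eq_inner inner_add_left inner_add_right inner_diff_left inner_diff_right inner_commute)
        have "q (x + s) + q (x - s) = ((norm (A *v x + A *v s))\<^sup>2 + (norm (A *v x - A *v s))\<^sup>2) + \<delta> * ((norm (x + s))\<^sup>2 + (norm (x - s))\<^sup>2)"
          by (simp add: q_def matrix_vector_right_distrib matrix_vector_mult_diff_distrib algebra_simps)
        also have "\<dots> = 2 * q x + 2 * q s" unfolding par by (simp add: q_def algebra_simps)
        finally have "2 * q x \<le> q (x + s) + q (x - s)" using d by (simp add: q_def)
        then show ?thesis by (auto simp: max_def)
      qed
      have "prob (exceed k) \<le> prob {\<omega>\<in>space M. \<exists>n\<in>{1..N}. bi k * t\<^sup>2 < q (T n \<omega>)}"
      proof (intro finite_measure_mono subsetI)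
        fix \<omega> assume "\<omega> \<in> exceed k"
        then obtain n where n: "\<omega> \<in> space M" "bi k \<le> n" "n \<le> N" "sqrt n * \<phi> n < norm (\<Gamma> n *v T n \<omega>)"
          by (auto simp: exceed_def N_def)
        have "t \<le> \<phi> n" unfolding t_def using n reg(2)[OF r] by (intro mono) auto
        then have "t\<^sup>2 \<le> (\<phi> n)\<^sup>2" using t by (intro power_mono) auto
        then have "bi k * t\<^sup>2 \<le> n * (\<phi> n)\<^sup>2" using n by (intro mult_mono) auto
        also have "\<dots> = (sqrt n * \<phi> n)\<^sup>2" by (simp add: power_mult_distrib)
        also have "\<dots> < (norm (\<Gamma> n *v T n \<omega>))\<^sup>2"
          using n(4) reg_phi(1)[OF r n(2) n(3)[unfolded N_def]] by (intro power_strict_mono) auto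
        also have "\<dots> \<le> q (T n \<omega>)"
          unfolding q_def A_def \<delta>_def using n reg_bi[OF r] by (intro reg_good_form[OF r good]) (auto simp: N_def)
        finally show "\<omega> \<in> {\<omega>\<in>space M. \<exists>n\<in>{1..N}. bi k * t\<^sup>2 < q (T n \<omega>)}" using n b by (auto intro!: bexI[of _ n])
      qed measurable
      also have "\<dots> \<le> 2 * prob {\<omega>\<in>space M. bi k * t\<^sup>2 < q (T N \<omega>)}" by (rule levy_maximal[OF qm qmax b(3)])
      also have "prob {\<omega>\<in>space M. bi k * t\<^sup>2 < q (T N \<omega>)} = prob {\<omega>\<in>space M. T N \<omega> /\<^sub>R sqrt N \<in> {v. bi k / N * t\<^sup>2 < q v}}"
      proof -
        have "bi k * t\<^sup>2 < q v \<longleftrightarrow> v /\<^sub>R sqrt N \<in> {v. bi k / N * t\<^sup>2 < q v}" for v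
        proof -
          have "q (v /\<^sub>R sqrt N) = q v / N"
            using b by (simp add: q_def matrix_vector_mult_scaleR power_mult_distrib power_inverse divide_inverse algebra_simps)
          then show ?thesis using b by (simp add: divide_less_cancel mult.commute)
        qed
        then show ?thesis by simp
      qed
      also have "\<dots> = G.prob {v. bi k / N * t\<^sup>2 < q v}" by (rule prob_T[OF b(3)]) measurable
      also have "\<dots> \<le> G.prob {v. t\<^sup>2 - K < (norm (A *v v))\<^sup>2 + (K / t\<^sup>2) * (norm v)\<^sup>2}"
      proof (intro G.finite_measure_mono subsetI CollectI)
        fix v assume v: "v \<in> {v. bi k / N * t\<^sup>2 < q v}"
        have "(1 - 2 / ln (real k)) * t\<^sup>2 \<le> bi k / N * t\<^sup>2" using reg(4)[OF r] by (intro mult_right_mono) (auto simp: N_def)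
        moreover have "2 / ln (real k) * t\<^sup>2 \<le> K"
        proof -
          have "2 / ln (real k) * t\<^sup>2 \<le> 2 / ln (real k) * (C0\<^sup>2 * ln (real k))" using t l by (intro mult_left_mono) auto
          then show ?thesis using l by (simp add: K_def)
        qed
        ultimately have "t\<^sup>2 - K \<le> bi k / N * t\<^sup>2" by (simp add: left_diff_distrib)
        also have "\<dots> < q v" using v by simp
        also have "\<dots> \<le> (norm (A *v v))\<^sup>2 + (K / t\<^sup>2) * (norm v)\<^sup>2"
        proof -
          have "\<delta> \<le> C0\<^sup>2 / t\<^sup>2" unfolding \<delta>_def t_def by (rule reg_inv_log[OF r order_refl reg_bi(2)[OF r]])
          also have "\<dots> \<le> K / t\<^sup>2" by (simp add: K_def divide_right_mono)
          finally show ?thesis unfolding q_def by (intro add_left_mono mult_right_mono) auto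
        qed
        finally show "t\<^sup>2 - K < (norm (A *v v))\<^sup>2 + (K / t\<^sup>2) * (norm v)\<^sup>2" .
      qed measurable
      also have "\<dots> \<le> C * gtail A t" using t(3) unfolding A_def by (intro C(2) reg_class[OF r]) auto
      finally show "prob (exceed k) \<le> (2 * C) * gtail (\<Gamma> (bi k)) (\<phi> (bi k))" by (simp add: A_def t_def)
    qed
  qed
  moreover have "2 * C \<ge> 1" using C(1) by linarith
  ultimately show ?thesis by blast
qed

text \<open>Without control of the oscillation, Levy's inequality is applied to \<open>|T\<^sub>n|\<close> itself; the loss is in the
  exponent but a negative power of \<open>k\<close> remains.\<close>

lemma exceed_crude:
  "\<exists>C\<ge>1. \<exists>\<delta>>0. \<forall>\<^sub>F k in sequentially. prob (exceed k) \<le> C * real k powr (- \<delta>)"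
proof -
  obtain C where C: "C \<ge> 1" "\<And>r. r \<ge> 0 \<Longrightarrow> measure (gauss 1 :: (real^'n) measure) {v. r < norm v} \<le> C * exp (- r\<^sup>2 / 4)"
    using gauss_norm_tail[where 'n='n] by blast
  define \<delta> where "\<delta> = c0\<^sup>2 / (64 * \<sigma>\<^sup>2)"
  have d: "\<delta> > 0" using c0 \<sigma>_pos by (simp add: \<delta>_def)
  have "\<forall>\<^sub>F k in sequentially. prob (exceed k) \<le> (2 * C) * real k powr (- \<delta>)"
    using eventually_regular
  proof eventually_elim
    case (elim k)
    note r = elim
    define N t where "N = bi (Suc k)" and "t = \<phi> (bi k)"
    have b: "0 < real (bi k)" "0 < real N" "1 \<le> N" "1 / 2 \<le> bi k / N" using reg_bi[OF r] by (auto simp: N_def)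
    have t: "0 < t" "c0\<^sup>2 * ln (real k) / 2 \<le> t\<^sup>2"
      using reg_phi[OF r order_refl reg_bi(2)[OF r]] by (auto simp: t_def)
    define \<rho> where "\<rho> = sqrt (bi k) * t / (2 * \<sigma>)"
    have \<rho>0: "0 \<le> \<rho>" using t \<sigma>_pos by (simp add: \<rho>_def)
    have nm: "norm x \<le> max (norm (x + s)) (norm (x - s))" for x s :: "real^'n"
    proof -
      have "(x + s) + (x - s) = 2 *\<^sub>R x" by (simp add: scaleR_2)
      then have "norm (2 *\<^sub>R x) \<le> norm (x + s) + norm (x - s)" using norm_triangle_ineq[of "x + s" "x - s"] by simp
      then have "2 * norm x \<le> norm (x + s) + norm (x - s)" by simp
      then show ?thesis by linarith
    qed
    have "prob (exceed k) \<le> prob {\<omega>\<in>space M. \<exists>n\<in>{1..N}. \<rho> < norm (T n \<omega>)}"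
    proof (intro finite_measure_mono subsetI)
      fix \<omega> assume "\<omega> \<in> exceed k"
      then obtain n where n: "\<omega> \<in> space M" "bi k \<le> n" "n \<le> N" "sqrt n * \<phi> n < norm (\<Gamma> n *v T n \<omega>)"
        by (auto simp: exceed_def N_def)
      have cl: "sym_nonneg_definite (\<Gamma> n)" "eigenvalue (\<Gamma> n) 1 \<le> 2 * \<sigma>" using reg_class[OF r n(2)] by (auto simp: spectral_class_def)
      have "t \<le> \<phi> n" unfolding t_def using n reg(2)[OF r] by (intro mono) auto
      then have "sqrt (bi k) * t \<le> sqrt n * \<phi> n" using n t by (intro mult_mono) auto
      also have "\<dots> < norm (\<Gamma> n *v T n \<omega>)" by (rule n(4))
      also have "\<dots> \<le> eigenvalue (\<Gamma> n) 1 * norm (T n \<omega>)" by (rule norm_matrix_le_top_eigenvalue[OF cl(1)])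
      also have "\<dots> \<le> 2 * \<sigma> * norm (T n \<omega>)" using cl by (intro mult_right_mono) auto
      finally have "\<rho> < norm (T n \<omega>)" using \<sigma>_pos by (simp add: \<rho>_def field_simps)
      then show "\<omega> \<in> {\<omega>\<in>space M. \<exists>n\<in>{1..N}. \<rho> < norm (T n \<omega>)}" using n b by (auto intro!: bexI[of _ n])
    qed measurable
    also have "\<dots> \<le> 2 * prob {\<omega>\<in>space M. \<rho> < norm (T N \<omega>)}" by (rule levy_maximal[OF _ nm b(3)]) measurable
    also have "prob {\<omega>\<in>space M. \<rho> < norm (T N \<omega>)} = prob {\<omega>\<in>space M. T N \<omega> /\<^sub>R sqrt N \<in> {v. \<rho> / sqrt N < norm v}}"
      using b by (intro arg_cong[where f = prob]) (auto simp: field_simps)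
    also have "\<dots> = measure (gauss 1) {v::real^'n. \<rho> / sqrt N < norm v}" by (rule prob_T[OF b(3)]) measurable
    also have "\<dots> \<le> C * exp (- (\<rho> / sqrt N)\<^sup>2 / 4)" using \<rho>0 by (intro C(2)) auto
    also have "\<dots> \<le> C * exp (- (\<delta> * ln (real k)))"
    proof -
      have "\<delta> * ln (real k) = (1 / 2 * (c0\<^sup>2 * ln (real k) / 2)) / (16 * \<sigma>\<^sup>2)" by (simp add: \<delta>_def)
      also have "\<dots> \<le> (bi k / N * t\<^sup>2) / (16 * \<sigma>\<^sup>2)"
        using b t reg(3)[OF r] by (intro divide_right_mono mult_mono) auto
      also have "\<dots> = (\<rho> / sqrt N)\<^sup>2 / 4" using b by (simp add: \<rho>_def power_divide power_mult_distrib)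
      finally show ?thesis using C(1) by simp
    qed
    also have "exp (- (\<delta> * ln (real k))) = real k powr (- \<delta>)" using reg(1)[OF r] by (intro exp_ln_powr) auto
    finally show ?case by simp
  qed
  moreover have "2 * C \<ge> 1" using C(1) by linarith
  ultimately show ?thesis using d by blast
qed

definition weighted_tail :: "nat \<Rightarrow> real" where
  "weighted_tail n = iter_log n / n * gtail (\<Gamma> n) (\<phi> n)"

lemma weighted_tail_nonneg: "0 \<le> weighted_tail n"
  using iter_log_ge_1[of n] by (simp add: weighted_tail_def gtail_nonneg)

lemma summable_on_thin:
  assumes B: "thin B" and d: "\<delta> > 0" and e: "\<forall>\<^sub>F k in sequentially. k \<in> B \<longrightarrow> \<bar>p k\<bar> \<le> C * real k powr (- \<delta>)" 
  shows "summable (\<lambda>k. if k \<in> B then p k else (0::real))"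
proof (rule summable_comparison_test_ev)
  show "summable (\<lambda>k. C * (if k \<in> B then real k powr (- \<delta>) else 0))"
    using B d by (intro summable_mult) (auto simp: thin_def)
  show "\<forall>\<^sub>F k in sequentially. norm (if k \<in> B then p k else 0) \<le> C * (if k \<in> B then real k powr (- \<delta>) else 0)"
    using e by eventually_elim auto
qed

text \<open>Borel-Cantelli over blocks. The exceedance probability of a block is compared with the sum of
  \<open>weighted_tail\<close> over the preceding block, where the boundary is lower; both blocks have to be good.\<close>

theorem almost_surely_below:
  assumes sm: "summable weighted_tail"
  shows "AE \<omega> in M. \<forall>\<^sub>F n in sequentially. norm (\<Gamma> n *v T n \<omega>) \<le> sqrt n * \<phi> n"
proof -
  obtain C1 where C1: "C1 \<ge> 1" "\<forall>\<^sub>F k in sequentially. k \<notin> bad 1 \<longrightarrow> prob (exceed k) \<le> C1 * gtail (\<Gamma> (bi k)) (\<phi> (bi k))"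
    using exceed_good by blast
  obtain C2 where C2: "C2 \<ge> 1" "\<forall>\<^sub>F k in sequentially. k \<notin> bad 1 \<longrightarrow> (\<forall>m n. bi k \<le> m \<longrightarrow> m \<le> bi (Suc k) \<longrightarrow> bi k \<le> n \<longrightarrow> n \<le> bi (Suc k) \<longrightarrow>
     gtail (\<Gamma> m) (\<phi> n) \<le> C2 * gtail (\<Gamma> n) (\<phi> n))"
    using block_compare by blast
  obtain C3 \<delta> where C3: "\<delta> > 0" "\<forall>\<^sub>F k in sequentially. prob (exceed k) \<le> C3 * real k powr (- \<delta>)"
    using exceed_crude by blast
  \<comment> \<open>blocks that are bad or follow a bad one\<close>
  define B where "B = bad 1 \<union> {k. k \<ge> 1 \<and> k - 1 \<in> bad 1}"
  have B: "thin B" unfolding B_def by (intro thin_Un thin_Suc thin_bad) auto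
  have 1: "summable (\<lambda>k. if k \<in> B then prob (exceed k) else 0)"
    by (rule summable_on_thin[OF B C3(1), of _ C3]) (use C3(2) in \<open>auto elim!: eventually_mono\<close>)
  have "summable (\<lambda>k. if Suc k \<in> B then 0 else prob (exceed (Suc k)))"
  proof (rule summable_comparison_test_ev)
    show "summable (\<lambda>k. 64 * (C1 * C2) * block_sum weighted_tail k)"
      by (intro summable_mult summable_block_sum_iff[THEN iffD2] weighted_tail_nonneg sm)
    show "\<forall>\<^sub>F k in sequentially. norm (if Suc k \<in> B then 0 else prob (exceed (Suc k))) \<le> 64 * (C1 * C2) * block_sum weighted_tail k"
      using eventually_regular C2(2) eventually_sequentially_Suc[THEN iffD2, OF C1(2)]
    proof eventually_elim
      case (elim k)
      note r = elim(1)
      let ?G = "gtail (\<Gamma> (bi (Suc k))) (\<phi> (bi (Suc k)))"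
      have bs: "0 \<le> block_sum weighted_tail k" unfolding block_sum_def by (intro sum_nonneg weighted_tail_nonneg)
      show ?case
      proof (cases "Suc k \<in> B")
        case False
        then have good: "k \<notin> bad 1" "Suc k \<notin> bad 1" by (auto simp: B_def)
        have "?G * (1 / 64) \<le> ?G * (\<Sum>m\<in>{bi k..<bi (Suc k)}. iter_log m / m)"
          by (intro mult_left_mono reg_weights(1)[OF r] gtail_nonneg)
        also have "\<dots> = (\<Sum>m\<in>{bi k..<bi (Suc k)}. iter_log m / m * ?G)" by (simp add: sum_distrib_left mult.commute)
        also have "\<dots> \<le> (\<Sum>m\<in>{bi k..<bi (Suc k)}. iter_log m / m * (C2 * gtail (\<Gamma> m) (\<phi> m)))"
        proof (intro sum_mono mult_left_mono)
          fix m assume m: "m \<in> {bi k..<bi (Suc k)}"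
          have "?G \<le> gtail (\<Gamma> (bi (Suc k))) (\<phi> m)" using m reg(2)[OF r] by (intro gtail_antimono mono) auto
          also have "\<dots> \<le> C2 * gtail (\<Gamma> m) (\<phi> m)" using elim(2) good(1) m by auto
          finally show "?G \<le> C2 * gtail (\<Gamma> m) (\<phi> m)" .
          show "0 \<le> iter_log m / m" using iter_log_ge_1[of m] by simp
        qed
        also have "\<dots> = C2 * block_sum weighted_tail k"
          by (simp add: block_sum_def weighted_tail_def sum_distrib_left mult_ac)
        finally have "?G \<le> 64 * (C2 * block_sum weighted_tail k)" by simp
        then have "C1 * ?G \<le> C1 * (64 * (C2 * block_sum weighted_tail k))" using C1(1) by (intro mult_left_mono) auto
        moreover have "prob (exceed (Suc k)) \<le> C1 * ?G" using elim(3) good(2) by blast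
        ultimately show ?thesis using False by simp
      qed (use C1(1) C2(1) bs in simp)
    qed
  qed
  then have 2: "summable (\<lambda>k. if k \<in> B then 0 else prob (exceed k))" by (subst (asm) summable_Suc_iff)
  have "summable (\<lambda>k. prob (exceed k))"
    by (rule summable_cong[THEN iffD1, OF _ summable_add[OF 1 2]]) auto
  then have "AE \<omega> in M. \<forall>\<^sub>F k in sequentially. \<omega> \<in> space M - exceed k"
    by (intro borel_cantelli_AE1) (auto simp: emeasure_eq_measure)
  then show ?thesis
  proof eventually_elim
    case (elim \<omega>)
    then obtain k1 where k1: "\<And>k. k \<ge> k1 \<Longrightarrow> \<omega> \<in> space M - exceed k" by (auto simp: eventually_sequentially)
    have "norm (\<Gamma> n *v T n \<omega>) \<le> sqrt n * \<phi> n" if n: "n \<ge> bi k1" for n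
    proof -
      obtain k where k: "k1 \<le> k" "bi k \<le> n" "n \<le> bi (Suc k)" using block_cover[OF n] by blast
      then show ?thesis using k1[OF k(1)] by (auto simp: exceed_def not_less)
    qed
    then show ?case unfolding eventually_sequentially by blast
  qed
qed

end

section \<open>Almost sure exceedance\<close>

context gaussian_walk
begin

text \<open>Whether the walk exceeds a boundary infinitely often up to a bounded error does not depend on
  finitely many steps, so Kolmogorov's zero-one law applies.\<close>

lemma zero_one_excess:
  fixes \<Gamma> :: "nat \<Rightarrow> real^'n^'n"
  assumes K: "\<forall>\<^sub>F n in sequentially. \<forall>v. norm (\<Gamma> n *v v) \<le> K * norm v" and K0: "0 \<le> K"
    and pos: "0 < prob {\<omega>\<in>space M. \<forall>m. \<exists>n\<ge>m. b n < norm (\<Gamma> n *v T n \<omega>)}"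
  shows "AE \<omega> in M. \<exists>x::nat. \<forall>m. \<exists>n\<ge>m. b n - x < norm (\<Gamma> n *v T n \<omega>)"
proof -
  define D where "D = {\<omega>\<in>space M. \<exists>x::nat. \<forall>m. \<exists>n\<ge>m. b n - x < norm (\<Gamma> n *v T n \<omega>)}"
  define D' where "D' j = {\<omega>\<in>space M. \<exists>x::nat. \<forall>m. \<exists>n\<ge>m. b n - x < norm (\<Gamma> n *v (\<Sum>i\<in>{j<..n}. Z i \<omega>))}" for j
  have Dm: "D \<in> events" unfolding D_def by measurable
  obtain n0 where n0: "\<And>n v. n \<ge> n0 \<Longrightarrow> norm (\<Gamma> n *v v) \<le> K * norm v" using K by (auto simp: eventually_sequentially)
  have shift: "\<exists>x::nat. \<forall>m. \<exists>n\<ge>m. b n - x < norm (\<Gamma> n *v g n)"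
    if fg: "\<And>n. n \<ge> j \<Longrightarrow> norm (f n - g n) \<le> R" and f: "\<exists>x::nat. \<forall>m. \<exists>n\<ge>m. b n - x < norm (\<Gamma> n *v f n)"
    for f g :: "nat \<Rightarrow> real^'n" and R and j :: nat
  proof -
    obtain x :: nat where x: "\<And>m. \<exists>n\<ge>m. b n - x < norm (\<Gamma> n *v f n)" using f by blast
    obtain y :: nat where y: "x + K * R \<le> y" using real_arch_simple by blast
    have "\<exists>n\<ge>m. b n - y < norm (\<Gamma> n *v g n)" for m
    proof -
      obtain n where n: "n \<ge> max m (max j n0)" "b n - x < norm (\<Gamma> n *v f n)" using x by blast
      have "norm (\<Gamma> n *v f n) - norm (\<Gamma> n *v g n) \<le> norm (\<Gamma> n *v (f n - g n))"
        unfolding matrix_vector_mult_diff_distrib by (rule norm_triangle_ineq2)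
      also have "\<dots> \<le> K * norm (f n - g n)" using n by (intro n0) auto
      also have "\<dots> \<le> K * R" using fg[of n] n K0 by (intro mult_left_mono) auto
      finally show ?thesis using n y by (intro exI[of _ n]) auto
    qed
    then show ?thesis by blast
  qed
  have DD: "D = D' j" for j
  proof -
    have "T n \<omega> - (\<Sum>i\<in>{j<..n}. Z i \<omega>) = T j \<omega>" if "n \<ge> j" for n \<omega> using T_diff[OF that, of \<omega>] by (simp add: algebra_simps)
    then have n: "norm (T n \<omega> - (\<Sum>i\<in>{j<..n}. Z i \<omega>)) \<le> norm (T j \<omega>)" "norm ((\<Sum>i\<in>{j<..n}. Z i \<omega>) - T n \<omega>) \<le> norm (T j \<omega>)"
      if "n \<ge> j" for n \<omega> using that by (auto simp: norm_minus_commute)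
    have "(\<exists>x::nat. \<forall>m. \<exists>n\<ge>m. b n - x < norm (\<Gamma> n *v T n \<omega>)) \<longleftrightarrow>
        (\<exists>x::nat. \<forall>m. \<exists>n\<ge>m. b n - x < norm (\<Gamma> n *v (\<Sum>i\<in>{j<..n}. Z i \<omega>)))" for \<omega>
    proof
      assume "\<exists>x::nat. \<forall>m. \<exists>n\<ge>m. b n - x < norm (\<Gamma> n *v T n \<omega>)"
      with n(1) show "\<exists>x::nat. \<forall>m. \<exists>n\<ge>m. b n - x < norm (\<Gamma> n *v (\<Sum>i\<in>{j<..n}. Z i \<omega>))"
        by (rule shift)
    next
      assume "\<exists>x::nat. \<forall>m. \<exists>n\<ge>m. b n - x < norm (\<Gamma> n *v (\<Sum>i\<in>{j<..n}. Z i \<omega>))"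
      with n(2) show "\<exists>x::nat. \<forall>m. \<exists>n\<ge>m. b n - x < norm (\<Gamma> n *v T n \<omega>)"
        by (rule shift)
    qed
    then show ?thesis unfolding D_def D'_def by simp
  qed
  define A where "A i = {Z (Suc i) -` S \<inter> space M | S. S \<in> sets borel}" for i
  have AP: "A i \<subseteq> Pow (space M)" for i by (auto simp: A_def)
  have A_sets: "A i = sets (vimage_algebra (space M) (Z (Suc i)) borel)" for i
    unfolding A_def by (subst sets_vimage_algebra2) auto
  have "prob D = 0 \<or> prob D = 1"
  proof (rule kolmogorov_0_1_law[of A])
    show "sigma_algebra (space M) (A i)" for i
      using sets.sigma_algebra_axioms[of "vimage_algebra (space M) (Z (Suc i)) borel"] unfolding A_sets by simp
    have "indep_sets (\<lambda>i. {Z i -` S \<inter> space M | S. S \<in> sets borel}) (range Suc)"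
      using Z_indep unfolding indep_vars_def2
      by (intro indep_sets_mono_index[of "range Suc" "{1..}"]) auto
    note ind = this
    show "indep_sets A UNIV"
    proof (rule indep_setsI)
      show "A i \<subseteq> events" for i unfolding A_def by auto
      fix S and J :: "nat set" assume J: "J \<noteq> {}" "finite J" "\<forall>j\<in>J. S j \<in> A j"
      have "prob (\<Inter>j\<in>Suc ` J. S (j - 1)) = (\<Prod>j\<in>Suc ` J. prob (S (j - 1)))"
        using J by (intro indep_setsD[OF ind]) (auto simp: A_def)
      then show "prob (\<Inter>j\<in>J. S j) = (\<Prod>j\<in>J. prob (S j))" by (simp add: prod.reindex)
    qed
    show "D \<in> tail_events A"
      unfolding tail_events_def
    proof (rule INT_I)
      fix j
      let ?N = "sigma (space M) (\<Union>i\<in>{j..}. A i)"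
      have N: "sets ?N = sigma_sets (space M) (\<Union>i\<in>{j..}. A i)" using AP by (intro sets_measure_of) auto
      have sN: "space ?N = space M" using AP by (intro space_measure_of) auto
      have Zm: "Z i \<in> borel_measurable ?N" if "i > j" for i
      proof (rule measurableI)
        fix S :: "(real^'n) set" assume "S \<in> sets borel"
        then have "Z i -` S \<inter> space M \<in> A (i - 1)" using that by (auto simp: A_def)
        then show "Z i -` S \<inter> space ?N \<in> sets ?N" unfolding N sN using that by (intro sigma_sets.Basic UN_I[of "i - 1"]) auto
      qed simp
      have "(\<lambda>\<omega>. \<Sum>i\<in>{j<..n}. Z i \<omega>) \<in> borel_measurable ?N" for n
        by (intro borel_measurable_sum Zm) simp
      then have [measurable]: "(\<lambda>\<omega>. \<Sum>i\<in>{j<..n}. Z i \<omega>) \<in> borel_measurable ?N" for n .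
      have "{\<omega>\<in>space ?N. \<exists>x::nat. \<forall>m. \<exists>n\<ge>m. b n - x < norm (\<Gamma> n *v (\<Sum>i\<in>{j<..n}. Z i \<omega>))} \<in> sets ?N" by measurable
      then have "D' j \<in> sets ?N" unfolding D'_def sN .
      then show "D \<in> sigma_sets (space M) (\<Union> (A ` {j..}))" unfolding DD[of j] N .
    qed
  qed
  moreover have "prob {\<omega>\<in>space M. \<forall>m. \<exists>n\<ge>m. b n < norm (\<Gamma> n *v T n \<omega>)} \<le> prob D"
  proof (rule finite_measure_mono[OF _ Dm], rule subsetI)
    fix \<omega> assume "\<omega> \<in> {\<omega>\<in>space M. \<forall>m. \<exists>n\<ge>m. b n < norm (\<Gamma> n *v T n \<omega>)}"
    then have "\<omega> \<in> space M" "\<forall>m. \<exists>n\<ge>m. b n - real 0 < norm (\<Gamma> n *v T n \<omega>)" by auto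
    then show "\<omega> \<in> D" unfolding D_def by blast
  qed
  ultimately have "prob D = 1" using pos by linarith
  then have "AE \<omega> in M. \<omega> \<in> D" using Dm by (simp add: prob_eq_1)
  then show ?thesis by eventually_elim (simp add: D_def)
qed

end

context threshold_walk
begin

definition hits :: "nat \<Rightarrow> 'a set" where
  "hits k = {\<omega>\<in>space M. sqrt (bi k) * \<phi> (bi k) < norm (\<Gamma> (bi k) *v T (bi k) \<omega>)}"

lemma hits_measurable [measurable]: "hits k \<in> events"
  unfolding hits_def by measurable

lemma prob_hits: "regular k \<Longrightarrow> prob (hits k) = gtail (\<Gamma> (bi k)) (\<phi> (bi k))"
  unfolding hits_def using reg_bi(1) by (intro prob_T_tail) auto

lemma bi_strict:
  assumes "regular j" "j < k" shows "bi j < bi k"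
proof -
  have "0 < real (bi (Suc j)) / (32 * ln j)" using reg_bi(3)[OF assms(1)] reg(3)[OF assms(1)] by simp
  then have "bi j < bi (Suc j)" using reg(5)[OF assms(1)] by linarith
  also have "\<dots> \<le> bi k" using assms reg(1)[OF assms(1)] by (intro bi_mono) auto
  finally show ?thesis .
qed

lemma hits_pair:
  assumes j: "regular j" and jk: "j < k"
  defines "X \<equiv> \<lambda>\<omega>. T (bi j) \<omega> /\<^sub>R sqrt (bi j)" and "W \<equiv> \<lambda>\<omega>. (T (bi k) \<omega> - T (bi j) \<omega>) /\<^sub>R sqrt (real (bi k) - real (bi j))"
    and "\<rho> \<equiv> sqrt (bi j / bi k)"
  shows "hits j \<inter> hits k = {\<omega>\<in>space M. \<phi> (bi j) < norm (\<Gamma> (bi j) *v X \<omega>) \<and> \<phi> (bi k) < norm (\<Gamma> (bi k) *v (\<rho> *\<^sub>R X \<omega> + sqrt (1 - \<rho>\<^sup>2) *\<^sub>R W \<omega>))}"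
    "indep_var borel X borel W" "distr M borel X = gauss 1" "distr M borel W = gauss 1" "0 \<le> \<rho>" "\<rho> < 1"
proof -
  have b: "1 \<le> bi j" "bi j < bi k" using reg_bi[OF j] bi_strict[OF j jk] by auto
  note wp = walk_pair[OF b]
  show "indep_var borel X borel W" "distr M borel X = gauss 1" "distr M borel W = gauss 1"
    unfolding X_def W_def by (rule wp)+
  show "0 \<le> \<rho>" "\<rho> < 1" using b by (auto simp: \<rho>_def)
  have sc: "sqrt n * t < norm (A *v v) \<longleftrightarrow> t < norm (A *v (v /\<^sub>R sqrt n))" if "n \<ge> 1" for n :: nat and t and A :: "real^'n^'n" and v
    using that by (simp add: matrix_vector_mult_scaleR field_simps)
  show "hits j \<inter> hits k = {\<omega>\<in>space M. \<phi> (bi j) < norm (\<Gamma> (bi j) *v X \<omega>) \<and> \<phi> (bi k) < norm (\<Gamma> (bi k) *v (\<rho> *\<^sub>R X \<omega> + sqrt (1 - \<rho>\<^sup>2) *\<^sub>R W \<omega>))}"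
    unfolding X_def W_def \<rho>_def wp(4)[symmetric] hits_def using sc[OF b(1)] sc[of "bi k"] b by auto
qed

lemma sqrt_bi_ratio:
  assumes h: "\<forall>j. 8 \<le> j \<longrightarrow> j < k \<longrightarrow> real (bi j) / real (bi k) \<le> exp (- (real k - real j) / (4 * ln k))" and "8 \<le> j" "j < k"
  shows "sqrt (bi j / bi k) \<le> exp (- ((real k - real j) / (8 * ln k)))"
proof (rule real_le_lsqrt)
  have "(exp (- ((real k - real j) / (8 * ln k))))\<^sup>2 = exp (- (real k - real j) / (4 * ln k))"
    by (simp add: power2_eq_square exp_add[symmetric] diff_divide_distrib field_simps)
  then show "real (bi j) / real (bi k) \<le> (exp (- ((real k - real j) / (8 * ln k))))\<^sup>2" using h assms(2,3) by simp
qed auto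

text \<open>The correlation \<open>\<rho>\<close> of the two times satisfies \<open>1 - \<rho> \<ge> \<mu> / 32\<close> with \<open>\<mu> = 1 \<and> (k - j) / ln j\<close>, and \<open>\<phi>\<^sup>2\<close> is at least of
  order \<open>ln j\<close>, so \<open>gauss_near_pair\<close> gains \<open>exp (- c' (k - j))\<close> or \<open>exp (- c' ln j)\<close>. It requires the two quadratic forms to
  differ by at most \<open>\<epsilon> \<mu>\<close>: up to \<open>ln j\<close> blocks apart, each good block contributes \<open>\<epsilon> / ln j\<close>; beyond that, convergence of the
  matrices suffices.\<close>

lemma hits_near:
  "\<exists>\<epsilon>\<in>{0<..1}. \<exists>C\<ge>1. \<exists>c>0. \<forall>\<^sub>F j in sequentially. \<forall>k>j. j \<notin> before (bad \<epsilon>) \<longrightarrow> real k \<le> real j + 4 * (ln (real j))\<^sup>2 \<longrightarrow>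
     prob (hits j \<inter> hits k) \<le> C * prob (hits j) * (exp (- c * (real k - real j)) + exp (- c * ln (real j)))"
proof -
  obtain C c \<epsilon> where near: "C \<ge> 1" "c > 0" "\<epsilon> > 0" and near_pair: "\<forall>A\<in>(spectral_class (\<sigma> / 2) (2 * \<sigma>) :: (real^'n^'n) set).
     \<forall>B\<in>spectral_class (\<sigma> / 2) (2 * \<sigma>). \<forall>f\<ge>2 * \<sigma>. \<forall>g\<ge>f. \<forall>\<rho> \<Delta> X W.
     0 \<le> \<rho> \<longrightarrow> \<rho> < 1 \<longrightarrow> 0 \<le> \<Delta> \<longrightarrow> \<Delta> \<le> \<epsilon> * (1 - \<rho>) \<longrightarrow> (\<forall>x. (norm (B *v x))\<^sup>2 \<le> (norm (A *v x))\<^sup>2 + \<Delta> * (norm x)\<^sup>2) \<longrightarrow>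
     indep_var borel X borel W \<longrightarrow> distr M borel X = gauss 1 \<longrightarrow> distr M borel W = gauss 1 \<longrightarrow>
     prob {\<omega>\<in>space M. f < norm (A *v X \<omega>) \<and> g < norm (B *v (\<rho> *\<^sub>R X \<omega> + sqrt (1 - \<rho>\<^sup>2) *\<^sub>R W \<omega>))}
       \<le> C * gtail A f * exp (- c * (1 - \<rho>) * f\<^sup>2)"
    using gauss_near_pair[OF s_class(1,2), where 'n='n] by (elim exE conjE) (rule that)
  define e where "e = min 1 (\<epsilon> / 32)"
  have e: "e \<in> {0<..1}" "e \<le> \<epsilon> / 32" "0 < e" using near by (auto simp: e_def)
  define c' where "c' = c * c0\<^sup>2 / 64"
  have c': "c' > 0" using near c0 by (simp add: c'_def)
  have ev1: "\<forall>\<^sub>F j in sequentially. \<forall>k\<ge>j. regular k" by (rule eventually_all_ge_at_top[OF eventually_regular])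
  have ev2: "\<forall>\<^sub>F j in sequentially. \<forall>k\<ge>j. \<forall>j. 8 \<le> j \<longrightarrow> j < k \<longrightarrow> real (bi j) / real (bi k) \<le> exp (- (real k - real j) / (4 * ln k))"
    by (rule eventually_all_ge_at_top[OF bi_ratio_upper])
  have ev3: "\<forall>\<^sub>F j in sequentially. \<forall>m\<ge>bi j. \<forall>n\<ge>bi j. \<forall>x. (norm (\<Gamma> n *v x))\<^sup>2 \<le> (norm (\<Gamma> m *v x))\<^sup>2 + e * (norm x)\<^sup>2"
    by (rule eventually_compose_filterlim[OF form_close[OF e(3)] bi_at_top])
  have ev4: "\<forall>\<^sub>F j in sequentially. ln (real j + 4 * (ln (real j))\<^sup>2) \<le> 2 * ln (real j)" by real_asymp
  have "\<forall>\<^sub>F j in sequentially. \<forall>k>j. j \<notin> before (bad e) \<longrightarrow> real k \<le> real j + 4 * (ln (real j))\<^sup>2 \<longrightarrow>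
     prob (hits j \<inter> hits k) \<le> C * prob (hits j) * (exp (- c' * (real k - real j)) + exp (- c' * ln (real j)))"
    using ev1 ev2 ev3 ev4 eventually_phi_large[of "2 * \<sigma>"]
  proof eventually_elim
    case (elim j)
    show ?case
    proof (intro allI impI)
      fix k assume jk: "j < k" and good: "j \<notin> before (bad e)" and kn: "real k \<le> real j + 4 * (ln (real j))\<^sup>2"
      have rj: "regular j" and rk: "regular k" using elim(1) jk by auto
      have lj: "4 \<le> ln (real j)" "8 \<le> j" using reg(1,3)[OF rj] by auto
      have lk: "0 < ln (real k)" "ln (real k) \<le> 2 * ln (real j)"
      proof -
        show "0 < ln (real k)" using reg(3)[OF rk] by linarith
        have "ln (real k) \<le> ln (real j + 4 * (ln (real j))\<^sup>2)" using kn jk lj by (subst ln_le_cancel_iff) auto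
        then show "ln (real k) \<le> 2 * ln (real j)" using elim(4) by linarith
      qed
      note hp = hits_pair[OF rj jk]
      let ?\<rho> = "sqrt (bi j / bi k)"
      define \<mu> where "\<mu> = min 1 ((real k - real j) / ln (real j))"
      have \<mu>0: "0 \<le> \<mu>" using jk lj by (simp add: \<mu>_def)
      have \<theta>: "\<mu> / 32 \<le> 1 - ?\<rho>"
      proof -
        define z where "z = (real k - real j) / (8 * ln k)"
        define y where "y = (real k - real j) / ln j"
        define w where "w = min 1 z"
        have z0: "0 \<le> z" using jk lk by (simp add: z_def)
        have "(real k - real j) / (16 * ln j) \<le> z" unfolding z_def using jk lk lj by (intro divide_left_mono) auto
        then have yz: "y / 16 \<le> z" by (simp add: y_def)
        have "\<mu> \<le> 1" "\<mu> \<le> y" unfolding \<mu>_def y_def by simp_all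
        then have "\<mu> / 16 \<le> 1" "\<mu> / 16 \<le> z" using yz by linarith+
        then have "\<mu> / 16 \<le> w" unfolding w_def by (rule min.boundedI)
        moreover have "w / 2 \<le> 1 - exp (- z)" unfolding w_def by (rule one_minus_exp_neg[OF z0])
        moreover have "?\<rho> \<le> exp (- z)" unfolding z_def using elim(2) jk lj by (intro sqrt_bi_ratio) auto
        ultimately show ?thesis by linarith
      qed
      have chain: "(norm (\<Gamma> (bi i) *v x))\<^sup>2 \<le> (norm (\<Gamma> (bi j) *v x))\<^sup>2 + (real i - real j) * (e / ln (real j)) * (norm x)\<^sup>2"
        if "j \<le> i" "i \<le> k" for i x
        using that
      proof (induction i rule: dec_induct)
        case (step i)
        have ri: "regular i" using elim(1) step by auto
        have gi: "i \<notin> bad e"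
        proof
          assume "i \<in> bad e"
          then have "j \<in> before (bad e)" using step kn unfolding before_def by (auto intro!: exI[of _ i])
          then show False using good by simp
        qed
        have "(norm (\<Gamma> (bi (Suc i)) *v x))\<^sup>2 \<le> (norm (\<Gamma> (bi i) *v x))\<^sup>2 + e / ln (real i) * (norm x)\<^sup>2"
          using reg_bi(2)[OF ri] by (intro reg_good_form[OF ri gi]) auto
        also have "\<dots> \<le> (norm (\<Gamma> (bi i) *v x))\<^sup>2 + e / ln (real j) * (norm x)\<^sup>2"
          using step lj e by (intro add_left_mono mult_right_mono divide_left_mono) auto
        also have "\<dots> \<le> (norm (\<Gamma> (bi j) *v x))\<^sup>2 + (real i - real j) * (e / ln (real j)) * (norm x)\<^sup>2 + e / ln (real j) * (norm x)\<^sup>2"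
          using step by (intro add_right_mono) auto
        also have "\<dots> = (norm (\<Gamma> (bi j) *v x))\<^sup>2 + (real (Suc i) - real j) * (e / ln (real j)) * (norm x)\<^sup>2"
        proof -
          have "(real i - real j) * a * b + a * b = (real (Suc i) - real j) * a * b" for a b :: real by (simp add: algebra_simps)
          from this[of "e / ln (real j)" "(norm x)\<^sup>2"] show ?thesis by (simp only: add.assoc)
        qed
        finally show ?case .
      qed simp
      have form: "(norm (\<Gamma> (bi k) *v x))\<^sup>2 \<le> (norm (\<Gamma> (bi j) *v x))\<^sup>2 + (e * \<mu>) * (norm x)\<^sup>2" for x
      proof (cases "1 \<le> (real k - real j) / ln (real j)")
        case True
        then show ?thesis using elim(3) bi_strict[OF rj jk] by (simp add: \<mu>_def)
      next
        case False
        then show ?thesis using chain[of k x] jk by (simp add: \<mu>_def mult.commute)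
      qed
      have "e * \<mu> \<le> \<epsilon> / 32 * \<mu>" using e \<mu>0 by (intro mult_right_mono) auto
      also have "\<dots> = \<epsilon> * (\<mu> / 32)" by simp
      also have "\<dots> \<le> \<epsilon> * (1 - ?\<rho>)" using \<theta> near by (intro mult_left_mono) auto
      finally have \<Delta>: "e * \<mu> \<le> \<epsilon> * (1 - ?\<rho>)" .
      have f: "2 * \<sigma> \<le> \<phi> (bi j)" using elim(5) reg_bi[OF rj] by auto
      have fg: "\<phi> (bi j) \<le> \<phi> (bi k)" using reg(2)[OF rj] bi_strict[OF rj jk] by (intro mono) auto
      have "prob (hits j \<inter> hits k) \<le> C * gtail (\<Gamma> (bi j)) (\<phi> (bi j)) * exp (- c * (1 - ?\<rho>) * (\<phi> (bi j))\<^sup>2)"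
        unfolding hp(1)
        by (rule near_pair[rule_format])
          (use f fg hp(2-6) \<Delta> form e \<mu>0 reg_class[OF rj order_refl] reg_class[OF rk order_refl] in auto)
      also have "\<dots> = C * prob (hits j) * exp (- c * (1 - ?\<rho>) * (\<phi> (bi j))\<^sup>2)" by (simp add: prob_hits[OF rj])
      also have "\<dots> \<le> C * prob (hits j) * (exp (- c' * (real k - real j)) + exp (- c' * ln (real j)))"
      proof (intro mult_left_mono)
        have "c' * (\<mu> * ln (real j)) = c * (\<mu> / 32) * (c0\<^sup>2 * ln (real j) / 2)" by (simp add: c'_def)
        also have "\<dots> \<le> c * (1 - ?\<rho>) * (\<phi> (bi j))\<^sup>2"
          using \<theta> near(2) \<mu>0 lj reg_phi(2)[OF rj order_refl reg_bi(2)[OF rj]] hp(6) by (intro mult_mono) auto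
        finally have "exp (- c * (1 - ?\<rho>) * (\<phi> (bi j))\<^sup>2) \<le> exp (- (c' * (\<mu> * ln (real j))))" by simp
        also have "\<dots> \<le> exp (- c' * (real k - real j)) + exp (- c' * ln (real j))"
          using lj by (cases "1 \<le> (real k - real j) / ln (real j)") (auto simp: \<mu>_def min_def)
        finally show "exp (- c * (1 - ?\<rho>) * (\<phi> (bi j))\<^sup>2) \<le> exp (- c' * (real k - real j)) + exp (- c' * ln (real j))" .
      qed (use near(1) in simp)
      finally show "prob (hits j \<inter> hits k) \<le> C * prob (hits j) * (exp (- c' * (real k - real j)) + exp (- c' * ln (real j)))" .
    qed
  qed
  then show ?thesis using near(1) c' e by blast
qed

text \<open>After \<open>4 (ln j)\<^sup>2\<close> blocks the correlation, at most \<open>exp (- (k - j) / (8 ln k))\<close>, is smaller than \<open>1 / \<phi>\<^sup>2\<close>, which is of order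
  \<open>1 / ln k\<close>.\<close>

lemma hits_far:
  "\<exists>C\<ge>1. \<forall>\<^sub>F j in sequentially. \<forall>k>j. real j + 4 * (ln (real j))\<^sup>2 < real k \<longrightarrow> prob (hits j \<inter> hits k) \<le> C * prob (hits j) * prob (hits k)"
proof -
  obtain C t0 where far: "C \<ge> 1" and far_pair: "\<forall>A\<in>(spectral_class (\<sigma> / 2) (2 * \<sigma>) :: (real^'n^'n) set).
     \<forall>B\<in>spectral_class (\<sigma> / 2) (2 * \<sigma>). \<forall>f\<ge>t0. \<forall>g\<ge>f. \<forall>\<rho> X W. 0 \<le> \<rho> \<longrightarrow> \<rho> < 1 \<longrightarrow> \<rho> * g\<^sup>2 \<le> 1 \<longrightarrow>
     indep_var borel X borel W \<longrightarrow> distr M borel X = gauss 1 \<longrightarrow> distr M borel W = gauss 1 \<longrightarrow>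
     prob {\<omega>\<in>space M. f < norm (A *v X \<omega>) \<and> g < norm (B *v (\<rho> *\<^sub>R X \<omega> + sqrt (1 - \<rho>\<^sup>2) *\<^sub>R W \<omega>))}
       \<le> C * gtail A f * gtail B g"
    using gauss_far_pair[OF s_class(1,2), where 'n='n] by (elim exE conjE) (rule that)
  have ev1: "\<forall>\<^sub>F j in sequentially. \<forall>k\<ge>j. regular k" by (rule eventually_all_ge_at_top[OF eventually_regular])
  have ev2: "\<forall>\<^sub>F j in sequentially. \<forall>k\<ge>j. \<forall>j. 8 \<le> j \<longrightarrow> j < k \<longrightarrow> real (bi j) / real (bi k) \<le> exp (- (real k - real j) / (4 * ln k))"
    by (rule eventually_all_ge_at_top[OF bi_ratio_upper])
  have ev3: "\<forall>\<^sub>F j in sequentially. C0\<^sup>2 * (2 * ln (real j)) \<le> exp (ln (real j) / 4)" by real_asymp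
  have "\<forall>\<^sub>F k in sequentially. C0\<^sup>2 * ln (real k) \<le> exp (real k / (16 * ln (real k)))" by real_asymp
  then have ev4: "\<forall>\<^sub>F j in sequentially. \<forall>k\<ge>j. C0\<^sup>2 * ln (real k) \<le> exp (real k / (16 * ln (real k)))" by (rule eventually_all_ge_at_top)
  have "\<forall>\<^sub>F j in sequentially. \<forall>k>j. real j + 4 * (ln (real j))\<^sup>2 < real k \<longrightarrow> prob (hits j \<inter> hits k) \<le> C * prob (hits j) * prob (hits k)"
    using ev1 ev2 ev3 ev4 eventually_phi_large[of t0]
  proof eventually_elim
    case (elim j)
    show ?case
    proof (intro allI impI)
      fix k assume jk: "j < k" and kn: "real j + 4 * (ln (real j))\<^sup>2 < real k"
      have rj: "regular j" and rk: "regular k" using elim(1) jk by auto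
      have lj: "4 \<le> ln (real j)" "8 \<le> j" using reg(1,3)[OF rj] by auto
      have lk: "0 < ln (real k)" using reg(3)[OF rk] by linarith
      note hp = hits_pair[OF rj jk]
      let ?\<rho> = "sqrt (bi j / bi k)" and ?z = "(real k - real j) / (8 * ln k)"
      have main: "C0\<^sup>2 * ln (real k) \<le> exp ?z"
      \<comment> \<open>as long as \<open>ln k\<close> and \<open>ln j\<close> are comparable the assumed distance counts, afterwards \<open>k\<close> itself\<close>
      proof (cases "real k \<le> (real j)\<^sup>2")
        case True
        have "ln (real k) \<le> ln ((real j)\<^sup>2)" using True jk lj by (subst ln_le_cancel_iff) auto
        then have l2: "ln (real k) \<le> 2 * ln (real j)" using lj by (simp add: ln_realpow)
        have "C0\<^sup>2 * ln (real k) \<le> C0\<^sup>2 * (2 * ln (real j))" using l2 by (intro mult_left_mono) auto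
        also have "\<dots> \<le> exp (ln (real j) / 4)" by (rule elim(3))
        also have "\<dots> \<le> exp ?z"
        proof -
          have "ln (real j) / 4 = 4 * (ln (real j))\<^sup>2 / (8 * (2 * ln (real j)))" using lj by (simp add: power2_eq_square)
          also have "\<dots> \<le> (real k - real j) / (8 * ln k)" using kn l2 lk lj jk by (intro frac_le) auto
          finally show ?thesis by simp
        qed
        finally show ?thesis .
      next
        case False
        have "2 * real j \<le> (real j)\<^sup>2" using lj by (simp add: power2_eq_square)
        then have "real k / 2 \<le> real k - real j" using False by linarith
        then have "real k / 2 / (8 * ln k) \<le> ?z" using lk by (intro divide_right_mono) auto
        then have "exp (real k / (16 * ln (real k))) \<le> exp ?z" by simp
        moreover have "C0\<^sup>2 * ln (real k) \<le> exp (real k / (16 * ln (real k)))" using elim(4) jk by auto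
        ultimately show ?thesis by linarith
      qed
      have "?\<rho> * (\<phi> (bi k))\<^sup>2 \<le> exp (- ?z) * (C0\<^sup>2 * ln (real k))"
        using elim(2) jk lj lk reg_phi(3)[OF rk order_refl reg_bi(2)[OF rk]] by (intro mult_mono sqrt_bi_ratio) auto
      also have "\<dots> \<le> exp (- ?z) * exp ?z" using main by (intro mult_left_mono) auto
      also have "\<dots> = 1" by (simp add: exp_minus)
      finally have r: "?\<rho> * (\<phi> (bi k))\<^sup>2 \<le> 1" .
      have f: "t0 \<le> \<phi> (bi j)" using elim(5) reg_bi[OF rj] by auto
      have fg: "\<phi> (bi j) \<le> \<phi> (bi k)" using reg(2)[OF rj] bi_strict[OF rj jk] by (intro mono) auto
      have "prob (hits j \<inter> hits k) \<le> C * gtail (\<Gamma> (bi j)) (\<phi> (bi j)) * gtail (\<Gamma> (bi k)) (\<phi> (bi k))"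
        unfolding hp(1)
        by (rule far_pair[rule_format])
          (use f fg hp(2-6) r reg_class[OF rj order_refl] reg_class[OF rk order_refl] in auto)
      then show "prob (hits j \<inter> hits k) \<le> C * prob (hits j) * prob (hits k)" by (simp add: prob_hits[OF rj] prob_hits[OF rk])
    qed
  qed
  then show ?thesis using far by blast
qed

text \<open>Only times \<open>n\<^sub>k\<close> are used, and only blocks that are not followed too soon by a bad one. The discarded
  set is thin, so the probabilities of the remaining events \<open>E\<close> still have divergent sum. For fixed \<open>j\<close> the near
  terms sum to a constant times \<open>prob (E j)\<close> and the far terms factorize, as the second moment method requires.\<close>

lemma infinitely_often_positive:
  assumes ns: "\<not> summable weighted_tail"
  shows "0 < prob {\<omega>\<in>space M. \<forall>m. \<exists>n\<ge>m. sqrt n * \<phi> n < norm (\<Gamma> n *v T n \<omega>)}"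
proof -
  obtain \<epsilon> Cn c where near: "\<epsilon> \<in> {0<..1}" "Cn \<ge> 1" "c > 0" "\<forall>\<^sub>F j in sequentially. \<forall>k>j. j \<notin> before (bad \<epsilon>) \<longrightarrow> real k \<le> real j + 4 * (ln (real j))\<^sup>2 \<longrightarrow>
     prob (hits j \<inter> hits k) \<le> Cn * prob (hits j) * (exp (- c * (real k - real j)) + exp (- c * ln (real j)))"
    using hits_near by blast
  obtain Cf where far: "Cf \<ge> 1" "\<forall>\<^sub>F j in sequentially. \<forall>k>j. real j + 4 * (ln (real j))\<^sup>2 < real k \<longrightarrow> prob (hits j \<inter> hits k) \<le> Cf * prob (hits j) * prob (hits k)"
    using hits_far by blast
  define B where "B = before (bad \<epsilon>)"
  have B: "thin B" unfolding B_def using near(1) by (intro thin_before thin_bad) auto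
  have Bbad: "k \<notin> bad 1" if "k \<notin> B" "8 \<le> k" for k
  proof
    assume "k \<in> bad 1"
    moreover have "\<epsilon> / ln (real k) \<le> 1 / ln (real k)" using near(1) that by (intro divide_right_mono) auto
    ultimately have "k \<in> bad \<epsilon>" unfolding bad_def by auto
    then have "k \<in> B" unfolding B_def before_def by (auto intro!: exI[of _ k])
    then show False using that by simp
  qed
  define E where "E k = (if k \<in> B then {} else hits k)" for k
  have E: "E k \<in> events" for k by (simp add: E_def)
  have nsE: "\<not> summable (\<lambda>k. prob (E k))"
  proof
    assume sE: "summable (\<lambda>k. prob (E k))"
    obtain C2 where C2: "C2 \<ge> 1" "\<forall>\<^sub>F k in sequentially. k \<notin> bad 1 \<longrightarrow> (\<forall>m n. bi k \<le> m \<longrightarrow> m \<le> bi (Suc k) \<longrightarrow> bi k \<le> n \<longrightarrow> n \<le> bi (Suc k) \<longrightarrow>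
       gtail (\<Gamma> m) (\<phi> n) \<le> C2 * gtail (\<Gamma> n) (\<phi> n))"
      using block_compare by blast
    obtain C3 \<delta> where C3: "C3 \<ge> 1" "\<delta> > 0" "\<forall>\<^sub>F k in sequentially. \<forall>m n. bi k \<le> m \<longrightarrow> bi k \<le> n \<longrightarrow> n \<le> bi (Suc k) \<longrightarrow> gtail (\<Gamma> m) (\<phi> n) \<le> C3 * real k powr (- \<delta>)"
      using gtail_crude by blast
    have "summable (\<lambda>k. 4 * C2 * prob (E k) + 4 * C3 * (if k \<in> B then real k powr (- \<delta>) else 0))"
      using B C3(2) by (intro summable_add summable_mult sE) (auto simp: thin_def)
    then have "summable (block_sum weighted_tail)"
    proof (rule summable_comparison_test_ev[rotated])
      show "\<forall>\<^sub>F k in sequentially. norm (block_sum weighted_tail k) \<le> 4 * C2 * prob (E k) + 4 * C3 * (if k \<in> B then real k powr (- \<delta>) else 0)"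
        using eventually_regular C2(2) C3(3)
      proof eventually_elim
        case (elim k)
        note r = elim(1)
        have b0: "0 \<le> block_sum weighted_tail k" unfolding block_sum_def by (intro sum_nonneg weighted_tail_nonneg)
        have bnd: "block_sum weighted_tail k \<le> 4 * H" if H: "\<And>m. m \<in> {bi k..<bi (Suc k)} \<Longrightarrow> gtail (\<Gamma> m) (\<phi> m) \<le> H" "0 \<le> H" for H
        proof -
          have "block_sum weighted_tail k \<le> (\<Sum>m\<in>{bi k..<bi (Suc k)}. iter_log m / m * H)"
            unfolding block_sum_def weighted_tail_def
          proof (intro sum_mono mult_left_mono H(1))
            fix m show "0 \<le> iter_log m / real m" using iter_log_ge_1[of m] by simp
          qed
          also have "\<dots> = (\<Sum>m\<in>{bi k..<bi (Suc k)}. iter_log m / m) * H" by (simp only: sum_distrib_right)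
          also have "\<dots> \<le> 4 * H" by (intro mult_right_mono reg_weights(2)[OF r] H(2))
          finally show ?thesis .
        qed
        show ?case
        proof (cases "k \<in> B")
          case True
          have "block_sum weighted_tail k \<le> 4 * (C3 * real k powr (- \<delta>))"
            using elim(3) C3(1) by (intro bnd) auto
          then show ?thesis using True b0 by (simp add: E_def)
        next
          case False
          have g: "k \<notin> bad 1" using False reg(1)[OF r] by (rule Bbad)
          have "block_sum weighted_tail k \<le> 4 * (C2 * gtail (\<Gamma> (bi k)) (\<phi> (bi k)))"
          proof (intro bnd)
            fix m assume m: "m \<in> {bi k..<bi (Suc k)}"
            have "gtail (\<Gamma> m) (\<phi> m) \<le> gtail (\<Gamma> m) (\<phi> (bi k))" using m reg(2)[OF r] by (intro gtail_antimono mono) auto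
            also have "\<dots> \<le> C2 * gtail (\<Gamma> (bi k)) (\<phi> (bi k))" using elim(2) g m reg_bi(2)[OF r] by auto
            finally show "gtail (\<Gamma> m) (\<phi> m) \<le> C2 * gtail (\<Gamma> (bi k)) (\<phi> (bi k))" .
          next
            show "0 \<le> C2 * gtail (\<Gamma> (bi k)) (\<phi> (bi k))" using C2(1) by (intro mult_nonneg_nonneg gtail_nonneg) auto
          qed
          then show ?thesis using False b0 by (simp add: E_def prob_hits[OF r])
        qed
      qed
    qed
    then have "summable weighted_tail" by (rule summable_block_sum_iff[THEN iffD1, rotated]) (rule weighted_tail_nonneg)
    then show False using ns by simp
  qed
  have geo: "summable (\<lambda>m. exp (- c) ^ m)" using near(3) by (intro summable_geometric) simp
  define Q where "Q = (\<Sum>m. exp (- c) ^ m)"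
  have ev: "\<forall>\<^sub>F j in sequentially. (4 * (ln (real j))\<^sup>2) * exp (- c * ln (real j)) \<le> 1" using near(3) by real_asymp
  obtain k0 where k0: "\<And>j. j \<ge> k0 \<Longrightarrow> regular j"
    "\<And>j k. j \<ge> k0 \<Longrightarrow> j < k \<Longrightarrow> j \<notin> B \<Longrightarrow> real k \<le> real j + 4 * (ln (real j))\<^sup>2 \<Longrightarrow>
     prob (hits j \<inter> hits k) \<le> Cn * prob (hits j) * (exp (- c * (real k - real j)) + exp (- c * ln (real j)))"
    "\<And>j k. j \<ge> k0 \<Longrightarrow> j < k \<Longrightarrow> real j + 4 * (ln (real j))\<^sup>2 < real k \<Longrightarrow> prob (hits j \<inter> hits k) \<le> Cf * prob (hits j) * prob (hits k)"
    "\<And>j. j \<ge> k0 \<Longrightarrow> (4 * (ln (real j))\<^sup>2) * exp (- c * ln (real j)) \<le> 1"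
  proof -
    have "\<forall>\<^sub>F j in sequentially. regular j \<and> (\<forall>k>j. j \<notin> B \<longrightarrow> real k \<le> real j + 4 * (ln (real j))\<^sup>2 \<longrightarrow>
     prob (hits j \<inter> hits k) \<le> Cn * prob (hits j) * (exp (- c * (real k - real j)) + exp (- c * ln (real j)))) \<and>
     (\<forall>k>j. real j + 4 * (ln (real j))\<^sup>2 < real k \<longrightarrow> prob (hits j \<inter> hits k) \<le> Cf * prob (hits j) * prob (hits k)) \<and>
     (4 * (ln (real j))\<^sup>2) * exp (- c * ln (real j)) \<le> 1"
      using eventually_regular near(4) far(2) ev unfolding B_def by eventually_elim blast
    then show ?thesis unfolding eventually_sequentially using that by blast
  qed
  define C where "C = max Cf (Cn * (Q + 1))"
  have Q0: "0 \<le> Q" unfolding Q_def using geo by (intro suminf_nonneg) auto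
  have C0': "0 \<le> C" using far(1) by (simp add: C_def le_max_iff_disj)
  have pairs: "(\<Sum>k\<in>{j<..N}. prob (E j \<inter> E k)) \<le> C * prob (E j) * (1 + (\<Sum>k\<in>{k0..N}. prob (E k)))" if j: "k0 \<le> j" for j N
  proof (cases "j \<in> B")
    case True
    then show ?thesis by (simp add: E_def)
  next
    case False
    let ?w = "4 * (ln (real j))\<^sup>2"
    have pj: "prob (E j) = prob (hits j)" using False by (simp add: E_def)
    have each: "prob (E j \<inter> E k) \<le> Cn * prob (E j) * (exp (- c) ^ (k - j) + (if real k \<le> real j + ?w then exp (- c * ln (real j)) else 0)) + Cf * prob (E j) * prob (E k)"
      if k: "k \<in> {j<..N}" for k
    proof (cases "k \<in> B")
      case True
      then show ?thesis using near(2) far(1) by (auto simp: E_def intro!: mult_nonneg_nonneg add_nonneg_nonneg)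
    next
      case kB: False
      have pk: "prob (E k) = prob (hits k)" "prob (E j \<inter> E k) = prob (hits j \<inter> hits k)" using False kB by (auto simp: E_def)
      show ?thesis
      proof (cases "real k \<le> real j + ?w")
        case True
        have "exp (- c * (real k - real j)) = exp (- c) ^ (k - j)"
          using k by (simp add: exp_of_nat_mult[symmetric] of_nat_diff mult.commute)
        then have "prob (E j \<inter> E k) \<le> Cn * prob (E j) * (exp (- c) ^ (k - j) + exp (- c * ln (real j)))"
          using k0(2)[OF j _ False True] k by (simp add: pk pj)
        moreover have "0 \<le> Cf * prob (E j) * prob (E k)" using far(1) by simp
        ultimately show ?thesis using True by simp
      next
        case nt: False
        have "prob (E j \<inter> E k) \<le> Cf * prob (E j) * prob (E k)" using k0(3)[OF j] k nt by (simp add: pk pj)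
        moreover have "0 \<le> Cn * prob (E j) * exp (- c) ^ (k - j)" using near(2) by simp
        ultimately show ?thesis using nt by simp
      qed
    qed
    have s1: "(\<Sum>k\<in>{j<..N}. exp (- c) ^ (k - j)) \<le> Q"
    proof -
      have "(\<Sum>k\<in>{j<..N}. exp (- c) ^ (k - j)) = (\<Sum>m\<in>(\<lambda>k. k - j) ` {j<..N}. exp (- c) ^ m)"
        by (subst sum.reindex) (auto simp: inj_on_def)
      also have "\<dots> \<le> Q" unfolding Q_def using geo by (intro sum_le_suminf) auto
      finally show ?thesis .
    qed
    have s2: "(\<Sum>k\<in>{j<..N}. (if real k \<le> real j + ?w then exp (- c * ln (real j)) else 0)) \<le> 1"
    proof -
      have "(\<Sum>k\<in>{j<..N}. (if real k \<le> real j + ?w then exp (- c * ln (real j)) else 0))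
          = (\<Sum>k\<in>{k\<in>{j<..N}. real k \<le> real j + ?w}. exp (- c * ln (real j)))" by (rule sum.inter_filter[symmetric]) simp
      also have "\<dots> = real (card {k\<in>{j<..N}. real k \<le> real j + ?w}) * exp (- c * ln (real j))" by simp
      also have "\<dots> \<le> ?w * exp (- c * ln (real j))"
      proof (intro mult_right_mono)
        have "{k\<in>{j<..N}. real k \<le> real j + ?w} \<subseteq> {j<..j + nat \<lfloor>?w\<rfloor>}"
        proof
          fix k assume k: "k \<in> {k\<in>{j<..N}. real k \<le> real j + ?w}"
          then have "of_int (int (k - j)) \<le> ?w" by (auto simp: of_nat_diff)
          then have "int (k - j) \<le> \<lfloor>?w\<rfloor>" by (simp only: le_floor_iff)
          then show "k \<in> {j<..j + nat \<lfloor>?w\<rfloor>}" using k by auto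
        qed
        then have "card {k\<in>{j<..N}. real k \<le> real j + ?w} \<le> nat \<lfloor>?w\<rfloor>" using card_mono[of "{j<..j + nat \<lfloor>?w\<rfloor>}"] by fastforce
        then have "real (card {k\<in>{j<..N}. real k \<le> real j + ?w}) \<le> real (nat \<lfloor>?w\<rfloor>)" by (rule of_nat_mono)
        also have "\<dots> \<le> ?w" by (rule of_nat_floor) simp
        finally show "real (card {k\<in>{j<..N}. real k \<le> real j + ?w}) \<le> ?w" .
      qed simp
      also have "\<dots> \<le> 1" by (rule k0(4)[OF j])
      finally show ?thesis .
    qed
    let ?S = "\<Sum>k\<in>{k0..N}. prob (E k)"
    have s3: "(\<Sum>k\<in>{j<..N}. prob (E k)) \<le> ?S" using j by (intro sum_mono2) auto
    have "(\<Sum>k\<in>{j<..N}. prob (E j \<inter> E k)) \<le> (\<Sum>k\<in>{j<..N}. Cn * prob (E j) * (exp (- c) ^ (k - j) + (if real k \<le> real j + ?w then exp (- c * ln (real j)) else 0)) + Cf * prob (E j) * prob (E k))"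
      by (intro sum_mono each)
    also have "\<dots> = Cn * prob (E j) * ((\<Sum>k\<in>{j<..N}. exp (- c) ^ (k - j)) + (\<Sum>k\<in>{j<..N}. (if real k \<le> real j + ?w then exp (- c * ln (real j)) else 0)))
        + Cf * prob (E j) * (\<Sum>k\<in>{j<..N}. prob (E k))"
      by (simp only: sum.distrib sum_distrib_left[symmetric])
    also have "\<dots> \<le> Cn * prob (E j) * (Q + 1) + Cf * prob (E j) * ?S"
      using s1 s2 s3 near(2) far(1) by (intro add_mono mult_left_mono) auto
    also have "\<dots> = prob (E j) * (Cn * (Q + 1) + Cf * ?S)" by (simp add: algebra_simps)
    also have "\<dots> \<le> prob (E j) * (C + C * ?S)"
      by (intro mult_left_mono add_mono mult_right_mono) (auto simp: C_def intro!: sum_nonneg)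
    also have "\<dots> = C * prob (E j) * (1 + ?S)" by (simp add: algebra_simps)
    finally show ?thesis .
  qed
  have "0 < prob (\<Inter>m. \<Union>k\<in>{m..}. E k)"
    by (rule infinitely_often_of_pairwise_bound[OF E C0' pairs nsE])
  also have "\<dots> \<le> prob {\<omega>\<in>space M. \<forall>m. \<exists>n\<ge>m. sqrt n * \<phi> n < norm (\<Gamma> n *v T n \<omega>)}"
  proof (rule finite_measure_mono)
    show "(\<Inter>m. \<Union>k\<in>{m..}. E k) \<subseteq> {\<omega>\<in>space M. \<forall>m. \<exists>n\<ge>m. sqrt n * \<phi> n < norm (\<Gamma> n *v T n \<omega>)}"
    proof
      fix \<omega> assume w: "\<omega> \<in> (\<Inter>m. \<Union>k\<in>{m..}. E k)"
      have "\<exists>n\<ge>m. sqrt n * \<phi> n < norm (\<Gamma> n *v T n \<omega>)" for m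
      proof -
        have "\<forall>\<^sub>F k in sequentially. m \<le> bi k" using bi_at_top unfolding filterlim_at_top by blast
        then obtain k1 where k1: "\<And>k. k \<ge> k1 \<Longrightarrow> m \<le> bi k" by (auto simp: eventually_sequentially)
        obtain k where "k \<ge> k1" "\<omega> \<in> E k" using w by blast
        then show ?thesis using k1[of k] by (intro exI[of _ "bi k"]) (auto simp: E_def hits_def split: if_splits)
      qed
      moreover have "\<omega> \<in> space M" using w sets.sets_into_space[OF E] by blast
      ultimately show "\<omega> \<in> {\<omega>\<in>space M. \<forall>m. \<exists>n\<ge>m. sqrt n * \<phi> n < norm (\<Gamma> n *v T n \<omega>)}" by blast
    qed
  qed measurable
  finally show ?thesis .
qed

text \<open>The zero-one law for excess up to a constant is applied to \<open>\<psi> = \<phi> + 1 / \<phi>\<close>: the additional \<open>\<surd>n / \<phi>\<close> tends to infinity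
  and absorbs the constant. Passing from \<open>\<phi>\<close> to \<open>\<psi>\<close> changes the squared boundary by at most 3, so divergence is
  preserved.\<close>

theorem almost_surely_above:
  assumes ns: "\<not> summable weighted_tail"
  shows "AE \<omega> in M. \<forall>m. \<exists>n\<ge>m. sqrt n * \<phi> n < norm (\<Gamma> n *v T n \<omega>)"
proof -
  interpret G: prob_space "gauss 1 :: (real^'n) measure" by (rule prob_space_gauss) simp
  have K: "(0::real) \<le> 3" by simp
  obtain C t0 where C: "C \<ge> 1" "\<And>A::real^'n^'n. \<And>t. A \<in> spectral_class (\<sigma> / 2) (2 * \<sigma>) \<Longrightarrow> t \<ge> t0 \<Longrightarrow>
     measure (gauss 1 :: (real^'n) measure) {v. t\<^sup>2 - 3 < (norm (A *v v))\<^sup>2 + (3 / t\<^sup>2) * (norm v)\<^sup>2} \<le> C * gtail A t"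
    using gtail_stable[OF s_class(1,2) K, where 'n='n] by blast
  have phi_large: "\<forall>\<^sub>F n in sequentially. t \<le> \<phi> n" for t
  proof -
    have "\<forall>\<^sub>F n in sequentially. t \<le> c0 * sqrt (ln (ln (real n)))" using c0 by real_asymp
    with iter_log_eq eventually_ge_at_top[of N0] show ?thesis
    proof eventually_elim
      case (elim n)
      then show ?case using bounds(1)[of n] by simp
    qed
  qed
  have "\<forall>\<^sub>F n in sequentially. 1 \<le> \<phi> n \<and> N0 \<le> n"
    using phi_large[of 1] eventually_ge_at_top[of N0] by eventually_elim blast
  then obtain N1 where N1: "\<And>n. n \<ge> N1 \<Longrightarrow> 1 \<le> \<phi> n" "\<And>n. n \<ge> N1 \<Longrightarrow> N0 \<le> n"
    unfolding eventually_sequentially by blast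
  define \<psi> where "\<psi> n = \<phi> n + 1 / \<phi> n" for n
  interpret P: threshold_walk M Z \<Gamma> \<Gamma>lim \<psi> c0 "2 * C0" N1
  proof
    fix m n assume mn: "N1 \<le> m" "m \<le> n"
    have le: "\<phi> m \<le> \<phi> n" and p: "1 \<le> \<phi> m" "1 \<le> \<phi> n" using mn N1 by (auto intro!: mono)
    have "1 / \<phi> m - 1 / \<phi> n = (\<phi> n - \<phi> m) / (\<phi> m * \<phi> n)" using p by (simp add: field_simps)
    also have "\<dots> \<le> (\<phi> n - \<phi> m) / (1 * 1)" using p le by (intro divide_left_mono mult_mono) auto
    finally show "\<psi> m \<le> \<psi> n" by (simp add: \<psi>_def)
  next
    fix n assume n: "N1 \<le> n"
    have p: "1 \<le> \<phi> n" "N0 \<le> n" using N1 n by auto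
    show "c0 * sqrt (iter_log n) \<le> \<psi> n" using bounds(1)[OF p(2)] p by (simp add: \<psi>_def add_increasing2)
    have "1 / \<phi> n \<le> \<phi> n" using p(1) by (smt (verit) divide_le_eq_1)
    then show "\<psi> n \<le> 2 * C0 * sqrt (iter_log n)" using bounds(2)[OF p(2)] by (simp add: \<psi>_def)
  qed (rule c0)
  have cmp: "\<forall>\<^sub>F n in sequentially. weighted_tail n \<le> C * P.weighted_tail n"
    using eventually_class phi_large[of t0] eventually_ge_at_top[of N1]
  proof eventually_elim
    case (elim n)
    have p: "1 \<le> \<phi> n" using N1 elim by auto
    have "t0 \<le> \<psi> n" using elim p by (simp add: \<psi>_def add_increasing2)
    have "gtail (\<Gamma> n) (\<phi> n) \<le> G.prob {v. (\<psi> n)\<^sup>2 - 3 < (norm (\<Gamma> n *v v))\<^sup>2 + (3 / (\<psi> n)\<^sup>2) * (norm v)\<^sup>2}"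
      unfolding gtail_def
    proof (intro G.finite_measure_mono subsetI CollectI)
      fix v assume "v \<in> {v. \<phi> n < norm (\<Gamma> n *v v)}"
      then have "(\<phi> n)\<^sup>2 < (norm (\<Gamma> n *v v))\<^sup>2" using p by (intro power_strict_mono) auto
      moreover have "(\<psi> n)\<^sup>2 = (\<phi> n)\<^sup>2 + 2 + (1 / \<phi> n)\<^sup>2" using p by (simp add: \<psi>_def power2_eq_square field_simps)
      moreover have "(1 / \<phi> n)\<^sup>2 \<le> 1" using p by (intro power_le_one) auto
      moreover have "0 \<le> (3 / (\<psi> n)\<^sup>2) * (norm v)\<^sup>2" by simp
      ultimately show "(\<psi> n)\<^sup>2 - 3 < (norm (\<Gamma> n *v v))\<^sup>2 + (3 / (\<psi> n)\<^sup>2) * (norm v)\<^sup>2" by linarith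
    qed measurable
    also have "\<dots> \<le> C * gtail (\<Gamma> n) (\<psi> n)" by (rule C(2)[OF elim(1) \<open>t0 \<le> \<psi> n\<close>])
    finally have "iter_log n / n * gtail (\<Gamma> n) (\<phi> n) \<le> iter_log n / n * (C * gtail (\<Gamma> n) (\<psi> n))"
      using iter_log_ge_1[of n] by (intro mult_left_mono) auto
    then show ?case by (simp add: weighted_tail_def P.weighted_tail_def mult_ac)
  qed
  have nsP: "\<not> summable P.weighted_tail"
  proof
    assume "summable P.weighted_tail"
    then have "summable (\<lambda>n. C * P.weighted_tail n)" by (rule summable_mult)
    then have "summable weighted_tail"
      by (rule summable_comparison_test_ev[rotated]) (use cmp weighted_tail_nonneg in \<open>auto elim!: eventually_mono\<close>)
    then show False using ns by simp
  qed
  have bnd: "\<forall>\<^sub>F n in sequentially. \<forall>v. norm (\<Gamma> n *v v) \<le> 2 * \<sigma> * norm v"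
    using eventually_class
  proof eventually_elim
    case (elim n)
    then have k: "sym_nonneg_definite (\<Gamma> n)" "eigenvalue (\<Gamma> n) 1 \<le> 2 * \<sigma>" by (auto simp: spectral_class_def)
    show ?case
    proof
      fix v
      have "norm (\<Gamma> n *v v) \<le> eigenvalue (\<Gamma> n) 1 * norm v" by (rule norm_matrix_le_top_eigenvalue[OF k(1)])
      also have "\<dots> \<le> 2 * \<sigma> * norm v" using k by (intro mult_right_mono) auto
      finally show "norm (\<Gamma> n *v v) \<le> 2 * \<sigma> * norm v" .
    qed
  qed
  have "AE \<omega> in M. \<exists>x::nat. \<forall>m. \<exists>n\<ge>m. sqrt n * \<psi> n - x < norm (\<Gamma> n *v T n \<omega>)"
    by (rule zero_one_excess[OF bnd _ P.infinitely_often_positive[OF nsP]]) (use \<sigma>_pos in simp)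
  then show ?thesis
  proof eventually_elim
    case (elim \<omega>)
    then obtain x :: nat where x: "\<And>m. \<exists>n\<ge>m. sqrt n * \<psi> n - x < norm (\<Gamma> n *v T n \<omega>)" by blast
    have "\<forall>\<^sub>F n in sequentially. x * (C0 * sqrt (ln (ln (real n)))) \<le> sqrt n" by real_asymp
    then have "\<forall>\<^sub>F n in sequentially. sqrt n * \<phi> n \<le> sqrt n * \<psi> n - x"
      using iter_log_eq eventually_ge_at_top[of N1]
    proof eventually_elim
      case (elim n)
      have p: "1 \<le> \<phi> n" "N0 \<le> n" using N1 elim by auto
      have "x * \<phi> n \<le> x * (C0 * sqrt (iter_log n))" using bounds(2)[OF p(2)] by (intro mult_left_mono) auto
      then have "x * \<phi> n \<le> sqrt n" using elim by simp
      then have "x \<le> sqrt n / \<phi> n" using p(1) by (simp add: pos_le_divide_eq)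
      moreover have "sqrt n * \<psi> n = sqrt n * \<phi> n + sqrt n / \<phi> n" by (simp add: \<psi>_def distrib_left)
      ultimately show ?case by linarith
    qed
    then obtain N where N: "\<And>n. n \<ge> N \<Longrightarrow> sqrt n * \<phi> n \<le> sqrt n * \<psi> n - x" unfolding eventually_sequentially by blast
    show ?case
    proof
      fix m
      obtain n where "n \<ge> max m N" "sqrt n * \<psi> n - x < norm (\<Gamma> n *v T n \<omega>)" using x by blast
      then show "\<exists>n\<ge>m. sqrt n * \<phi> n < norm (\<Gamma> n *v T n \<omega>)" using N[of n] by (intro exI[of _ n]) auto
    qed
  qed
qed

end

section \<open>The terms of the test series\<close>

text \<open>The real value of a test term: \<open>1 / max (eigen_gap A i) (\<lambda>\<^sub>1 / t)\<close> is the minimum in the \<open>i\<close>-th factor, also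
  in the case of equal eigenvalues, where the quotient is infinite.\<close>

definition tau :: "real^'n^'n \<Rightarrow> nat \<Rightarrow> nat \<Rightarrow> real \<Rightarrow> real" where
  "tau A d1 n t = t / (n * eigenvalue A 1) * (\<Prod>i=2..d1. 1 / max (eigen_gap A i) (eigenvalue A 1 / t))
     * exp (- t\<^sup>2 / (2 * (eigenvalue A 1)\<^sup>2))"

lemma test_factor:
  assumes s: "0 < s" and l: "0 \<le> l" "l \<le> s" and t: "0 < t"
  shows "min (ennreal s / ennreal (sqrt (s\<^sup>2 - l\<^sup>2))) (ennreal (t / s)) = ennreal (1 / max (sqrt (1 - (l / s)\<^sup>2)) (s / t))"
proof -
  define g where "g = sqrt (1 - (l / s)\<^sup>2)"
  have "(l / s)\<^sup>2 \<le> 1" using s l by (intro power_le_one) auto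
  then have g0: "0 \<le> g" by (simp add: g_def)
  have "s\<^sup>2 - l\<^sup>2 = s\<^sup>2 * (1 - (l / s)\<^sup>2)" using s by (simp add: power_divide right_diff_distrib)
  then have sq: "sqrt (s\<^sup>2 - l\<^sup>2) = s * g" using s by (simp add: real_sqrt_mult g_def)
  show ?thesis
  proof (cases "g = 0")
    case True
    have "ennreal s / 0 = top" using s by (simp add: ennreal_divide_eq_top_iff)
    then show ?thesis using s t True unfolding sq g_def[symmetric] by (simp add: max_absorb2)
  next
    case False
    then have gp: "0 < g" using g0 by simp
    have "ennreal s / ennreal (s * g) = ennreal (1 / g)" using s gp by (subst divide_ennreal) auto
    moreover have "min (ennreal (1 / g)) (ennreal (t / s)) = ennreal (min (1 / g) (t / s))"
      using gp s t by (auto simp: min_def ennreal_le_iff)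
    moreover have "min (1 / g) (t / s) = 1 / max g (s / t)"
    proof (cases "g \<le> s / t")
      case True
      then have "t / s \<le> 1 / g" using gp s t by (simp add: field_simps)
      then show ?thesis using True by (simp add: min_absorb2 max_absorb2)
    next
      case False
      then have "1 / g \<le> t / s" using gp s t by (simp add: field_simps)
      then show ?thesis using False by (simp add: min_absorb1 max_absorb1)
    qed
    ultimately show ?thesis unfolding sq g_def[symmetric] by simp
  qed
qed

lemma tau_nonneg:
  assumes "0 \<le> t" "0 < eigenvalue A 1" shows "0 \<le> tau A d1 n t"
  unfolding tau_def using assms
  by (intro mult_nonneg_nonneg prod_nonneg divide_nonneg_nonneg) (auto simp: le_max_iff_disj)

lemma tau_scaled:
  assumes "0 < eigenvalue A 1" "0 < t" and x: "x = t / eigenvalue A 1"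
  shows "tau A d1 n t = x / n * (\<Prod>i=2..d1. 1 / max (eigen_gap A i) (1 / x)) * exp (- x\<^sup>2 / 2)"
proof -
  have "t / (n * eigenvalue A 1) = x / n" "eigenvalue A 1 / t = 1 / x" by (simp_all add: x)
  moreover have "- t\<^sup>2 / (2 * (eigenvalue A 1)\<^sup>2) = - x\<^sup>2 / 2" by (simp add: x power_divide)
  ultimately show ?thesis by (simp only: tau_def)
qed

lemma test_term_eq_tau:
  fixes \<Gamma> :: "nat \<Rightarrow> real^'n^'n"
  assumes A: "sym_nonneg_definite (\<Gamma> n)" "0 < eigenvalue (\<Gamma> n) 1" and n: "1 \<le> n" and t: "0 < \<phi> n" and d1: "d1 \<le> CARD('n)"
  shows "test_term \<Gamma> d1 \<phi> n = ennreal (tau (\<Gamma> n) d1 n (\<phi> n))"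
proof -
  let ?s = "eigenvalue (\<Gamma> n) 1"
  have sym: "transpose (\<Gamma> n) = \<Gamma> n" using A by (simp add: sym_nonneg_definite_def)
  have "(\<Prod>i = 2..d1. min (ennreal ?s / ennreal (sqrt (?s\<^sup>2 - (eigenvalue (\<Gamma> n) i)\<^sup>2))) (ennreal (\<phi> n / ?s)))
      = (\<Prod>i = 2..d1. ennreal (1 / max (eigen_gap (\<Gamma> n) i) (?s / \<phi> n)))"
    unfolding eigen_gap_def using d1 t
    by (intro prod.cong refl test_factor eigenvalue_nonneg[OF A(1)] eigenvalue_decreasing[OF sym] A(2)) auto
  also have "\<dots> = ennreal (\<Prod>i = 2..d1. 1 / max (eigen_gap (\<Gamma> n) i) (?s / \<phi> n))"
    using A t by (intro prod_ennreal) (simp add: le_max_iff_disj)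
  finally have p: "(\<Prod>i = 2..d1. min (ennreal ?s / ennreal (sqrt (?s\<^sup>2 - (eigenvalue (\<Gamma> n) i)\<^sup>2))) (ennreal (\<phi> n / ?s)))
      = ennreal (\<Prod>i = 2..d1. 1 / max (eigen_gap (\<Gamma> n) i) (?s / \<phi> n))" .
  have p0: "0 \<le> (\<Prod>i = 2..d1. 1 / max (eigen_gap (\<Gamma> n) i) (?s / \<phi> n))"
    using A t by (intro prod_nonneg) (simp add: le_max_iff_disj)
  have q0: "0 \<le> \<phi> n / (real n * ?s)" using A t by simp
  show ?thesis
    unfolding test_term_def Let_def p tau_def ennreal_mult'[OF mult_nonneg_nonneg[OF q0 p0]] ennreal_mult'[OF q0] ..
qed

lemma infsum_ennreal_finite_iff:
  fixes g :: "nat \<Rightarrow> real"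
  assumes "\<And>n. n \<in> S \<Longrightarrow> 0 \<le> g n" "\<And>n. n \<in> S \<Longrightarrow> f n = ennreal (g n)"
  shows "infsum f S < \<infinity> \<longleftrightarrow> summable (\<lambda>n. if n \<in> S then g n else 0)"
proof -
  let ?h = "\<lambda>n. if n \<in> S then g n else 0"
  have "infsum f S = infsum (\<lambda>n. ennreal (?h n)) UNIV"
    using assms(2) by (intro infsum_cong_neutral) auto
  also have "\<dots> = (\<Sum>n. ennreal (?h n))"
  proof -
    have "((\<lambda>n. ennreal (?h n)) has_sum infsum (\<lambda>n. ennreal (?h n)) UNIV) UNIV"
      by (intro has_sum_infsum nonneg_summable_on_complete) auto
    from has_sum_imp_sums[OF this] show ?thesis by (rule sums_unique)
  qed
  finally have eq: "infsum f S = (\<Sum>n. ennreal (?h n))" .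
  have nn: "0 \<le> ?h n" for n using assms(1) by auto
  show ?thesis unfolding eq infinity_ennreal_def less_top[symmetric]
    by (rule iffI[OF summable_suminf_not_top[OF nn] ennreal_suminf_neq_top[OF _ nn]])
qed

context matrix_walk
begin

definition d1 :: nat where "d1 = largest_eigenvalue_mult \<Gamma>lim"

lemma d1: "1 \<le> d1" "d1 \<le> CARD('n)"
  using largest_eigenvalue_mult_props(1,2)[of \<Gamma>lim] psd_lim by (auto simp: d1_def sym_nonneg_definite_def)

abbreviation "term_at n t \<equiv> tau (\<Gamma> n) d1 n t"

text \<open>Weyl's inequality keeps the eigenvalues beyond the multiplicity \<open>d1\<close> away from the largest one.\<close>

lemma eventually_gap:
  "\<exists>\<beta>>0. \<beta> \<le> 1 \<and> (\<forall>\<^sub>F n in sequentially. \<forall>i. d1 < i \<longrightarrow> i \<le> CARD('n) \<longrightarrow> \<beta> \<le> eigen_gap (\<Gamma> n) i)"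
proof -
  have sym: "transpose \<Gamma>lim = \<Gamma>lim" using psd_lim by (simp add: sym_nonneg_definite_def)
  define \<mu> where "\<mu> = (if d1 < CARD('n) then eigenvalue \<Gamma>lim (Suc d1) else 0)"
  have \<mu>: "0 \<le> \<mu>" "\<mu> < \<sigma>"
    using eigenvalue_nonneg[OF psd_lim, of "Suc d1"] largest_eigenvalue_mult_props(3)[OF sym, of "Suc d1"] \<sigma>_pos
    by (auto simp: \<mu>_def \<sigma>_def d1_def)
  have le: "eigenvalue \<Gamma>lim i \<le> \<mu>" if "d1 < i" "i \<le> CARD('n)" for i
    using that eigenvalue_decreasing[OF sym, of "Suc d1" i] by (auto simp: \<mu>_def)
  define e where "e = (\<sigma> - \<mu>) / 4"
  have e: "e > 0" using \<mu> by (simp add: e_def)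
  define q where "q = (\<mu> + e) / (\<sigma> - e)"
  have "4 * e = \<sigma> - \<mu>" by (simp add: e_def)
  then have den: "0 < \<sigma> - e" "\<mu> + e < \<sigma> - e" using \<mu> by linarith+
  have q: "0 \<le> q" "q < 1" using den \<mu> e by (auto simp: q_def)
  define \<beta> where "\<beta> = sqrt (1 - q\<^sup>2)"
  have "q\<^sup>2 < 1" using q power_strict_mono[of q 1 2] by simp
  then have \<beta>: "0 < \<beta>" "\<beta> \<le> 1" by (auto simp: \<beta>_def)
  have "\<forall>\<^sub>F n in sequentially. \<forall>i. d1 < i \<longrightarrow> i \<le> CARD('n) \<longrightarrow> \<beta> \<le> eigen_gap (\<Gamma> n) i"
    using matrices_close[OF e] eventually_ge_at_top[of 1]
  proof eventually_elim
    case (elim n)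
    show ?case
    proof (intro allI impI)
      fix i assume i: "d1 < i" "i \<le> CARD('n)"
      have c: "norm (\<Gamma>lim *v v - \<Gamma> n *v v) \<le> e * norm v" "norm (\<Gamma> n *v v - \<Gamma>lim *v v) \<le> e * norm v" for v
        using elim(1) by (auto simp: norm_minus_commute)
      have d0: "0 < CARD('n)" "i - 1 < CARD('n)" "Suc (i - 1) = i" using i d1 by auto
      have "eigenvalue (\<Gamma> n) i \<le> eigenvalue \<Gamma>lim i + e"
        using eigenvalue_perturbation[OF psd[OF elim(2)] psd_lim c(2) d0(2)] d0(3) by simp
      then have 1: "eigenvalue (\<Gamma> n) i \<le> \<mu> + e" using le[OF i] by linarith
      have 2: "\<sigma> - e \<le> eigenvalue (\<Gamma> n) 1"
        using eigenvalue_perturbation[OF psd_lim psd[OF elim(2)] c(1) d0(1)] by (simp add: \<sigma>_def)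
      have 0: "0 \<le> eigenvalue (\<Gamma> n) i" using i d1 by (intro eigenvalue_nonneg[OF psd[OF elim(2)]]) auto
      have "eigenvalue (\<Gamma> n) i / eigenvalue (\<Gamma> n) 1 \<le> q" unfolding q_def using 0 1 2 den by (intro frac_le) auto
      moreover have "0 \<le> eigenvalue (\<Gamma> n) i / eigenvalue (\<Gamma> n) 1" using 0 2 den by simp
      ultimately have "(eigenvalue (\<Gamma> n) i / eigenvalue (\<Gamma> n) 1)\<^sup>2 \<le> q\<^sup>2" by (intro power_mono) auto
      then show "\<beta> \<le> eigen_gap (\<Gamma> n) i" unfolding \<beta>_def eigen_gap_def by simp
    qed
  qed
  then show ?thesis using \<beta> by blast
qed

text \<open>Test term and \<open>tail_size\<close> differ by the factor \<open>x\<^sup>2 / n\<close> and by the factors with \<open>i > d1\<close>, which lie between 1 and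
  \<open>1 / \<beta>\<close>.\<close>

lemma term_at_vs_gtail:
  "\<exists>c>0. \<exists>C>0. \<forall>\<^sub>F n in sequentially. \<forall>t\<ge>2 * \<sigma>. c * (t\<^sup>2 / n * gtail (\<Gamma> n) t) \<le> term_at n t \<and> term_at n t \<le> C * (t\<^sup>2 / n * gtail (\<Gamma> n) t)"
proof -
  obtain c C where cC: "0 < c" "0 < C" and two: "\<And>A::real^'n^'n. \<And>x. sym_nonneg_definite A \<Longrightarrow> eigenvalue A 1 > 0 \<Longrightarrow> 1 \<le> x \<Longrightarrow>
     c * tail_size A x \<le> gtail A (x * eigenvalue A 1) \<and> gtail A (x * eigenvalue A 1) \<le> C * tail_size A x"
    using gtail_two_sided[where 'n='n] by blast
  obtain \<beta> where \<beta>: "0 < \<beta>" "\<beta> \<le> 1" "\<forall>\<^sub>F n in sequentially. \<forall>i. d1 < i \<longrightarrow> i \<le> CARD('n) \<longrightarrow> \<beta> \<le> eigen_gap (\<Gamma> n) i"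
    using eventually_gap by blast
  define k where "k = (1 / \<beta>) ^ CARD('n)"
  have k: "1 \<le> k" unfolding k_def using \<beta> by (intro one_le_power) auto
  define c' where "c' = 1 / (4 * \<sigma>\<^sup>2 * C * k)"
  define C' where "C' = 4 / (\<sigma>\<^sup>2 * c)"
  have "\<forall>\<^sub>F n in sequentially. \<forall>t\<ge>2 * \<sigma>. c' * (t\<^sup>2 / n * gtail (\<Gamma> n) t) \<le> term_at n t \<and> term_at n t \<le> C' * (t\<^sup>2 / n * gtail (\<Gamma> n) t)"
    using \<beta>(3) eventually_class eventually_ge_at_top[of 1]
  proof eventually_elim
    case (elim n)
    let ?A = "\<Gamma> n" and ?s = "eigenvalue (\<Gamma> n) 1"
    have A: "sym_nonneg_definite ?A" "\<sigma> / 2 \<le> ?s" "?s \<le> 2 * \<sigma>" using elim(2) by (auto simp: spectral_class_def)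
    have s0: "0 < ?s" using A \<sigma>_pos by linarith
    show ?case
    proof (intro allI impI)
      fix t assume t: "2 * \<sigma> \<le> t"
      define x where "x = t / ?s"
      have t0: "0 < t" using t \<sigma>_pos by linarith
      have x: "1 \<le> x" using t A s0 by (simp add: x_def)
      have sx: "?s / t = 1 / x" "t / ?s = x" "x * ?s = t" using s0 t0 by (auto simp: x_def)
      define P1 where "P1 = (\<Prod>i=2..d1. 1 / max (eigen_gap ?A i) (1 / x))"
      define P2 where "P2 = (\<Prod>i\<in>{Suc d1..CARD('n)}. 1 / max (eigen_gap ?A i) (1 / x))"
      have g: "0 \<le> eigen_gap ?A i" "eigen_gap ?A i \<le> 1" if "1 \<le> i" "i \<le> CARD('n)" for i
        using eigen_gap_bounds[OF A(1) s0 that] by auto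
      have "{2..CARD('n)} = {2..d1} \<union> {Suc d1..CARD('n)}" using d1 by auto
      then have split: "tail_size ?A x = exp (- x\<^sup>2 / 2) / x * (P1 * P2)"
        unfolding tail_size_def P1_def P2_def by (simp only:) (subst prod.union_disjoint, auto)
      have P2: "1 \<le> P2" "P2 \<le> k"
      proof -
        show "1 \<le> P2" unfolding P2_def using g x d1 by (intro prod_inverse_max_ge_1) auto
        have "P2 \<le> (\<Prod>i\<in>{Suc d1..CARD('n)}. 1 / \<beta>)"
          unfolding P2_def
        proof (intro prod_mono conjI)
          fix i assume i: "i \<in> {Suc d1..CARD('n)}"
          then have "\<beta> \<le> max (eigen_gap ?A i) (1 / x)" using elim(1) by (auto simp: le_max_iff_disj)
          then show "1 / max (eigen_gap ?A i) (1 / x) \<le> 1 / \<beta>" using \<beta> by (intro divide_left_mono mult_pos_pos) auto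
          show "0 \<le> 1 / max (eigen_gap ?A i) (1 / x)" using x by (simp add: le_max_iff_disj)
        qed
        also have "\<dots> \<le> k" unfolding k_def using \<beta> by (simp only: prod_constant) (intro power_increasing, auto)
        finally show "P2 \<le> k" .
      qed
      have P10: "0 \<le> P1" unfolding P1_def using x by (intro prod_nonneg) (simp add: le_max_iff_disj)
      define w where "w = exp (- x\<^sup>2 / 2) / x * P1"
      have w0: "0 \<le> w" using x P10 by (simp add: w_def)
      have "x\<^sup>2 / n * w = x / n * P1 * exp (- x\<^sup>2 / 2)" using x by (simp add: w_def power2_eq_square)
      then have ta: "term_at n t = x\<^sup>2 / n * w"
        unfolding tau_scaled[OF s0 t0 x_def] P1_def[symmetric] by (rule sym)
      have ts: "tail_size ?A x = w * P2" by (simp add: split w_def)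
      have w1: "c * w \<le> gtail ?A t"
      proof -
        have "c * (w * 1) \<le> c * (w * P2)" using cC by (intro mult_left_mono P2(1) w0) auto
        also have "\<dots> \<le> gtail ?A t" using two[OF A(1) s0 x] sx ts by simp
        finally show ?thesis by simp
      qed
      have w2: "gtail ?A t \<le> C * k * w"
      proof -
        have "gtail ?A t \<le> C * (w * P2)" using two[OF A(1) s0 x] sx ts by simp
        also have "\<dots> \<le> C * (w * k)" using cC by (intro mult_left_mono P2(2) w0) auto
        finally show ?thesis by (simp add: mult_ac)
      qed
      have "t / (2 * \<sigma>) \<le> x" unfolding x_def using A s0 t0 by (intro divide_left_mono) auto
      then have "(t / (2 * \<sigma>))\<^sup>2 \<le> x\<^sup>2" using t0 \<sigma>_pos by (intro power_mono) auto
      then have x2l: "t\<^sup>2 / (4 * \<sigma>\<^sup>2) \<le> x\<^sup>2" by (simp add: power_divide power_mult_distrib)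
      have "x \<le> t / (\<sigma> / 2)" unfolding x_def using A s0 t0 \<sigma>_pos by (intro divide_left_mono) auto
      then have "x\<^sup>2 \<le> (t / (\<sigma> / 2))\<^sup>2" using x by (intro power_mono) auto
      also have "(t / (\<sigma> / 2))\<^sup>2 = 4 * t\<^sup>2 / \<sigma>\<^sup>2" by (simp add: power_divide)
      finally have x2u: "x\<^sup>2 \<le> 4 * t\<^sup>2 / \<sigma>\<^sup>2" .
      have Ck: "0 < C * k" using cC k by (intro mult_pos_pos) auto
      have "c' * (t\<^sup>2 / n * gtail ?A t) \<le> c' * (t\<^sup>2 / n * (C * k * w))"
        using w2 cC k \<sigma>_pos by (intro mult_left_mono) (auto simp: c'_def)
      also have "\<dots> = (t\<^sup>2 / (4 * \<sigma>\<^sup>2)) / n * w" using Ck \<sigma>_pos cC k by (simp add: c'_def field_simps)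
      also have "\<dots> \<le> x\<^sup>2 / n * w" using x2l w0 by (intro mult_right_mono divide_right_mono) auto
      finally have lower: "c' * (t\<^sup>2 / n * gtail ?A t) \<le> term_at n t" unfolding ta .
      have "term_at n t \<le> (4 * t\<^sup>2 / \<sigma>\<^sup>2) / n * (gtail ?A t / c)"
        unfolding ta using x2u w0 w1 cC by (intro mult_mono divide_right_mono) (auto simp: pos_le_divide_eq mult.commute)
      also have "\<dots> = C' * (t\<^sup>2 / n * gtail ?A t)" by (simp add: C'_def mult_ac)
      finally show "c' * (t\<^sup>2 / n * gtail ?A t) \<le> term_at n t \<and> term_at n t \<le> C' * (t\<^sup>2 / n * gtail ?A t)" using lower by blast
    qed
  qed
  moreover have "c' > 0" "C' > 0" using cC k \<sigma>_pos by (auto simp: c'_def C'_def)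
  ultimately show ?thesis by blast
qed

abbreviation u :: "nat \<Rightarrow> real" where "u n \<equiv> sqrt (iter_log n)"

text \<open>A telescoping series in \<open>1 / ln n\<close>.\<close>

lemma summable_log_square: "summable (\<lambda>n. 1 / (real n * (ln (real n))\<^sup>2))"
proof -
  have "summable (\<lambda>n. 1 / ln (real (n + 2)) - 1 / ln (real (Suc n + 2)))"
  proof -
    have "(\<lambda>n. 1 / ln (real (n + 2))) \<longlonglongrightarrow> 0" by real_asymp
    from telescope_sums'[OF this] show ?thesis by (rule sums_summable)
  qed
  then have s: "summable (\<lambda>n. 2 * (1 / ln (real (n + 2)) - 1 / ln (real (Suc n + 2))))" by (rule summable_mult)
  have "\<forall>\<^sub>F n in sequentially. 1 / ((real n + 2) * (ln (real n + 2))\<^sup>2) \<le> 2 * (1 / ln (real n + 2) - 1 / ln (real n + 3))"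
    by real_asymp
  then have "\<forall>\<^sub>F n in sequentially. norm (1 / (real (n + 2) * (ln (real (n + 2)))\<^sup>2)) \<le> 2 * (1 / ln (real (n + 2)) - 1 / ln (real (Suc n + 2)))"
    by eventually_elim (simp add: add.commute)
  then have "summable (\<lambda>n. 1 / (real (n + 2) * (ln (real (n + 2)))\<^sup>2))" by (rule summable_comparison_test_ev[OF _ s])
  then show ?thesis by (rule summable_iff_shift[THEN iffD1, of "\<lambda>n. 1 / (real n * (ln (real n))\<^sup>2)" 2])
qed

text \<open>Here \<open>x \<ge> 3 u\<close>, since the largest eigenvalue is at most \<open>2 \<sigma>\<close>. Half of the exponent \<open>x\<^sup>2 / 2\<close> absorbs the power of \<open>x\<close>, the
  other half gives \<open>(ln n)\<^sup>-\<^sup>2\<close>.\<close>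

lemma term_at_upper:
  "\<forall>\<^sub>F n in sequentially. \<forall>t\<ge>6 * \<sigma> * u n. term_at n t \<le> exp ((real d1)\<^sup>2) * (1 / (real n * (ln (real n))\<^sup>2))"
proof -
  have "\<forall>\<^sub>F n in sequentially. 1 < ln (real n)" by real_asymp
  then show ?thesis using eventually_class iter_log_eq eventually_ge_at_top[of 1]
  proof eventually_elim
    case (elim n)
    let ?A = "\<Gamma> n" and ?s = "eigenvalue (\<Gamma> n) 1"
    have A: "sym_nonneg_definite ?A" "\<sigma> / 2 \<le> ?s" "?s \<le> 2 * \<sigma>" using elim(2) by (auto simp: spectral_class_def)
    have s0: "0 < ?s" using A \<sigma>_pos by linarith
    have u1: "1 \<le> u n" using iter_log_ge_1[of n] by simp
    show ?case
    proof (intro allI impI)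
      fix t assume t: "6 * \<sigma> * u n \<le> t"
      define x where "x = t / ?s"
      have "0 < 6 * \<sigma> * u n" using \<sigma>_pos u1 by simp
      then have t0: "0 < t" using t by linarith
      have sx: "?s / t = 1 / x" using s0 t0 by (simp add: x_def)
      have "3 * u n * ?s \<le> 3 * u n * (2 * \<sigma>)" using A u1 by (intro mult_left_mono) auto
      then have x3: "3 * u n \<le> x" unfolding x_def using t s0 by (simp add: pos_le_divide_eq)
      have x1: "1 \<le> x" using x3 u1 by linarith
      have "(\<Prod>i=2..d1. 1 / max (eigen_gap ?A i) (1 / x)) \<le> (\<Prod>i\<in>{2..d1}. x)"
      proof (intro prod_mono conjI)
        fix i
        have "1 / x \<le> max (eigen_gap ?A i) (1 / x)" by simp
        then have "1 / max (eigen_gap ?A i) (1 / x) \<le> 1 / (1 / x)" using x1 by (intro divide_left_mono mult_pos_pos) (auto simp: less_max_iff_disj)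
        then show "1 / max (eigen_gap ?A i) (1 / x) \<le> x" by simp
        show "0 \<le> 1 / max (eigen_gap ?A i) (1 / x)" using x1 by (simp add: le_max_iff_disj)
      qed
      also have "\<dots> = x ^ (d1 - 1)" by simp
      finally have p: "(\<Prod>i=2..d1. 1 / max (eigen_gap ?A i) (1 / x)) \<le> x ^ (d1 - 1)" .
      have "term_at n t = 1 / n * (x * (\<Prod>i=2..d1. 1 / max (eigen_gap ?A i) (1 / x)) * exp (- x\<^sup>2 / 2))"
        unfolding tau_scaled[OF s0 t0 x_def] by simp
      also have "\<dots> \<le> 1 / n * (x * x ^ (d1 - 1) * exp (- x\<^sup>2 / 2))"
        using p x1 by (intro mult_left_mono mult_right_mono) auto
      also have "x * x ^ (d1 - 1) = x ^ d1" using d1 by (cases d1) auto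
      also have "x ^ d1 * exp (- x\<^sup>2 / 2) = (x ^ d1 * exp (- x\<^sup>2 / 4)) * exp (- x\<^sup>2 / 4)" by (simp add: exp_add[symmetric])
      also have "\<dots> \<le> exp ((real d1)\<^sup>2) * exp (- 2 * iter_log n)"
      proof (intro mult_mono power_exp_bound)
        have "(3 * u n)\<^sup>2 \<le> x\<^sup>2" using x3 u1 by (intro power_mono) auto
        then have "9 * iter_log n \<le> x\<^sup>2" using iter_log_ge_1[of n] by (simp add: power_mult_distrib)
        then show "exp (- x\<^sup>2 / 4) \<le> exp (- 2 * iter_log n)" using iter_log_ge_1[of n] by simp
      qed (use x1 in auto)
      also have "exp (- 2 * iter_log n) = 1 / (ln (real n))\<^sup>2"
      proof -
        have "exp (- 2 * iter_log n) = 1 / (exp (iter_log n))\<^sup>2" by (simp add: exp_minus exp_double[symmetric] field_simps)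
        also have "exp (iter_log n) = ln (real n)" unfolding elim(3) by (rule exp_ln) (use elim(1) in linarith)
        finally show ?thesis .
      qed
      finally show "term_at n t \<le> exp ((real d1)\<^sup>2) * (1 / (real n * (ln (real n))\<^sup>2))" by (simp add: divide_right_mono)
    qed
  qed
qed

text \<open>If \<open>\<phi>\<close> is small at time \<open>N\<close>, then by monotonicity it is small at all earlier times, and each term with \<open>n \<le> N\<close> is at
  least \<open>\<kappa> (ln N)\<^sup>-\<^sup>1\<^sup>/\<^sup>2 / n\<close>. These terms sum to the order of \<open>(ln N)\<^sup>1\<^sup>/\<^sup>2\<close>, which is unbounded.\<close>

lemma term_at_not_summable:
  assumes pos: "\<And>n. 1 \<le> n \<Longrightarrow> 0 < \<phi> n" and mono: "mono_on {1..} \<phi>"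
    and small: "\<exists>\<^sub>F n in sequentially. \<phi> n \<le> \<sigma> / 2 * u n"
  shows "\<not> summable (\<lambda>n. term_at n (\<phi> n))"
proof
  assume sm: "summable (\<lambda>n. term_at n (\<phi> n))"
  \<comment> \<open>a lower bound for \<open>\<phi> n\<close> divided by the largest eigenvalue, and thereby for the factors of the product\<close>
  define x0 where "x0 = min 1 (\<phi> 1 / (2 * \<sigma>))"
  have x0: "0 < x0" "x0 \<le> 1" using pos[of 1] \<sigma>_pos by (auto simp: x0_def)
  define \<kappa> where "\<kappa> = x0 ^ d1"
  have \<kappa>: "0 < \<kappa>" using x0 by (simp add: \<kappa>_def)
  have mono': "\<phi> m \<le> \<phi> n" if "1 \<le> m" "m \<le> n" for m n using mono that by (auto simp: mono_on_def)
  obtain N2 where N2: "N2 \<ge> 1" "\<And>n. n \<ge> N2 \<Longrightarrow> \<Gamma> n \<in> spectral_class (\<sigma> / 2) (2 * \<sigma>)"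
    using eventually_class unfolding eventually_sequentially by (metis le_trans nat_le_linear)
  have low: "\<kappa> * exp (- iter_log N / 2) * (1 / n) \<le> term_at n (\<phi> n)" if n: "N2 \<le> n" "n \<le> N" and N: "\<phi> N \<le> \<sigma> / 2 * u N" for n N
  proof -
    let ?A = "\<Gamma> n" and ?s = "eigenvalue (\<Gamma> n) 1" and ?t = "\<phi> n"
    have n1: "1 \<le> n" using n N2 by linarith
    have A: "sym_nonneg_definite ?A" "\<sigma> / 2 \<le> ?s" "?s \<le> 2 * \<sigma>" using N2(2)[OF n(1)] by (auto simp: spectral_class_def)
    have s0: "0 < ?s" using A \<sigma>_pos by linarith
    have t0: "0 < ?t" using pos n1 by simp
    define x where "x = ?t / ?s"
    have sx: "?s / ?t = 1 / x" using s0 t0 by (simp add: x_def)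
    have xp: "0 < x" using s0 t0 by (simp add: x_def)
    have "\<phi> 1 / (2 * \<sigma>) \<le> ?t / ?s" using mono'[of 1 n] n1 A s0 t0 by (intro frac_le) auto
    then have xx0: "x0 \<le> x" by (simp add: x0_def x_def)
    have "?t \<le> \<sigma> / 2 * u N" using mono'[OF n1 n(2)] N by linarith
    also have "\<dots> \<le> ?s * u N" using A iter_log_ge_1[of N] by (intro mult_right_mono) auto
    finally have "x \<le> u N" using s0 by (simp add: x_def pos_divide_le_eq mult.commute)
    then have "x\<^sup>2 \<le> (u N)\<^sup>2" using xp by (intro power_mono) auto
    then have x2: "x\<^sup>2 \<le> iter_log N" using iter_log_ge_1[of N] by simp
    have "(\<Prod>i\<in>{2..d1}. x0) \<le> (\<Prod>i=2..d1. 1 / max (eigen_gap ?A i) (1 / x))"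
    proof (intro prod_mono conjI)
      fix i assume i: "i \<in> {2..d1}"
      have "eigen_gap ?A i \<le> 1" using i d1 by (intro eigen_gap_bounds[OF A(1) s0]) auto
      moreover have "1 \<le> 1 / x0" "1 / x \<le> 1 / x0" using x0 xx0 xp by (auto simp: field_simps)
      ultimately have "max (eigen_gap ?A i) (1 / x) \<le> 1 / x0" by auto
      then have "1 / (1 / x0) \<le> 1 / max (eigen_gap ?A i) (1 / x)" using x0 xp by (intro divide_left_mono mult_pos_pos) (auto simp: less_max_iff_disj)
      then show "x0 \<le> 1 / max (eigen_gap ?A i) (1 / x)" by simp
    qed (use x0 in auto)
    then have p: "x0 ^ (d1 - 1) \<le> (\<Prod>i=2..d1. 1 / max (eigen_gap ?A i) (1 / x))" by simp
    have "\<kappa> = x0 * x0 ^ (d1 - 1)" unfolding \<kappa>_def using d1 by (cases d1) auto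
    also have "\<dots> \<le> x * (\<Prod>i=2..d1. 1 / max (eigen_gap ?A i) (1 / x))"
      using p xx0 x0 by (intro mult_mono) auto
    finally have "\<kappa> * exp (- iter_log N / 2) \<le> (x * (\<Prod>i=2..d1. 1 / max (eigen_gap ?A i) (1 / x))) * exp (- x\<^sup>2 / 2)"
      using x2 \<kappa> by (intro mult_mono) auto
    then have "1 / n * (\<kappa> * exp (- iter_log N / 2)) \<le> 1 / n * (x * (\<Prod>i=2..d1. 1 / max (eigen_gap ?A i) (1 / x)) * exp (- x\<^sup>2 / 2))"
      by (intro mult_left_mono) auto
    also have "\<dots> = term_at n ?t" unfolding tau_scaled[OF s0 t0 x_def] by simp
    finally show ?thesis by (simp add: mult.commute)
  qed
  have nn: "0 \<le> term_at n (\<phi> n)" if "n \<ge> N2" for n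
  proof (rule tau_nonneg)
    show "0 \<le> \<phi> n" using pos[of n] that N2(1) by simp
    show "0 < eigenvalue (\<Gamma> n) 1" using N2(2)[OF that] \<sigma>_pos by (auto simp: spectral_class_def)
  qed
  have sm': "summable (\<lambda>n. term_at (n + N2) (\<phi> (n + N2)))" by (rule summable_iff_shift[THEN iffD2, of "\<lambda>n. term_at n (\<phi> n)", OF sm])
  define S where "S = (\<Sum>n. term_at (n + N2) (\<phi> (n + N2)))"
  have harm: "ln (real (N2 + m)) - ln (real N2) \<le> (\<Sum>n<m. 1 / real (n + N2))" for m
  proof (induction m)
    case (Suc m)
    have p: "0 < real (N2 + m)" using N2(1) by simp
    have "ln (real (N2 + Suc m)) - ln (real (N2 + m)) = ln (1 + 1 / real (N2 + m))"
    proof -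
      have "1 + 1 / real (N2 + m) = real (N2 + Suc m) / real (N2 + m)" using p by (simp add: field_simps)
      then show ?thesis using p by (simp add: ln_div)
    qed
    also have "\<dots> \<le> 1 / real (N2 + m)" using p by (intro ln_add_one_self_le_self) simp
    finally show ?case using Suc by (simp add: add.commute)
  qed simp
  have key: "\<kappa> * exp (- iter_log N / 2) * (ln (real N) - ln (real N2)) \<le> S" if N: "N2 \<le> N" "\<phi> N \<le> \<sigma> / 2 * u N" for N
  proof -
    have "\<kappa> * exp (- iter_log N / 2) * (ln (real N) - ln (real N2)) \<le> \<kappa> * exp (- iter_log N / 2) * (\<Sum>n<N - N2. 1 / real (n + N2))"
      using harm[of "N - N2"] N(1) \<kappa> by (intro mult_left_mono) auto
    also have "\<dots> = (\<Sum>n<N - N2. \<kappa> * exp (- iter_log N / 2) * (1 / real (n + N2)))" by (simp only: sum_distrib_left)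
    also have "\<dots> \<le> (\<Sum>n<N - N2. term_at (n + N2) (\<phi> (n + N2)))"
      using N by (intro sum_mono low) auto
    also have "\<dots> \<le> S" unfolding S_def using sm' nn by (intro sum_le_suminf) auto
    finally show ?thesis .
  qed
  have "\<forall>\<^sub>F N in sequentially. S < \<kappa> * exp (- ln (ln (real N)) / 2) * (ln (real N) - ln (real N2))" using \<kappa> by real_asymp
  then have "\<forall>\<^sub>F N in sequentially. \<not> (\<phi> N \<le> \<sigma> / 2 * u N)"
    using iter_log_eq eventually_ge_at_top[of N2]
  proof eventually_elim
    case (elim N)
    then show ?case using key[of N] by auto
  qed
  then show False using small by (simp add: frequently_def)
qed

end

section \<open>General boundaries\<close>

context threshold_walk
begin

text \<open>The squared boundary is comparable to the iterated logarithm.\<close>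

lemma summable_weighted_tail_iff: "summable weighted_tail \<longleftrightarrow> summable (\<lambda>n. term_at n (\<phi> n))"
proof -
  obtain c C where c: "0 < c" and C: "0 < C" and cmp: "\<forall>\<^sub>F n in sequentially. \<forall>t\<ge>2 * \<sigma>.
      c * (t\<^sup>2 / n * gtail (\<Gamma> n) t) \<le> term_at n t \<and> term_at n t \<le> C * (t\<^sup>2 / n * gtail (\<Gamma> n) t)"
    using term_at_vs_gtail by blast
  have large: "\<forall>\<^sub>F n in sequentially. 2 * \<sigma> \<le> \<phi> n"
  proof -
    have "\<forall>\<^sub>F n in sequentially. 2 * \<sigma> \<le> c0 * sqrt (ln (ln (real n)))" using c0 by real_asymp
    with iter_log_eq eventually_ge_at_top[of N0] show ?thesis
    proof eventually_elim
      case (elim n)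
      then show ?case using bounds(1)[of n] by simp
    qed
  qed
  have both: "\<forall>\<^sub>F n in sequentially. weighted_tail n \<le> 1 / (c * c0\<^sup>2) * term_at n (\<phi> n)
      \<and> term_at n (\<phi> n) \<le> C * C0\<^sup>2 * weighted_tail n \<and> 0 \<le> term_at n (\<phi> n)"
    using cmp large eventually_ge_at_top[of N0]
  proof eventually_elim
    case (elim n)
    let ?g = "gtail (\<Gamma> n) (\<phi> n)"
    have g: "0 \<le> ?g" by (simp add: gtail_def)
    have u0: "0 \<le> iter_log n" using iter_log_ge_1[of n] by linarith
    have lo: "(c0 * sqrt (iter_log n))\<^sup>2 \<le> (\<phi> n)\<^sup>2" using bounds(1)[OF elim(3)] c0 u0 by (intro power_mono) auto
    have "0 \<le> \<phi> n" using elim(2) \<sigma>_pos by linarith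
    then have hi: "(\<phi> n)\<^sup>2 \<le> (C0 * sqrt (iter_log n))\<^sup>2" using bounds(2)[OF elim(3)] by (intro power_mono) auto
    have lo': "c0\<^sup>2 * iter_log n \<le> (\<phi> n)\<^sup>2" and hi': "(\<phi> n)\<^sup>2 \<le> C0\<^sup>2 * iter_log n"
      using lo hi u0 by (simp_all add: power_mult_distrib)
    have 1: "c0\<^sup>2 * weighted_tail n \<le> (\<phi> n)\<^sup>2 / n * ?g"
      using mult_right_mono[OF divide_right_mono[OF lo', of "real n"] g] by (simp add: weighted_tail_def)
    have 2: "(\<phi> n)\<^sup>2 / n * ?g \<le> C0\<^sup>2 * weighted_tail n"
      using mult_right_mono[OF divide_right_mono[OF hi', of "real n"] g] by (simp add: weighted_tail_def)
    have 3: "c * ((\<phi> n)\<^sup>2 / n * ?g) \<le> term_at n (\<phi> n)" "term_at n (\<phi> n) \<le> C * ((\<phi> n)\<^sup>2 / n * ?g)"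
      using elim(1,2) by auto
    have "c * (c0\<^sup>2 * weighted_tail n) \<le> term_at n (\<phi> n)" using mult_left_mono[OF 1, of c] 3 c by linarith
    moreover have "term_at n (\<phi> n) \<le> C * (C0\<^sup>2 * weighted_tail n)" using mult_left_mono[OF 2, of C] 3 C by linarith
    moreover have "0 \<le> c * ((\<phi> n)\<^sup>2 / n * ?g)" using c g by simp
    ultimately show ?case using 3 c c0 by (simp add: field_simps)
  qed
  show ?thesis
  proof
    assume "summable weighted_tail"
    then have "summable (\<lambda>n. C * C0\<^sup>2 * weighted_tail n)" by (rule summable_mult)
    then show "summable (\<lambda>n. term_at n (\<phi> n))"
      by (rule summable_comparison_test_ev[rotated]) (use both in \<open>auto elim!: eventually_mono\<close>)
  next
    assume "summable (\<lambda>n. term_at n (\<phi> n))"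
    then have "summable (\<lambda>n. 1 / (c * c0\<^sup>2) * term_at n (\<phi> n))" by (rule summable_mult)
    then show "summable weighted_tail"
      by (rule summable_comparison_test_ev[rotated]) (use both weighted_tail_nonneg in \<open>auto elim!: eventually_mono\<close>)
  qed
qed

end

context matrix_walk
begin

lemma u_mono: "m \<le> n \<Longrightarrow> u m \<le> u n" using iter_log_mono by simp

lemma u_ge_1: "1 \<le> u n" using iter_log_ge_1[of n] by simp

lemma eventually_term_nonneg: "\<forall>\<^sub>F n in sequentially. \<forall>t\<ge>0. 0 \<le> term_at n t"
  using eventually_class
proof eventually_elim
  case (elim n)
  then have "0 < eigenvalue (\<Gamma> n) 1" using \<sigma>_pos by (auto simp: spectral_class_def)
  then show ?case using tau_nonneg by blast
qed

abbreviation (input) top_bound :: "nat \<Rightarrow> real" where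
  "top_bound n \<equiv> exp ((real d1)\<^sup>2) * (1 / (real n * (ln (real n))\<^sup>2))"

lemma top_bound: "summable top_bound" "0 \<le> top_bound n"
  by (rule summable_mult[OF summable_log_square]) simp

text \<open>The boundary is truncated at \<open>6 \<sigma> u\<close>, which changes the series by a convergent one; it is eventually above
  \<open>(\<sigma> / 2) u\<close>, because otherwise the series would diverge.\<close>

theorem almost_surely_eventually_below:
  assumes pos: "\<And>n. 1 \<le> n \<Longrightarrow> 0 < \<phi> n" and mono: "mono_on {1..} \<phi>"
    and sm: "summable (\<lambda>n. term_at n (\<phi> n))"
  shows "AE \<omega> in M. \<forall>\<^sub>F n in sequentially. norm (\<Gamma> n *v T n \<omega>) \<le> sqrt n * \<phi> n"
proof -
  have "\<forall>\<^sub>F n in sequentially. \<sigma> / 2 * u n < \<phi> n"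
    using term_at_not_summable[OF pos mono] sm by (auto simp: frequently_def not_le)
  then have "\<forall>\<^sub>F n in sequentially. 1 \<le> n \<and> \<sigma> / 2 * u n < \<phi> n"
    using eventually_ge_at_top[of 1] by eventually_elim blast
  then obtain N0 where N0: "\<And>n. n \<ge> N0 \<Longrightarrow> 1 \<le> n" "\<And>n. n \<ge> N0 \<Longrightarrow> \<sigma> / 2 * u n < \<phi> n"
    unfolding eventually_sequentially by blast
  define \<psi> where "\<psi> n = min (\<phi> n) (6 * \<sigma> * u n)" for n
  interpret P: threshold_walk M Z \<Gamma> \<Gamma>lim \<psi> "\<sigma> / 2" "6 * \<sigma>" N0
  proof
    fix m n assume mn: "N0 \<le> m" "m \<le> n"
    have "\<phi> m \<le> \<phi> n" using mono N0(1)[OF mn(1)] mn(2) by (auto simp: mono_on_def)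
    moreover have "6 * \<sigma> * u m \<le> 6 * \<sigma> * u n" using u_mono[OF mn(2)] \<sigma>_pos by (intro mult_left_mono) auto
    ultimately show "\<psi> m \<le> \<psi> n" by (auto simp: \<psi>_def)
  next
    fix n assume n: "N0 \<le> n"
    have "\<sigma> / 2 * u n \<le> 6 * \<sigma> * u n" using \<sigma>_pos u_ge_1[of n] by (intro mult_right_mono) auto
    then show "\<sigma> / 2 * u n \<le> \<psi> n" using N0(2)[OF n] by (auto simp: \<psi>_def)
    show "\<psi> n \<le> 6 * \<sigma> * u n" by (simp add: \<psi>_def)
  qed (use \<sigma>_pos in simp)
  have "\<forall>\<^sub>F n in sequentially. norm (term_at n (\<psi> n)) \<le> term_at n (\<phi> n) + top_bound n"
    using eventually_term_nonneg term_at_upper eventually_ge_at_top[of 1]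
  proof eventually_elim
    case (elim n)
    have p: "0 \<le> \<phi> n" "0 \<le> 6 * \<sigma> * u n" using pos[OF elim(3)] \<sigma>_pos u_ge_1[of n] by auto
    have "0 \<le> term_at n (\<psi> n)" by (rule elim(1)[rule_format]) (use p in \<open>simp add: \<psi>_def\<close>)
    moreover have "term_at n (\<psi> n) \<le> term_at n (\<phi> n) + top_bound n"
    proof (cases "\<phi> n \<le> 6 * \<sigma> * u n")
      case True
      then have "\<psi> n = \<phi> n" by (simp add: \<psi>_def)
      then show ?thesis using top_bound(2)[of n] by simp
    next
      case False
      then have "\<psi> n = 6 * \<sigma> * u n" by (simp add: \<psi>_def)
      then have "term_at n (\<psi> n) \<le> top_bound n" by (intro elim(2)[rule_format]) simp
      moreover have "0 \<le> term_at n (\<phi> n)" by (rule elim(1)[rule_format, OF p(1)])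
      ultimately show ?thesis by linarith
    qed
    ultimately show ?case by (simp only: real_norm_def abs_of_nonneg)
  qed
  then have "summable (\<lambda>n. term_at n (\<psi> n))"
    by (rule summable_comparison_test_ev) (rule summable_add[OF sm top_bound(1)])
  then have "summable P.weighted_tail" by (simp only: P.summable_weighted_tail_iff)
  from P.almost_surely_below[OF this] show ?thesis
  proof eventually_elim
    case (elim \<omega>)
    then show ?case
    proof eventually_elim
      case (elim n)
      have "sqrt n * \<psi> n \<le> sqrt n * \<phi> n" by (intro mult_left_mono) (auto simp: \<psi>_def)
      then show ?case using elim by linarith
    qed
  qed
qed

text \<open>Truncation from both sides preserves divergence. The truncated boundary \<open>\<psi>\<close> is exceeded infinitely often while
  \<open>6 \<sigma> u\<close> eventually is not, and where they differ \<open>\<psi> \<ge> \<phi>\<close>.\<close>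

theorem almost_surely_infinitely_often_above:
  assumes pos: "\<And>n. 1 \<le> n \<Longrightarrow> 0 < \<phi> n" and mono: "mono_on {1..} \<phi>"
    and ns: "\<not> summable (\<lambda>n. term_at n (\<phi> n))"
  shows "AE \<omega> in M. \<forall>m. \<exists>n\<ge>m. sqrt n * \<phi> n < norm (\<Gamma> n *v T n \<omega>)"
proof -
  define \<psi> where "\<psi> n = min (max (\<phi> n) (\<sigma> / 2 * u n)) (6 * \<sigma> * u n)" for n
  have ord: "\<sigma> / 2 * u n \<le> 6 * \<sigma> * u n" "0 < \<sigma> / 2 * u n" for n
    using \<sigma>_pos u_ge_1[of n] by (auto intro!: mult_right_mono)
  interpret P: threshold_walk M Z \<Gamma> \<Gamma>lim \<psi> "\<sigma> / 2" "6 * \<sigma>" 1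
  proof
    fix m n :: nat assume mn: "1 \<le> m" "m \<le> n"
    have "\<phi> m \<le> \<phi> n" using mono mn by (auto simp: mono_on_def)
    moreover have "c * u m \<le> c * u n" if "0 \<le> c" for c using u_mono[OF mn(2)] that by (rule mult_left_mono)
    then have "6 * \<sigma> * u m \<le> 6 * \<sigma> * u n" "\<sigma> / 2 * u m \<le> \<sigma> / 2 * u n" using \<sigma>_pos by simp_all
    ultimately show "\<psi> m \<le> \<psi> n" unfolding \<psi>_def by (intro min.mono max.mono)
  next
    fix n :: nat
    show "\<sigma> / 2 * u n \<le> \<psi> n" using ord[of n] by (auto simp: \<psi>_def)
    show "\<psi> n \<le> 6 * \<sigma> * u n" by (simp add: \<psi>_def)
  qed (use \<sigma>_pos in simp)
  have \<psi>_pos: "0 < \<psi> n" for n using ord[of n] by (auto simp: \<psi>_def less_max_iff_disj)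
  have \<psi>_mono: "mono_on {1..} \<psi>" by (rule mono_onI) (auto intro: P.mono)
  have "\<not> summable (\<lambda>n. term_at n (\<psi> n))"
  proof
    assume sm: "summable (\<lambda>n. term_at n (\<psi> n))"
    have "\<forall>\<^sub>F n in sequentially. \<sigma> / 2 * u n < \<psi> n"
      using term_at_not_summable[OF \<psi>_pos \<psi>_mono] sm by (auto simp: frequently_def not_le)
    then have "\<forall>\<^sub>F n in sequentially. norm (term_at n (\<phi> n)) \<le> term_at n (\<psi> n) + top_bound n"
      using eventually_term_nonneg term_at_upper eventually_ge_at_top[of 1]
    proof eventually_elim
      case (elim n)
      have p: "0 \<le> \<phi> n" "0 \<le> \<psi> n" using pos[OF elim(4)] \<psi>_pos[of n] by auto
      have nn: "0 \<le> term_at n (\<phi> n)" "0 \<le> term_at n (\<psi> n)" by (rule elim(2)[rule_format, OF p(1)], rule elim(2)[rule_format, OF p(2)])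
      moreover have "term_at n (\<phi> n) \<le> term_at n (\<psi> n) + top_bound n"
      proof (cases "\<phi> n \<le> 6 * \<sigma> * u n")
        case True
        then have "\<psi> n = \<phi> n" using elim(1) by (auto simp: \<psi>_def min_def max_def split: if_splits)
        then show ?thesis using top_bound(2)[of n] by simp
      next
        case False
        then have "term_at n (\<phi> n) \<le> top_bound n" by (intro elim(3)[rule_format]) simp
        then show ?thesis using nn by linarith
      qed
      ultimately show ?case by (simp only: real_norm_def abs_of_nonneg)
    qed
    then have "summable (\<lambda>n. term_at n (\<phi> n))"
      by (rule summable_comparison_test_ev) (rule summable_add[OF sm top_bound(1)])
    then show False using ns by simp
  qed
  then have ns': "\<not> summable P.weighted_tail" by (simp only: P.summable_weighted_tail_iff not_False_eq_True)
  have "AE \<omega> in M. \<forall>\<^sub>F n in sequentially. norm (\<Gamma> n *v T n \<omega>) \<le> sqrt n * (6 * \<sigma> * u n)"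
  proof (rule almost_surely_eventually_below)
    show "0 < 6 * \<sigma> * u n" for n using ord[of n] by linarith
    show "mono_on {1..} (\<lambda>n. 6 * \<sigma> * u n)"
      using \<sigma>_pos by (intro mono_onI mult_left_mono u_mono) auto
    have "\<forall>\<^sub>F n in sequentially. norm (term_at n (6 * \<sigma> * u n)) \<le> top_bound n"
      using eventually_term_nonneg term_at_upper
    proof eventually_elim
      case (elim n)
      have "0 \<le> 6 * \<sigma> * u n" using ord[of n] by linarith
      then have "0 \<le> term_at n (6 * \<sigma> * u n)" by (rule elim(1)[rule_format])
      moreover have "term_at n (6 * \<sigma> * u n) \<le> top_bound n" by (rule elim(2)[rule_format]) simp
      ultimately show ?case by (simp only: real_norm_def abs_of_nonneg)
    qed
    then show "summable (\<lambda>n. term_at n (6 * \<sigma> * u n))"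
      by (rule summable_comparison_test_ev) (rule top_bound(1))
  qed
  with P.almost_surely_above[OF ns'] show ?thesis
  proof eventually_elim
    case (elim \<omega>)
    obtain N where N: "\<And>n. n \<ge> N \<Longrightarrow> norm (\<Gamma> n *v T n \<omega>) \<le> sqrt n * (6 * \<sigma> * u n)"
      using elim(2) unfolding eventually_sequentially by blast
    show ?case
    proof
      fix m
      obtain n where n: "n \<ge> max m N" "sqrt n * \<psi> n < norm (\<Gamma> n *v T n \<omega>)" using elim(1) by blast
      have "sqrt n * \<psi> n < sqrt n * (6 * \<sigma> * u n)" using N[of n] n by auto
      then have "\<psi> n < 6 * \<sigma> * u n" by (rule mult_left_less_imp_less) simp
      then have "\<phi> n \<le> \<psi> n" by (auto simp: \<psi>_def)
      then have "sqrt n * \<phi> n \<le> sqrt n * \<psi> n" by (intro mult_left_mono) auto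
      then show "\<exists>n\<ge>m. sqrt n * \<phi> n < norm (\<Gamma> n *v T n \<omega>)" using n by (intro exI[of _ n]) auto
    qed
  qed
qed

lemma test_series_finite_iff:
  assumes pos: "\<And>n. 1 \<le> n \<Longrightarrow> 0 < \<phi> n"
  shows "test_series \<Gamma> d1 \<phi> < \<infinity> \<longleftrightarrow> summable (\<lambda>n. term_at n (\<phi> n))"
proof -
  define S where "S = {n. 1 \<le> n \<and> eigenvalue (\<Gamma> n) 1 \<noteq> 0}"
  have S: "1 \<le> n" "0 < eigenvalue (\<Gamma> n) 1" if "n \<in> S" for n
  proof -
    show n1: "1 \<le> n" using that by (simp add: S_def)
    have "0 \<le> eigenvalue (\<Gamma> n) 1" by (rule eigenvalue_nonneg[OF psd[OF n1]]) (use d1 in auto)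
    moreover have "eigenvalue (\<Gamma> n) 1 \<noteq> 0" using that by (simp add: S_def)
    ultimately show "0 < eigenvalue (\<Gamma> n) 1" by (simp add: less_le)
  qed
  have "test_series \<Gamma> d1 \<phi> < \<infinity> \<longleftrightarrow> summable (\<lambda>n. if n \<in> S then term_at n (\<phi> n) else 0)"
    unfolding test_series_def S_def[symmetric]
  proof (rule infsum_ennreal_finite_iff)
    fix n assume n: "n \<in> S"
    show "0 \<le> term_at n (\<phi> n)" by (rule tau_nonneg[OF less_imp_le[OF pos[OF S(1)[OF n]]] S(2)[OF n]])
    show "test_term \<Gamma> d1 \<phi> n = ennreal (term_at n (\<phi> n))"
      by (rule test_term_eq_tau[of \<Gamma> n \<phi> d1, OF psd[OF S(1)[OF n]] S(2)[OF n] S(1)[OF n] pos[OF S(1)[OF n]] d1(2)])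
  qed
  also have "\<dots> \<longleftrightarrow> summable (\<lambda>n. term_at n (\<phi> n))"
  proof (rule summable_cong)
    show "\<forall>\<^sub>F n in sequentially. (if n \<in> S then term_at n (\<phi> n) else 0) = term_at n (\<phi> n)"
      using eventually_class eventually_ge_at_top[of 1]
    proof eventually_elim
      case (elim n)
      then have "n \<in> S" using \<sigma>_pos by (auto simp: S_def spectral_class_def)
      then show ?case by simp
    qed
  qed
  finally show ?thesis .
qed

end

theorem theorem1p1:
  fixes M :: "'a measure"
    and \<Gamma> :: "nat \<Rightarrow> real ^ 'n ^ 'n"
    and \<Gamma>lim :: "real ^ 'n ^ 'n"
    and Z :: "nat \<Rightarrow> 'a \<Rightarrow> real ^ 'n"
    and \<phi> :: "nat \<Rightarrow> real"
  assumes "CARD('n) \<ge> 2"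
    and "\<And>n. n \<ge> 1 \<Longrightarrow> sym_nonneg_definite (\<Gamma> n)"
    and "sym_nonneg_definite \<Gamma>lim"
    and "\<Gamma>lim \<noteq> 0"
    and "\<Gamma> \<longlonglongrightarrow> \<Gamma>lim"
    and "\<And>\<alpha> \<delta>. \<alpha> > 0 \<Longrightarrow> \<delta> > 0 \<Longrightarrow>
           (\<lambda>k. real k powr (- \<delta>) * block_osc \<Gamma> \<alpha> k) summable_on {1..}"
    and "prob_space M"
    and "prob_space.indep_vars M (\<lambda>_. borel) Z {1..}"
    and "\<And>n. n \<ge> 1 \<Longrightarrow> distributed M lborel (Z n) (\<lambda>x. ennreal (multi_normal_density 0 (mat 1) x))"
    and "\<And>n. n \<ge> 1 \<Longrightarrow> \<phi> n > 0"
    and "mono_on {1..} \<phi>"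
  shows "(test_series \<Gamma> (largest_eigenvalue_mult \<Gamma>lim) \<phi> < \<infinity> \<longrightarrow>
            measure M {\<omega> \<in> space M. \<forall>\<^sub>F n in sequentially.
              norm (\<Gamma> n *v (\<Sum>j = 1..n. Z j \<omega>)) \<le> sqrt (real n) * \<phi> n} = 1) \<and>
         (test_series \<Gamma> (largest_eigenvalue_mult \<Gamma>lim) \<phi> = \<infinity> \<longrightarrow>
            measure M {\<omega> \<in> space M. \<forall>\<^sub>F n in sequentially.
              norm (\<Gamma> n *v (\<Sum>j = 1..n. Z j \<omega>)) \<le> sqrt (real n) * \<phi> n} = 0)"
proof -
  interpret prob_space M by fact
  have Z: "distr M borel (Z n) = gauss 1" if "n \<ge> 1" for n
  proof -
    have "distr M lborel (Z n) = gauss 1"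
      using assms(9)[OF that] by (simp add: distributed_def gauss_1_eq)
    then show ?thesis by (simp cong: distr_cong)
  qed
  interpret W: matrix_walk M Z \<Gamma> \<Gamma>lim
    by unfold_locales (use assms(2-6,8) Z in auto)
  let ?E = "{\<omega> \<in> space M. \<forall>\<^sub>F n in sequentially. norm (\<Gamma> n *v (\<Sum>j = 1..n. Z j \<omega>)) \<le> sqrt (real n) * \<phi> n}"
  have E: "?E = {\<omega> \<in> space M. \<forall>\<^sub>F n in sequentially. norm (\<Gamma> n *v W.T n \<omega>) \<le> sqrt (real n) * \<phi> n}"
    by (simp add: W.T_def)
  have meas: "?E \<in> events" unfolding E by measurable
  have fin: "test_series \<Gamma> (largest_eigenvalue_mult \<Gamma>lim) \<phi> < \<infinity> \<longleftrightarrow> summable (\<lambda>n. W.term_at n (\<phi> n))"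
    using W.test_series_finite_iff[of \<phi>, OF assms(10)] by (simp add: W.d1_def)
  show ?thesis
  proof (intro conjI impI)
    assume "test_series \<Gamma> (largest_eigenvalue_mult \<Gamma>lim) \<phi> < \<infinity>"
    then have sm: "summable (\<lambda>n. W.term_at n (\<phi> n))" using fin by simp
    have "AE \<omega> in M. \<forall>\<^sub>F n in sequentially. norm (\<Gamma> n *v W.T n \<omega>) \<le> sqrt n * \<phi> n"
      by (rule W.almost_surely_eventually_below; fact assms(10) assms(11) sm)
    then show "prob ?E = 1" using prob_Collect_eq_1[OF meas] by (simp add: W.T_def)
  next
    assume "test_series \<Gamma> (largest_eigenvalue_mult \<Gamma>lim) \<phi> = \<infinity>"
    then have ns: "\<not> summable (\<lambda>n. W.term_at n (\<phi> n))" using fin by simp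
    have "AE \<omega> in M. \<forall>m. \<exists>n\<ge>m. sqrt n * \<phi> n < norm (\<Gamma> n *v W.T n \<omega>)"
      by (rule W.almost_surely_infinitely_often_above; fact assms(10) assms(11) ns)
    then have "AE \<omega> in M. \<not> (\<forall>\<^sub>F n in sequentially. norm (\<Gamma> n *v W.T n \<omega>) \<le> sqrt n * \<phi> n)"
      by (rule AE_mp) (auto simp: eventually_sequentially not_le)
    then show "prob ?E = 0" using prob_Collect_eq_0[OF meas] by (simp add: W.T_def)
  qed
qed

end
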